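(* Let $1\le p<\infty$, let $\omega\in A_p^-(\mathbb{R})$, and let $u\in L^p(\mathbb{R},\omega)$. For $0<\alpha<1$ let $(D_{\mathrm{left}})^\alpha u$ denote the (distributional) left fractional derivative of $u$. (a) If $u\in W^{1,p}(\mathbb{R},\omega)$, then the distribution $(D_{\mathrm{left}})^\alpha u$ coincides with a function in $L^p(\mathbb{R},\omega)$ and $$(D_{\mathrm{left}})^\alpha u(t)=\frac{1}{\Gamma(-\alpha)}\int_{-\infty}^t\frac{u(\tau)-u(t)}{(t-\tau)^{1+\alpha}}\,d\tau\quad\text{for a.e. }t\in\mathbb{R},$$ with $$\|(D_{\mathrm{left}})^\alpha u\|_{L^p(\mathbb{R},\omega)}\le C_{p,\omega}\big(\|u\|_{L^p(\mathbb{R},\omega)}+\|u'\|_{L^p(\mathbb{R},\omega)}\big)$$ for some constant $C_{p,\omega}>0$ (depending only on $p$ and $\omega$). Moreover, $$\lim_{\alpha\to1^-}(D_{\mathrm{left}})^\alpha u=u'\quad\text{in }L^p(\mathbb{R},\omega)\text{ and a.e. in }\mathbb{R},$$ and $$\lim_{\alpha\to0^+}(D_{\mathrm{left}})^\alpha u=u\quad\text{a.e. in }\mathbb{R}.$$ Furthermore, the limit $\lim_{\alpha\to0^+}(D_{\mathrm{left}})^\alpha u=u$ holds also in $L^p(\mathbb{R},\omega)$ when $1<p<\infty$, and in $L^1(\mathbb{R},\omega)$ when $p=1$ and $M^-u,\,M^-u'\in L^1(\mathbb{R},\omega)$. (b) Conversely, suppose that $(D_{\mathrm{left}})^\alpha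 u\in L^p(\mathbb{R},\omega)$ and that $(D_{\mathrm{left}})^\alpha u$ converges in $L^p(\mathbb{R},\omega)$ as $\alpha\to1^-$. Then $u\in W^{1,p}(\mathbb{R},\omega)$ and $\lim_{\alpha\to1^-}(D_{\mathrm{left}})^\alpha u=u'$ in $L^p(\mathbb{R},\omega)$ and a.e. in $\mathbb{R}$. (c) Alternatively, suppose that $(D_{\mathrm{left}})^\alpha u\in L^p(\mathbb{R},\omega)$ and that $(D_{\mathrm{left}})^\alpha u$ converges in $L^p(\mathbb{R},\omega)$ as $\alpha\to0^+$. Then $\lim_{\alpha\to0^+}(D_{\mathrm{left}})^\alpha u=u$ a.e. in $\mathbb{R}$ and, as a consequence, $(D_{\mathrm{left}})^\alpha u\to u$ in $L^p(\mathbb{R},\omega)$ as $\alpha\to0^+$.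
   Context: Always $0<\alpha<1$; $\Gamma$ is the Gamma function. One-sided maximal functions: $M^-u(t)=\sup_{h>0}\frac1h\int_{t-h}^t|u(\tau)|\,d\tau$ and $M^+u(t)=\sup_{h>0}\frac1h\int_t^{t+h}|u(\tau)|\,d\tau$. Left-sided Sawyer weights: a nonnegative locally integrable function $\omega$ on $\mathbb{R}$ belongs to $A_p^-(\mathbb{R})$, $1<p<\infty$, if there is $C>0$ with $$\Big(\frac1h\int_a^{a+h}\omega\,d\tau\Big)^{1/p}\Big(\frac1h\int_{a-h}^a\omega^{1-p'}\,d\tau\Big)^{1/p'}\le C\quad\text{for all }a\in\mathbb{R},\ h>0,$$ where $1/p+1/p'=1$; $\omega\in A_1^-(\mathbb{R})$ if there is $C>0$ with $M^+\omega(t)\le C\omega(t)$ for a.e. $t\in\mathbb{R}$. Weights are assumed to satisfy $0<\omega<\infty$ in $\mathbb{R}$. $L^p(\mathbb{R},\omega)$ is the $L^p$ space with respect to $\omega(t)\,dt$. $W^{1,p}(\mathbb{R},\omega)=\{u\in L^p(\mathbb{R},\omega):u'\in L^p(\mathbb{R},\omega)\}$ ($u'$ the distributional derivative), with norm $\|u\|_{W^{1,p}(\mathbb{R},\omega)}^p=\|u\|_{L^p(\mathbb{R},\omega)}^p+\|u'\|_{L^p(\mathbb{R},\omega)}^p$. Distributional setting: $\mathcal{S}_-$ is the set of Schwartz functions $\varphi$ on $\mathbb{R}$ with $\operatorname{supp}\varphi\subset(-\infty,A]$ for some $A\in\mathbb{R}$, with seminorms $\sup_t|t|^\ell|\varphi^{(k)}(t)|$,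 $\ell,k\ge0$. $\mathcal{S}_-^\alpha$ is the set of $\varphi\in C^\infty(\mathbb{R})$ such that $\operatorname{supp}\varphi\subset(-\infty,A]$ for some $A\in\mathbb{R}$ and for each $k\ge0$ there is $C>0$ with $|\varphi^{(k)}(t)|\le C/(1+|t|^{1+\alpha})$ for all $t$, with seminorms $\sup_t(1+|t|^{1+\alpha})|\varphi^{(k)}(t)|$, $k\ge0$. Their duals are $(\mathcal{S}_-)'$ and $(\mathcal{S}_-^\alpha)'$. For $\varphi\in\mathcal{S}_-$, $(D_{\mathrm{right}})^\alpha\varphi(t)=\frac{1}{\Gamma(-\alpha)}\int_t^\infty\frac{\varphi(\tau)-\varphi(t)}{(\tau-t)^{1+\alpha}}\,d\tau$, which belongs to $\mathcal{S}_-^\alpha$. For $u\in(\mathcal{S}_-^\alpha)'$, $(D_{\mathrm{left}})^\alpha u\in(\mathcal{S}_-)'$ is the distribution $((D_{\mathrm{left}})^\alpha u)(\varphi)=u((D_{\mathrm{right}})^\alpha\varphi)$, $\varphi\in\mathcal{S}_-$. Every $u\in L^p(\mathbb{R},\omega)$ with $\omega\in A_p^-(\mathbb{R})$ satisfies $u\in L^1_{\mathrm{loc}}(\mathbb{R})$ and $\int_{-\infty}^A\frac{|u(\tau)|}{1+|\tau|^{1+\alpha}}\,d\tau<\infty$ for all $A\in\mathbb{R}$, hence defines an element of $(\mathcal{S}_-^\alpha)'$ by $\varphi\mapsto\int u\varphi\,dt$; so $(D_{\mathrm{left}})^\alpha u\in(\mathcal{S}_-)'$ is well defined. A distribution $T\in(\mathcal{S}_-)'$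 coincides with a function $f$ (and one writes $T\in L^p(\mathbb{R},\omega)$ if $f\in L^p(\mathbb{R},\omega)$) when $T(\varphi)=\int f\varphi\,dt$ for all $\varphi\in\mathcal{S}_-$. *)

theory Defs
  imports "HOL-Analysis.Analysis"
begin

definition locally_integrable :: "(real \<Rightarrow> real) \<Rightarrow> bool" where
  "locally_integrable f \<longleftrightarrow> (\<forall>a b. f absolutely_integrable_on {a..b})"

definition M_minus :: "(real \<Rightarrow> real) \<Rightarrow> real \<Rightarrow> ennreal" where
  "M_minus u t = (SUP h\<in>{0<..}. ennreal (1 / h) * (\<integral>\<^sup>+\<tau>\<in>{t - h..t}. ennreal \<bar>u \<tau>\<bar> \<partial>lebesgue))"

definition M_plus :: "(real \<Rightarrow> real) \<Rightarrow> real \<Rightarrow> ennreal" where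
  "M_plus u t = (SUP h\<in>{0<..}. ennreal (1 / h) * (\<integral>\<^sup>+\<tau>\<in>{t..t + h}. ennreal \<bar>u \<tau>\<bar> \<partial>lebesgue))"

(* Bochner integrals of non-integrable functions are 0 by convention, so the finiteness of the
   integrals of \<omega> powr (1 - q), which the inequality with a finite constant entails (the other factor
   being positive), has to be stated explicitly. Here q is the conjugate exponent of p. *)
definition A_minus :: "real \<Rightarrow> (real \<Rightarrow> real) set" where
  "A_minus p = {\<omega>. (\<forall>t. 0 < \<omega> t) \<and> locally_integrable \<omega> \<and>
     (if p = 1
      then \<exists>C>0. AE t in lebesgue. M_plus \<omega> t \<le> ennreal (C * \<omega> t)
      else (let q = p / (p - 1) in
             locally_integrable (\<lambda>t. \<omega> t powr (1 - q)) \<and>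
             (\<exists>C>0. \<forall>a. \<forall>h>0.
                (1 / h * (LINT \<tau>:{a..a + h}|lebesgue. \<omega> \<tau>)) powr (1 / p) *
                (1 / h * (LINT \<tau>:{a - h..a}|lebesgue. \<omega> \<tau> powr (1 - q))) powr (1 / q) \<le> C)))}"

definition weighted :: "(real \<Rightarrow> real) \<Rightarrow> real measure" where
  "weighted \<omega> = density lebesgue (\<lambda>t. ennreal (\<omega> t))"

definition Lp :: "real \<Rightarrow> (real \<Rightarrow> real) \<Rightarrow> (real \<Rightarrow> real) set" where
  "Lp p \<omega> = {u \<in> borel_measurable lebesgue. integrable (weighted \<omega>) (\<lambda>t. \<bar>u t\<bar> powr p)}"

definition Lp_norm :: "real \<Rightarrow> (real \<Rightarrow> real) \<Rightarrow> (real \<Rightarrow> real) \<Rightarrow> real" where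
  "Lp_norm p \<omega> u = (LINT t|weighted \<omega>. \<bar>u t\<bar> powr p) powr (1 / p)"

definition Lp_tendsto ::
    "real \<Rightarrow> (real \<Rightarrow> real) \<Rightarrow> ('i \<Rightarrow> real \<Rightarrow> real) \<Rightarrow> (real \<Rightarrow> real) \<Rightarrow> 'i filter \<Rightarrow> bool" where
  "Lp_tendsto p \<omega> f g F \<longleftrightarrow>
     g \<in> Lp p \<omega> \<and> (\<forall>\<^sub>F i in F. f i \<in> Lp p \<omega>) \<and>
     ((\<lambda>i. Lp_norm p \<omega> (\<lambda>t. f i t - g t)) \<longlongrightarrow> 0) F"

definition smooth :: "(real \<Rightarrow> real) \<Rightarrow> bool" where
  "smooth \<phi> \<longleftrightarrow> (\<forall>k t. (deriv ^^ k) \<phi> differentiable (at t))"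

definition has_weak_deriv :: "(real \<Rightarrow> real) \<Rightarrow> (real \<Rightarrow> real) \<Rightarrow> bool" where
  "has_weak_deriv u v \<longleftrightarrow> locally_integrable u \<and> locally_integrable v \<and>
     (\<forall>\<phi>. smooth \<phi> \<and> (\<exists>A. \<forall>t. A < \<bar>t\<bar> \<longrightarrow> \<phi> t = 0) \<longrightarrow>
        (LINT t|lebesgue. u t * deriv \<phi> t) = - (LINT t|lebesgue. v t * \<phi> t))"

definition W1p :: "real \<Rightarrow> (real \<Rightarrow> real) \<Rightarrow> (real \<Rightarrow> real) set" where
  "W1p p \<omega> = {u \<in> Lp p \<omega>. \<exists>v \<in> Lp p \<omega>. has_weak_deriv u v}"

definition S_minus :: "(real \<Rightarrow> real) set" where
  "S_minus = {\<phi>. smooth \<phi> \<and> (\<exists>A. \<forall>t>A. \<phi> t = 0) \<and>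
     (\<forall>l k. \<exists>B. \<forall>t. \<bar>t\<bar> ^ l * \<bar>(deriv ^^ k) \<phi> t\<bar> \<le> B)}"

definition Dright :: "real \<Rightarrow> (real \<Rightarrow> real) \<Rightarrow> real \<Rightarrow> real" where
  "Dright \<alpha> \<phi> t =
     1 / Gamma (- \<alpha>) * (LINT \<tau>:{t<..}|lebesgue. (\<phi> \<tau> - \<phi> t) / (\<tau> - t) powr (1 + \<alpha>))"

(* Distributions are represented by their underlying functionals on test functions;
   only their values on test functions matter below. *)
definition distr_of :: "(real \<Rightarrow> real) \<Rightarrow> (real \<Rightarrow> real) \<Rightarrow> real" where
  "distr_of u \<psi> = (LINT t|lebesgue. u t * \<psi> t)"

definition Dleft :: "real \<Rightarrow> ((real \<Rightarrow> real) \<Rightarrow> real) \<Rightarrow> (real \<Rightarrow> real) \<Rightarrow> real" where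
  "Dleft \<alpha> T \<phi> = T (Dright \<alpha> \<phi>)"

definition coincides_with :: "((real \<Rightarrow> real) \<Rightarrow> real) \<Rightarrow> (real \<Rightarrow> real) \<Rightarrow> bool" where
  "coincides_with T f \<longleftrightarrow>
     (\<forall>\<phi>\<in>S_minus. integrable lebesgue (\<lambda>t. f t * \<phi> t) \<and> T \<phi> = (LINT t|lebesgue. f t * \<phi> t))"

definition Dleft_integrand :: "real \<Rightarrow> (real \<Rightarrow> real) \<Rightarrow> real \<Rightarrow> real \<Rightarrow> real" where
  "Dleft_integrand \<alpha> u t \<tau> = (u \<tau> - u t) / (t - \<tau>) powr (1 + \<alpha>)"

definition Dleft_pointwise :: "real \<Rightarrow> (real \<Rightarrow> real) \<Rightarrow> real \<Rightarrow> real" where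
  "Dleft_pointwise \<alpha> u t =
     1 / Gamma (- \<alpha>) * (LINT \<tau>:{..<t}|lebesgue. Dleft_integrand \<alpha> u t \<tau>)"

(* Almost everywhere convergence of a family of functions that are determined only up to null
   sets (as the functions representing a family of distributions are). Since the index set may be
   uncountable, changing every f i on a null set can destroy pointwise convergence everywhere,
   so the convergence is required of suitable representatives of the classes of the f i. *)
definition ae_class_tendsto ::
    "('i \<Rightarrow> real \<Rightarrow> real) \<Rightarrow> (real \<Rightarrow> real) \<Rightarrow> 'i filter \<Rightarrow> bool" where
  "ae_class_tendsto f g F \<longleftrightarrow>
     (\<exists>f'. (\<forall>i. AE t in lebesgue. f' i t = f i t) \<and>
           (AE t in lebesgue. ((\<lambda>i. f' i t) \<longlongrightarrow> g t) F))"

end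

theory Submission imports Defs
begin

text \<open>Everything is measured by the modular N g, the integral of g^p W for a nonnegative function g and a
Borel version W of the weight. The class of W enters through one inequality only, for adjacent
intervals: the p-th power of the integral of f over [y - h, y], multiplied by the W-measure of
[y, y + h], is at most (C h)^p times the integral of f^p W over [y - h, y]. For p > 1 this is
Jensen's inequality for the measure \<open>\<sigma> dx\<close> with \<open>\<sigma>\<close> = W^(1-q), and for p = 1 it is the bound on the
maximal function of W. A dyadic decomposition turns it into a Hardy inequality on intervals
(hardy), hence into N (avg h g) \<le> K N g for the averages of g over [t - h, t], with K independent
of h (N_avg), hence, by Jensen again, into the same bound for every mixture of such averages
(N_mixture). Moreover the averages tend to 0 pointwise as h tends to infinity (avg_tendsto_0).

Suppose that u has the weak derivative v. Then u(t) - u(t - s) is s times the mean of v over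
[t - s, t]. Splitting the hypersingular integral at s = 1 gives (sobolev_pointwise)
  \<open>D\<^sup>\<alpha> u = \<alpha>/\<Gamma>(2 - \<alpha>) A\<^sub>\<alpha> v + 1/\<Gamma>(1 - \<alpha>) (u - F\<^sub>\<alpha> u)\<close>,
where \<open>A\<^sub>\<alpha> v\<close> averages the means of v over [t - s, t] against the probability density
\<open>(1 - \<alpha>) s^(-\<alpha>)\<close> on (0, 1], and \<open>F\<^sub>\<alpha> u\<close> averages u(t - s) against \<open>\<alpha> s^(-1-\<alpha>)\<close> on s > 1. Both are
mixtures of one-sided averages, which gives the norm estimate. As \<open>\<alpha>\<close> tends to 1 the first density
concentrates at s = 0 and \<open>1/\<Gamma>(1 - \<alpha>)\<close> tends to 0, so the limit is v; as \<open>\<alpha>\<close> tends to 0 the second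
density escapes to infinity and \<open>F\<^sub>\<alpha> u\<close> vanishes, while the first part has the factor \<open>\<alpha>\<close>, so the
limit is u. For convergence in norm it is enough to treat bounded functions of bounded support;
their \<open>F\<^sub>\<alpha>\<close> is estimated explicitly and tends to 0 in norm when p > 1, whereas for p = 1 the function \<open>F\<^sub>\<alpha> u\<close> is dominated by the left maximal
function. Fubini's theorem identifies the pointwise with the distributional derivative
(coincidence).

For the converse at \<open>\<alpha>\<close> = 1, let \<open>\<phi>\<close> be a test function. The right derivatives \<open>D\<^sup>\<alpha> \<phi>\<close> tend to
\<open>-\<phi>'\<close> and stay below an envelope that is integrable against every function of finite modular, so
the limit of \<open>D\<^sup>\<alpha> u\<close> is the weak derivative of u (limit_weak_deriv).

For the converse at \<open>\<alpha>\<close> = 0, fix one small order \<open>\<beta>\<close> for which \<open>v = D\<^sup>\<beta> u\<close> has finite modular. The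
increment \<open>k\<^sub>s\<close> over a step s of the Riemann-Liouville kernel \<open>x^(\<beta>-1)/\<Gamma>(\<beta>)\<close> satisfies
\<open>u(t) - u(t - s) = (k\<^sub>s * v)(t)\<close> almost everywhere (kdiff_Dright, frac_increment), and its mass is
O(\<open>s^\<beta>\<close>). So the increments of u are O(\<open>s^\<beta>\<close>) in the mean on bounded intervals, and for every
\<open>\<alpha> < \<beta>\<close> the derivative \<open>D\<^sup>\<alpha> u\<close> is given by the absolutely convergent pointwise formula and tends to
u almost everywhere as \<open>\<alpha>\<close> tends to 0 (small_order_limit). By Fatou's lemma the limit in norm is u as
well (small_order_identify).\<close>

section \<open>Powers of extended reals and Jensen's inequality\<close>

text \<open>The modulus as an extended real function, the form in which norms and averages take it.\<close>

abbreviation eabs :: "('a \<Rightarrow> real) \<Rightarrow> 'a \<Rightarrow> ennreal" where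
  "eabs u \<equiv> \<lambda>t. ennreal \<bar>u t\<bar>"

text \<open>The action of the distribution u on a test function.\<close>

abbreviation pair :: "(real \<Rightarrow> real) \<Rightarrow> (real \<Rightarrow> real) \<Rightarrow> real" where
  "pair u \<phi> \<equiv> LINT t|lborel. u t * \<phi> t"

text \<open>The hypersingular kernel, normalised to have integral 1 over (1, \<open>\<infinity>\<close>).\<close>

abbreviation hker :: "real \<Rightarrow> real \<Rightarrow> real" where
  "hker \<alpha> s \<equiv> \<alpha> * s powr (- 1 - \<alpha>)"

text \<open>For intervals whose end points are themselves measurable functions, as in iterated integrals.\<close>

lemma measurable_pred_interval [measurable (raw)]:
  fixes f g k :: "'a \<Rightarrow> real"
  assumes [measurable]: "f \<in> borel_measurable M" "g \<in> borel_measurable M" "k \<in> borel_measurable M"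
  shows "Measurable.pred M (\<lambda>x. f x \<in> {g x..})" "Measurable.pred M (\<lambda>x. f x \<in> {g x<..})"
    "Measurable.pred M (\<lambda>x. f x \<in> {..g x})" "Measurable.pred M (\<lambda>x. f x \<in> {..<g x})"
    "Measurable.pred M (\<lambda>x. f x \<in> {g x..k x})" "Measurable.pred M (\<lambda>x. f x \<in> {g x<..k x})"
    "Measurable.pred M (\<lambda>x. f x \<in> {g x..<k x})" "Measurable.pred M (\<lambda>x. f x \<in> {g x<..<k x})"
  by simp_all

definition epow :: "real \<Rightarrow> ennreal \<Rightarrow> ennreal" where
  "epow p x = (if x = top then top else ennreal (enn2real x powr p))"

lemma epow_ennreal [simp]: "0 \<le> r \<Longrightarrow> epow p (ennreal r) = ennreal (r powr p)"
  by (simp add: epow_def)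

lemma epow_top [simp]: "epow p top = top"
  by (simp add: epow_def)

lemma epow_zero [simp]: "epow p 0 = 0"
  by (simp add: epow_def)

lemma epow_mono: "0 \<le> p \<Longrightarrow> x \<le> y \<Longrightarrow> epow p x \<le> epow p y"
  by (cases x; cases y) (auto simp: ennreal_le_iff powr_mono2 top_unique)

lemma epow_eq_0_iff: "epow p x = 0 \<longleftrightarrow> x = 0"
  by (cases x) auto

lemma epow_eq_top_iff: "epow p x = top \<longleftrightarrow> x = top"
  by (cases x) auto

lemma epow_mult: "epow p (x * y) = epow p x * epow p y"
proof (cases "x = top \<or> y = top")
  case True
  then show ?thesis
    by (cases "x = 0"; cases "y = 0") (auto simp: ennreal_mult_top ennreal_top_mult epow_eq_0_iff)
next
  case False
  then obtain a b where "x = ennreal a" "y = ennreal b" "0 \<le> a" "0 \<le> b"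
    by (metis ennreal_cases)
  then show ?thesis
    by (simp add: ennreal_mult[symmetric] powr_mult)
qed

lemma epow_add_le:
  assumes "0 \<le> p"
  shows "epow p (x + y) \<le> ennreal (2 powr p) * (epow p x + epow p y)"
proof -
  have "x + y \<le> 2 * max x y"
    by (metis add_mono max.cobounded1 max.cobounded2 mult_2)
  then have "epow p (x + y) \<le> epow p (2 * max x y)"
    using assms epow_mono by blast
  also have "\<dots> = ennreal (2 powr p) * epow p (max x y)"
    using epow_ennreal[of 2 p] by (simp add: epow_mult)
  also have "\<dots> \<le> ennreal (2 powr p) * (epow p x + epow p y)"
    by (intro mult_left_mono) (auto simp: max_def)
  finally show ?thesis .
qed

lemma measurable_epow [measurable]: "epow p \<in> borel_measurable borel"
  unfolding epow_def by measurable

lemma powr_tangent_le: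
  fixes p x r :: real
  assumes "1 \<le> p" "0 \<le> x" "0 \<le> r"
  shows "p * r powr (p - 1) * x \<le> x powr p + (p - 1) * r powr p"
proof (cases "p = 1")
  case True
  then show ?thesis using assms by (cases "r = 0") auto
next
  case False
  define q where "q = p / (p - 1)"
  have p: "p > 1" using False assms by simp
  have "q > 1" "1 / p + 1 / q = 1" using p by (auto simp: q_def field_simps)
  from Youngs_inequality[of p q x "r powr (p - 1)"] this p assms
  have "x * r powr (p - 1) \<le> x powr p / p + (r powr (p - 1)) powr q / q" by simp
  also have "(r powr (p - 1)) powr q = r powr p" using p by (simp add: powr_powr q_def)
  finally have "p * (x * r powr (p - 1)) \<le> p * (x powr p / p + r powr p / q)"
    using p by (intro mult_left_mono) auto
  also have "\<dots> = x powr p + (p - 1) * r powr p" using p by (simp add: q_def field_simps)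
  finally show ?thesis by (simp add: algebra_simps)
qed

text \<open>Jensen's inequality for a sub-probability density \<open>\<rho>\<close>. Integrating the tangent inequality at the
point r gives a bound that is affine in the integral of \<open>\<rho> g\<close>; the choice of r equal to that
integral yields the claim. The mass below 1 only improves the bound, since the constant term of
the tangent is not positive.\<close>

lemma epow_nn_integral_le:
  assumes p: "1 \<le> p" and [measurable]: "\<rho> \<in> borel_measurable M" "g \<in> borel_measurable M"
    and \<rho>: "(\<integral>\<^sup>+x. \<rho> x \<partial>M) \<le> 1"
  shows "epow p (\<integral>\<^sup>+x. \<rho> x * g x \<partial>M) \<le> (\<integral>\<^sup>+x. \<rho> x * epow p (g x) \<partial>M)"
proof (cases "(\<integral>\<^sup>+x. \<rho> x * epow p (g x) \<partial>M) = top")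
  case False
  define R where "R = (\<integral>\<^sup>+x. \<rho> x * epow p (g x) \<partial>M)"
  have tang: "ennreal (p * r powr (p - 1)) * x \<le> epow p x + ennreal ((p - 1) * r powr p)"
    if r: "0 \<le> r" for r x
  proof (cases x)
    case (real y)
    then show ?thesis using powr_tangent_le[OF p, of y r] r p
      by (simp add: ennreal_mult[symmetric] ennreal_plus[symmetric] del: ennreal_plus)
  qed auto
  have int: "ennreal (p * r powr (p - 1)) * (\<integral>\<^sup>+x. \<rho> x * g x \<partial>M) \<le> R + ennreal ((p - 1) * r powr p)"
    if r: "0 \<le> r" for r
  proof -
    have "ennreal (p * r powr (p - 1)) * (\<integral>\<^sup>+x. \<rho> x * g x \<partial>M)
        = (\<integral>\<^sup>+x. \<rho> x * (ennreal (p * r powr (p - 1)) * g x) \<partial>M)"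
      by (subst nn_integral_cmult[symmetric]) (auto simp: mult_ac)
    also have "\<dots> \<le> (\<integral>\<^sup>+x. \<rho> x * epow p (g x) + ennreal ((p - 1) * r powr p) * \<rho> x \<partial>M)"
      using tang[OF r] by (intro nn_integral_mono) (metis distrib_left mult.commute mult_left_mono zero_le)
    also have "\<dots> = R + ennreal ((p - 1) * r powr p) * (\<integral>\<^sup>+x. \<rho> x \<partial>M)"
      unfolding R_def by (subst nn_integral_add) (auto simp: nn_integral_cmult)
    also have "\<dots> \<le> R + ennreal ((p - 1) * r powr p) * 1"
      using \<rho> by (intro add_left_mono mult_left_mono) auto
    finally show ?thesis by simp
  qed
  have "(\<integral>\<^sup>+x. \<rho> x * g x \<partial>M) \<noteq> top"
  proof
    assume *: "(\<integral>\<^sup>+x. \<rho> x * g x \<partial>M) = top"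
    have "R + ennreal ((p - 1) * 1 powr p) = top"
      using int[of 1] p by (simp add: * ennreal_mult_top top_unique)
    then show False using False by (simp add: R_def)
  qed
  then obtain c where c: "(\<integral>\<^sup>+x. \<rho> x * g x \<partial>M) = ennreal c" "0 \<le> c" by (metis ennreal_cases)
  obtain d where d: "R = ennreal d" "0 \<le> d" using False by (metis R_def ennreal_cases)
  have "p * c powr (p - 1) * c \<le> d + (p - 1) * c powr p"
    using int[of c] c d p
    by (simp add: ennreal_mult[symmetric] ennreal_plus[symmetric] del: ennreal_plus)
  moreover have "c powr (p - 1) * c = c powr p"
    using c by (cases "c = 0") (auto simp: powr_diff)
  ultimately have "p * c powr p \<le> d + (p - 1) * c powr p" by (simp add: mult.assoc)
  then have "c powr p \<le> d" by (simp add: algebra_simps)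
  then show ?thesis using c d by (simp add: R_def[symmetric] ennreal_le_iff)
qed auto

section \<open>Lebesgue differentiation and the two kernels\<close>

definition locint :: "(real \<Rightarrow> real) \<Rightarrow> bool" where
  "locint f \<longleftrightarrow> f \<in> borel_measurable borel \<and> (\<forall>a b. set_integrable lborel {a..b} f)"

text \<open>The differentiation theorem for Henstock-Kurzweil integrals concerns cubes with x as their lower
corner; it is applied to the reflected function.\<close>

lemma lebesgue_differentiation_left:
  assumes "locint f"
  shows "AE t in lborel. ((\<lambda>h. 1 / h * (LINT \<tau>:{t - h..t}|lborel. f \<tau>)) \<longlongrightarrow> f t) (at_right 0)"
proof -
  have int: "set_integrable lborel {a..b} f" for a b using assms by (auto simp: locint_def)
  have hk: "f integrable_on {a..b}" "(LINT \<tau>:{a..b}|lborel. f \<tau>) = integral {a..b} f" for a b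
    using set_borel_integral_eq_integral[OF int] by auto
  define g where "g x = f (- x)" for x
  have gi: "g integrable_on cbox a b" for a b
    using hk(1)[of "-b" "-a"] Henstock_Kurzweil_Integration.integrable_reflect_real[where f=f and a="-b" and b="-a"] unfolding g_def by simp
  obtain N where N: "negligible N" "\<And>x e. \<lbrakk>x \<notin> N; 0 < e\<rbrakk> \<Longrightarrow> \<exists>d>0. \<forall>h. 0 < h \<and> h < d \<longrightarrow>
       norm(integral (cbox x (x + h *\<^sub>R One)) g /\<^sub>R h ^ DIM(real) - g x) < e"
    using integrable_ccontinuous_explicit[of g, OF gi] by metis
  have refl: "integral {-t..-t + h} g = (LINT \<tau>:{t - h..t}|lborel. f \<tau>)" for t h
    using Henstock_Kurzweil_Integration.integral_reflect_real[where f=f and a="t-h" and b=t] hk(2)[of "t-h" t] unfolding g_def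
    by (simp add: add.commute)
  have lim: "((\<lambda>h. 1 / h * (LINT \<tau>:{t - h..t}|lborel. f \<tau>)) \<longlongrightarrow> f t) (at_right 0)" if "- t \<notin> N" for t
  proof (rule tendstoI)
    fix e :: real assume "0 < e"
    from N(2)[OF that this] obtain d where "d > 0"
      and d: "\<And>h. 0 < h \<Longrightarrow> h < d \<Longrightarrow> norm(integral (cbox (-t) (-t + h *\<^sub>R One)) g /\<^sub>R h ^ DIM(real) - g (-t)) < e"
      by auto
    show "\<forall>\<^sub>F h in at_right 0. dist (1 / h * (LINT \<tau>:{t - h..t}|lborel. f \<tau>)) (f t) < e"
      using d \<open>d > 0\<close> refl[of t] unfolding eventually_at_right_field
      by (auto intro!: exI[of _ d] simp: dist_real_def g_def field_simps)
  qed
  have "negligible (uminus ` N)"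
    by (rule negligible_differentiable_image_negligible[OF order_refl N(1)]) (auto intro!: derivative_intros)
  then have "uminus ` N \<in> null_sets (completion lborel)" by (simp add: negligible_iff_null_sets)
  then have "AE t in completion lborel. t \<notin> uminus ` N" by (rule AE_not_in)
  then have "AE t in lborel. t \<notin> uminus ` N" by (simp add: AE_completion_iff)
  then show ?thesis
    by eventually_elim (use lim in \<open>auto simp: image_iff\<close>, metis add.inverse_inverse lim)
qed

lemma nn_integral_powr_atLeast:
  assumes "0 < r" "0 < s"
  shows "(\<integral>\<^sup>+h\<in>{s..}. ennreal (r * h powr (- r - 1)) \<partial>lborel) = ennreal (s powr (- r))"
proof -
  have "(\<integral>\<^sup>+h\<in>{s..}. ennreal (r * h powr (- r - 1)) \<partial>lborel) = ennreal (0 - (- (s powr (- r))))"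
  proof (rule nn_integral_FTC_atLeast)
    fix x assume "s \<le> x"
    then show "((\<lambda>x. - (x powr (- r))) has_real_derivative r * x powr (- r - 1)) (at x)"
      using assms by (auto intro!: derivative_eq_intros simp: powr_diff divide_simps)
    show "0 \<le> r * x powr (- r - 1)" using assms by auto
  next
    have "((\<lambda>x. x powr (- r)) \<longlongrightarrow> 0) at_top"
      using assms by (intro tendsto_neg_powr filterlim_ident) auto
    then show "((\<lambda>x. - (x powr (- r))) \<longlongrightarrow> 0) at_top" using tendsto_minus[of _ 0] by simp
  qed auto
  then show ?thesis by simp
qed

text \<open>The layer cake formula: \<open>s^(-r)\<close> is the integral of \<open>r h^(-r-1)\<close> over h > s. It rewrites an integral
against a decreasing power as a mixture of integrals over bounded intervals.\<close>

lemma nn_integral_powr_layer: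
  assumes r: "0 < r" and [measurable]: "g \<in> borel_measurable borel"
  shows "(\<integral>\<^sup>+s\<in>{1<..}. g s * ennreal (s powr (- r)) \<partial>lborel) =
    (\<integral>\<^sup>+h\<in>{1<..}. ennreal (r * h powr (- r - 1)) * (\<integral>\<^sup>+s\<in>{1<..h}. g s \<partial>lborel) \<partial>lborel)"
proof -
  have "(\<integral>\<^sup>+s\<in>{1<..}. g s * ennreal (s powr (- r)) \<partial>lborel) =
     (\<integral>\<^sup>+s. (\<integral>\<^sup>+h. g s * indicator {1<..} s * (ennreal (r * h powr (- r - 1)) * indicator {s..} h) \<partial>lborel) \<partial>lborel)"
    using nn_integral_powr_atLeast[OF r]
    by (intro nn_integral_cong) (auto simp: nn_integral_cmult split: split_indicator)
  also have "\<dots> = (\<integral>\<^sup>+h. (\<integral>\<^sup>+s. g s * indicator {1<..} s * (ennreal (r * h powr (- r - 1)) * indicator {s..} h) \<partial>lborel) \<partial>lborel)"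
    by (rule lborel_pair.Fubini') measurable
  also have "\<dots> = (\<integral>\<^sup>+h. (\<integral>\<^sup>+s. (ennreal (r * h powr (- r - 1)) * indicator {1<..} h) * (g s * indicator {1<..h} s) \<partial>lborel) \<partial>lborel)"
    by (intro nn_integral_cong) (auto simp: mult_ac split: split_indicator)
  also have "\<dots> = (\<integral>\<^sup>+h\<in>{1<..}. ennreal (r * h powr (- r - 1)) * (\<integral>\<^sup>+s\<in>{1<..h}. g s \<partial>lborel) \<partial>lborel)"
    by (subst nn_integral_cmult) (auto simp: mult_ac)
  finally show ?thesis .
qed

lemma nn_integral_powr_Icc:
  assumes "- 1 < a" "0 \<le> c"
  shows "(\<integral>\<^sup>+x\<in>{0..c}. ennreal (x powr a) \<partial>lborel) = ennreal (c powr (a + 1) / (a + 1))"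
proof -
  have "(\<integral>\<^sup>+x. ennreal (indicator {0..c} x * x powr a) \<partial>lborel) = ennreal (c powr (a + 1) / (a + 1))"
    by (rule nn_integral_has_integral_lebesgue[OF _ has_integral_powr_from_0[OF assms]]) auto
  also have "(\<integral>\<^sup>+x. ennreal (indicator {0..c} x * x powr a) \<partial>lborel) = (\<integral>\<^sup>+x\<in>{0..c}. ennreal (x powr a) \<partial>lborel)"
    by (intro nn_integral_cong) (auto split: split_indicator)
  finally show ?thesis .
qed

lemma ennreal_tendsto_0I:
  assumes "\<And>e::real. 0 < e \<Longrightarrow> \<forall>\<^sub>F x in F. f x \<le> ennreal e"
  shows "(f \<longlongrightarrow> (0::ennreal)) F"
proof (rule order_tendstoI)
  fix a :: ennreal assume "0 < a"
  then obtain e where e: "0 < e" "ennreal e < a"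
    by (metis dense ennreal_cases ennreal_less_zero_iff less_top_ennreal less_trans top.not_eq_extremum)
  from assms[OF e(1)] show "\<forall>\<^sub>F x in F. f x < a"
    by eventually_elim (use e in auto)
qed auto

text \<open>The two probability densities that arise when the hypersingular integral is split at s = 1: one on
(0, 1], for the derivative, and one on (1, \<open>\<infinity>\<close>), for the function itself.\<close>

definition kn :: "real \<Rightarrow> real \<Rightarrow> ennreal" where
  "kn \<alpha> s = ennreal ((1 - \<alpha>) * s powr (- \<alpha>)) * indicator {0<..1} s"

definition kf :: "real \<Rightarrow> real \<Rightarrow> ennreal" where
  "kf \<alpha> h = ennreal (hker \<alpha> h) * indicator {1<..} h"

lemma measurable_kn [measurable]: "kn \<alpha> \<in> borel_measurable borel"
  unfolding kn_def by measurable

lemma measurable_kf [measurable]: "kf \<alpha> \<in> borel_measurable borel"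
  unfolding kf_def by measurable

lemma nn_integral_kn:
  assumes "\<alpha> < 1"
  shows "(\<integral>\<^sup>+s. kn \<alpha> s \<partial>lborel) = 1"
proof -
  have "(\<integral>\<^sup>+s. kn \<alpha> s \<partial>lborel) = (\<integral>\<^sup>+s. ennreal (1 - \<alpha>) * (ennreal (s powr (- \<alpha>)) * indicator {0..1} s) \<partial>lborel)"
    using assms by (intro nn_integral_cong) (auto simp: kn_def ennreal_mult mult_ac split: split_indicator)
  also have "\<dots> = 1"
    using nn_integral_powr_Icc[of "-\<alpha>" 1] assms
    by (simp add: nn_integral_cmult ennreal_mult[symmetric])
  finally show ?thesis .
qed

lemma nn_integral_kf:
  assumes "0 < \<alpha>"
  shows "(\<integral>\<^sup>+s. kf \<alpha> s \<partial>lborel) = 1"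
proof -
  have "(\<integral>\<^sup>+s. kf \<alpha> s \<partial>lborel) = (\<integral>\<^sup>+h\<in>{1..}. ennreal (\<alpha> * h powr (- \<alpha> - 1)) \<partial>lborel)"
    by (intro nn_integral_cong_AE eventually_mono[OF AE_lborel_singleton[of 1]])
       (auto simp: kf_def minus_diff_commute split: split_indicator)
  then show ?thesis using nn_integral_powr_atLeast[OF assms, of 1] by simp
qed

lemma kn_approx_identity:
  assumes [measurable]: "m \<in> borel_measurable borel"
    and B: "\<And>s. 0 < s \<Longrightarrow> s \<le> 1 \<Longrightarrow> m s \<le> ennreal B" "0 \<le> B" and lim: "(m \<longlongrightarrow> 0) (at_right 0)"
  shows "((\<lambda>\<alpha>. \<integral>\<^sup>+s. kn \<alpha> s * m s \<partial>lborel) \<longlongrightarrow> 0) (at_left 1)"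
proof (rule ennreal_tendsto_0I)
  fix e :: real assume e: "0 < e"
  have "\<forall>\<^sub>F s in at_right 0. m s < ennreal (e / 2)"
    using order_tendstoD(2)[OF lim] e by simp
  then obtain \<delta> where \<delta>: "0 < \<delta>" "\<And>s. 0 < s \<Longrightarrow> s < \<delta> \<Longrightarrow> m s < ennreal (e / 2)"
    by (auto simp: eventually_at_right_field)
  \<comment> \<open>Below \<open>\<delta>\<close> the function m is small; above \<open>\<delta>\<close> the density is at most \<open>(1 - \<alpha>)/\<delta>\<close>.\<close>
  have le: "(\<integral>\<^sup>+s. kn \<alpha> s * m s \<partial>lborel) \<le> ennreal (e / 2 + (1 - \<alpha>) * B / \<delta>)" if \<alpha>: "0 < \<alpha>" "\<alpha> < 1" for \<alpha>
  proof -
    have pt: "kn \<alpha> s * m s \<le> ennreal (e / 2) * kn \<alpha> s + ennreal ((1 - \<alpha>) * B / \<delta>) * indicator {0<..1} s" for s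
    proof (cases "0 < s \<and> s \<le> 1")
      case True
      show ?thesis
      proof (cases "s < \<delta>")
        case True
        then show ?thesis using \<delta>(2)[of s] \<open>0 < s \<and> s \<le> 1\<close>
          by (subst mult.commute) (intro order_trans[OF mult_right_mono[of "m s" "ennreal (e/2)" "kn \<alpha> s"]], auto)
      next
        case False
        have "s powr (- \<alpha>) \<le> s powr (-1)" using True \<alpha> by (intro powr_mono') auto
        also have "\<dots> \<le> 1 / \<delta>" using True False \<delta>(1) by (simp add: powr_minus divide_simps)
        finally have "kn \<alpha> s \<le> ennreal ((1 - \<alpha>) / \<delta>)"
          using True \<alpha> mult_left_mono[of "s powr (- \<alpha>)" "1 / \<delta>" "1 - \<alpha>"] by (simp add: kn_def ennreal_leI)
        then have "kn \<alpha> s * m s \<le> ennreal ((1 - \<alpha>) / \<delta>) * ennreal B"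
          using B True by (intro mult_mono) auto
        also have "\<dots> = ennreal ((1 - \<alpha>) * B / \<delta>)"
          using \<alpha> B \<delta>(1) by (simp add: ennreal_mult[symmetric])
        finally show ?thesis using True by (simp add: add_increasing)
      qed
    qed (auto simp: kn_def)
    have "(\<integral>\<^sup>+s. kn \<alpha> s * m s \<partial>lborel) \<le> (\<integral>\<^sup>+s. ennreal (e / 2) * kn \<alpha> s + ennreal ((1 - \<alpha>) * B / \<delta>) * indicator {0<..1} s \<partial>lborel)"
      by (intro nn_integral_mono pt)
    also have "\<dots> = ennreal (e / 2) + ennreal ((1 - \<alpha>) * B / \<delta>)"
      using \<alpha> by (simp add: nn_integral_add nn_integral_cmult nn_integral_kn)
    also have "\<dots> = ennreal (e / 2 + (1 - \<alpha>) * B / \<delta>)"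
      using \<alpha> B \<delta>(1) e by (simp add: ennreal_plus[symmetric] del: ennreal_plus)
    finally show ?thesis .
  qed
  have "((\<lambda>\<alpha>. e / 2 + (1 - \<alpha>) * B / \<delta>) \<longlongrightarrow> e / 2 + (1 - 1) * B / \<delta>) (at_left 1)"
    using \<delta>(1) by (intro tendsto_intros) auto
  from order_tendstoD(2)[OF this, of e] have "\<forall>\<^sub>F \<alpha> in at_left 1. e / 2 + (1 - \<alpha>) * B / \<delta> < e"
    using e by auto
  moreover have "\<forall>\<^sub>F \<alpha> in at_left (1::real). \<alpha> \<in> {0<..<1}"
    by (intro eventually_at_leftI[of 0]) auto
  ultimately show "\<forall>\<^sub>F \<alpha> in at_left 1. (\<integral>\<^sup>+s. kn \<alpha> s * m s \<partial>lborel) \<le> ennreal e"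
    by eventually_elim (rule order_trans[OF le], auto intro!: ennreal_leI)
qed

lemma kf_approx_infinity:
  assumes [measurable]: "m \<in> borel_measurable borel"
    and B: "\<And>s. 1 < s \<Longrightarrow> m s \<le> ennreal B" "0 \<le> B" and lim: "(m \<longlongrightarrow> 0) at_top"
  shows "((\<lambda>\<alpha>. \<integral>\<^sup>+s. kf \<alpha> s * m s \<partial>lborel) \<longlongrightarrow> 0) (at_right 0)"
proof (rule ennreal_tendsto_0I)
  fix e :: real assume e: "0 < e"
  have "\<forall>\<^sub>F s in at_top. m s < ennreal (e / 2)"
    using order_tendstoD(2)[OF lim] e by simp
  then obtain R0 where R0: "\<And>s. R0 \<le> s \<Longrightarrow> m s < ennreal (e / 2)"
    by (auto simp: eventually_at_top_linorder)
  define R where "R = max R0 1"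
  have R: "1 \<le> R" "\<And>s. R \<le> s \<Longrightarrow> m s < ennreal (e / 2)" using R0 by (auto simp: R_def)
  \<comment> \<open>Beyond R the function m is small; below R the density is at most \<open>\<alpha>\<close>.\<close>
  have le: "(\<integral>\<^sup>+s. kf \<alpha> s * m s \<partial>lborel) \<le> ennreal (e / 2 + \<alpha> * B * R)" if \<alpha>: "0 < \<alpha>" for \<alpha>
  proof -
    have pt: "kf \<alpha> s * m s \<le> ennreal (e / 2) * kf \<alpha> s + ennreal (\<alpha> * B) * indicator {0..R} s" for s
    proof (cases "1 < s")
      case True
      show ?thesis
      proof (cases "s < R")
        case False
        then show ?thesis using R(2)[of s]
          by (subst mult.commute) (intro order_trans[OF mult_right_mono[of "m s" "ennreal (e/2)" "kf \<alpha> s"]], auto)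
      next
        case s: True
        have "s powr (-1 - \<alpha>) \<le> s powr 0" using True \<alpha> by (intro powr_mono) auto
        then have "kf \<alpha> s \<le> ennreal \<alpha>"
          using True \<alpha> mult_left_mono[of "s powr (-1 - \<alpha>)" "1" "\<alpha>"] by (simp add: kf_def ennreal_leI)
        then have "kf \<alpha> s * m s \<le> ennreal \<alpha> * ennreal B"
          using B True by (intro mult_mono) auto
        then show ?thesis using True s \<alpha> B by (simp add: add_increasing ennreal_mult)
      qed
    qed (auto simp: kf_def)
    have "(\<integral>\<^sup>+s. kf \<alpha> s * m s \<partial>lborel) \<le> (\<integral>\<^sup>+s. ennreal (e / 2) * kf \<alpha> s + ennreal (\<alpha> * B) * indicator {0..R} s \<partial>lborel)"
      by (intro nn_integral_mono pt)
    also have "\<dots> = ennreal (e / 2) + ennreal (\<alpha> * B) * ennreal R"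
      using \<alpha> R by (simp add: nn_integral_add nn_integral_cmult nn_integral_kf)
    also have "\<dots> = ennreal (e / 2 + \<alpha> * B * R)"
      using \<alpha> B R e by (simp add: ennreal_plus[symmetric] ennreal_mult[symmetric] del: ennreal_plus)
    finally show ?thesis .
  qed
  have "((\<lambda>\<alpha>. e / 2 + \<alpha> * B * R) \<longlongrightarrow> e / 2 + 0 * B * R) (at_right 0)"
    by (intro tendsto_intros)
  from order_tendstoD(2)[OF this, of e] have "\<forall>\<^sub>F \<alpha> in at_right 0. e / 2 + \<alpha> * B * R < e"
    using e by auto
  moreover have "\<forall>\<^sub>F \<alpha> in at_right (0::real). \<alpha> \<in> {0<..<1}"
    by (intro eventually_at_rightI[of _ 1]) auto
  ultimately show "\<forall>\<^sub>F \<alpha> in at_right 0. (\<integral>\<^sup>+s. kf \<alpha> s * m s \<partial>lborel) \<le> ennreal e"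
    by eventually_elim (rule order_trans[OF le], auto intro!: ennreal_leI)
qed

section \<open>One-sided weights and one-sided averages\<close>

lemma nn_integral_lebesgue [simp]: "(\<integral>\<^sup>+x. f x \<partial>lebesgue) = (\<integral>\<^sup>+x. f x \<partial>lborel)"
  by (rule nn_integral_completion)

lemma set_nn_integral_real:
  assumes "set_integrable lborel A f" "\<And>x. 0 \<le> f x"
  shows "(\<integral>\<^sup>+x\<in>A. ennreal (f x) \<partial>lborel) = ennreal (LINT x:A|lborel. f x)"
proof -
  have "(\<integral>\<^sup>+x\<in>A. ennreal (f x) \<partial>lborel) = (\<integral>\<^sup>+x. ennreal (indicator A x *\<^sub>R f x) \<partial>lborel)"
    by (intro nn_integral_cong) (auto split: split_indicator)
  also have "\<dots> = ennreal (LINT x:A|lborel. f x)"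
    using assms unfolding set_integrable_def set_lebesgue_integral_def
    by (intro nn_integral_eq_integral) auto
  finally show ?thesis .
qed

lemma set_nn_integral_pos:
  fixes f :: "real \<Rightarrow> real"
  assumes [measurable]: "f \<in> borel_measurable borel" and "a < b" "\<And>x. 0 < f x"
  shows "0 < (\<integral>\<^sup>+x\<in>{a..b}. ennreal (f x) \<partial>lborel)"
proof (rule ccontr)
  assume "\<not> ?thesis"
  then have "(\<integral>\<^sup>+x. ennreal (f x) * indicator {a..b} x \<partial>lborel) = 0" by (simp add: not_less)
  then have "AE x in lborel. ennreal (f x) * indicator {a..b} x = 0"
    by (subst (asm) nn_integral_0_iff_AE) auto
  then have "AE x in lborel. x \<notin> {a..b}"
    by eventually_elim (use assms(3) in \<open>auto simp: indicator_def ennreal_eq_0_iff not_le[symmetric] split: if_splits\<close>)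
  then have "{a..b} \<in> null_sets lborel"
    using AE_iff_null_sets[of "{a..b}" lborel] by simp
  then have "emeasure lborel {a..b} = 0" by auto
  then show False using \<open>a < b\<close> by simp
qed

text \<open>Used in the proof of Hardy's inequality to find points where the primitive takes prescribed
values.\<close>

lemma continuous_on_set_nn_integral:
  fixes f :: "real \<Rightarrow> ennreal"
  assumes [measurable]: "f \<in> borel_measurable borel"
    and fin: "(\<integral>\<^sup>+x\<in>{a..b}. f x \<partial>lborel) < top"
  shows "continuous_on {a..b} (\<lambda>t. enn2real (\<integral>\<^sup>+x\<in>{a..t}. f x \<partial>lborel))"
proof -
  define g where "g x = enn2real (f x) * indicator {a..b} x" for x
  have [measurable]: "g \<in> borel_measurable borel" unfolding g_def by measurable
  have "AE x in lborel. f x * indicator {a..b} x \<noteq> top"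
    using fin nn_integral_PInf_AE[of "\<lambda>x. f x * indicator {a..b} x" lborel] by auto
  then have ae: "AE x in lborel. f x * indicator {a..b} x = ennreal (g x)"
    by eventually_elim (auto simp: g_def less_top split: split_indicator)
  have gint: "integrable lborel g"
  proof (rule integrableI_nonneg)
    show "(\<integral>\<^sup>+x. ennreal (g x) \<partial>lborel) < \<infinity>"
      using fin nn_integral_cong_AE[OF ae] by simp
  qed (auto simp: g_def)
  have eq: "enn2real (\<integral>\<^sup>+x\<in>{a..t}. f x \<partial>lborel) = integral {a..t} g" if "t \<in> {a..b}" for t
  proof -
    have si: "set_integrable lborel {a..t} g"
      unfolding set_integrable_def by (rule integrable_mult_indicator[OF _ gint]) auto
    have "(\<integral>\<^sup>+x\<in>{a..t}. f x \<partial>lborel) = (\<integral>\<^sup>+x\<in>{a..t}. ennreal (g x) \<partial>lborel)"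
    proof (rule nn_integral_cong_AE, use ae in eventually_elim)
      fix x assume "f x * indicator {a..b} x = ennreal (g x)"
      then show "f x * indicator {a..t} x = ennreal (g x) * indicator {a..t} x"
        using that by (auto split: split_indicator)
    qed
    also have "\<dots> = ennreal (LINT x:{a..t}|lborel. g x)"
      by (rule set_nn_integral_real[OF si]) (simp add: g_def)
    finally have "(\<integral>\<^sup>+x\<in>{a..t}. f x \<partial>lborel) = ennreal (LINT x:{a..t}|lborel. g x)" .
    moreover have "0 \<le> (LINT x:{a..t}|lborel. g x)"
      unfolding set_lebesgue_integral_def by (intro integral_nonneg_AE) (auto simp: g_def)
    ultimately show ?thesis
      using set_borel_integral_eq_integral(2)[OF si] by simp
  qed
  have "g integrable_on {a..b}"
    using gint integrable_on_lborel integrable_on_subinterval by blast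
  from indefinite_integral_continuous_1[OF this] show ?thesis
    by (rule continuous_on_eq) (use eq in auto)
qed

definition avg :: "real \<Rightarrow> (real \<Rightarrow> ennreal) \<Rightarrow> real \<Rightarrow> ennreal" where
  "avg h g t = ennreal (1 / h) * (\<integral>\<^sup>+\<tau>\<in>{t - h..t}. g \<tau> \<partial>lborel)"

lemma measurable_avg [measurable (raw)]:
  assumes [measurable]: "g \<in> borel_measurable borel" "h \<in> borel_measurable M" "t \<in> borel_measurable M"
  shows "(\<lambda>x. avg (h x) g (t x)) \<in> borel_measurable M"
  unfolding avg_def by measurable

lemma nn_integral_translate:
  fixes g :: "real \<Rightarrow> ennreal"
  assumes [measurable]: "g \<in> borel_measurable borel"
  shows "(\<integral>\<^sup>+s. g (t - s) \<partial>lborel) = (\<integral>\<^sup>+s. g s \<partial>lborel)" "(\<integral>\<^sup>+s. g (t + s) \<partial>lborel) = (\<integral>\<^sup>+s. g s \<partial>lborel)"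
  using nn_integral_real_affine[of g "-1" t] nn_integral_real_affine[of g 1 t] by simp_all

lemma nn_integral_window:
  assumes [measurable]: "H \<in> borel_measurable borel" and "0 \<le> a" "0 \<le> b"
  shows "(\<integral>\<^sup>+y. (\<integral>\<^sup>+t\<in>{y - a..y + b}. H t \<partial>lborel) \<partial>lborel) = ennreal (a + b) * (\<integral>\<^sup>+t. H t \<partial>lborel)"
proof -
  have "(\<integral>\<^sup>+y. (\<integral>\<^sup>+t\<in>{y - a..y + b}. H t \<partial>lborel) \<partial>lborel)
      = (\<integral>\<^sup>+t. (\<integral>\<^sup>+y. H t * indicator {y - a..y + b} t \<partial>lborel) \<partial>lborel)"
    by (rule lborel_pair.Fubini') measurable
  also have "\<dots> = (\<integral>\<^sup>+t. (\<integral>\<^sup>+y. H t * indicator {t - b..t + a} y \<partial>lborel) \<partial>lborel)"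
    by (intro nn_integral_cong) (auto split: split_indicator)
  also have "\<dots> = (\<integral>\<^sup>+t. ennreal (a + b) * H t \<partial>lborel)"
    using assms by (simp add: nn_integral_cmult mult.commute add.commute)
  finally show ?thesis by (simp add: nn_integral_cmult)
qed

abbreviation mass :: "(real \<Rightarrow> real) \<Rightarrow> real set \<Rightarrow> ennreal" where
  "mass W A \<equiv> \<integral>\<^sup>+x\<in>A. ennreal (W x) \<partial>lborel"

abbreviation energy :: "real \<Rightarrow> (real \<Rightarrow> real) \<Rightarrow> real set \<Rightarrow> (real \<Rightarrow> ennreal) \<Rightarrow> ennreal" where
  "energy p W A f \<equiv> \<integral>\<^sup>+x\<in>A. epow p (f x) * ennreal (W x) \<partial>lborel"

text \<open>The one-sided weight condition enters through \<open>adjacent\<close>, an inequality which makes sense for p = 1 and p > 1 alike. Note that f is integrated to the left of the interval that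
carries the weight.\<close>

locale left_weight =
  fixes p :: real and W :: "real \<Rightarrow> real" and C :: real
  assumes p: "1 \<le> p" and C: "0 < C"
    and W_measurable [measurable]: "W \<in> borel_measurable borel"
    and W_pos: "\<And>t. 0 < W t"
    and W_int: "\<And>a b. set_integrable lborel {a..b} W"
    and adjacent: "\<And>f y h. f \<in> borel_measurable borel \<Longrightarrow> 0 < h \<Longrightarrow>
      epow p (\<integral>\<^sup>+x\<in>{y - h..y}. f x \<partial>lborel) * mass W {y..y + h}
      \<le> ennreal ((C * h) powr p) * energy p W {y - h..y} f"
begin

lemma p_pos: "0 < p" "0 \<le> p" using p by auto

lemma W_finite: "mass W {a..b} < top"
  using set_nn_integral_real[OF W_int[of a b]] W_pos by (simp add: less_imp_le)

lemma W_positive: "a < b \<Longrightarrow> 0 < mass W {a..b}"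
  using W_pos by (intro set_nn_integral_pos) auto

lemma adjacent_sub:
  assumes [measurable]: "f \<in> borel_measurable borel" and h: "0 < h" "y - x \<le> h" "z - y \<le> h"
  shows "epow p (\<integral>\<^sup>+t\<in>{x<..y}. f t \<partial>lborel) * mass W {y..z}
      \<le> ennreal ((C * h) powr p) * energy p W {x<..y} f"
proof -
  let ?f = "\<lambda>t. f t * indicator {x<..y} t"
  have "(\<integral>\<^sup>+t\<in>{x<..y}. f t \<partial>lborel) = (\<integral>\<^sup>+t\<in>{y-h..y}. ?f t \<partial>lborel)"
    using h by (intro nn_integral_cong) (auto split: split_indicator)
  moreover have "energy p W {x<..y} f
      = energy p W {y-h..y} ?f"
    using h by (intro nn_integral_cong) (auto split: split_indicator)
  moreover have "mass W {y..z} \<le> mass W {y..y+h}"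
    using h by (intro nn_integral_mono) (auto split: split_indicator)
  ultimately show ?thesis
    using adjacent[of ?f h y] h by (auto intro: order_trans[OF mult_left_mono])
qed

text \<open>Let F be the primitive of f from a and let \<open>x\<^sub>k\<close> be a point where F takes the value \<open>2\<^sup>-\<^sup>k F(b)\<close>. On the
set where F lies between two consecutive dyadic levels, F is at most four times the integral of f
over \<open>(x\<^sub>k\<^sub>+\<^sub>2, x\<^sub>k\<^sub>+\<^sub>1]\<close>, and this set lies to the right of \<open>x\<^sub>k\<^sub>+\<^sub>1\<close>. The
inequality for adjacent intervals bounds each level by an integral of \<open>f\<^sup>p W\<close> over that interval,
and these intervals are disjoint.\<close>

lemma hardy:
  assumes [measurable]: "f \<in> borel_measurable borel" and L: "a < b" "b - a \<le> L"
  shows "(\<integral>\<^sup>+t\<in>{a..b}. epow p (\<integral>\<^sup>+x\<in>{a..t}. f x \<partial>lborel) * ennreal (W t) \<partial>lborel)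
    \<le> ennreal ((4 * C * L) powr p) * energy p W {a..b} f"
\<comment> \<open>If f is not integrable, the weight to the right of b forces the right-hand side to be infinite.\<close>
proof (cases "(\<integral>\<^sup>+x\<in>{a..b}. f x \<partial>lborel) = top")
  case True
  have "(\<integral>\<^sup>+t\<in>{a<..b}. f t \<partial>lborel) = (\<integral>\<^sup>+t\<in>{a..b}. f t \<partial>lborel)"
    by (intro nn_integral_cong_AE eventually_mono[OF AE_lborel_singleton[of a]]) (auto split: split_indicator)
  then have "ennreal ((C * L) powr p) * energy p W {a<..b} f = top"
    using adjacent_sub[of f L b a "b + L"] L less_imp_neq[OF W_positive[of b "b + L"]] True
    by (auto simp: ennreal_top_mult top_unique split: if_splits)
  then have "energy p W {a<..b} f = top"
    by (simp add: ennreal_mult_eq_top_iff)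
  moreover have "energy p W {a<..b} f \<le> energy p W {a..b} f"
    by (intro nn_integral_mono) (auto split: split_indicator)
  ultimately show ?thesis using C L by (simp add: top_unique ennreal_mult_top)
next
  case False
  define F where "F t = (\<integral>\<^sup>+x\<in>{a..t}. f x \<partial>lborel)" for t
  define G where "G t = enn2real (F t)" for t
  define s where "s = G b"
  have F_mono: "F t \<le> F t'" if "t \<le> t'" for t t'
    unfolding F_def using that by (intro nn_integral_mono) (auto split: split_indicator)
  have FG: "F t = ennreal (G t)" if "t \<le> b" for t
  proof -
    have "F b < top" using False by (simp add: F_def less_top)
    then have "F t < top" using F_mono[OF that] by (rule le_less_trans[rotated])
    then show ?thesis by (simp add: G_def)
  qed
  have G_nn: "0 \<le> G t" for t by (simp add: G_def)
  have G_mono: "G t \<le> G t'" if "t \<le> t'" "t' \<le> b" for t t'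
    using F_mono[OF that(1)] FG[of t] FG[of t'] that G_nn by (simp add: ennreal_le_iff)
  have cont: "continuous_on {a..b} G"
    unfolding G_def F_def using False by (intro continuous_on_set_nn_integral) (auto simp: top.not_eq_extremum)
  have Ga: "G a = 0" by (simp add: G_def F_def)
  have "\<exists>x\<in>{a..b}. G x = s / 2 ^ k" for k
  proof -
    have "s / 2 ^ k \<le> s" using G_nn[of b] by (simp add: s_def divide_le_eq mult_le_cancel_left1)
    then show ?thesis
      using IVT'[of G a "s / 2 ^ k" b] cont Ga L G_nn[of b] unfolding s_def[symmetric] by auto
  qed
  then obtain x where x: "\<And>k. x k \<in> {a..b}" "\<And>k. G (x k) = s / 2 ^ k" by metis
  show ?thesis
  proof (cases "s = 0")
    case True
    then have "F t = 0" if "t \<le> b" for t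
      using G_mono[of t b] G_nn[of t] FG[of t] that by (simp add: s_def)
    then have "energy p W {a..b} F = (\<integral>\<^sup>+t. 0 \<partial>(lborel :: real measure))"
      by (intro nn_integral_cong) (auto split: split_indicator)
    then show ?thesis by (simp add: F_def)
  next
    case False
    then have s: "0 < s" using G_nn[of b] by (simp add: s_def)
    have x_dec: "x (Suc k) \<le> x k" for k
    proof (rule ccontr)
      assume "\<not> ?thesis"
      then have "G (x k) \<le> G (x (Suc k))" using x(1)[of "Suc k"] by (intro G_mono) auto
      then show False using s x(2) by (simp add: field_simps)
    qed
    have x_antimono: "decseq x" using x_dec by (rule decseq_SucI)
    \<comment> \<open>The intervals whose integrals of f control the level sets of F.\<close>
    define D where "D k = {x (k + 2)<..x (k + 1)}" for k
    have disj: "disjoint_family D"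
      unfolding disjoint_family_on_def
    proof (intro ballI impI)
      fix i j :: nat assume "i \<noteq> j"
      have "D i \<inter> D j = {}" if "i < j" for i j
        using decseqD[OF x_antimono, of "i + 2" "j + 1"] that by (auto simp: D_def)
      from this[of i j] this[of j i] show "D i \<inter> D j = {}" using \<open>i \<noteq> j\<close> by (cases "i < j") auto
    qed
    have inc: "(\<integral>\<^sup>+t\<in>D k. f t \<partial>lborel) = ennreal (s / 2 ^ (k + 2))" for k
    proof -
      have "F (x (k + 1)) = F (x (k + 2)) + (\<integral>\<^sup>+t\<in>D k. f t \<partial>lborel)"
        unfolding F_def D_def using x_dec[of "k+1"] x(1)[of "k+2"]
        by (subst nn_integral_add[symmetric]) (auto intro!: nn_integral_cong split: split_indicator)
      then have "ennreal (s / 2 ^ (k + 1)) = ennreal (s / 2 ^ (k + 2)) + (\<integral>\<^sup>+t\<in>D k. f t \<partial>lborel)"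
        using FG[of "x (k+1)"] FG[of "x (k+2)"] x by simp
      moreover have "ennreal (s / 2 ^ (k + 1)) = ennreal (s / 2 ^ (k + 2)) + ennreal (s / 2 ^ (k + 2))"
        using s by (simp add: ennreal_plus[symmetric] field_simps del: ennreal_plus)
      ultimately show ?thesis
        by (simp only: ennreal_add_left_cancel) simp
    qed
    \<comment> \<open>T k majorises the integrand on the k-th level set, which lies to the right of x (k + 1).\<close>
    define T where "T k t = ennreal ((s / 2 ^ k) powr p) * (ennreal (W t) * indicator {x (k + 1)..b} t)" for k t
    have "epow p (F t) * ennreal (W t) * indicator {a..b} t \<le> (\<Sum>k. T k t)" for t
    proof (cases "t \<in> {a..b} \<and> 0 < G t")
      case True
      have "\<exists>k. s / 2 ^ Suc k < G t"
      proof -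
        have "0 < G t / s" using True s by simp
        then obtain k where "(1 / 2) ^ k < G t / s" using real_arch_pow_inv[of "G t / s" "1/2"] by auto
        then have "s * (1 / 2) ^ k < G t" using s by (simp add: pos_less_divide_eq mult.commute)
        then have "s / 2 ^ k < G t" by (simp add: power_divide)
        moreover have "s / 2 ^ Suc k \<le> s / 2 ^ k" using s by (simp add: field_simps)
        ultimately show ?thesis by (intro exI[of _ k]) linarith
      qed
      \<comment> \<open>The level of t: the least k whose lower threshold is exceeded.\<close>
      define k where "k = (LEAST k. s / 2 ^ Suc k < G t)"
      have k: "s / 2 ^ Suc k < G t" unfolding k_def by (rule LeastI_ex) fact
      have k': "G t \<le> s / 2 ^ k"
      proof (cases k)
        case 0 then show ?thesis using G_mono[of t b] True by (simp add: s_def)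
      next
        case (Suc j)
        then have "j < (LEAST k. s / 2 ^ Suc k < G t)" by (simp add: k_def)
        then have "\<not> s / 2 ^ Suc j < G t" by (rule not_less_Least)
        then show ?thesis using Suc by simp
      qed
      have "x (k + 1) \<le> t"
      proof (rule ccontr)
        assume "\<not> ?thesis"
        then have "G t \<le> G (x (k + 1))" using x(1)[of "k+1"] by (intro G_mono) auto
        then show False using k x(2) by simp
      qed
      moreover have "epow p (F t) \<le> ennreal ((s / 2 ^ k) powr p)"
        using True k' FG[of t] G_nn[of t] p_pos by (simp add: ennreal_leI powr_mono2)
      ultimately have "epow p (F t) * ennreal (W t) * indicator {a..b} t \<le> T k t"
        using True unfolding T_def by (simp add: mult_right_mono)
      also have "T k t \<le> (\<Sum>k. T k t)"
        using sum_le_suminf[of "\<lambda>k. T k t" "{k}"] by simp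
      finally show ?thesis .
    next
      case False
      show ?thesis
      proof (cases "t \<in> {a..b}")
        case True
        then have "F t = 0" using FG[of t] G_nn[of t] False by simp
        then show ?thesis by simp
      qed simp
    qed
    then have "energy p W {a..b} F \<le> (\<integral>\<^sup>+t. (\<Sum>k. T k t) \<partial>lborel)"
      by (intro nn_integral_mono)
    also have "\<dots> = (\<Sum>k. \<integral>\<^sup>+t. T k t \<partial>lborel)"
      by (rule nn_integral_suminf) (auto simp: T_def)
    also have "\<dots> \<le> (\<Sum>k. ennreal ((4 * C * L) powr p) * energy p W (D k) f)"
    proof (rule suminf_le)
      fix k
      have "(\<integral>\<^sup>+t. T k t \<partial>lborel) = ennreal ((s / 2 ^ k) powr p) * mass W {x (k + 1)..b}"
        unfolding T_def by (rule nn_integral_cmult) auto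
      also have "(s / 2 ^ k) powr p = 4 powr p * (s / 2 ^ (k + 2)) powr p"
        using powr_mult[of 4 "s / 2 ^ (k + 2)" p] s by simp
      also have "ennreal \<dots> * mass W {x (k + 1)..b}
         = ennreal (4 powr p) * (epow p (\<integral>\<^sup>+t\<in>D k. f t \<partial>lborel) * mass W {x (k + 1)..b})"
        using s by (simp add: inc ennreal_mult mult.assoc)
      also have "\<dots> \<le> ennreal (4 powr p) * (ennreal ((C * L) powr p) * energy p W (D k) f)"
        unfolding D_def using L x(1)[of "k+2"] x(1)[of "k+1"]
        by (intro mult_left_mono adjacent_sub) auto
      also have "\<dots> = ennreal ((4 * C * L) powr p) * energy p W (D k) f"
        using C L by (simp add: mult.assoc[symmetric] ennreal_mult[symmetric] powr_mult)
      finally show "(\<integral>\<^sup>+t. T k t \<partial>lborel) \<le> ennreal ((4 * C * L) powr p) * energy p W (D k) f" .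
    qed auto
    also have "\<dots> = ennreal ((4 * C * L) powr p) * (\<integral>\<^sup>+t\<in>(\<Union>k. D k). epow p (f t) * ennreal (W t) \<partial>lborel)"
      by (subst nn_integral_disjoint_family[OF _ _ disj]) (auto simp: D_def ennreal_suminf_cmult)
    also have "\<dots> \<le> ennreal ((4 * C * L) powr p) * energy p W {a..b} f"
    proof -
      have "D k \<subseteq> {a..b}" for k using x(1)[of "k+1"] x(1)[of "k+2"] by (auto simp: D_def)
      then have "(\<Union>k. D k) \<subseteq> {a..b}" by auto
      then have "indicator (\<Union>k. D k) t \<le> (indicator {a..b} t :: ennreal)" for t
        by (rule indicator_leI[OF subsetD])
      then show ?thesis
        by (intro mult_left_mono nn_integral_mono mult_left_mono) auto
    qed
    finally show ?thesis by (simp add: F_def)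
  qed
qed

text \<open>The p-th power of the weighted norm. It obeys the triangle inequality up to the factor \<open>2\<^sup>p\<close>, which
suffices for all limits below.\<close>

definition N :: "(real \<Rightarrow> ennreal) \<Rightarrow> ennreal" where
  "N g = (\<integral>\<^sup>+t. epow p (g t) * ennreal (W t) \<partial>lborel)"

lemma N_mono: "(AE t in lborel. f t \<le> g t) \<Longrightarrow> N f \<le> N g"
  unfolding N_def by (intro nn_integral_mono_AE, erule eventually_mono) (intro mult_right_mono epow_mono p_pos; simp)

lemma N_cong: "(AE t in lborel. f t = g t) \<Longrightarrow> N f = N g"
  unfolding N_def by (intro nn_integral_cong_AE, erule eventually_mono) auto

lemma N_cmult: "g \<in> borel_measurable borel \<Longrightarrow> N (\<lambda>t. c * g t) = epow p c * N g"
  unfolding N_def by (subst nn_integral_cmult[symmetric]) (auto simp: epow_mult mult_ac)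

lemma N_add:
  assumes [measurable]: "f \<in> borel_measurable borel" "g \<in> borel_measurable borel"
  shows "N (\<lambda>t. f t + g t) \<le> ennreal (2 powr p) * (N f + N g)"
proof -
  have "N (\<lambda>t. f t + g t) \<le> (\<integral>\<^sup>+t. ennreal (2 powr p) * (epow p (f t) * ennreal (W t) + epow p (g t) * ennreal (W t)) \<partial>lborel)"
    unfolding N_def
    using mult_right_mono[OF epow_add_le[OF p_pos(2)]]
    by (intro nn_integral_mono) (simp add: distrib_right distrib_left mult_ac)
  also have "\<dots> = ennreal (2 powr p) * (N f + N g)"
    unfolding N_def by (subst nn_integral_cmult) (auto simp: nn_integral_add)
  finally show ?thesis .
qed

definition K :: real where "K = 2 * (8 * C) powr p"

lemma K_pos: "0 < K" using C by (simp add: K_def)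

text \<open>The integral of a function over the line is 1/h times the integral over y of its integral over
[y, y + h]. For t in [y, y + h] the window [t - h, t] is contained in [y - h, t], so Hardy's
inequality on [y - h, y + h] applies, and a second integration over y restores the whole line.\<close>

lemma N_avg:
  assumes [measurable]: "g \<in> borel_measurable borel" and h: "0 < h"
  shows "N (avg h g) \<le> ennreal K * N g"
proof -
  define H where "H t = epow p (\<integral>\<^sup>+\<tau>\<in>{t - h..t}. g \<tau> \<partial>lborel) * ennreal (W t)" for t
  have [measurable]: "H \<in> borel_measurable borel" unfolding H_def by measurable
  have y: "(\<integral>\<^sup>+t\<in>{y - 0..y + h}. H t \<partial>lborel) \<le> ennreal ((8 * C * h) powr p) * energy p W {y - h..y + h} g" for y
  proof -
    have "(\<integral>\<^sup>+t\<in>{y - 0..y + h}. H t \<partial>lborel) \<le>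
        (\<integral>\<^sup>+t\<in>{y-h..y+h}. epow p (\<integral>\<^sup>+x\<in>{y-h..t}. g x \<partial>lborel) * ennreal (W t) \<partial>lborel)"
    proof (rule nn_integral_mono)
      fix t
      have "epow p (\<integral>\<^sup>+\<tau>\<in>{t - h..t}. g \<tau> \<partial>lborel) \<le> epow p (\<integral>\<^sup>+x\<in>{y-h..t}. g x \<partial>lborel)" if "y \<le> t"
        using that by (intro epow_mono p_pos nn_integral_mono) (auto split: split_indicator)
      then show "H t * indicator {y - 0..y + h} t \<le> epow p (\<integral>\<^sup>+x\<in>{y-h..t}. g x \<partial>lborel) * ennreal (W t) * indicator {y-h..y+h} t"
        using h by (auto simp: H_def intro!: mult_right_mono split: split_indicator)
    qed
    also have "\<dots> \<le> ennreal ((4 * C * (2 * h)) powr p) * energy p W {y - h..y + h} g"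
      using h by (intro hardy) auto
    finally show ?thesis by (simp add: mult_ac)
  qed
  have "ennreal h * (\<integral>\<^sup>+t. H t \<partial>lborel) = (\<integral>\<^sup>+y. (\<integral>\<^sup>+t\<in>{y - 0..y + h}. H t \<partial>lborel) \<partial>lborel)"
    using nn_integral_window[of H 0 h] h by simp
  also have "\<dots> \<le> (\<integral>\<^sup>+y. ennreal ((8 * C * h) powr p) * energy p W {y - h..y + h} g \<partial>lborel)"
    by (intro nn_integral_mono y)
  also have "\<dots> = ennreal ((8 * C * h) powr p) * (ennreal (h + h) * N g)"
    unfolding N_def using h by (subst nn_integral_cmult) (auto simp: nn_integral_window)
  finally have 1: "ennreal h * (\<integral>\<^sup>+t. H t \<partial>lborel) \<le> ennreal ((8 * C * h) powr p) * (ennreal (h + h) * N g)" .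
  have "N (avg h g) = ennreal ((1 / h) powr p) * (\<integral>\<^sup>+t. H t \<partial>lborel)"
    unfolding N_def avg_def H_def using h
    by (subst nn_integral_cmult[symmetric]) (auto simp: epow_mult mult_ac)
  also have "\<dots> = ennreal ((1 / h) powr p * (1 / h)) * (ennreal h * (\<integral>\<^sup>+t. H t \<partial>lborel))"
    using h by (simp add: mult.assoc[symmetric] ennreal_mult[symmetric])
  also have "\<dots> \<le> ennreal ((1 / h) powr p * (1 / h)) * (ennreal ((8 * C * h) powr p) * (ennreal (h + h) * N g))"
    by (intro mult_left_mono 1) simp
  also have "\<dots> = ennreal ((1 / h) powr p * (1 / h) * (8 * C * h) powr p * (h + h)) * N g"
    using h C by (simp add: mult.assoc[symmetric] ennreal_mult[symmetric])
  also have "(1 / h) powr p * (1 / h) * (8 * C * h) powr p * (h + h) = K"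
  proof -
    have "(1 / h) powr p * (8 * C * h) powr p = (8 * C) powr p"
      using h C by (subst powr_mult[symmetric]) (auto simp: field_simps)
    then show ?thesis using h by (simp add: K_def field_simps)
  qed
  finally show ?thesis .
qed

lemma N_mixture:
  assumes [measurable]: "g \<in> borel_measurable borel" "\<rho> \<in> borel_measurable borel"
    and \<rho>: "(\<integral>\<^sup>+h. \<rho> h \<partial>lborel) \<le> 1" "\<And>h. h \<le> 0 \<Longrightarrow> \<rho> h = 0"
  shows "N (\<lambda>t. \<integral>\<^sup>+h. \<rho> h * avg h g t \<partial>lborel) \<le> ennreal K * N g"
proof -
  have "N (\<lambda>t. \<integral>\<^sup>+h. \<rho> h * avg h g t \<partial>lborel)
      \<le> (\<integral>\<^sup>+t. (\<integral>\<^sup>+h. \<rho> h * epow p (avg h g t) \<partial>lborel) * ennreal (W t) \<partial>lborel)"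
    unfolding N_def using p \<rho> by (intro nn_integral_mono mult_right_mono epow_nn_integral_le) auto
  also have "\<dots> = (\<integral>\<^sup>+t. (\<integral>\<^sup>+h. \<rho> h * (epow p (avg h g t) * ennreal (W t)) \<partial>lborel) \<partial>lborel)"
    by (intro nn_integral_cong, subst nn_integral_multc[symmetric]) (auto simp: mult_ac)
  also have "\<dots> = (\<integral>\<^sup>+h. (\<integral>\<^sup>+t. \<rho> h * (epow p (avg h g t) * ennreal (W t)) \<partial>lborel) \<partial>lborel)"
    by (rule lborel_pair.Fubini') measurable
  also have "\<dots> = (\<integral>\<^sup>+h. \<rho> h * N (avg h g) \<partial>lborel)"
    unfolding N_def by (intro nn_integral_cong nn_integral_cmult) measurable
  also have "\<dots> \<le> (\<integral>\<^sup>+h. \<rho> h * (ennreal K * N g) \<partial>lborel)"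
  proof (rule nn_integral_mono)
    fix h show "\<rho> h * N (avg h g) \<le> \<rho> h * (ennreal K * N g)"
      using N_avg[of g h] \<rho>(2)[of h] by (cases "0 < h") (auto intro!: mult_left_mono)
  qed
  also have "\<dots> = (\<integral>\<^sup>+h. \<rho> h \<partial>lborel) * (ennreal K * N g)"
    by (rule nn_integral_multc) measurable
  also have "\<dots> \<le> 1 * (ennreal K * N g)" by (intro mult_right_mono \<rho>) auto
  finally show ?thesis by simp
qed

end

text \<open>If x lies in [y - h, y], then [y, y + h] is contained in [x, x + 2h], so the maximal function bound
at x controls the weight of [y, y + h] by a multiple of W(x).\<close>

lemma left_weight_A1:
  assumes [measurable]: "W \<in> borel_measurable borel" and W: "\<And>t. 0 < W t" "\<And>a b. set_integrable lborel {a..b} W"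
    and C: "0 < C" "AE t in lborel. \<forall>h>0. mass W {t..t + h} \<le> ennreal (C * h * W t)"
  shows "left_weight 1 W (2 * C)"
proof
  fix f :: "real \<Rightarrow> ennreal" and y h :: real
  assume [measurable]: "f \<in> borel_measurable borel" and h: "0 < h"
  have e1: "epow 1 x = x" for x :: ennreal by (cases x) auto
  have "(\<integral>\<^sup>+x\<in>{y - h..y}. f x \<partial>lborel) * mass W {y..y + h}
    = (\<integral>\<^sup>+x. f x * indicator {y - h..y} x * mass W {y..y + h} \<partial>lborel)"
    by (subst nn_integral_multc) auto
  also have "\<dots> \<le> (\<integral>\<^sup>+x. ennreal (2 * C * h) * (f x * ennreal (W x) * indicator {y - h..y} x) \<partial>lborel)"
  proof (rule nn_integral_mono_AE, use C(2) in eventually_elim)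
    fix x assume *: "\<forall>h>0. mass W {x..x + h} \<le> ennreal (C * h * W x)"
    show "f x * indicator {y - h..y} x * mass W {y..y + h}
      \<le> ennreal (2 * C * h) * (f x * ennreal (W x) * indicator {y - h..y} x)"
    proof (cases "x \<in> {y - h..y}")
      case True
      then have "mass W {y..y + h} \<le> mass W {x..x + 2 * h}"
        by (intro nn_integral_mono) (auto split: split_indicator)
      also have "\<dots> \<le> ennreal (C * (2 * h) * W x)" using * h by simp
      also have "\<dots> = ennreal (2 * C * h) * ennreal (W x)"
        using C h W(1)[of x] by (subst ennreal_mult[symmetric]) (auto simp: mult_ac)
      finally have "f x * mass W {y..y + h} \<le> f x * (ennreal (2 * C * h) * ennreal (W x))"
        by (rule mult_left_mono) simp
      then show ?thesis using True by (simp add: mult_ac)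
    qed simp
  qed
  also have "\<dots> = ennreal (2 * C * h) * (\<integral>\<^sup>+x\<in>{y - h..y}. f x * ennreal (W x) \<partial>lborel)"
    by (rule nn_integral_cmult) measurable
  finally show "epow 1 (\<integral>\<^sup>+x\<in>{y - h..y}. f x \<partial>lborel) * mass W {y..y + h}
      \<le> ennreal ((2 * C * h) powr 1) * (\<integral>\<^sup>+x\<in>{y - h..y}. epow 1 (f x) * ennreal (W x) \<partial>lborel)"
    using C h by (simp add: e1 powr_one)
qed (use assms in auto)

text \<open>Jensen's inequality for the probability measure \<open>\<sigma> dx / S\<close> on [y - h, y] and the function \<open>f/\<sigma>\<close>, where
\<open>\<sigma> = W^(1-q)\<close> is the dual weight; then \<open>\<sigma> (1/\<sigma>)^p = W\<close>, and the \<open>A\<^sub>p\<close> condition bounds the product of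
the weight of [y, y + h] and \<open>S^(p-1)\<close>.\<close>

lemma left_weight_Ap:
  assumes [measurable]: "W \<in> borel_measurable borel" and W: "\<And>t. 0 < W t" "\<And>a b. set_integrable lborel {a..b} W"
    and p: "1 < p" and q: "q = p / (p - 1)" and \<sigma>: "\<And>a b. set_integrable lborel {a..b} (\<lambda>t. W t powr (1 - q))"
    and C: "0 < C" "\<And>a h. 0 < h \<Longrightarrow> (1 / h * (LINT \<tau>:{a..a + h}|lborel. W \<tau>)) powr (1 / p) *
                (1 / h * (LINT \<tau>:{a - h..a}|lborel. W \<tau> powr (1 - q))) powr (1 / q) \<le> C"
  shows "left_weight p W C"
proof
  fix f :: "real \<Rightarrow> ennreal" and y h :: real
  assume [measurable]: "f \<in> borel_measurable borel" and h: "0 < h"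
  define \<sigma> where "\<sigma> t = W t powr (1 - q)" for t
  have [measurable]: "\<sigma> \<in> borel_measurable borel" unfolding \<sigma>_def by measurable
  define S where "S = (LINT \<tau>:{y - h..y}|lborel. \<sigma> \<tau>)"
  define R where "R = (LINT \<tau>:{y..y + h}|lborel. W \<tau>)"
  have \<sigma>_pos: "0 < \<sigma> t" for t using W(1)[of t] by (simp add: \<sigma>_def)
  have SI: "(\<integral>\<^sup>+x\<in>{y - h..y}. ennreal (\<sigma> x) \<partial>lborel) = ennreal S"
    unfolding S_def \<sigma>_def using assms(6) by (intro set_nn_integral_real) auto
  have RI: "mass W {y..y + h} = ennreal R"
    unfolding R_def using W by (intro set_nn_integral_real) (auto simp: less_imp_le)
  have S: "0 < S" using set_nn_integral_pos[of \<sigma> "y - h" y] SI h \<sigma>_pos by (auto simp: ennreal_less_zero_iff)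
  have R: "0 < R" using set_nn_integral_pos[of W y "y + h"] RI h W by (auto simp: ennreal_less_zero_iff)
  \<comment> \<open>The condition on W raised to the power p; note that \<open>p/q = p - 1\<close>.\<close>
  have const: "R * S powr (p - 1) \<le> (C * h) powr p"
  proof -
    have "((1 / h * R) powr (1 / p) * (1 / h * S) powr (1 / q)) powr p \<le> C powr p"
      using C(2)[OF h, of y] p unfolding R_def S_def \<sigma>_def by (intro powr_mono2) auto
    moreover have "((1 / h * S) powr (1 / q)) powr p = (1 / h * S) powr (p - 1)"
      using p by (simp only: powr_powr) (simp add: q)
    moreover have "((1 / h * R) powr (1 / p)) powr p = 1 / h * R"
      using p h R by (simp only: powr_powr) simp
    ultimately have "1 / h * R * (1 / h * S) powr (p - 1) \<le> C powr p"
      by (simp only: powr_mult)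
    then have "R * S powr (p - 1) * (1 / h * (1 / h) powr (p - 1)) \<le> C powr p"
      by (simp only: powr_mult mult_ac)
    moreover have "1 / h * (1 / h) powr (p - 1) = 1 / h powr p"
      using h by (simp add: powr_divide powr_diff)
    ultimately have "R * S powr (p - 1) * (1 / h powr p) \<le> C powr p" by (simp only:)
    then have "R * S powr (p - 1) / h powr p \<le> C powr p" by simp
    then show ?thesis using h by (simp add: powr_mult pos_divide_le_eq)
  qed
  have "epow p (\<integral>\<^sup>+x. ennreal (\<sigma> x / S) * indicator {y - h..y} x * (f x * ennreal (1 / \<sigma> x)) \<partial>lborel)
    \<le> (\<integral>\<^sup>+x. ennreal (\<sigma> x / S) * indicator {y - h..y} x * epow p (f x * ennreal (1 / \<sigma> x)) \<partial>lborel)"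
  proof (rule epow_nn_integral_le)
    have "(\<integral>\<^sup>+x. ennreal (\<sigma> x / S) * indicator {y - h..y} x \<partial>lborel)
      = (\<integral>\<^sup>+x. ennreal (1 / S) * (ennreal (\<sigma> x) * indicator {y - h..y} x) \<partial>lborel)"
      using S \<sigma>_pos by (intro nn_integral_cong) (simp add: mult.assoc[symmetric] ennreal_mult[symmetric] less_imp_le)
    also have "\<dots> = 1" using S by (subst nn_integral_cmult) (auto simp: SI ennreal_mult[symmetric])
    finally show "(\<integral>\<^sup>+x. ennreal (\<sigma> x / S) * indicator {y - h..y} x \<partial>lborel) \<le> 1" by simp
  qed (use p in auto)
  also have "(\<integral>\<^sup>+x. ennreal (\<sigma> x / S) * indicator {y - h..y} x * (f x * ennreal (1 / \<sigma> x)) \<partial>lborel)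
    = (\<integral>\<^sup>+x. ennreal (1 / S) * (f x * indicator {y - h..y} x) \<partial>lborel)"
  proof (rule nn_integral_cong)
    fix x
    have "ennreal (\<sigma> x / S) * ennreal (1 / \<sigma> x) = ennreal (1 / S)"
      using S \<sigma>_pos[of x] by (subst ennreal_mult[symmetric]) auto
    then show "ennreal (\<sigma> x / S) * indicator {y - h..y} x * (f x * ennreal (1 / \<sigma> x)) = ennreal (1 / S) * (f x * indicator {y - h..y} x)"
      by (metis (no_types, lifting) mult.assoc mult.commute)
  qed
  also have "\<dots> = ennreal (1 / S) * (\<integral>\<^sup>+x\<in>{y - h..y}. f x \<partial>lborel)"
    by (rule nn_integral_cmult) measurable
  also have "(\<integral>\<^sup>+x. ennreal (\<sigma> x / S) * indicator {y - h..y} x * epow p (f x * ennreal (1 / \<sigma> x)) \<partial>lborel)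
    = (\<integral>\<^sup>+x. ennreal (1 / S) * (epow p (f x) * ennreal (W x) * indicator {y - h..y} x) \<partial>lborel)"
  proof (rule nn_integral_cong)
    fix x
    have "\<sigma> x * (1 / \<sigma> x) powr p = \<sigma> x powr (1 - p)"
      using \<sigma>_pos[of x] by (simp add: powr_divide powr_diff)
    also have "\<dots> = W x powr ((1 - q) * (1 - p))" by (simp add: \<sigma>_def powr_powr)
    also have "(1 - q) * (1 - p) = 1" using p by (simp add: q field_simps)
    finally have *: "\<sigma> x * (1 / \<sigma> x) powr p = W x" using W(1)[of x] by simp
    have "ennreal (\<sigma> x / S) * epow p (ennreal (1 / \<sigma> x)) = ennreal (\<sigma> x / S * (1 / \<sigma> x) powr p)"
      using S \<sigma>_pos[of x] by (simp add: ennreal_mult[symmetric])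
    also have "\<sigma> x / S * (1 / \<sigma> x) powr p = 1 / S * W x" using * by simp
    finally have "ennreal (\<sigma> x / S) * epow p (ennreal (1 / \<sigma> x)) = ennreal (1 / S) * ennreal (W x)"
      using S W(1)[of x] by (simp only: ennreal_mult[of "1 / S" "W x"] less_imp_le divide_nonneg_pos zero_le_one)
    then show "ennreal (\<sigma> x / S) * indicator {y - h..y} x * epow p (f x * ennreal (1 / \<sigma> x)) =
      ennreal (1 / S) * (epow p (f x) * ennreal (W x) * indicator {y - h..y} x)"
      by (auto simp only: epow_mult mult_ac split: split_indicator)
  qed
  also have "\<dots> = ennreal (1 / S) * energy p W {y - h..y} f"
    by (rule nn_integral_cmult) measurable
  finally have main: "ennreal ((1 / S) powr p) * epow p (\<integral>\<^sup>+x\<in>{y - h..y}. f x \<partial>lborel)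
     \<le> ennreal (1 / S) * energy p W {y - h..y} f"
    using S by (simp add: epow_mult)
  have "epow p (\<integral>\<^sup>+x\<in>{y - h..y}. f x \<partial>lborel) * ennreal R
     = ennreal (S powr p * R) * (ennreal ((1 / S) powr p) * epow p (\<integral>\<^sup>+x\<in>{y - h..y}. f x \<partial>lborel))"
  proof -
    have "S powr p * R * (1 / S) powr p = R"
      using S by (simp add: powr_divide)
    then have "ennreal (S powr p * R) * ennreal ((1 / S) powr p) = ennreal R"
      using R by (subst ennreal_mult[symmetric]) auto
    then show ?thesis by (simp only: mult.assoc[symmetric] mult.commute[of _ "ennreal R"])
  qed
  also have "\<dots> \<le> ennreal (S powr p * R) * (ennreal (1 / S) * energy p W {y - h..y} f)"
    by (intro mult_left_mono main) simp
  also have "\<dots> = ennreal (R * S powr (p - 1)) * energy p W {y - h..y} f"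
  proof -
    have "S powr p * R * (1 / S) = R * S powr (p - 1)" using S by (simp add: powr_diff)
    then show ?thesis using S R by (simp only: mult.assoc[symmetric] ennreal_mult[symmetric] mult_nonneg_nonneg powr_ge_zero less_imp_le divide_nonneg_pos zero_le_one)
  qed
  also have "\<dots> \<le> ennreal ((C * h) powr p) * energy p W {y - h..y} f"
    using const by (intro mult_right_mono ennreal_leI) auto
  finally show "epow p (\<integral>\<^sup>+x\<in>{y - h..y}. f x \<partial>lborel) * mass W {y..y + h}
      \<le> ennreal ((C * h) powr p) * energy p W {y - h..y} f"
    by (simp add: RI)
qed (use assms in auto)

section \<open>Pointwise bounds for averages\<close>

definition mean :: "real \<Rightarrow> (real \<Rightarrow> real) \<Rightarrow> real \<Rightarrow> real" where
  "mean s v t = 1 / s * (LINT \<tau>:{t - s..t}|lborel. v \<tau>)"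

lemma measurable_mean [measurable (raw)]:
  assumes [measurable]: "v \<in> borel_measurable borel" "s \<in> borel_measurable M" "t \<in> borel_measurable M"
  shows "(\<lambda>x. mean (s x) v (t x)) \<in> borel_measurable M"
  unfolding mean_def set_lebesgue_integral_def by measurable

lemma kn_nonpos: "s \<le> 0 \<Longrightarrow> kn \<alpha> s = 0" by (simp add: kn_def)

lemma kf_nonpos: "s \<le> 0 \<Longrightarrow> kf \<alpha> s = 0" by (simp add: kf_def)

definition far :: "real \<Rightarrow> (real \<Rightarrow> ennreal) \<Rightarrow> real \<Rightarrow> ennreal" where
  "far \<alpha> g t = (\<integral>\<^sup>+s. kf \<alpha> s * g (t - s) \<partial>lborel)"

lemma measurable_far [measurable (raw)]:
  assumes [measurable]: "g \<in> borel_measurable borel" "t \<in> borel_measurable M"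
  shows "(\<lambda>x. far \<alpha> g (t x)) \<in> borel_measurable M"
  unfolding far_def by measurable

text \<open>Apply the layer cake formula to the far kernel and enlarge (1, h] to [0, h]: up to the factor
\<open>1 + \<alpha>\<close>, the far part becomes a mixture of the averages over [t - h, t] with the far kernel itself as mixing density.\<close>

lemma far_le_avg:
  assumes \<alpha>: "0 < \<alpha>" and [measurable]: "g \<in> borel_measurable borel"
  shows "far \<alpha> g t \<le> ennreal (1 + \<alpha>) * (\<integral>\<^sup>+h. kf \<alpha> h * avg h g t \<partial>lborel)"
proof -
  have "far \<alpha> g t = (\<integral>\<^sup>+s. ennreal \<alpha> * (g (t - s) * ennreal (s powr (- (1 + \<alpha>))) * indicator {1<..} s) \<partial>lborel)"
    unfolding far_def kf_def using \<alpha>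
    by (intro nn_integral_cong) (auto simp: ennreal_mult mult_ac split: split_indicator)
  also have "\<dots> = ennreal \<alpha> * (\<integral>\<^sup>+h\<in>{1<..}. ennreal ((1 + \<alpha>) * h powr (- (1 + \<alpha>) - 1)) * (\<integral>\<^sup>+s\<in>{1<..h}. g (t - s) \<partial>lborel) \<partial>lborel)"
    using \<alpha> by (subst nn_integral_powr_layer[symmetric]) (auto intro!: nn_integral_cmult)
  also have "\<dots> = (\<integral>\<^sup>+h. ennreal \<alpha> * (ennreal ((1 + \<alpha>) * h powr (- (1 + \<alpha>) - 1)) * (\<integral>\<^sup>+s\<in>{1<..h}. g (t - s) \<partial>lborel) * indicator {1<..} h) \<partial>lborel)"
    by (rule nn_integral_cmult[symmetric]) measurable
  also have "\<dots> \<le> (\<integral>\<^sup>+h. ennreal (1 + \<alpha>) * (kf \<alpha> h * avg h g t) \<partial>lborel)"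
  proof (rule nn_integral_mono)
    fix h :: real
    show "ennreal \<alpha> * (ennreal ((1 + \<alpha>) * h powr (- (1 + \<alpha>) - 1)) * (\<integral>\<^sup>+s\<in>{1<..h}. g (t - s) \<partial>lborel) * indicator {1<..} h)
      \<le> ennreal (1 + \<alpha>) * (kf \<alpha> h * avg h g t)"
    proof (cases "1 < h")
      case True
      have "(\<integral>\<^sup>+s\<in>{1<..h}. g (t - s) \<partial>lborel) \<le> (\<integral>\<^sup>+s. g (t - s) * indicator {t-h..t} (t - s) \<partial>lborel)"
        by (intro nn_integral_mono) (auto split: split_indicator)
      also have "\<dots> = (\<integral>\<^sup>+s. g s * indicator {t-h..t} s \<partial>lborel)"
        by (rule nn_integral_translate(1)[of "\<lambda>s. g s * indicator {t-h..t} s"]) measurable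
      also have "\<dots> = ennreal h * avg h g t"
        using True unfolding avg_def by (simp add: mult.assoc[symmetric] ennreal_mult[symmetric])
      finally have "ennreal \<alpha> * (ennreal ((1 + \<alpha>) * h powr (- (1 + \<alpha>) - 1)) * (\<integral>\<^sup>+s\<in>{1<..h}. g (t - s) \<partial>lborel))
         \<le> ennreal \<alpha> * (ennreal ((1 + \<alpha>) * h powr (- (1 + \<alpha>) - 1)) * (ennreal h * avg h g t))"
        by (intro mult_left_mono) auto
      also have "\<dots> = ennreal (\<alpha> * ((1 + \<alpha>) * h powr (- (1 + \<alpha>) - 1)) * h) * avg h g t"
        using \<alpha> True by (simp add: ennreal_mult mult.assoc)
      also have "\<alpha> * ((1 + \<alpha>) * h powr (- (1 + \<alpha>) - 1)) * h = (1 + \<alpha>) * (hker \<alpha> h)"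
        using True powr_diff[of h "- (1 + \<alpha>)" 1] by simp
      also have "ennreal \<dots> * avg h g t = ennreal (1 + \<alpha>) * (kf \<alpha> h * avg h g t)"
        using \<alpha> True by (simp add: kf_def ennreal_mult mult.assoc)
      finally show ?thesis using True by simp
    qed simp
  qed
  also have "\<dots> = ennreal (1 + \<alpha>) * (\<integral>\<^sup>+h. kf \<alpha> h * avg h g t \<partial>lborel)"
    by (rule nn_integral_cmult) measurable
  finally show ?thesis .
qed

lemma le_of_epow_le:
  assumes "0 < p" "epow p x \<le> ennreal d" "0 \<le> d"
  shows "x \<le> ennreal (d powr (1 / p))"
proof (cases x)
  case (real r)
  then have "r powr p \<le> d" using assms by (simp add: ennreal_le_iff)
  then have "(r powr p) powr (1 / p) \<le> d powr (1 / p)" using assms by (intro powr_mono2) auto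
  then show ?thesis using real assms by (simp add: powr_powr ennreal_leI)
qed (use assms in \<open>simp add: top_unique\<close>)

definition osc :: "real \<Rightarrow> (real \<Rightarrow> real) \<Rightarrow> real \<Rightarrow> ennreal" where
  "osc s v t = ennreal \<bar>mean s v t - v t\<bar>"

lemma measurable_osc [measurable (raw)]:
  assumes [measurable]: "v \<in> borel_measurable borel" "s \<in> borel_measurable M" "t \<in> borel_measurable M"
  shows "(\<lambda>x. osc (s x) v (t x)) \<in> borel_measurable M"
  unfolding osc_def by measurable

lemma locint_abs: "locint v \<Longrightarrow> locint (\<lambda>t. \<bar>v t\<bar>)"
  by (auto simp: locint_def intro: set_integrable_abs)

lemma avg_abs:
  assumes "locint v" "0 < s"
  shows "avg s (eabs v) t = ennreal (mean s (\<lambda>t. \<bar>v t\<bar>) t)"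
proof -
  have "set_integrable lborel {t - s..t} (\<lambda>t. \<bar>v t\<bar>)" using locint_abs[OF assms(1)] by (simp add: locint_def)
  moreover have "0 \<le> (LINT \<tau>:{t - s..t}|lborel. \<bar>v \<tau>\<bar>)"
    unfolding set_lebesgue_integral_def by (intro integral_nonneg_AE) auto
  ultimately show ?thesis using assms(2) set_nn_integral_real[of "{t - s..t}" "\<lambda>t. \<bar>v t\<bar>"]
    unfolding avg_def mean_def by (simp add: ennreal_mult[symmetric])
qed

lemma abs_mean_le:
  assumes "locint v" "0 < s"
  shows "\<bar>mean s v t\<bar> \<le> mean s (\<lambda>t. \<bar>v t\<bar>) t"
proof -
  have "\<bar>LINT \<tau>:{t - s..t}|lborel. v \<tau>\<bar> \<le> (LINT \<tau>:{t - s..t}|lborel. \<bar>v \<tau>\<bar>)"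
    using assms set_integral_norm_bound[of lborel "{t - s..t}" v] by (simp add: locint_def)
  then show ?thesis using assms unfolding mean_def abs_mult by (intro mult_mono) auto
qed

lemma tendsto_osc:
  assumes "locint v"
  shows "AE t in lborel. ((\<lambda>s. osc s v t) \<longlongrightarrow> 0) (at_right 0)"
  using lebesgue_differentiation_left[OF assms]
proof eventually_elim
  case (elim t)
  then have "((\<lambda>s. \<bar>mean s v t - v t\<bar>) \<longlongrightarrow> \<bar>v t - v t\<bar>) (at_right 0)"
    unfolding mean_def by (intro tendsto_intros)
  then have "((\<lambda>s. ennreal \<bar>mean s v t - v t\<bar>) \<longlongrightarrow> ennreal 0) (at_right 0)"
    by (intro tendsto_ennrealI) simp
  then show ?case by (simp add: osc_def)
qed

lemma avg_bounded_near:
  assumes "locint v"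
  shows "AE t in lborel. \<exists>B\<ge>0. \<forall>s. 0 < s \<longrightarrow> s \<le> 1 \<longrightarrow> mean s (\<lambda>t. \<bar>v t\<bar>) t \<le> B"
  using lebesgue_differentiation_left[OF locint_abs[OF assms]]
proof eventually_elim
  case (elim t)
  then have "\<forall>\<^sub>F s in at_right 0. mean s (\<lambda>t. \<bar>v t\<bar>) t < \<bar>v t\<bar> + 1"
    unfolding mean_def by (intro order_tendstoD(2)) auto
  then obtain \<delta> where \<delta>: "0 < \<delta>" "\<And>s. 0 < s \<Longrightarrow> s < \<delta> \<Longrightarrow> mean s (\<lambda>t. \<bar>v t\<bar>) t < \<bar>v t\<bar> + 1"
    by (auto simp: eventually_at_right_field)
  define J where "J = (LINT \<tau>:{t - 1..t}|lborel. \<bar>v \<tau>\<bar>)"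
  have J: "(LINT \<tau>:{t - s..t}|lborel. \<bar>v \<tau>\<bar>) \<le> J" "0 \<le> (LINT \<tau>:{t - s..t}|lborel. \<bar>v \<tau>\<bar>)" if "s \<le> 1" for s
  proof -
    have "set_integrable lborel {t - r..t} (\<lambda>t. \<bar>v t\<bar>)" for r
      using locint_abs[OF assms] by (auto simp: locint_def)
    then show "(LINT \<tau>:{t - s..t}|lborel. \<bar>v \<tau>\<bar>) \<le> J"
      unfolding J_def set_lebesgue_integral_def set_integrable_def using that
      by (intro integral_mono) (auto split: split_indicator)
    show "0 \<le> (LINT \<tau>:{t - s..t}|lborel. \<bar>v \<tau>\<bar>)"
      unfolding set_lebesgue_integral_def by (intro integral_nonneg_AE) auto
  qed
  have "mean s (\<lambda>t. \<bar>v t\<bar>) t \<le> max (\<bar>v t\<bar> + 1) (J / \<delta>)" if "0 < s" "s \<le> 1" for s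
  proof (cases "s < \<delta>")
    case True
    then show ?thesis using \<delta>(2)[of s] that by simp
  next
    case False
    have "mean s (\<lambda>t. \<bar>v t\<bar>) t \<le> J / s"
      using J[of s] that by (simp add: mean_def divide_right_mono)
    also have "\<dots> \<le> J / \<delta>" using False \<delta>(1) that J[of 1] by (intro divide_left_mono) (auto simp: J_def)
    finally show ?thesis by simp
  qed
  then show ?case by (intro exI[of _ "max (\<bar>v t\<bar> + 1) (J / \<delta>)"]) auto
qed

context left_weight
begin

text \<open>A large average is charged to the weight of the fixed interval [t, t + 1], which gives pointwise
bounds that are uniform in h.\<close>

lemma adjacent_unit:
  assumes [measurable]: "g \<in> borel_measurable borel" and h: "1 \<le> h"
  shows "epow p (avg h g t) * mass W {t..t + 1}
    \<le> ennreal (C powr p) * N (\<lambda>\<tau>. g \<tau> * indicator {..t} \<tau>)"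
proof -
  have "epow p (avg h g t) * mass W {t..t + 1}
     \<le> epow p (avg h g t) * mass W {t..t + h}"
    using h by (intro mult_left_mono nn_integral_mono) (auto split: split_indicator)
  also have "\<dots> = ennreal ((1 / h) powr p) * (epow p (\<integral>\<^sup>+\<tau>\<in>{t - h..t}. g \<tau> \<partial>lborel) * mass W {t..t + h})"
    using h unfolding avg_def by (simp add: epow_mult mult.assoc)
  also have "\<dots> \<le> ennreal ((1 / h) powr p) * (ennreal ((C * h) powr p) * energy p W {t - h..t} g)"
    using h by (intro mult_left_mono adjacent) auto
  also have "\<dots> = ennreal (C powr p) * energy p W {t - h..t} g"
    using h C powr_mult[of "1 / h" "C * h" p] by (simp add: mult.assoc[symmetric] ennreal_mult[symmetric])
  also have "\<dots> \<le> ennreal (C powr p) * N (\<lambda>\<tau>. g \<tau> * indicator {..t} \<tau>)"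
    unfolding N_def by (intro mult_left_mono nn_integral_mono) (auto split: split_indicator)
  finally show ?thesis .
qed

lemma avg_le_of_N_le:
  assumes [measurable]: "g \<in> borel_measurable borel" and h: "1 \<le> h" and "0 \<le> d"
    and N: "N (\<lambda>\<tau>. g \<tau> * indicator {..t} \<tau>) \<le> ennreal d"
  shows "avg h g t \<le> ennreal ((C powr p * d / enn2real (mass W {t..t + 1})) powr (1 / p))"
proof -
  obtain w where w: "mass W {t..t + 1} = ennreal w" "0 < w"
    using W_finite[of t "t+1"] W_positive[of t "t+1"]
    by (cases "mass W {t..t + 1}") (auto simp: ennreal_less_zero_iff)
  have "epow p (avg h g t) * ennreal w \<le> ennreal (C powr p) * ennreal d"
    using adjacent_unit[OF assms(1) h, of t] w(1) mult_left_mono[OF N, of "ennreal (C powr p)"]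
    by (auto intro: order_trans)
  then have "ennreal (1 / w) * (epow p (avg h g t) * ennreal w) \<le> ennreal (1 / w) * (ennreal (C powr p) * ennreal d)"
    by (intro mult_left_mono) auto
  moreover have "ennreal (1 / w) * (epow p (avg h g t) * ennreal w) = epow p (avg h g t)"
  proof -
    have "ennreal (1 / w) * (epow p (avg h g t) * ennreal w) = ennreal (1 / w) * ennreal w * epow p (avg h g t)"
      by (simp only: mult_ac)
    also have "ennreal (1 / w) * ennreal w = 1" using w(2) by (simp add: ennreal_mult[symmetric])
    finally show ?thesis by simp
  qed
  moreover have "ennreal (1 / w) * (ennreal (C powr p) * ennreal d) = ennreal (C powr p * d / w)"
    using w(2) assms(3) by (simp add: ennreal_mult[symmetric])
  ultimately have "epow p (avg h g t) \<le> ennreal (C powr p * d / w)" by simp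
  from le_of_epow_le[OF p_pos(1) this] show ?thesis using w assms(3) by simp
qed

lemma N_restrict_le: "N (\<lambda>\<tau>. g \<tau> * indicator A \<tau>) \<le> N g"
  by (intro N_mono AE_I2) (auto split: split_indicator)

lemma avg_bounded_far:
  assumes [measurable]: "g \<in> borel_measurable borel" and N: "N g < top"
  obtains B where "0 \<le> B" "\<And>h. 1 \<le> h \<Longrightarrow> avg h g t \<le> ennreal B"
proof -
  obtain d where d: "N g = ennreal d" "0 \<le> d" using N by (cases "N g") auto
  show ?thesis
    by (rule that[OF _ avg_le_of_N_le[OF assms(1) _ d(2)]]) (use N_restrict_le[of g] d in auto)
qed

lemma N_finite_imp_local:
  assumes [measurable]: "g \<in> borel_measurable borel" and N: "N g < top"
  shows "(\<integral>\<^sup>+x\<in>{a..b}. g x \<partial>lborel) < top"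
proof -
  define h where "h = max 1 (b - a)"
  have h: "1 \<le> h" "b - h \<le> a" by (auto simp: h_def)
  obtain B where B: "0 \<le> B" "avg h g b \<le> ennreal B"
    using avg_bounded_far[OF assms, of b] h by metis
  have "(\<integral>\<^sup>+x\<in>{a..b}. g x \<partial>lborel) \<le> (\<integral>\<^sup>+x\<in>{b - h..b}. g x \<partial>lborel)"
    using h by (intro nn_integral_mono) (auto split: split_indicator)
  also have "\<dots> = ennreal h * avg h g b"
    using h unfolding avg_def by (simp add: mult.assoc[symmetric] ennreal_mult[symmetric])
  also have "\<dots> \<le> ennreal h * ennreal B" by (intro mult_left_mono B) simp
  also have "\<dots> < top" by (simp add: ennreal_mult_less_top)
  finally show ?thesis .
qed

lemma N_finite_AE: "g \<in> borel_measurable borel \<Longrightarrow> N g < top \<Longrightarrow> AE t in lborel. g t < top"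
proof -
  assume [measurable]: "g \<in> borel_measurable borel" and N: "N g < top"
  have "AE t in lborel. epow p (g t) * ennreal (W t) \<noteq> top"
    using N nn_integral_PInf_AE[of "\<lambda>t. epow p (g t) * ennreal (W t)" lborel] by (auto simp: N_def)
  then show ?thesis
    by eventually_elim (use W_pos in \<open>auto simp: ennreal_mult_eq_top_iff epow_eq_top_iff less_top ennreal_eq_0_iff not_le\<close>)
qed

lemma N_dominated_seq:
  assumes [measurable]: "\<And>n. G n \<in> borel_measurable borel" "H \<in> borel_measurable borel"
    and le: "\<And>n. AE t in lborel. G n t \<le> H t" and H: "N H < top"
    and lim: "AE t in lborel. (\<lambda>n. G n t) \<longlonglongrightarrow> 0"
  shows "(\<lambda>n. N (G n)) \<longlonglongrightarrow> 0"
proof -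
  have "(\<lambda>n. N (G n)) \<longlonglongrightarrow> (\<integral>\<^sup>+t. 0 \<partial>(lborel :: real measure))"
    unfolding N_def
  proof (rule nn_integral_dominated_convergence[where w="\<lambda>t. epow p (H t) * ennreal (W t)"])
    show "AE t in lborel. epow p (G n t) * ennreal (W t) \<le> epow p (H t) * ennreal (W t)" for n
      using le[of n] by eventually_elim (intro mult_right_mono epow_mono p_pos, auto)
    show "AE t in lborel. (\<lambda>n. epow p (G n t) * ennreal (W t)) \<longlonglongrightarrow> 0"
      using lim
    proof eventually_elim
      case (elim t)
      have "(\<lambda>n. epow p (G n t)) \<longlonglongrightarrow> 0"
      proof (rule ennreal_tendsto_0I)
        fix e :: real assume e: "0 < e"
        have "\<forall>\<^sub>F n in sequentially. G n t < ennreal (e powr (1 / p))"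
          using order_tendstoD(2)[OF elim] e by simp
        then show "\<forall>\<^sub>F n in sequentially. epow p (G n t) \<le> ennreal e"
        proof eventually_elim
          case (elim n)
          then have "epow p (G n t) \<le> epow p (ennreal (e powr (1 / p)))" by (intro epow_mono p_pos less_imp_le)
          then show ?case using e p_pos by (simp add: powr_powr)
        qed
      qed
      from tendsto_mult_ennreal[OF this tendsto_const[of "ennreal (W t)"]] show ?case by simp
    qed
  qed (use H in \<open>auto simp: N_def\<close>)
  then show ?thesis by simp
qed

lemma N_truncate:
  assumes [measurable]: "g \<in> borel_measurable borel" and N: "N g < top" and e: "0 < e"
  obtains M :: nat and A where "A \<in> sets borel" "N (\<lambda>t. g t * indicator A t) \<le> ennreal e"
    "\<And>t. t \<notin> A \<Longrightarrow> \<bar>t\<bar> \<le> real M \<and> g t \<le> ennreal (real M)"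
proof -
  let ?A = "\<lambda>M::nat. {t. \<not> (\<bar>t\<bar> \<le> real M \<and> g t \<le> ennreal (real M))}"
  have m: "?A M \<in> sets borel" for M by measurable
  have "(\<lambda>M. N (\<lambda>t. g t * indicator (?A M) t)) \<longlonglongrightarrow> 0"
  proof (rule N_dominated_seq[where H=g])
    show "AE t in lborel. (\<lambda>M. g t * indicator (?A M) t) \<longlonglongrightarrow> 0"
      using N_finite_AE[OF assms(1) N]
    proof eventually_elim
      case (elim t)
      then obtain r where r: "g t = ennreal r" "0 \<le> r" by (cases "g t") auto
      obtain n :: nat where n: "\<bar>t\<bar> \<le> real n" "r \<le> real n"
        using real_arch_simple[of "max \<bar>t\<bar> r"] by auto
      have "\<forall>\<^sub>F M in sequentially. g t * indicator (?A M) t = 0"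
        using eventually_ge_at_top[of n]
        by eventually_elim (use n r in \<open>auto simp: indicator_def intro: order_trans\<close>)
      then show ?case by (rule tendsto_eventually)
    qed
  qed (use N in \<open>auto intro!: AE_I2 split: split_indicator\<close>)
  then have "\<forall>\<^sub>F M in sequentially. N (\<lambda>t. g t * indicator (?A M) t) < ennreal e"
    using e by (intro order_tendstoD(2)) auto
  then obtain M where "N (\<lambda>t. g t * indicator (?A M) t) < ennreal e"
    by (auto dest: eventually_happens)
  then show thesis using that[OF m less_imp_le] by blast
qed

text \<open>Cut g into a bounded function of bounded support, whose averages are O(1/h), and a rest of small
modular, whose averages are uniformly small.\<close>

lemma avg_tendsto_0:
  assumes [measurable]: "g \<in> borel_measurable borel" and N: "N g < top"
  shows "((\<lambda>h. avg h g t) \<longlongrightarrow> 0) at_top"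
proof (rule ennreal_tendsto_0I)
  fix e :: real assume e: "0 < e"
  define w where "w = enn2real (mass W {t..t + 1})"
  have w: "0 < w" using W_finite[of t "t+1"] W_positive[of t "t+1"] by (simp add: w_def enn2real_positive_iff)
  \<comment> \<open>Chosen so that a rest of modular d has averages at most e/2.\<close>
  define d where "d = (e / 2) powr p * w / C powr p"
  have d: "0 < d" using e w C by (simp add: d_def)
  obtain M :: nat and A where [measurable]: "A \<in> sets borel" and M: "N (\<lambda>t. g t * indicator A t) \<le> ennreal d"
    and A: "\<And>t. t \<notin> A \<Longrightarrow> \<bar>t\<bar> \<le> real M \<and> g t \<le> ennreal (real M)"
    using N_truncate[OF assms d] by metis
  have far: "avg h (\<lambda>t. g t * indicator A t) t \<le> ennreal (e / 2)" if "1 \<le> h" for h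
  proof -
    have "N (\<lambda>\<tau>. (g \<tau> * indicator A \<tau>) * indicator {..t} \<tau>) \<le> ennreal d"
      using N_restrict_le[of "\<lambda>t. g t * indicator A t" "{..t}"] M by simp
    from avg_le_of_N_le[OF _ that _ this] d
    have "avg h (\<lambda>t. g t * indicator A t) t \<le> ennreal ((C powr p * d / w) powr (1 / p))"
      by (simp add: w_def)
    also have "C powr p * d / w = (e / 2) powr p" using w C by (simp add: d_def)
    finally show ?thesis using e p_pos by (simp add: powr_powr)
  qed
  have near: "avg h (\<lambda>t. g t * indicator (- A) t) t \<le> ennreal (1 / h * (real M * (2 * real M)))" if "1 \<le> h" for h
  proof -
    have "(\<integral>\<^sup>+\<tau>\<in>{t - h..t}. g \<tau> * indicator (- A) \<tau> \<partial>lborel) \<le> (\<integral>\<^sup>+\<tau>. ennreal (real M) * indicator {- real M..real M} \<tau> \<partial>lborel)"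
      proof (rule nn_integral_mono)
      fix \<tau> show "g \<tau> * indicator (- A) \<tau> * indicator {t - h..t} \<tau> \<le> ennreal (real M) * indicator {- real M..real M} \<tau>"
        using A[of \<tau>] by (auto simp: abs_le_iff split: split_indicator)
    qed
    also have "\<dots> = ennreal (real M * (2 * real M))"
      by (simp add: nn_integral_cmult ennreal_mult[symmetric])
    finally show ?thesis using that unfolding avg_def by (subst ennreal_mult) (auto intro!: mult_left_mono)
  qed
  have split: "avg h g t \<le> ennreal (e / 2) + ennreal (1 / h * (real M * (2 * real M)))" if "1 \<le> h" for h
  proof -
    have "avg h g t = avg h (\<lambda>t. g t * indicator A t) t + avg h (\<lambda>t. g t * indicator (- A) t) t"
      unfolding avg_def by (subst distrib_left[symmetric], subst nn_integral_add[symmetric])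
        (auto intro!: arg_cong2[where f="(*)"] nn_integral_cong split: split_indicator)
    then show ?thesis using far[OF that] near[OF that] by (auto intro: add_mono)
  qed
  have "((\<lambda>h::real. 1 / h * (real M * (2 * real M))) \<longlongrightarrow> 0 * (real M * (2 * real M))) at_top"
    by (intro tendsto_intros tendsto_divide_0[OF tendsto_const] filterlim_at_top_imp_at_infinity filterlim_ident)
  then have "\<forall>\<^sub>F h in at_top. 1 / h * (real M * (2 * real M)) < e / 2"
    using e by (intro order_tendstoD(2)[of _ 0]) auto
  with eventually_ge_at_top[of 1] show "\<forall>\<^sub>F h in at_top. avg h g t \<le> ennreal e"
  proof eventually_elim
    case (elim h)
    have "ennreal (1 / h * (real M * (2 * real M))) \<le> ennreal (e / 2)"
      using elim by (intro ennreal_leI) auto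
    then have "avg h g t \<le> ennreal (e / 2) + ennreal (e / 2)"
      using split[OF elim(1)] by (meson add_left_mono order_trans)
    then show ?case using e by (simp add: ennreal_plus[symmetric] del: ennreal_plus)
  qed
qed

lemma N_far:
  assumes [measurable]: "g \<in> borel_measurable borel" and \<alpha>: "0 < \<alpha>" "\<alpha> \<le> 1"
  shows "N (far \<alpha> g) \<le> ennreal (2 powr p * K) * N g"
proof -
  have "N (far \<alpha> g) \<le> N (\<lambda>t. ennreal (1 + \<alpha>) * (\<integral>\<^sup>+h. kf \<alpha> h * avg h g t \<partial>lborel))"
    using \<alpha> by (intro N_mono AE_I2 far_le_avg) auto
  also have "\<dots> = epow p (ennreal (1 + \<alpha>)) * N (\<lambda>t. \<integral>\<^sup>+h. kf \<alpha> h * avg h g t \<partial>lborel)"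
    by (rule N_cmult) measurable
  also have "\<dots> \<le> ennreal (2 powr p) * (ennreal K * N g)"
  proof (intro mult_mono N_mixture)
    show "epow p (ennreal (1 + \<alpha>)) \<le> ennreal (2 powr p)"
      using \<alpha> p_pos by (simp add: ennreal_leI powr_mono2 del: ennreal_plus)
  qed (use \<alpha> in \<open>auto simp: nn_integral_kf kf_nonpos\<close>)
  finally show ?thesis using K_pos by (simp add: ennreal_mult mult.assoc)
qed

lemma far_bounded:
  assumes [measurable]: "g \<in> borel_measurable borel" and N: "N g < top"
  obtains B where "0 \<le> B" "\<And>\<alpha>. 0 < \<alpha> \<Longrightarrow> \<alpha> \<le> 1 \<Longrightarrow> far \<alpha> g t \<le> ennreal B"
proof -
  obtain B where B: "0 \<le> B" "\<And>h. 1 \<le> h \<Longrightarrow> avg h g t \<le> ennreal B"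
    using avg_bounded_far[OF assms, of t] by metis
  have "far \<alpha> g t \<le> ennreal (2 * B)" if \<alpha>: "0 < \<alpha>" "\<alpha> \<le> 1" for \<alpha>
  proof -
    have "far \<alpha> g t \<le> ennreal (1 + \<alpha>) * (\<integral>\<^sup>+h. kf \<alpha> h * avg h g t \<partial>lborel)"
      using \<alpha> by (intro far_le_avg) auto
    also have "(\<integral>\<^sup>+h. kf \<alpha> h * avg h g t \<partial>lborel) \<le> (\<integral>\<^sup>+h. kf \<alpha> h * ennreal B \<partial>lborel)"
      using B by (intro nn_integral_mono) (auto simp: kf_def intro!: mult_left_mono split: split_indicator)
    also have "\<dots> = ennreal B" using \<alpha> by (simp add: nn_integral_multc nn_integral_kf)
    also have "ennreal (1 + \<alpha>) * ennreal B \<le> ennreal (2 * B)"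
      using \<alpha> B by (simp add: ennreal_mult[symmetric] ennreal_leI mult_right_mono del: ennreal_plus)
    finally show ?thesis by (simp add: mult_left_mono)
  qed
  then show thesis using that[of "2 * B"] B by simp
qed

lemma far_tendsto_0:
  assumes [measurable]: "g \<in> borel_measurable borel" and N: "N g < top"
  shows "((\<lambda>\<alpha>. far \<alpha> g t) \<longlongrightarrow> 0) (at_right 0)"
proof -
  obtain B where B: "0 \<le> B" "\<And>h. 1 \<le> h \<Longrightarrow> avg h g t \<le> ennreal B"
    using avg_bounded_far[OF assms, of t] by metis
  have "((\<lambda>\<alpha>. ennreal 2 * (\<integral>\<^sup>+h. kf \<alpha> h * avg h g t \<partial>lborel)) \<longlongrightarrow> ennreal 2 * 0) (at_right 0)"
    using B avg_tendsto_0[OF assms, of t]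
    by (intro tendsto_mult_ennreal tendsto_const kf_approx_infinity[where B=B]) auto
  moreover have "\<forall>\<^sub>F \<alpha> in at_right (0::real). \<alpha> \<in> {0<..<1}"
    by (intro eventually_at_rightI[of _ 1]) auto
  then have "\<forall>\<^sub>F \<alpha> in at_right 0. far \<alpha> g t \<le> ennreal 2 * (\<integral>\<^sup>+h. kf \<alpha> h * avg h g t \<partial>lborel)"
  proof eventually_elim
    case (elim \<alpha>)
    then have "ennreal (1 + \<alpha>) \<le> ennreal 2" by (intro ennreal_leI) auto
    then show ?case using elim
      by (intro order_trans[OF far_le_avg] mult_right_mono) auto
  qed
  ultimately show ?thesis
    by (intro tendsto_sandwich[of "\<lambda>_. 0" "\<lambda>\<alpha>. far \<alpha> g t"]) auto
qed

lemma N_near: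
  assumes [measurable]: "g \<in> borel_measurable borel" and \<alpha>: "\<alpha> < 1"
  shows "N (\<lambda>t. \<integral>\<^sup>+s. kn \<alpha> s * avg s g t \<partial>lborel) \<le> ennreal K * N g"
  using \<alpha> by (intro N_mixture) (auto simp: nn_integral_kn kn_nonpos)

end

section \<open>Convergence of the near and far parts in the weighted norm\<close>

lemma filterlim_seq_at_left: "(\<And>n. S n < b) \<Longrightarrow> S \<longlonglongrightarrow> (b::real) \<Longrightarrow> filterlim S (at_left b) sequentially"
  by (auto simp: filterlim_at intro!: always_eventually)

lemma filterlim_seq_at_right: "(\<And>n. b < S n) \<Longrightarrow> S \<longlonglongrightarrow> (b::real) \<Longrightarrow> filterlim S (at_right b) sequentially"
  by (auto simp: filterlim_at intro!: always_eventually)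

text \<open>The mean oscillation of v at t, weighted by the near kernel. It bounds the distance between v(t) and
the near part of the fractional derivative (see \<open>near_mean_bounds\<close>).\<close>

definition near_osc :: "real \<Rightarrow> (real \<Rightarrow> real) \<Rightarrow> real \<Rightarrow> ennreal" where
  "near_osc \<alpha> v t = (\<integral>\<^sup>+s. kn \<alpha> s * osc s v t \<partial>lborel)"

lemma measurable_near_osc [measurable (raw)]:
  assumes [measurable]: "v \<in> borel_measurable borel" "t \<in> borel_measurable M"
  shows "(\<lambda>x. near_osc \<alpha> v (t x)) \<in> borel_measurable M"
  unfolding near_osc_def by measurable

lemma osc_le:
  assumes "locint v" "0 < s"
  shows "osc s v t \<le> ennreal (mean s (\<lambda>t. \<bar>v t\<bar>) t + \<bar>v t\<bar>)"
  unfolding osc_def using abs_mean_le[OF assms, of t] by (intro ennreal_leI) linarith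

lemma near_osc_tendsto_0:
  assumes v: "locint v"
  shows "AE t in lborel. ((\<lambda>\<alpha>. near_osc \<alpha> v t) \<longlongrightarrow> 0) (at_left 1)"
  using tendsto_osc[OF v] avg_bounded_near[OF v]
proof eventually_elim
  case (elim t)
  then obtain B where B: "0 \<le> B" "\<And>s. 0 < s \<Longrightarrow> s \<le> 1 \<Longrightarrow> mean s (\<lambda>t. \<bar>v t\<bar>) t \<le> B" by auto
  have [measurable]: "v \<in> borel_measurable borel" using v by (simp add: locint_def)
  show ?case unfolding near_osc_def
  proof (rule kn_approx_identity[where B = "B + \<bar>v t\<bar>"])
    fix s :: real assume "0 < s" "s \<le> 1"
    then show "osc s v t \<le> ennreal (B + \<bar>v t\<bar>)"
      using B(2)[of s] by (intro order_trans[OF osc_le[OF v]] ennreal_leI) auto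
  qed (use B elim in auto)
qed

lemma mean_add:
  assumes "locint u" "locint v"
  shows "mean s (\<lambda>t. u t + v t) t = mean s u t + mean s v t"
  using assms unfolding mean_def locint_def by (simp add: set_integral_add distrib_left)

context left_weight
begin

lemma N_finite_imp_locint:
  assumes [measurable]: "v \<in> borel_measurable borel" and "N (eabs v) < top"
  shows "locint v"
  unfolding locint_def set_integrable_def
proof (intro conjI allI integrableI_bounded)
  fix a b
  have "(\<integral>\<^sup>+x. ennreal (norm (indicat_real {a..b} x *\<^sub>R v x)) \<partial>lborel) = (\<integral>\<^sup>+x\<in>{a..b}. ennreal \<bar>v x\<bar> \<partial>lborel)"
    by (intro nn_integral_cong) (auto split: split_indicator)
  then show "(\<integral>\<^sup>+x. ennreal (norm (indicat_real {a..b} x *\<^sub>R v x)) \<partial>lborel) < \<infinity>"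
    using N_finite_imp_local[of "\<lambda>t. ennreal \<bar>v t\<bar>" a b] assms(2) by simp
qed auto

lemma N_dominated_at_left:
  fixes G :: "real \<Rightarrow> real \<Rightarrow> ennreal"
  assumes "\<And>\<alpha>. 0 < \<alpha> \<Longrightarrow> \<alpha> < 1 \<Longrightarrow> G \<alpha> \<in> borel_measurable borel" "H \<in> borel_measurable borel"
    and "\<And>\<alpha>. 0 < \<alpha> \<Longrightarrow> \<alpha> < 1 \<Longrightarrow> AE t in lborel. G \<alpha> t \<le> H t" and "N H < top"
    and lim: "AE t in lborel. ((\<lambda>\<alpha>. G \<alpha> t) \<longlongrightarrow> 0) (at_left 1)"
  shows "((\<lambda>\<alpha>. N (G \<alpha>)) \<longlongrightarrow> 0) (at_left 1)"
proof (rule tendsto_at_left_sequentially[of 0])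
  fix S :: "nat \<Rightarrow> real" assume S: "\<And>n. S n < 1" "\<And>n. 0 < S n" "S \<longlonglongrightarrow> 1"
  show "(\<lambda>n. N (G (S n))) \<longlonglongrightarrow> 0"
  proof (rule N_dominated_seq[where H=H])
    show "AE t in lborel. (\<lambda>n. G (S n) t) \<longlonglongrightarrow> 0"
      using lim by eventually_elim (rule filterlim_compose[OF _ filterlim_seq_at_left[OF S(1,3)]])
  qed (use assms S in auto)
qed simp

lemma N_dominated_at_right:
  fixes G :: "real \<Rightarrow> real \<Rightarrow> ennreal"
  assumes "\<And>\<alpha>. 0 < \<alpha> \<Longrightarrow> \<alpha> < 1 \<Longrightarrow> G \<alpha> \<in> borel_measurable borel" "H \<in> borel_measurable borel"
    and "\<And>\<alpha>. 0 < \<alpha> \<Longrightarrow> \<alpha> < 1 \<Longrightarrow> AE t in lborel. G \<alpha> t \<le> H t" and "N H < top"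
    and lim: "AE t in lborel. ((\<lambda>\<alpha>. G \<alpha> t) \<longlongrightarrow> 0) (at_right 0)"
  shows "((\<lambda>\<alpha>. N (G \<alpha>)) \<longlongrightarrow> 0) (at_right 0)"
proof (rule tendsto_at_right_sequentially[of _ 1])
  fix S :: "nat \<Rightarrow> real" assume S: "\<And>n. S n < 1" "\<And>n. 0 < S n" "S \<longlonglongrightarrow> 0"
  show "(\<lambda>n. N (G (S n))) \<longlonglongrightarrow> 0"
  proof (rule N_dominated_seq[where H=H])
    show "AE t in lborel. (\<lambda>n. G (S n) t) \<longlonglongrightarrow> 0"
      using lim by eventually_elim (rule filterlim_compose[OF _ filterlim_seq_at_right[OF S(2,3)]])
  qed (use assms S in auto)
qed simp

lemma N_bounded_support: "N (\<lambda>t. ennreal c * indicator {a..b} t) < top"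
proof -
  have "N (\<lambda>t. ennreal c * indicator {a..b} t) = (\<integral>\<^sup>+t. epow p (ennreal c) * (ennreal (W t) * indicator {a..b} t) \<partial>lborel)"
    unfolding N_def by (intro nn_integral_cong) (auto split: split_indicator)
  also have "\<dots> = epow p (ennreal c) * (\<integral>\<^sup>+t. ennreal (W t) * indicator {a..b} t \<partial>lborel)"
    by (rule nn_integral_cmult) measurable
  also have "\<dots> < top" using W_finite[of a b]
    by (intro ennreal_mult_less_top[THEN iffD2] disjI2 conjI) (simp_all add: less_top[symmetric] epow_eq_top_iff)
  finally show ?thesis .
qed

lemma near_osc_bounded_tendsto_0:
  assumes [measurable]: "v \<in> borel_measurable borel" and v: "\<And>t. \<bar>v t\<bar> \<le> M * indicator {-M..M} t" and M: "0 \<le> M"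
  shows "((\<lambda>\<alpha>. N (near_osc \<alpha> v)) \<longlongrightarrow> 0) (at_left 1)"
proof -
  have vM: "\<bar>v t\<bar> \<le> M" for t using v[of t] M by (auto split: split_indicator_asm)
  have loc: "locint v"
  proof (rule N_finite_imp_locint)
    have "N (eabs v) \<le> N (\<lambda>t. ennreal M * indicator {-M..M} t)"
      using v by (intro N_mono AE_I2) (metis ennreal_leI ennreal_indicator ennreal_mult M indicator_pos_le)
    then show "N (eabs v) < top" using N_bounded_support by (rule le_less_trans)
  qed simp
  have osc: "osc s v t \<le> ennreal (2 * M) * indicator {-M..M+1} t" if s: "0 < s" "s \<le> 1" for s t
  proof (cases "t \<in> {-M..M+1}")
    case True
    have si: "set_integrable lborel {t - s..t} (\<lambda>t. \<bar>v t\<bar>)"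
      using locint_abs[OF loc] by (simp add: locint_def)
    have "(LINT \<tau>:{t - s..t}|lborel. \<bar>v \<tau>\<bar>) \<le> (LINT \<tau>:{t - s..t}|lborel. M)"
      using vM by (intro set_integral_mono si borel_integrable_atLeastAtMost') auto
    also have "\<dots> = s * M" using s by (simp add: set_lebesgue_integral_def)
    finally have "mean s (\<lambda>t. \<bar>v t\<bar>) t \<le> M" using s by (simp add: mean_def pos_divide_le_eq mult.commute)
    then have "osc s v t \<le> ennreal (2 * M)"
      using vM[of t] by (intro order_trans[OF osc_le[OF loc s(1)]] ennreal_leI) auto
    then show ?thesis using True by simp
  next
    case False
    then have z: "v \<tau> = 0" if "\<tau> \<in> {t - s..t}" for \<tau>
      using v[of \<tau>] s that by (auto split: split_indicator_asm)
    have "(LINT \<tau>:{t - s..t}|lborel. v \<tau>) = (LINT \<tau>:{t - s..t}|lborel. 0)"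
      using z by (intro set_lebesgue_integral_cong) auto
    then have "mean s v t = 0" by (simp add: mean_def)
    moreover have "v t = 0" using z[of t] s by auto
    ultimately show ?thesis by (simp add: osc_def)
  qed
  show ?thesis
  proof (rule N_dominated_at_left[where H="\<lambda>t. ennreal (2 * M) * indicator {-M..M+1} t"])
    fix \<alpha> :: real assume \<alpha>: "0 < \<alpha>" "\<alpha> < 1"
    have "near_osc \<alpha> v t \<le> ennreal (2 * M) * indicator {-M..M+1} t" for t
    proof -
      have "near_osc \<alpha> v t \<le> (\<integral>\<^sup>+s. kn \<alpha> s * (ennreal (2 * M) * indicator {-M..M+1} t) \<partial>lborel)"
        unfolding near_osc_def using osc[of _ t]
        by (intro nn_integral_mono) (auto simp: kn_def intro!: mult_left_mono split: split_indicator)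
      also have "\<dots> = ennreal (2 * M) * indicator {-M..M+1} t"
        using \<alpha> by (simp add: nn_integral_multc nn_integral_kn)
      finally show ?thesis .
    qed
    then show "AE t in lborel. near_osc \<alpha> v t \<le> ennreal (2 * M) * indicator {-M..M+1} t" by simp
  qed (use near_osc_tendsto_0[OF loc] N_bounded_support in auto)
qed

lemma near_osc_split:
  assumes u: "locint u" and w: "locint w" and \<alpha>: "\<alpha> < 1"
  shows "near_osc \<alpha> (\<lambda>t. u t + w t) t \<le> near_osc \<alpha> u t + (\<integral>\<^sup>+s. kn \<alpha> s * avg s (eabs w) t \<partial>lborel) + ennreal \<bar>w t\<bar>"
proof -
  have [measurable]: "u \<in> borel_measurable borel" "w \<in> borel_measurable borel"
    using u w by (auto simp: locint_def)
  have "near_osc \<alpha> (\<lambda>t. u t + w t) t \<le> (\<integral>\<^sup>+s. kn \<alpha> s * osc s u t + kn \<alpha> s * avg s (eabs w) t + kn \<alpha> s * ennreal \<bar>w t\<bar> \<partial>lborel)"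
    unfolding near_osc_def
  proof (rule nn_integral_mono)
    fix s :: real
    show "kn \<alpha> s * osc s (\<lambda>t. u t + w t) t \<le> kn \<alpha> s * osc s u t + kn \<alpha> s * avg s (eabs w) t + kn \<alpha> s * ennreal \<bar>w t\<bar>"
    proof (cases "0 < s")
      case True
      have "\<bar>mean s u t + mean s w t - (u t + w t)\<bar> \<le> \<bar>mean s u t - u t\<bar> + mean s (\<lambda>t. \<bar>w t\<bar>) t + \<bar>w t\<bar>"
        using abs_mean_le[OF w True, of t] by linarith
      then have "osc s (\<lambda>t. u t + w t) t \<le> osc s u t + avg s (eabs w) t + ennreal \<bar>w t\<bar>"
        using abs_mean_le[OF w True, of t]
        by (simp add: osc_def mean_add[OF u w] avg_abs[OF w True] ennreal_plus[symmetric] ennreal_leI del: ennreal_plus)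
      from mult_left_mono[OF this, of "kn \<alpha> s"] show ?thesis by (simp add: distrib_left)
    qed (simp add: kn_nonpos)
  qed
  also have "\<dots> = near_osc \<alpha> u t + (\<integral>\<^sup>+s. kn \<alpha> s * avg s (eabs w) t \<partial>lborel) + ennreal \<bar>w t\<bar>"
    using \<alpha> by (simp add: nn_integral_add near_osc_def nn_integral_multc nn_integral_kn)
  finally show ?thesis .
qed

text \<open>Approximation by bounded functions of bounded support: for these the oscillations are dominated by
a fixed function of finite modular, and the contribution of the rest is controlled by N_near.\<close>

lemma N_near_osc_tendsto_0:
  assumes [measurable]: "v \<in> borel_measurable borel" and fin: "N (eabs v) < top"
  shows "((\<lambda>\<alpha>. N (near_osc \<alpha> v)) \<longlongrightarrow> 0) (at_left 1)"
proof (rule ennreal_tendsto_0I)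
  fix e :: real assume e: "0 < e"
  \<comment> \<open>The total factor by which the modular of the rest enters the estimate \<open>main\<close>.\<close>
  define q where "q = 2 powr p * (2 powr p * K + 1)"
  have q: "0 < q" using K_pos by (simp add: q_def add_pos_pos)
  define \<epsilon> where "\<epsilon> = e / (2 * q)"
  have \<epsilon>: "0 < \<epsilon>" using e q by (simp add: \<epsilon>_def)
  obtain M :: nat and A where [measurable]: "A \<in> sets borel" and M: "N (\<lambda>t. ennreal \<bar>v t\<bar> * indicator A t) \<le> ennreal \<epsilon>"
    and A: "\<And>t. t \<notin> A \<Longrightarrow> \<bar>t\<bar> \<le> real M \<and> ennreal \<bar>v t\<bar> \<le> ennreal (real M)"
  proof (rule N_truncate[OF _ fin \<epsilon>])
    show "eabs v \<in> borel_measurable borel" by measurable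
  qed (rule that)
  define u where "u t = v t * indicator (- A) t" for t
  define w where "w t = v t * indicator A t" for t
  have [measurable]: "u \<in> borel_measurable borel" "w \<in> borel_measurable borel"
    unfolding u_def w_def by measurable
  have v: "v = (\<lambda>t. u t + w t)" by (auto simp: u_def w_def fun_eq_iff split: split_indicator)
  have wN: "N (eabs w) \<le> ennreal \<epsilon>"
    using M unfolding w_def by (simp add: abs_mult ennreal_mult ennreal_indicator)
  have uM: "\<bar>u t\<bar> \<le> real M * indicator {-real M..real M} t" for t
    using A[of t] by (auto simp: u_def ennreal_le_iff abs_le_iff split: split_indicator)
  have "N (eabs u) \<le> N (eabs v)"
    by (intro N_mono AE_I2 ennreal_leI) (auto simp: u_def split: split_indicator)
  then have u_loc: "locint u" using fin by (intro N_finite_imp_locint) auto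
  have w_loc: "locint w" using wN by (intro N_finite_imp_locint) (auto intro: le_less_trans)
  have main: "N (near_osc \<alpha> v) \<le> ennreal (2 powr p * 2 powr p) * N (near_osc \<alpha> u) + ennreal (e / 2)" if \<alpha>: "\<alpha> < 1" for \<alpha>
  proof -
    let ?E = "\<lambda>t. \<integral>\<^sup>+s. kn \<alpha> s * avg s (eabs w) t \<partial>lborel"
    have "N (near_osc \<alpha> v) \<le> N (\<lambda>t. near_osc \<alpha> u t + ?E t + ennreal \<bar>w t\<bar>)"
      unfolding v using near_osc_split[OF u_loc w_loc \<alpha>] by (intro N_mono AE_I2)
    also have "\<dots> \<le> ennreal (2 powr p) * (N (\<lambda>t. near_osc \<alpha> u t + ?E t) + N (eabs w))"
      by (rule N_add) measurable
    also have "\<dots> \<le> ennreal (2 powr p) * (ennreal (2 powr p) * (N (near_osc \<alpha> u) + N ?E) + N (eabs w))"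
      by (intro mult_left_mono add_right_mono N_add) measurable
    also have "\<dots> \<le> ennreal (2 powr p) * (ennreal (2 powr p) * (N (near_osc \<alpha> u) + ennreal K * ennreal \<epsilon>) + ennreal \<epsilon>)"
      using \<alpha> wN order_trans[OF N_near[of "\<lambda>t. ennreal \<bar>w t\<bar>" \<alpha>] mult_left_mono[OF wN]]
      by (intro mult_left_mono add_mono order_refl) auto
    also have "\<dots> = ennreal (2 powr p * 2 powr p) * N (near_osc \<alpha> u) + ennreal (q * \<epsilon>)"
      using K_pos \<epsilon> by (simp add: q_def distrib_left ennreal_mult[symmetric] mult.assoc[symmetric] add.assoc
        ennreal_plus[symmetric] del: ennreal_plus) (simp add: algebra_simps)
    also have "q * \<epsilon> = e / 2" using q by (simp add: \<epsilon>_def)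
    finally show ?thesis .
  qed
  have "((\<lambda>\<alpha>. ennreal (2 powr p * 2 powr p) * N (near_osc \<alpha> u)) \<longlongrightarrow> ennreal (2 powr p * 2 powr p) * 0) (at_left 1)"
    by (intro tendsto_mult_ennreal tendsto_const near_osc_bounded_tendsto_0[where M="real M"] uM) auto
  then have "\<forall>\<^sub>F \<alpha> in at_left 1. ennreal (2 powr p * 2 powr p) * N (near_osc \<alpha> u) < ennreal (e / 2)"
    using e by (intro order_tendstoD(2)[of _ 0]) auto
  moreover have "\<forall>\<^sub>F \<alpha> in at_left (1::real). \<alpha> \<in> {0<..<1}"
    by (intro eventually_at_leftI[of 0]) auto
  ultimately show "\<forall>\<^sub>F \<alpha> in at_left 1. N (near_osc \<alpha> v) \<le> ennreal e"
  proof eventually_elim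
    case (elim \<alpha>)
    then have "N (near_osc \<alpha> v) \<le> ennreal (e / 2) + ennreal (e / 2)"
      by (intro order_trans[OF main] add_right_mono) auto
    then show ?case using e by (simp add: ennreal_plus[symmetric] del: ennreal_plus)
  qed
qed

lemma W_growth:
  assumes h: "1 \<le> h"
  shows "mass W {y..y + h} \<le> ennreal ((C * h) powr p) * mass W {y - 1..y}"
proof -
  have "(\<integral>\<^sup>+x\<in>{y - h..y}. indicator {y - 1..y} x \<partial>lborel) = (\<integral>\<^sup>+x. indicator {y - 1..y} x \<partial>lborel)"
    using h by (intro nn_integral_cong) (auto split: split_indicator)
  then have "(\<integral>\<^sup>+x\<in>{y - h..y}. indicator {y - 1..y} x \<partial>lborel) = ennreal 1" by simp
  moreover have "(\<integral>\<^sup>+x\<in>{y - h..y}. epow p (indicator {y - 1..y} x) * ennreal (W x) \<partial>lborel) = mass W {y - 1..y}"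
    using h epow_ennreal[of 1 p] by (intro nn_integral_cong) (auto split: split_indicator)
  ultimately show ?thesis
    using adjacent[of "indicator {y - 1..y}" h y] h epow_ennreal[of 1 p] by simp
qed

text \<open>By the layer cake formula and \<open>W_growth\<close>, the integral converges because the exponent \<open>(1 + \<alpha>) p\<close>
exceeds p; the excess \<open>\<alpha> p\<close> produces the factor \<open>1/\<alpha>\<close>.\<close>

lemma W_tail:
  assumes \<alpha>: "0 < \<alpha>" "\<alpha> \<le> 1"
  shows "(\<integral>\<^sup>+t\<in>{y + 1<..}. ennreal ((t - y) powr (- ((1 + \<alpha>) * p))) * ennreal (W t) \<partial>lborel)
    \<le> ennreal (2 / \<alpha>) * (ennreal (C powr p) * mass W {y - 1..y})"
proof -
  define r where "r = (1 + \<alpha>) * p"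
  define Q where "Q = ennreal (C powr p) * mass W {y - 1..y}"
  have r: "0 < r" using \<alpha> p by (simp add: r_def)
  have "(\<integral>\<^sup>+t\<in>{y + 1<..}. ennreal ((t - y) powr (- r)) * ennreal (W t) \<partial>lborel)
    = (\<integral>\<^sup>+s. ennreal (((y + s) - y) powr (- r)) * ennreal (W (y + s)) * indicator {y + 1<..} (y + s) \<partial>lborel)"
    by (rule nn_integral_translate(2)[symmetric]) measurable
  also have "\<dots> = (\<integral>\<^sup>+s\<in>{1<..}. ennreal (W (y + s)) * ennreal (s powr (- r)) \<partial>lborel)"
    by (intro nn_integral_cong) (auto simp: mult_ac split: split_indicator)
  also have "\<dots> = (\<integral>\<^sup>+h\<in>{1<..}. ennreal (r * h powr (- r - 1)) * (\<integral>\<^sup>+s\<in>{1<..h}. ennreal (W (y + s)) \<partial>lborel) \<partial>lborel)"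
    using r by (intro nn_integral_powr_layer) auto
  also have "\<dots> \<le> (\<integral>\<^sup>+h. ennreal ((1 + \<alpha>) / \<alpha>) * Q * (ennreal (\<alpha> * p * h powr (- (\<alpha> * p) - 1)) * indicator {1..} h) \<partial>lborel)"
  proof (rule nn_integral_mono)
    fix h :: real
    show "ennreal (r * h powr (- r - 1)) * (\<integral>\<^sup>+s\<in>{1<..h}. ennreal (W (y + s)) \<partial>lborel) * indicator {1<..} h
      \<le> ennreal ((1 + \<alpha>) / \<alpha>) * Q * (ennreal (\<alpha> * p * h powr (- (\<alpha> * p) - 1)) * indicator {1..} h)"
    proof (cases "1 < h")
      case True
      have "(\<integral>\<^sup>+s\<in>{1<..h}. ennreal (W (y + s)) \<partial>lborel) \<le> (\<integral>\<^sup>+s. ennreal (W (y + s)) * indicator {y..y + h} (y + s) \<partial>lborel)"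
        by (intro nn_integral_mono) (auto split: split_indicator)
      also have "\<dots> = mass W {y..y + h}"
        by (rule nn_integral_translate(2)[of "\<lambda>s. ennreal (W s) * indicator {y..y + h} s"]) measurable
      also have "\<dots> \<le> ennreal (h powr p) * Q"
        using W_growth[of h y] True C by (simp add: Q_def powr_mult ennreal_mult mult_ac)
      finally have "ennreal (r * h powr (- r - 1)) * (\<integral>\<^sup>+s\<in>{1<..h}. ennreal (W (y + s)) \<partial>lborel)
         \<le> ennreal (r * h powr (- r - 1)) * (ennreal (h powr p) * Q)" by (rule mult_left_mono) simp
      also have "\<dots> = ennreal (r * h powr (- r - 1) * h powr p) * Q"
        using r by (simp add: ennreal_mult mult.assoc)
      also have "r * h powr (- r - 1) * h powr p = (1 + \<alpha>) / \<alpha> * (\<alpha> * p * h powr (- (\<alpha> * p) - 1))"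
      proof -
        have "h powr (- r - 1) * h powr p = h powr (- (\<alpha> * p) - 1)"
          unfolding powr_add[symmetric] by (rule arg_cong[where f="\<lambda>x. h powr x"]) (simp add: r_def algebra_simps)
        moreover have "r = (1 + \<alpha>) / \<alpha> * (\<alpha> * p)" using \<alpha> by (simp add: r_def)
        ultimately show ?thesis by (metis (no_types, opaque_lifting) mult.assoc)
      qed
      also have "ennreal \<dots> * Q = ennreal ((1 + \<alpha>) / \<alpha>) * Q * ennreal (\<alpha> * p * h powr (- (\<alpha> * p) - 1))"
        using \<alpha> p_pos by (subst ennreal_mult) (auto simp: mult_ac)
      finally show ?thesis using True by simp
    qed simp
  qed
  also have "\<dots> = ennreal ((1 + \<alpha>) / \<alpha>) * Q * 1"
    using nn_integral_powr_atLeast[of "\<alpha> * p" 1] \<alpha> p_pos by (subst nn_integral_cmult) auto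
  also have "\<dots> \<le> ennreal (2 / \<alpha>) * Q"
    using \<alpha> by (auto intro!: mult_right_mono ennreal_leI divide_right_mono)
  finally show ?thesis unfolding r_def Q_def .
qed

text \<open>For bounded g supported in [-M, M] the far part is at most a multiple of \<open>\<alpha>\<close> times a fixed profile b
that decays like \<open>(t - M)^(-1-\<alpha>)\<close> to the right of the support. Its modular is \<open>O(1/\<alpha>)\<close> by \<open>W_tail\<close>, so
the total is \<open>O(\<alpha>^(p-1))\<close>. This is where p > 1 is needed.\<close>

lemma far_bounded_tendsto_0:
  assumes [measurable]: "g \<in> borel_measurable borel" and g: "\<And>t. g t \<le> ennreal M * indicator {-M..M} t" and M: "0 \<le> M"
    and p1: "1 < p"
  shows "((\<lambda>\<alpha>. N (far \<alpha> g)) \<longlongrightarrow> 0) (at_right 0)"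
proof -
  define w where "w = enn2real (mass W {-M..M + 1})"
  define Q where "Q = C powr p * enn2real (mass W {M - 1..M})"
  have w: "mass W {-M..M + 1} = ennreal w" "0 \<le> w"
    using W_finite by (auto simp: w_def)
  have Q: "ennreal (C powr p) * mass W {M - 1..M} = ennreal Q" "0 \<le> Q"
    using W_finite C by (auto simp: Q_def ennreal_mult)
  define m where "m = 2 * M * M"
  have m: "0 \<le> m" using M by (simp add: m_def)
  have bound: "N (far \<alpha> g) \<le> ennreal (m powr p * (\<alpha> powr p * w + 2 * Q * \<alpha> powr (p - 1)))" if \<alpha>: "0 < \<alpha>" "\<alpha> < 1" for \<alpha>
  proof -
    \<comment> \<open>On [-M, M + 1] the kernel is bounded by 1; further right, the support is at distance t - M.\<close>
    define b where "b t = indicator {-M..M + 1} t + ennreal ((t - M) powr (- (1 + \<alpha>))) * indicator {M + 1<..} t" for t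
    have [measurable]: "b \<in> borel_measurable borel" unfolding b_def by measurable
    have far_b: "far \<alpha> g t \<le> ennreal (\<alpha> * m) * b t" for t
    proof -
      have pt: "kf \<alpha> s * g (t - s) \<le> ennreal (\<alpha> * M) * b t * indicator {t - M..t + M} s" for s
      proof (cases "1 < s \<and> t - s \<in> {-M..M}")
        case True
        have "s powr (- 1 - \<alpha>) \<le> 1" using True \<alpha> powr_mono[of "-1-\<alpha>" 0 s] by simp
        moreover have "s powr (- 1 - \<alpha>) \<le> (t - M) powr (- 1 - \<alpha>)" if "M + 1 < t"
          using that True \<alpha> by (intro powr_mono2') auto
        ultimately have "ennreal (s powr (- 1 - \<alpha>)) \<le> b t"
          using True unfolding b_def
          by (cases "t \<le> M + 1") (auto simp: ennreal_le_1 ennreal_leI split: split_indicator)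
        then have "kf \<alpha> s \<le> ennreal \<alpha> * b t"
          using \<alpha> True by (simp add: kf_def ennreal_mult mult_left_mono)
        moreover have "g (t - s) \<le> ennreal M" using g[of "t - s"] True by simp
        ultimately have "kf \<alpha> s * g (t - s) \<le> ennreal \<alpha> * b t * ennreal M" by (intro mult_mono) auto
        then show ?thesis using True \<alpha> M by (simp add: ennreal_mult mult_ac)
      next
        case False
        then show ?thesis using g[of "t - s"] by (auto simp: kf_def split: split_indicator_asm)
      qed
      have "far \<alpha> g t \<le> (\<integral>\<^sup>+s. ennreal (\<alpha> * M) * b t * indicator {t - M..t + M} s \<partial>lborel)"
        unfolding far_def by (intro nn_integral_mono pt)
      also have "\<dots> = ennreal (\<alpha> * M) * b t * ennreal (2 * M)"
        using M by (simp add: nn_integral_cmult)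
      also have "\<dots> = ennreal (\<alpha> * m) * b t"
        using \<alpha> M by (simp add: m_def ennreal_mult mult_ac)
      finally show ?thesis .
    qed
    have "N b = (\<integral>\<^sup>+t. ennreal (W t) * indicator {-M..M + 1} t + ennreal ((t - M) powr (- ((1 + \<alpha>) * p))) * ennreal (W t) * indicator {M + 1<..} t \<partial>lborel)"
      unfolding N_def b_def using epow_ennreal[of 1 p]
      by (intro nn_integral_cong) (auto simp: powr_powr minus_mult_left[symmetric] split: split_indicator simp del: minus_add_distrib mult_minus_left)
    also have "\<dots> = ennreal w + (\<integral>\<^sup>+t\<in>{M + 1<..}. ennreal ((t - M) powr (- ((1 + \<alpha>) * p))) * ennreal (W t) \<partial>lborel)"
      by (subst nn_integral_add) (auto simp: w)
    also have "\<dots> \<le> ennreal w + ennreal (2 / \<alpha>) * ennreal Q"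
      using W_tail[of \<alpha> M] \<alpha> by (intro add_left_mono) (simp add: Q)
    also have "\<dots> = ennreal (w + 2 * Q / \<alpha>)"
      using \<alpha> w Q by (simp add: ennreal_mult[symmetric] ennreal_plus[symmetric] mult.commute del: ennreal_plus)
    finally have Nb: "N b \<le> ennreal (w + 2 * Q / \<alpha>)" .
    have "N (far \<alpha> g) \<le> N (\<lambda>t. ennreal (\<alpha> * m) * b t)" by (intro N_mono AE_I2 far_b)
    also have "\<dots> = ennreal ((\<alpha> * m) powr p) * N b" using \<alpha> m by (simp add: N_cmult)
    also have "\<dots> \<le> ennreal ((\<alpha> * m) powr p) * ennreal (w + 2 * Q / \<alpha>)" by (intro mult_left_mono Nb) simp
    also have "\<dots> = ennreal ((\<alpha> * m) powr p * (w + 2 * Q / \<alpha>))"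
      using \<alpha> w Q by (simp add: ennreal_mult)
    also have "(\<alpha> * m) powr p * (w + 2 * Q / \<alpha>) = m powr p * (\<alpha> powr p * w + 2 * Q * \<alpha> powr (p - 1))"
      using \<alpha> by (simp add: powr_mult powr_diff algebra_simps)
    finally show ?thesis .
  qed
  have z: "((\<lambda>\<alpha>. \<alpha> powr a) \<longlongrightarrow> 0) (at_right (0::real))" if "0 < a" for a
    using that by (intro tendsto_zero_powrI[where b=a]) (auto simp: eventually_at_right_less intro!: tendsto_intros eventually_at_rightI[of _ 1])
  have "((\<lambda>\<alpha>. m powr p * (\<alpha> powr p * w + 2 * Q * \<alpha> powr (p - 1))) \<longlongrightarrow> m powr p * (0 * w + 2 * Q * 0)) (at_right 0)"
    using p1 by (intro tendsto_intros z) auto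
  then have "((\<lambda>\<alpha>. ennreal (m powr p * (\<alpha> powr p * w + 2 * Q * \<alpha> powr (p - 1)))) \<longlongrightarrow> ennreal 0) (at_right 0)"
    by (intro tendsto_ennrealI) simp
  moreover have "\<forall>\<^sub>F \<alpha> in at_right (0::real). \<alpha> \<in> {0<..<1}"
    by (intro eventually_at_rightI[of _ 1]) auto
  then have "\<forall>\<^sub>F \<alpha> in at_right 0. N (far \<alpha> g) \<le> ennreal (m powr p * (\<alpha> powr p * w + 2 * Q * \<alpha> powr (p - 1)))"
    by eventually_elim (use bound in auto)
  ultimately show ?thesis
    by (intro tendsto_sandwich[of "\<lambda>_. 0" "\<lambda>\<alpha>. N (far \<alpha> g)"]) auto
qed

lemma far_add:
  assumes [measurable]: "f \<in> borel_measurable borel" "g \<in> borel_measurable borel"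
  shows "far \<alpha> (\<lambda>t. f t + g t) t = far \<alpha> f t + far \<alpha> g t"
  unfolding far_def by (subst nn_integral_add[symmetric]) (auto simp: distrib_left)

lemma N_far_tendsto_0:
  assumes [measurable]: "g \<in> borel_measurable borel" and fin: "N g < top" and p1: "1 < p"
  shows "((\<lambda>\<alpha>. N (far \<alpha> g)) \<longlongrightarrow> 0) (at_right 0)"
proof (rule ennreal_tendsto_0I)
  fix e :: real assume e: "0 < e"
  define q where "q = 2 powr p * (2 powr p * K)"
  have q: "0 < q" using K_pos by (simp add: q_def)
  define \<epsilon> where "\<epsilon> = e / (2 * q)"
  have \<epsilon>: "0 < \<epsilon>" using e q by (simp add: \<epsilon>_def)
  obtain M :: nat and A where [measurable]: "A \<in> sets borel" and M: "N (\<lambda>t. g t * indicator A t) \<le> ennreal \<epsilon>"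
    and A: "\<And>t. t \<notin> A \<Longrightarrow> \<bar>t\<bar> \<le> real M \<and> g t \<le> ennreal (real M)"
    using N_truncate[OF assms(1) fin \<epsilon>] by metis
  define u where "u t = g t * indicator (- A) t" for t
  define w where "w t = g t * indicator A t" for t
  have [measurable]: "u \<in> borel_measurable borel" "w \<in> borel_measurable borel"
    unfolding u_def w_def by measurable
  have g: "g = (\<lambda>t. u t + w t)" by (auto simp: u_def w_def fun_eq_iff split: split_indicator)
  have wN: "N w \<le> ennreal \<epsilon>" using M unfolding w_def .
  have uM: "u t \<le> ennreal (real M) * indicator {-real M..real M} t" for t
    using A[of t] by (auto simp: u_def abs_le_iff split: split_indicator)
  have main: "N (far \<alpha> g) \<le> ennreal (2 powr p) * N (far \<alpha> u) + ennreal (e / 2)" if \<alpha>: "0 < \<alpha>" "\<alpha> < 1" for \<alpha>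
  proof -
    have "N (far \<alpha> g) = N (\<lambda>t. far \<alpha> u t + far \<alpha> w t)"
      unfolding g by (intro N_cong AE_I2 far_add) auto
    also have "\<dots> \<le> ennreal (2 powr p) * (N (far \<alpha> u) + N (far \<alpha> w))"
      by (rule N_add) measurable
    also have "\<dots> \<le> ennreal (2 powr p) * (N (far \<alpha> u) + ennreal (2 powr p * K) * ennreal \<epsilon>)"
      using \<alpha> wN order_trans[OF N_far[of w \<alpha>] mult_left_mono[OF wN]]
      by (intro mult_left_mono add_mono order_refl) auto
    also have "\<dots> = ennreal (2 powr p) * N (far \<alpha> u) + ennreal (q * \<epsilon>)"
      using K_pos \<epsilon> by (simp add: q_def distrib_left ennreal_mult[symmetric] mult.assoc)
    also have "q * \<epsilon> = e / 2" using q by (simp add: \<epsilon>_def)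
    finally show ?thesis .
  qed
  have "((\<lambda>\<alpha>. ennreal (2 powr p) * N (far \<alpha> u)) \<longlongrightarrow> ennreal (2 powr p) * 0) (at_right 0)"
    by (intro tendsto_mult_ennreal tendsto_const far_bounded_tendsto_0[where M="real M"] uM p1) auto
  then have "\<forall>\<^sub>F \<alpha> in at_right 0. ennreal (2 powr p) * N (far \<alpha> u) < ennreal (e / 2)"
    using e by (intro order_tendstoD(2)[of _ 0]) auto
  moreover have "\<forall>\<^sub>F \<alpha> in at_right (0::real). \<alpha> \<in> {0<..<1}"
    by (intro eventually_at_rightI[of _ 1]) auto
  ultimately show "\<forall>\<^sub>F \<alpha> in at_right 0. N (far \<alpha> g) \<le> ennreal e"
  proof eventually_elim
    case (elim \<alpha>)
    then have "N (far \<alpha> g) \<le> ennreal (e / 2) + ennreal (e / 2)"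
      by (intro order_trans[OF main] add_right_mono) auto
    then show ?case using e by (simp add: ennreal_plus[symmetric] del: ennreal_plus)
  qed
qed

text \<open>Averages over [t - h, t] with h > 1 are comparable with averages over intervals of integer length,
so a countable supremum dominates the far part; it is measurable, and dominated convergence
applies.\<close>

lemma N_far_tendsto_0_maximal:
  assumes [measurable]: "g \<in> borel_measurable borel" and fin: "N g < top"
    and max: "N (\<lambda>t. SUP n. avg (real (Suc n)) g t) < top"
  shows "((\<lambda>\<alpha>. N (far \<alpha> g)) \<longlongrightarrow> 0) (at_right 0)"
proof (rule N_dominated_at_right[where H="\<lambda>t. 4 * (SUP n. avg (real (Suc n)) g t)"])
  show "N (\<lambda>t. 4 * (SUP n. avg (real (Suc n)) g t)) < top"
    using max epow_ennreal[of 4 p] by (subst N_cmult) (auto simp: ennreal_mult_less_top)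
  fix \<alpha> :: real assume \<alpha>: "0 < \<alpha>" "\<alpha> < 1"
  have "far \<alpha> g t \<le> 4 * (SUP n. avg (real (Suc n)) g t)" for t
  proof -
    define S where "S = (SUP n. avg (real (Suc n)) g t)"
    have avg: "avg h g t \<le> 2 * S" if h: "1 < h" for h
    proof -
      define n where "n = nat \<lceil>h\<rceil>"
      have n: "h \<le> real n" "real n \<le> 2 * h" "0 < n" using h unfolding n_def by linarith+
      have "(\<integral>\<^sup>+\<tau>\<in>{t - h..t}. g \<tau> \<partial>lborel) \<le> (\<integral>\<^sup>+\<tau>\<in>{t - real n..t}. g \<tau> \<partial>lborel)"
        using n by (intro nn_integral_mono) (auto split: split_indicator)
      moreover have "ennreal (1 / h) \<le> ennreal 2 * ennreal (1 / real n)"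
        using n h by (subst ennreal_mult[symmetric]) (auto intro!: ennreal_leI simp: field_simps)
      ultimately have "avg h g t \<le> ennreal 2 * ennreal (1 / real n) * (\<integral>\<^sup>+\<tau>\<in>{t - real n..t}. g \<tau> \<partial>lborel)"
        unfolding avg_def by (intro mult_mono) auto
      also have "\<dots> = 2 * avg (real (Suc (n - 1))) g t" using n by (simp add: avg_def mult.assoc)
      also have "\<dots> \<le> 2 * S" unfolding S_def by (intro mult_left_mono SUP_upper) auto
      finally show ?thesis .
    qed
    have "far \<alpha> g t \<le> ennreal (1 + \<alpha>) * (\<integral>\<^sup>+h. kf \<alpha> h * avg h g t \<partial>lborel)"
      using \<alpha> by (intro far_le_avg) auto
    also have "\<dots> \<le> ennreal 2 * (\<integral>\<^sup>+h. kf \<alpha> h * (2 * S) \<partial>lborel)"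
    proof (rule mult_mono[OF ennreal_leI nn_integral_mono])
      fix h show "kf \<alpha> h * avg h g t \<le> kf \<alpha> h * (2 * S)"
        using avg[of h] by (auto simp: kf_def intro!: mult_left_mono split: split_indicator)
    qed (use \<alpha> in auto)
    also have "\<dots> = ennreal 2 * (2 * S)" using \<alpha> by (simp add: nn_integral_multc nn_integral_kf)
    also have "\<dots> = 4 * S" by (simp add: mult.assoc[symmetric])
    finally show ?thesis unfolding S_def .
  qed
  then show "AE t in lborel. far \<alpha> g t \<le> 4 * (SUP n. avg (real (Suc n)) g t)" by simp
qed (use far_tendsto_0[OF _ fin] in auto)

end

section \<open>Test functions and weak derivatives\<close>

lemma Fubini_real:
  fixes f :: "real \<Rightarrow> real \<Rightarrow> real"
  assumes [measurable]: "(\<lambda>(x, y). f x y) \<in> borel_measurable (borel \<Otimes>\<^sub>M borel)"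
    and fin: "(\<integral>\<^sup>+x. (\<integral>\<^sup>+y. ennreal \<bar>f x y\<bar> \<partial>lborel) \<partial>lborel) < top"
  shows "(LINT x|lborel. LINT y|lborel. f x y) = (LINT y|lborel. LINT x|lborel. f x y)"
    "integrable lborel (\<lambda>x. LINT y|lborel. f x y)" "integrable lborel (\<lambda>y. LINT x|lborel. f x y)"
    "AE x in lborel. integrable lborel (\<lambda>y. f x y)" "AE y in lborel. integrable lborel (\<lambda>x. f x y)"
proof -
  have m: "(\<lambda>(x, y). f x y) \<in> borel_measurable (lborel \<Otimes>\<^sub>M lborel)" by measurable
  have int: "integrable (lborel \<Otimes>\<^sub>M lborel) (\<lambda>(x, y). f x y)"
  proof (rule integrableI_bounded)
    have "(\<integral>\<^sup>+z. ennreal (norm (case z of (x, y) \<Rightarrow> f x y)) \<partial>(lborel \<Otimes>\<^sub>M lborel))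
        = (\<integral>\<^sup>+x. (\<integral>\<^sup>+y. ennreal \<bar>f x y\<bar> \<partial>lborel) \<partial>lborel)"
      by (subst lborel.nn_integral_fst[symmetric]) auto
    then show "(\<integral>\<^sup>+z. ennreal (norm (case z of (x, y) \<Rightarrow> f x y)) \<partial>(lborel \<Otimes>\<^sub>M lborel)) < \<infinity>"
      using fin by simp
  qed (rule m)
  show "(LINT x|lborel. LINT y|lborel. f x y) = (LINT y|lborel. LINT x|lborel. f x y)"
    using lborel_pair.Fubini_integral[OF int] by simp
  show "integrable lborel (\<lambda>x. LINT y|lborel. f x y)" using lborel_pair.integrable_fst[OF int] .
  show "integrable lborel (\<lambda>y. LINT x|lborel. f x y)" using lborel_pair.integrable_snd[OF int] .
  show "AE x in lborel. integrable lborel (\<lambda>y. f x y)" using lborel_pair.AE_integrable_fst[OF int] .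
  show "AE y in lborel. integrable lborel (\<lambda>x. f x y)" using lborel_pair.AE_integrable_snd[OF int] .
qed

lemma smoothI:
  assumes "\<And>k t. (F k has_real_derivative F (Suc k) t) (at t)"
  shows "smooth (F 0)" "(deriv ^^ k) (F 0) = F k"
proof -
  have *: "(deriv ^^ k) (F 0) = F k" for k
  proof (induction k)
    case (Suc k)
    have "deriv (F k) = F (Suc k)" using DERIV_imp_deriv[OF assms] by blast
    then show ?case using Suc by simp
  qed simp
  show "(deriv ^^ k) (F 0) = F k" by (rule *)
  show "smooth (F 0)" unfolding smooth_def *
    using assms real_differentiable_def by blast
qed

lemma smooth_DERIV: "smooth f \<Longrightarrow> ((deriv ^^ k) f has_real_derivative deriv ((deriv ^^ k) f) t) (at t)"
  by (simp add: smooth_def DERIV_deriv_iff_real_differentiable)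

lemma smooth_DERIV0: "smooth f \<Longrightarrow> (f has_real_derivative deriv f t) (at t)"
  using smooth_DERIV[of f 0 t] by simp

lemma smooth_deriv: "smooth f \<Longrightarrow> smooth (deriv f)"
  unfolding smooth_def by (metis comp_apply funpow_Suc_right)

lemma smooth_continuous: "smooth f \<Longrightarrow> continuous_on A ((deriv ^^ k) f)"
  by (meson DERIV_isCont continuous_at_imp_continuous_on smooth_DERIV)

lemma smooth_measurable [measurable]: "smooth f \<Longrightarrow> (deriv ^^ k) f \<in> borel_measurable borel"
  by (intro borel_measurable_continuous_onI smooth_continuous)

lemma smooth_measurable0: "smooth f \<Longrightarrow> f \<in> borel_measurable borel" "smooth f \<Longrightarrow> deriv f \<in> borel_measurable borel"
  using smooth_measurable[of f 0] smooth_measurable[of f 1] by auto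

lemma smooth_cong_DERIV:
  assumes "smooth f" "\<And>t. (g has_real_derivative f t) (at t)"
  shows "smooth g"
  by (rule smoothI(1)[of "\<lambda>k. case k of 0 \<Rightarrow> g | Suc k \<Rightarrow> (deriv ^^ k) f", simplified])
     (use assms smooth_DERIV[OF assms(1)] in \<open>auto split: nat.splits\<close>)

lemma smooth_affine: "smooth f \<Longrightarrow> smooth (\<lambda>x. f (a * x + b))"
  by (rule smoothI(1)[of "\<lambda>k x. a ^ k * (deriv ^^ k) f (a * x + b)", simplified])
     (auto intro!: derivative_eq_intros DERIV_chain'[OF _ smooth_DERIV])

lemma smooth_diff: "smooth f \<Longrightarrow> smooth g \<Longrightarrow> smooth (\<lambda>x. f x - g x)"
  by (rule smoothI(1)[of "\<lambda>k x. (deriv ^^ k) f x - (deriv ^^ k) g x", simplified])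
     (intro DERIV_diff smooth_DERIV)

text \<open>Sums of products of smooth functions: a class that contains f g and is closed under
differentiation, which proves smoothness of products without Leibniz' formula.\<close>

inductive prod_sum :: "(real \<Rightarrow> real) \<Rightarrow> bool" where
  prod: "smooth f \<Longrightarrow> smooth g \<Longrightarrow> prod_sum (\<lambda>x. f x * g x)"
| sum: "prod_sum f \<Longrightarrow> prod_sum g \<Longrightarrow> prod_sum (\<lambda>x. f x + g x)"

lemma prod_sum_step: "prod_sum f \<Longrightarrow> (\<forall>t. f differentiable (at t)) \<and> prod_sum (deriv f)"
proof (induction rule: prod_sum.induct)
  case (prod f g)
  have d: "((\<lambda>x. f x * g x) has_real_derivative (deriv f t * g t + deriv g t * f t)) (at t)" for t
    using DERIV_mult[OF smooth_DERIV0[OF prod(1)] smooth_DERIV0[OF prod(2)]] .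
  then have "deriv (\<lambda>x. f x * g x) = (\<lambda>t. deriv f t * g t + deriv g t * f t)"
    using DERIV_imp_deriv by blast
  then show ?case using d prod
    by (auto intro!: prod_sum.intros smooth_deriv simp: real_differentiable_def)
next
  case (sum f g)
  then have d: "((\<lambda>x. f x + g x) has_real_derivative (deriv f t + deriv g t)) (at t)" for t
    by (intro DERIV_add) (auto simp: DERIV_deriv_iff_real_differentiable)
  then have "deriv (\<lambda>x. f x + g x) = (\<lambda>t. deriv f t + deriv g t)"
    using DERIV_imp_deriv by blast
  then show ?case using d sum
    by (auto intro!: prod_sum.sum simp: real_differentiable_def)
qed

lemma smooth_mult:
  assumes "smooth f" "smooth g"
  shows "smooth (\<lambda>x. f x * g x)"
proof -
  have "prod_sum ((deriv ^^ k) (\<lambda>x. f x * g x))" for k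
    by (induction k) (use assms prod_sum_step prod_sum.prod in auto)
  then show ?thesis unfolding smooth_def using prod_sum_step by blast
qed

text \<open>The standard smooth function that vanishes exactly for x \<le> 0; its limit at infinity is 1.\<close>

definition smooth_step :: "real \<Rightarrow> real" where
  "smooth_step x = (if x \<le> 0 then 0 else exp (- 1 / x))"

lemma poly_exp_tendsto_0: "((\<lambda>y::real. poly P y * exp (- y)) \<longlongrightarrow> 0) at_top"
proof -
  have "((\<lambda>y::real. \<Sum>i\<le>degree P. coeff P i * (y ^ i / exp y)) \<longlongrightarrow> (\<Sum>i\<le>degree P. coeff P i * 0)) at_top"
    by (intro tendsto_sum tendsto_mult tendsto_const tendsto_power_div_exp_0)
  then show ?thesis by (simp add: poly_altdef sum_distrib_right exp_minus divide_inverse mult.assoc)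
qed

text \<open>All derivatives have the form P(1/x) exp(-1/x) for x > 0 with polynomials P that satisfy a
recursion, and such functions are \<open>o(x)\<close> at 0.\<close>

lemma smooth_smooth_step: "smooth smooth_step"
proof -
  define P :: "nat \<Rightarrow> real poly" where "P k = ((\<lambda>P. monom 1 2 * (P - pderiv P)) ^^ k) 1" for k
  have P: "P 0 = 1" "P (Suc k) = monom 1 2 * (P k - pderiv (P k))" for k
    by (simp_all add: P_def)
  define F where "F k x = (if x \<le> 0 then 0 else poly (P k) (1 / x) * exp (- 1 / x))" for k and x :: real
  have F0: "F 0 = smooth_step" by (auto simp: F_def smooth_step_def P fun_eq_iff)
  have "(F k has_real_derivative F (Suc k) x) (at x)" for k x
  proof (cases "x = 0")
    case True
    have "((\<lambda>y::real. poly (monom 1 1 * P k) y * exp (- y)) \<longlongrightarrow> 0) at_top" by (rule poly_exp_tendsto_0)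
    then have "((\<lambda>h::real. poly (monom 1 1 * P k) (inverse h) * exp (- inverse h)) \<longlongrightarrow> 0) (at_right 0)"
      by (rule filterlim_compose[OF _ filterlim_inverse_at_top_right])
    then have "((\<lambda>h. F k h / h) \<longlongrightarrow> 0) (at_right 0)"
      by (rule Lim_transform_eventually)
         (auto simp: F_def eventually_at_right_field poly_monom field_simps intro!: exI[of _ 1])
    moreover have "((\<lambda>h. F k h / h) \<longlongrightarrow> 0) (at_left 0)"
      by (rule tendsto_eventually) (auto simp: F_def eventually_at_left_field intro!: exI[of _ "-1"])
    ultimately have "((\<lambda>h. F k h / h) \<longlongrightarrow> 0) (at 0)"
      by (simp add: filterlim_split_at)
    then show ?thesis using True by (simp add: DERIV_def F_def)
  next
    case False
    show ?thesis
    proof (cases "x < 0")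
      case True
      have "((\<lambda>_. 0) has_real_derivative 0) (at x)" by simp
      then have "(F k has_real_derivative 0) (at x)"
        by (rule has_field_derivative_transform_within_open[where S="{..<0}"]) (use True in \<open>auto simp: F_def\<close>)
      then show ?thesis using True by (simp add: F_def)
    next
      case neg: False
      then have x: "0 < x" using False by simp
      have "((\<lambda>x. poly (P k) (1 / x) * exp (- 1 / x)) has_real_derivative F (Suc k) x) (at x)"
        using x by (auto intro!: derivative_eq_intros DERIV_chain'[OF _ poly_DERIV]
            simp: F_def P poly_monom power2_eq_square field_simps)
      then show ?thesis
        by (rule has_field_derivative_transform_within_open[where S="{0<..}"]) (use x in \<open>auto simp: F_def\<close>)
    qed
  qed
  from smoothI(1)[of F, OF this] F0 show ?thesis by simp
qed

definition test :: "(real \<Rightarrow> real) \<Rightarrow> bool" where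
  "test \<phi> \<longleftrightarrow> smooth \<phi> \<and> (\<exists>A. \<forall>t. A < \<bar>t\<bar> \<longrightarrow> \<phi> t = 0)"

lemma test_deriv_support:
  assumes "smooth \<phi>" "\<And>t. A < \<bar>t\<bar> \<Longrightarrow> \<phi> t = 0"
  shows "A < \<bar>t\<bar> \<Longrightarrow> (deriv ^^ k) \<phi> t = 0"
proof (induction k arbitrary: t)
  case (Suc k)
  have "((\<lambda>_. 0) has_real_derivative 0) (at t)" by simp
  then have "((deriv ^^ k) \<phi> has_real_derivative 0) (at t)"
    by (rule has_field_derivative_transform_within_open[where S="{t. A < \<bar>t\<bar>}"])
       (use Suc in \<open>auto intro!: open_Collect_less continuous_intros\<close>)
  then show ?case by (simp add: DERIV_imp_deriv)
qed (use assms in auto)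

lemma test_bounded:
  assumes "test \<phi>"
  obtains A B where "0 < A" "0 \<le> B" "\<And>t. A < \<bar>t\<bar> \<Longrightarrow> (deriv ^^ k) \<phi> t = 0" "\<And>t. \<bar>(deriv ^^ k) \<phi> t\<bar> \<le> B * indicator {-A..A} t"
proof -
  obtain A0 where "smooth \<phi>" "\<And>t. A0 < \<bar>t\<bar> \<Longrightarrow> \<phi> t = 0" using assms by (auto simp: test_def)
  define A where "A = max A0 1"
  have A: "0 < A" "\<And>t. A < \<bar>t\<bar> \<Longrightarrow> (deriv ^^ k) \<phi> t = 0"
    using test_deriv_support[OF \<open>smooth \<phi>\<close>, of A0] \<open>\<And>t. A0 < \<bar>t\<bar> \<Longrightarrow> \<phi> t = 0\<close> by (auto simp: A_def)
  have "compact ((\<lambda>t. \<bar>(deriv ^^ k) \<phi> t\<bar>) ` {-A..A})"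
    using \<open>smooth \<phi>\<close> by (intro compact_continuous_image continuous_intros smooth_continuous) auto
  then obtain B where "\<And>x. x \<in> {-A..A} \<Longrightarrow> \<bar>(deriv ^^ k) \<phi> x\<bar> \<le> B"
    by (force simp: bounded_iff dest!: compact_imp_bounded)
  then have B: "\<bar>(deriv ^^ k) \<phi> x\<bar> \<le> max B 0 * indicator {-A..A} x" for x
    using A(2)[of x] by (cases "x \<in> {-A..A}") (auto simp: le_max_iff_disj)
  show ?thesis by (rule that[of A "max B 0", OF A(1) _ A(2) B]) auto
qed

lemma test_in_S_minus:
  assumes "test \<phi>"
  shows "\<phi> \<in> S_minus"
  unfolding S_minus_def
proof (intro CollectI conjI allI)
  show "smooth \<phi>" using assms by (simp add: test_def)
  show "\<exists>A. \<forall>t>A. \<phi> t = 0" using assms unfolding test_def by (metis abs_ge_self less_le_trans)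
  fix l k
  obtain A B where AB: "0 < A" "0 \<le> B" "\<And>t. A < \<bar>t\<bar> \<Longrightarrow> (deriv ^^ k) \<phi> t = 0"
    "\<And>t. \<bar>(deriv ^^ k) \<phi> t\<bar> \<le> B * indicator {-A..A} t" using test_bounded[OF assms, of k] by metis
  have "\<bar>t\<bar> ^ l * \<bar>(deriv ^^ k) \<phi> t\<bar> \<le> A ^ l * B" for t
  proof (cases "A < \<bar>t\<bar>")
    case False
    then have "\<bar>(deriv ^^ k) \<phi> t\<bar> \<le> B" using AB(4)[of t] AB(2) by (auto split: split_indicator_asm)
    then show ?thesis using False AB by (intro mult_mono power_mono) auto
  qed (use AB in simp)
  then show "\<exists>B. \<forall>t. \<bar>t\<bar> ^ l * \<bar>(deriv ^^ k) \<phi> t\<bar> \<le> B" by blast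
qed

lemma test_measurable: "test \<phi> \<Longrightarrow> \<phi> \<in> borel_measurable borel" "test \<phi> \<Longrightarrow> deriv \<phi> \<in> borel_measurable borel"
  using smooth_measurable0 by (auto simp: test_def)

lemma locint_mult_bounded:
  assumes f: "locint f" and [measurable]: "\<phi> \<in> borel_measurable borel" and \<phi>: "\<And>t. \<bar>\<phi> t\<bar> \<le> B * indicator {a..b} t"
  shows "integrable lborel (\<lambda>t. f t * \<phi> t)"
proof (rule Bochner_Integration.integrable_bound)
  have [measurable]: "f \<in> borel_measurable borel" using f by (simp add: locint_def)
  show "(\<lambda>t. f t * \<phi> t) \<in> borel_measurable lborel" by simp
  show "integrable lborel (\<lambda>t. B * (indicator {a..b} t *\<^sub>R f t))"
    using f unfolding locint_def set_integrable_def by (intro integrable_mult_right) auto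
  show "AE t in lborel. norm (f t * \<phi> t) \<le> norm (B * (indicator {a..b} t *\<^sub>R f t))"
  proof (rule AE_I2)
    fix t
    show "norm (f t * \<phi> t) \<le> norm (B * (indicator {a..b} t *\<^sub>R f t))"
      using mult_left_mono[OF \<phi>[of t], of "\<bar>f t\<bar>"]
      by (auto simp: abs_mult mult.commute split: split_indicator) (smt (verit) abs_ge_zero abs_le_zero_iff mult_left_mono mult.commute)
  qed
qed

lemma test_integrable:
  assumes f: "locint f" and \<phi>: "test \<phi>"
  shows "integrable lborel (\<lambda>t. f t * \<phi> t)" "integrable lborel (\<lambda>t. f t * deriv \<phi> t)"
proof -
  obtain A B where "\<And>t. \<bar>(deriv ^^ 0) \<phi> t\<bar> \<le> B * indicator {-A..A} t" using test_bounded[OF \<phi>, of 0] by metis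
  then show "integrable lborel (\<lambda>t. f t * \<phi> t)" by (intro locint_mult_bounded[OF f test_measurable(1)[OF \<phi>]]) auto
  obtain A B where "\<And>t. \<bar>(deriv ^^ 1) \<phi> t\<bar> \<le> B * indicator {-A..A} t" using test_bounded[OF \<phi>, of 1] by metis
  then show "integrable lborel (\<lambda>t. f t * deriv \<phi> t)" by (intro locint_mult_bounded[OF f test_measurable(2)[OF \<phi>]]) auto
qed

text \<open>Products of two rescaled steps increase to the indicator of an open interval, so all integrals of f
over intervals vanish; then so do the difference quotients of the primitive.\<close>

lemma locint_ae_zero:
  assumes f: "locint f" and z: "\<And>\<phi>. test \<phi> \<Longrightarrow> pair f \<phi> = 0"
  shows "AE t in lborel. f t = 0"
proof -
  have [measurable]: "f \<in> borel_measurable borel" using f by (simp add: locint_def)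
  have Ioo: "(LINT t|lborel. f t * indicator {a<..<b} t) = 0" for a b
  proof -
    define \<phi> where "\<phi> n x = smooth_step (real n * (x - a)) * smooth_step (real n * (b - x))" for n :: nat and x
    have test: "test (\<phi> n)" for n
    proof -
      have "smooth (\<phi> n)" unfolding \<phi>_def
        using smooth_mult[OF smooth_affine[OF smooth_smooth_step, of "real n" "- real n * a"]
            smooth_affine[OF smooth_smooth_step, of "- real n" "real n * b"]]
        by (simp add: algebra_simps)
      moreover have "\<phi> n t = 0" if "max \<bar>a\<bar> \<bar>b\<bar> < \<bar>t\<bar>" for t
      proof -
        have "t < a \<or> b < t" using that by auto
        then have "real n * (t - a) \<le> 0 \<or> real n * (b - t) \<le> 0" by (auto intro: mult_nonneg_nonpos)
        then show ?thesis by (auto simp: \<phi>_def smooth_step_def)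
      qed
      ultimately show ?thesis unfolding test_def by blast
    qed
    have bound: "\<bar>\<phi> n x\<bar> \<le> indicator {a<..<b} x" for n x
    proof (cases "x \<in> {a<..<b}")
      case True
      have "\<bar>smooth_step y\<bar> \<le> 1" for y by (simp add: smooth_step_def)
      then show ?thesis using True by (auto simp: \<phi>_def abs_mult intro: mult_le_one)
    next
      case False
      then have "real n * (x - a) \<le> 0 \<or> real n * (b - x) \<le> 0" by (auto simp: not_less intro: mult_nonneg_nonpos)
      then show ?thesis using False by (auto simp: \<phi>_def smooth_step_def)
    qed
    have step_lim: "(\<lambda>n::nat. smooth_step (real n * c)) \<longlonglongrightarrow> 1" if "0 < c" for c
    proof -
      have "filterlim (\<lambda>n. real n * c) at_top sequentially"
        unfolding mult.commute[of _ c]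
        by (rule filterlim_tendsto_pos_mult_at_top[OF tendsto_const that filterlim_real_sequentially])
      then have "(\<lambda>n. exp (- 1 / (real n * c))) \<longlonglongrightarrow> exp 0"
        by (intro tendsto_exp tendsto_divide_0[OF tendsto_const] filterlim_at_top_imp_at_infinity)
      then have "(\<lambda>n. exp (- 1 / (real n * c))) \<longlonglongrightarrow> 1" by simp
      then show ?thesis
        by (rule Lim_transform_eventually)
           (use that in \<open>auto intro!: eventually_sequentiallyI[of 1] simp: smooth_step_def mult_le_0_iff\<close>)
    qed
    have lim: "(\<lambda>n. \<phi> n x) \<longlonglongrightarrow> indicator {a<..<b} x" for x
    proof (cases "x \<in> {a<..<b}")
      case True
      then have "(\<lambda>n. \<phi> n x) \<longlonglongrightarrow> 1 * 1" unfolding \<phi>_def by (intro tendsto_mult step_lim) auto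
      then show ?thesis using True by simp
    next
      case False
      then have "\<phi> n x = 0" for n using bound[of n x] by simp
      then show ?thesis using False by simp
    qed
    have "(\<lambda>n. LINT t|lborel. f t * \<phi> n t) \<longlonglongrightarrow> (LINT t|lborel. f t * indicator {a<..<b} t)"
    proof (rule integral_dominated_convergence[where w="\<lambda>t. \<bar>f t * indicator {a..b} t\<bar>"])
      show "integrable lborel (\<lambda>t. \<bar>f t * indicator {a..b} t\<bar>)"
        by (intro integrable_abs locint_mult_bounded[OF f, where B=1 and a=a and b=b]) auto
      show "(\<lambda>t. f t * \<phi> n t) \<in> borel_measurable lborel" for n using test_measurable(1)[OF test] by measurable
      show "AE t in lborel. norm (f t * \<phi> n t) \<le> \<bar>f t * indicator {a..b} t\<bar>" for n
      proof (rule AE_I2)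
        fix t
        have "\<bar>\<phi> n t\<bar> \<le> indicator {a..b} t" using bound[of n t] by (auto split: split_indicator_asm split_indicator)
        then show "norm (f t * \<phi> n t) \<le> \<bar>f t * indicator {a..b} t\<bar>" by (simp add: abs_mult mult_left_mono)
      qed
    qed (auto intro!: tendsto_mult lim)
    then show ?thesis using z[OF test] by (simp add: LIMSEQ_const_iff)
  qed
  have mean0: "(LINT \<tau>:{t - h..t}|lborel. f \<tau>) = 0" for h t
  proof -
    have "(LINT \<tau>:{t - h..t}|lborel. f \<tau>) = (LINT \<tau>|lborel. f \<tau> * indicator {t - h<..<t} \<tau>)"
      unfolding set_lebesgue_integral_def
      by (intro integral_cong_AE, measurable)
         (use AE_lborel_singleton[of t] AE_lborel_singleton[of "t - h"] in \<open>eventually_elim, auto split: split_indicator\<close>)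
    then show ?thesis using Ioo by simp
  qed
  show ?thesis using lebesgue_differentiation_left[OF f]
    by eventually_elim (simp add: mean0 tendsto_const_iff)
qed

lemma locint_diff: "locint f \<Longrightarrow> locint g \<Longrightarrow> locint (\<lambda>t. f t - g t)"
  by (auto simp: locint_def set_integral_diff)

lemma locint_ae_eq:
  assumes f: "locint f" "locint g" and z: "\<And>\<phi>. test \<phi> \<Longrightarrow> pair f \<phi> = pair g \<phi>"
  shows "AE t in lborel. f t = g t"
proof -
  have "AE t in lborel. f t - g t = 0"
    by (intro locint_ae_zero locint_diff f) (use z test_integrable[OF f(1)] test_integrable[OF f(2)] in \<open>simp add: left_diff_distrib\<close>)
  then show ?thesis by simp
qed

lemma nn_integral_locint:
  assumes "locint f"
  shows "(\<integral>\<^sup>+t\<in>{a..b}. ennreal \<bar>f t\<bar> \<partial>lborel) < top"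
  using set_nn_integral_real[of "{a..b}" "\<lambda>t. \<bar>f t\<bar>"] locint_abs[OF assms] by (simp add: locint_def)

lemma locintI:
  assumes [measurable]: "f \<in> borel_measurable borel" and "\<And>a b. (\<integral>\<^sup>+t\<in>{a..b}. ennreal \<bar>f t\<bar> \<partial>lborel) < top"
  shows "locint f"
  unfolding locint_def set_integrable_def
proof (intro conjI allI integrableI_bounded)
  fix a b
  have "(\<integral>\<^sup>+x. ennreal (norm (indicat_real {a..b} x *\<^sub>R f x)) \<partial>lborel) = (\<integral>\<^sup>+x\<in>{a..b}. ennreal \<bar>f x\<bar> \<partial>lborel)"
    by (intro nn_integral_cong) (auto split: split_indicator)
  then show "(\<integral>\<^sup>+x. ennreal (norm (indicat_real {a..b} x *\<^sub>R f x)) \<partial>lborel) < \<infinity>"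
    using assms(2)[of a b] by simp
qed auto

lemma lborel_integral_shift:
  fixes f :: "real \<Rightarrow> real"
  shows "(LINT x|lborel. f (x + c)) = (LINT x|lborel. f x)" "(LINT x|lborel. f (c - x)) = (LINT x|lborel. f x)"
  using lborel_integral_real_affine[of 1 f c] lborel_integral_real_affine[of "-1" f c] by (simp_all add: add.commute)

lemma locint_shift: 
  assumes "locint f" shows "locint (\<lambda>t. f (t - h))"
proof (rule locintI)
  have [measurable]: "f \<in> borel_measurable borel" using assms by (simp add: locint_def)
  show "(\<lambda>t. f (t - h)) \<in> borel_measurable borel" by measurable
  fix a b
  have "(\<integral>\<^sup>+t\<in>{a..b}. ennreal \<bar>f (t - h)\<bar> \<partial>lborel) = (\<integral>\<^sup>+t. ennreal \<bar>f (-h + t)\<bar> * indicator {a-h..b-h} (-h + t) \<partial>lborel)"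
    by (intro nn_integral_cong) (auto split: split_indicator)
  also have "\<dots> = (\<integral>\<^sup>+t. ennreal \<bar>f t\<bar> * indicator {a-h..b-h} t \<partial>lborel)"
    by (rule nn_integral_translate(2)[of "\<lambda>t. ennreal \<bar>f t\<bar> * indicator {a-h..b-h} t"]) measurable
  finally show "(\<integral>\<^sup>+t\<in>{a..b}. ennreal \<bar>f (t - h)\<bar> \<partial>lborel) < top" using nn_integral_locint[OF assms] by simp
qed

lemma test_shift: "test \<phi> \<Longrightarrow> test (\<lambda>x. \<phi> (x + h))"
  unfolding test_def
proof safe
  fix A assume "smooth \<phi>" "\<forall>t. A < \<bar>t\<bar> \<longrightarrow> \<phi> t = 0"
  then show "smooth (\<lambda>x. \<phi> (x + h))" using smooth_affine[of \<phi> 1 h] by simp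
  show "\<exists>A. \<forall>t. A < \<bar>t\<bar> \<longrightarrow> \<phi> (t + h) = 0"
    using \<open>\<forall>t. A < \<bar>t\<bar> \<longrightarrow> \<phi> t = 0\<close> by (intro exI[of _ "A + \<bar>h\<bar>"]) auto
qed

text \<open>Test the weak derivative with \<open>\<phi>(x) = \<integral>\<theta>(x + r) dr\<close> over [0, h]. Then \<open>\<phi>'(x) = \<theta>(x + h) - \<theta>(x)\<close>, and
moving translations and integrals onto u and v shows that both sides of the claim have the same
pairing with every \<open>\<theta>\<close>. The exceptional set may depend on h.\<close>

lemma weak_deriv_increment:
  assumes u: "locint u" and v: "locint v"
    and weak: "\<And>\<phi>. test \<phi> \<Longrightarrow> pair u (deriv \<phi>) = - pair v \<phi>" and h: "0 < h"
  shows "AE t in lborel. u t - u (t - h) = h * mean h v t"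
proof -
  have [measurable]: "u \<in> borel_measurable borel" "v \<in> borel_measurable borel"
    using u v by (auto simp: locint_def)
  have "locint (\<lambda>t. h * mean h v t)"
  proof (rule locintI)
    fix a b
    have "(\<integral>\<^sup>+t\<in>{a..b}. ennreal \<bar>h * mean h v t\<bar> \<partial>lborel) \<le> (\<integral>\<^sup>+t\<in>{a..b}. (\<integral>\<^sup>+x\<in>{a-h..b}. ennreal \<bar>v x\<bar> \<partial>lborel) \<partial>lborel)"
    proof (rule nn_integral_mono)
      fix t
      show "ennreal \<bar>h * mean h v t\<bar> * indicator {a..b} t \<le> (\<integral>\<^sup>+x\<in>{a-h..b}. ennreal \<bar>v x\<bar> \<partial>lborel) * indicator {a..b} t"
      proof (cases "t \<in> {a..b}")
        case True
        have "ennreal \<bar>h * mean h v t\<bar> \<le> ennreal (h * mean h (\<lambda>t. \<bar>v t\<bar>) t)"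
          using abs_mean_le[OF v h, of t] h by (intro ennreal_leI) (simp add: abs_mult)
        also have "\<dots> = ennreal h * avg h (eabs v) t"
          using h by (simp add: avg_abs[OF v h] ennreal_mult')
        also have "\<dots> = (\<integral>\<^sup>+x\<in>{t-h..t}. ennreal \<bar>v x\<bar> \<partial>lborel)"
          using h by (simp add: avg_def mult.assoc[symmetric] ennreal_mult[symmetric])
        also have "\<dots> \<le> (\<integral>\<^sup>+x\<in>{a-h..b}. ennreal \<bar>v x\<bar> \<partial>lborel)"
          using True by (intro nn_integral_mono) (auto split: split_indicator)
        finally show ?thesis using True by simp
      qed simp
    qed
    also have "\<dots> < top"
      using nn_integral_locint[OF v, of "a-h" b] by (subst nn_integral_cmult) (auto simp: ennreal_mult_less_top emeasure_lborel_Icc_eq)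
    finally show "(\<integral>\<^sup>+t\<in>{a..b}. ennreal \<bar>h * mean h v t\<bar> \<partial>lborel) < top" .
  qed measurable
  moreover have "(LINT t|lborel. (u t - u (t - h)) * \<theta> t) = (LINT t|lborel. h * mean h v t * \<theta> t)" if \<theta>: "test \<theta>" for \<theta>
  proof -
    have [measurable]: "\<theta> \<in> borel_measurable borel" using test_measurable[OF \<theta>] by simp
    obtain A B where AB: "0 < A" "0 \<le> B" "\<And>t. A < \<bar>t\<bar> \<Longrightarrow> \<theta> t = 0" "\<And>t. \<bar>\<theta> t\<bar> \<le> B * indicator {-A..A} t"
      using test_bounded[OF \<theta>, of 0] by (metis funpow_0)
    have \<theta>_cont: "continuous_on X \<theta>" for X using \<theta> smooth_continuous[of \<theta> X 0] by (simp add: test_def)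
    define \<phi> where "\<phi> x = (LINT r:{0..h}|lborel. \<theta> (x + r))" for x
    obtain G where G: "\<And>x. (G has_real_derivative \<theta> x) (at x)"
      using einterval_antiderivative[of "-\<infinity>" \<infinity> \<theta>] \<theta>_cont[of UNIV]
      by (auto simp: continuous_on_eq_continuous_at has_real_derivative_iff_has_vector_derivative)
    have \<phi>_G: "\<phi> x = G (x + h) - G x" for x
    proof -
      have dG: "((\<lambda>r. G (x + r)) has_real_derivative \<theta> (x + r)) (at r)" for r
      proof -
        have "((\<lambda>r. x + r) has_real_derivative 1) (at r)" by (auto intro!: derivative_eq_intros)
        from DERIV_chain'[OF this G[of "x + r"]] show ?thesis by simp
      qed
      have c\<theta>: "isCont (\<lambda>r. \<theta> (x + r)) r" for r
      proof -
        have "((\<lambda>r. x + r) has_real_derivative 1) (at r)" by (auto intro!: derivative_eq_intros)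
        from DERIV_chain'[OF this smooth_DERIV0[of \<theta> "x + r"]] show ?thesis using \<theta> by (auto simp: test_def intro: DERIV_isCont)
      qed
      have "(LBINT r. \<theta> (x + r) * indicator {0..h} r) = G (x + h) - G (x + 0)"
        using h dG c\<theta> by (intro integral_FTC_Icc_real[of 0 h "\<lambda>r. G (x + r)"]) auto
      then show ?thesis by (simp add: \<phi>_def set_lebesgue_integral_def mult.commute)
    qed
    have \<phi>_deriv: "(\<phi> has_real_derivative \<theta> (x + h) - \<theta> x) (at x)" for x
      unfolding \<phi>_G by (auto intro!: derivative_eq_intros DERIV_chain'[OF _ G] G)
    have "test \<phi>"
      unfolding test_def
    proof (intro conjI exI allI impI)
      show "smooth \<phi>"
        by (rule smooth_cong_DERIV[OF smooth_diff \<phi>_deriv]) (use test_shift[OF \<theta>, of h] \<theta> in \<open>auto simp: test_def\<close>)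
      fix t assume "A + h < \<bar>t\<bar>"
      then have "\<And>r. r \<in> {0..h} \<Longrightarrow> \<theta> (t + r) = 0" by (intro AB(3)) auto
      then have "\<phi> t = (LINT r:{0..h}|lborel. 0)" unfolding \<phi>_def by (intro set_lebesgue_integral_cong) auto
      then show "\<phi> t = 0" by simp
    qed
    from weak[OF this] have 1: "(LINT t|lborel. u t * (\<theta> (t + h) - \<theta> t)) = - pair v \<phi>"
      using DERIV_imp_deriv[OF \<phi>_deriv] by simp
    have i1: "integrable lborel (\<lambda>t. u t * \<theta> (t + h))" "integrable lborel (\<lambda>t. u t * \<theta> t)" "integrable lborel (\<lambda>t. u (t - h) * \<theta> t)"
      using test_integrable(1)[OF u test_shift[OF \<theta>]] test_integrable(1)[OF u \<theta>] test_integrable(1)[OF locint_shift[OF u] \<theta>] by auto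
    have 2: "(LINT t|lborel. (u t - u (t - h)) * \<theta> t) = - (LINT t|lborel. u t * (\<theta> (t + h) - \<theta> t))"
      using i1 lborel_integral_shift(1)[of "\<lambda>t. u (t - h) * \<theta> t" h]
      by (simp add: left_diff_distrib right_diff_distrib)
    have "pair v \<phi> = (LINT t|lborel. LINT r|lborel. v t * \<theta> (t + r) * indicator {0..h} r)"
      unfolding \<phi>_def set_lebesgue_integral_def
      by (subst integral_mult_right_zero[symmetric]) (simp add: mult_ac)
    also have "\<dots> = (LINT t|lborel. LINT y|lborel. v t * \<theta> y * indicator {0..h} (y - t))"
    proof (rule Bochner_Integration.integral_cong[OF refl])
      fix t
      show "(LINT r|lborel. v t * \<theta> (t + r) * indicator {0..h} r) = (LINT y|lborel. v t * \<theta> y * indicator {0..h} (y - t))"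
        using lborel_integral_shift(1)[of "\<lambda>y. v t * \<theta> y * indicator {0..h} (y - t)" t] by (simp add: add.commute)
    qed
    also have "\<dots> = (LINT y|lborel. LINT t|lborel. v t * \<theta> y * indicator {0..h} (y - t))"
    proof (rule Fubini_real(1))
      have "(\<integral>\<^sup>+t. \<integral>\<^sup>+y. ennreal \<bar>v t * \<theta> y * indicator {0..h} (y - t)\<bar> \<partial>lborel \<partial>lborel)
        \<le> (\<integral>\<^sup>+t. \<integral>\<^sup>+y. (ennreal \<bar>v t\<bar> * indicator {-A-h..A} t) * (ennreal B * indicator {-A..A} y) \<partial>lborel \<partial>lborel)"
      proof (intro nn_integral_mono)
        fix t y
        show "ennreal \<bar>v t * \<theta> y * indicator {0..h} (y - t)\<bar> \<le> (ennreal \<bar>v t\<bar> * indicator {-A-h..A} t) * (ennreal B * indicator {-A..A} y)"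
          using AB(4)[of y] AB(2) h
          by (auto simp: abs_mult ennreal_mult[symmetric] intro!: ennreal_leI mult_left_mono split: split_indicator split_indicator_asm)
      qed
      also have "\<dots> = (\<integral>\<^sup>+t\<in>{-A-h..A}. ennreal \<bar>v t\<bar> \<partial>lborel) * (ennreal B * ennreal (2 * A))"
        using AB(1) by (simp add: nn_integral_cmult nn_integral_multc)
      also have "\<dots> < top" using nn_integral_locint[OF v] by (simp add: ennreal_mult_less_top)
      finally show "(\<integral>\<^sup>+t. \<integral>\<^sup>+y. ennreal \<bar>v t * \<theta> y * indicator {0..h} (y - t)\<bar> \<partial>lborel \<partial>lborel) < top" .
    qed measurable
    also have "\<dots> = (LINT y|lborel. h * mean h v y * \<theta> y)"
    proof (intro Bochner_Integration.integral_cong refl)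
      fix y
      have "(LINT t|lborel. v t * \<theta> y * indicator {0..h} (y - t)) = (LINT t|lborel. \<theta> y * (indicator {y - h..y} t *\<^sub>R v t))"
        by (intro Bochner_Integration.integral_cong refl) (auto split: split_indicator)
      then show "(LINT t|lborel. v t * \<theta> y * indicator {0..h} (y - t)) = h * mean h v y * \<theta> y"
        using h by (simp add: mean_def set_lebesgue_integral_def)
    qed
    finally show ?thesis using 1 2 by simp
  qed
  ultimately show ?thesis using locint_diff[OF u locint_shift[OF u]] by (intro locint_ae_eq)
qed

section \<open>Fractional integration by parts\<close>

lemma inverse_Gamma_minus: "1 / Gamma (- \<alpha>) = - \<alpha> * rGamma (1 - \<alpha>)" for \<alpha> :: real
  using rGamma_plus1[of "- \<alpha>"] by (simp add: rGamma_inverse_Gamma inverse_eq_divide)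

text \<open>The substitution \<open>s = t - \<tau>\<close>; by the functional equation \<open>1/\<Gamma>(-\<alpha>) = -\<alpha>/\<Gamma>(1 - \<alpha>)\<close>, which normalises the
kernel.\<close>

lemma Dleft_pointwise_eq:
  assumes [measurable]: "u \<in> borel_measurable borel"
  shows "Dleft_pointwise \<alpha> u t = rGamma (1 - \<alpha>) * (LINT s:{0<..}|lborel. hker \<alpha> s * (u t - u (t - s)))"
proof -
  have "(LINT \<tau>:{..<t}|lebesgue. Dleft_integrand \<alpha> u t \<tau>) = (LINT \<tau>|lborel. indicator {..<t} \<tau> * ((u \<tau> - u t) / (t - \<tau>) powr (1 + \<alpha>)))"
    unfolding set_lebesgue_integral_def Dleft_integrand_def by (subst integral_completion) auto
  also have "\<dots> = (LINT s|lborel. indicator {..<t} (t - s) * ((u (t - s) - u t) / (t - (t - s)) powr (1 + \<alpha>)))"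
    by (rule lborel_integral_shift(2)[symmetric])
  finally have "- \<alpha> * (LINT \<tau>:{..<t}|lebesgue. Dleft_integrand \<alpha> u t \<tau>) = (LINT s|lborel. - \<alpha> * (indicator {..<t} (t - s) * ((u (t - s) - u t) / (t - (t - s)) powr (1 + \<alpha>))))"
    by (simp only: integral_mult_right_zero)
  also have "\<dots> = (LINT s:{0<..}|lborel. hker \<alpha> s * (u t - u (t - s)))"
    unfolding set_lebesgue_integral_def
    by (intro Bochner_Integration.integral_cong refl)
       (auto simp: powr_minus[of _ "1 + \<alpha>", simplified] field_simps split: split_indicator)
  finally have "rGamma (1 - \<alpha>) * (- \<alpha> * (LINT \<tau>:{..<t}|lebesgue. Dleft_integrand \<alpha> u t \<tau>)) =
    rGamma (1 - \<alpha>) * (LINT s:{0<..}|lborel. hker \<alpha> s * (u t - u (t - s)))" by (rule arg_cong)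
  then show ?thesis unfolding Dleft_pointwise_def inverse_Gamma_minus by (simp only: mult_ac)
qed

lemma Dright_eq:
  assumes [measurable]: "\<phi> \<in> borel_measurable borel"
  shows "Dright \<alpha> \<phi> t = rGamma (1 - \<alpha>) * (LINT s:{0<..}|lborel. hker \<alpha> s * (\<phi> t - \<phi> (t + s)))"
proof -
  have "(LINT \<tau>:{t<..}|lebesgue. (\<phi> \<tau> - \<phi> t) / (\<tau> - t) powr (1 + \<alpha>)) = (LINT \<tau>|lborel. indicator {t<..} \<tau> * ((\<phi> \<tau> - \<phi> t) / (\<tau> - t) powr (1 + \<alpha>)))"
    unfolding set_lebesgue_integral_def by (subst integral_completion) auto
  also have "\<dots> = (LINT s|lborel. indicator {t<..} (s + t) * ((\<phi> (s + t) - \<phi> t) / (s + t - t) powr (1 + \<alpha>)))"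
    by (rule lborel_integral_shift(1)[symmetric])
  finally have "- \<alpha> * (LINT \<tau>:{t<..}|lebesgue. (\<phi> \<tau> - \<phi> t) / (\<tau> - t) powr (1 + \<alpha>)) = (LINT s|lborel. - \<alpha> * (indicator {t<..} (s + t) * ((\<phi> (s + t) - \<phi> t) / (s + t - t) powr (1 + \<alpha>))))"
    by (simp only: integral_mult_right_zero)
  also have "\<dots> = (LINT s:{0<..}|lborel. hker \<alpha> s * (\<phi> t - \<phi> (t + s)))"
    unfolding set_lebesgue_integral_def
    by (intro Bochner_Integration.integral_cong refl)
       (auto simp: powr_minus[of _ "1 + \<alpha>", simplified] field_simps split: split_indicator)
  finally have "rGamma (1 - \<alpha>) * (- \<alpha> * (LINT \<tau>:{t<..}|lebesgue. (\<phi> \<tau> - \<phi> t) / (\<tau> - t) powr (1 + \<alpha>))) =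
    rGamma (1 - \<alpha>) * (LINT s:{0<..}|lborel. hker \<alpha> s * (\<phi> t - \<phi> (t + s)))" by (rule arg_cong)
  then show ?thesis unfolding Dright_def inverse_Gamma_minus by (simp only: mult_ac)
qed

lemma measurable_Dright [measurable (raw)]:
  assumes [measurable]: "\<phi> \<in> borel_measurable borel"
  shows "Dright \<alpha> \<phi> \<in> borel_measurable borel"
  unfolding Dright_eq[OF assms, abs_def] set_lebesgue_integral_def by measurable

lemma measurable_Dleft_pointwise [measurable (raw)]:
  assumes [measurable]: "u \<in> borel_measurable borel"
  shows "Dleft_pointwise \<alpha> u \<in> borel_measurable borel"
  unfolding Dleft_pointwise_eq[OF assms, abs_def] set_lebesgue_integral_def by measurable

text \<open>The part over (0, 1] of the absolute hypersingular integral.\<close>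

definition near :: "real \<Rightarrow> (real \<Rightarrow> real) \<Rightarrow> real \<Rightarrow> ennreal" where
  "near \<alpha> u t = (\<integral>\<^sup>+s\<in>{0<..1}. ennreal (hker \<alpha> s * \<bar>u t - u (t - s)\<bar>) \<partial>lborel)"

lemma measurable_near [measurable (raw)]:
  assumes [measurable]: "u \<in> borel_measurable borel" "t \<in> borel_measurable M"
  shows "(\<lambda>x. near \<alpha> u (t x)) \<in> borel_measurable M"
  unfolding near_def by measurable

text \<open>Splits an absolute hypersingular integral at s = 1; beyond 1 the kernel is a probability density.\<close>

lemma nn_integral_kernel_le:
  assumes [measurable]: "w \<in> borel_measurable borel" and "0 < \<alpha>"
    and le: "\<And>s. 1 < s \<Longrightarrow> \<bar>w s\<bar> \<le> a + b s" and ab: "0 \<le> a" "\<And>s. 0 \<le> b s" and [measurable]: "b \<in> borel_measurable borel"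
  shows "(\<integral>\<^sup>+s\<in>{0<..}. ennreal (hker \<alpha> s * \<bar>w s\<bar>) \<partial>lborel)
    \<le> (\<integral>\<^sup>+s\<in>{0<..1}. ennreal (hker \<alpha> s * \<bar>w s\<bar>) \<partial>lborel) + ennreal a + (\<integral>\<^sup>+s. kf \<alpha> s * ennreal (b s) \<partial>lborel)"
proof -
  have "(\<integral>\<^sup>+s\<in>{0<..}. ennreal (hker \<alpha> s * \<bar>w s\<bar>) \<partial>lborel)
    \<le> (\<integral>\<^sup>+s. (ennreal (hker \<alpha> s * \<bar>w s\<bar>) * indicator {0<..1} s + kf \<alpha> s * ennreal a) + kf \<alpha> s * ennreal (b s) \<partial>lborel)"
  proof (rule nn_integral_mono)
    fix s :: real
    have "ennreal (hker \<alpha> s * \<bar>w s\<bar>) \<le> kf \<alpha> s * ennreal a + kf \<alpha> s * ennreal (b s)" if "1 < s"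
    proof -
      have "hker \<alpha> s * \<bar>w s\<bar> \<le> hker \<alpha> s * (a + b s)"
        using le[OF that] assms(2) by (intro mult_left_mono) auto
      then have "ennreal (hker \<alpha> s * \<bar>w s\<bar>) \<le> ennreal (hker \<alpha> s * (a + b s))" by (rule ennreal_leI)
      also have "\<dots> = ennreal (hker \<alpha> s) * (ennreal a + ennreal (b s))"
        using ab assms(2) by (subst ennreal_mult) auto
      finally show ?thesis using that by (simp add: kf_def distrib_left)
    qed
    then show "ennreal (hker \<alpha> s * \<bar>w s\<bar>) * indicator {0<..} s
      \<le> (ennreal (hker \<alpha> s * \<bar>w s\<bar>) * indicator {0<..1} s + kf \<alpha> s * ennreal a) + kf \<alpha> s * ennreal (b s)"
      by (cases "1 < s") (auto split: split_indicator)
  qed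
  also have "\<dots> = (\<integral>\<^sup>+s\<in>{0<..1}. ennreal (hker \<alpha> s * \<bar>w s\<bar>) \<partial>lborel) + ennreal a + (\<integral>\<^sup>+s. kf \<alpha> s * ennreal (b s) \<partial>lborel)"
    using assms(2) by (simp add: nn_integral_add nn_integral_multc nn_integral_kf)
  finally show ?thesis .
qed

text \<open>If w(s) = O(s), one power of s is gained and the hypersingular kernel becomes \<open>\<alpha>/(1 - \<alpha>)\<close> times the
near kernel.\<close>

lemma nn_integral_hker_near_le:
  assumes \<alpha>: "0 < \<alpha>" "\<alpha> < 1" and b: "0 \<le> b" and le: "\<And>s. 0 < s \<Longrightarrow> s \<le> 1 \<Longrightarrow> \<bar>w s\<bar> \<le> s * b"
  shows "(\<integral>\<^sup>+s\<in>{0<..1}. ennreal (hker \<alpha> s * \<bar>w s\<bar>) \<partial>lborel) \<le> ennreal (\<alpha> / (1 - \<alpha>) * b)"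
proof -
  have "(\<integral>\<^sup>+s\<in>{0<..1}. ennreal (hker \<alpha> s * \<bar>w s\<bar>) \<partial>lborel) \<le> (\<integral>\<^sup>+s. kn \<alpha> s * ennreal (\<alpha> / (1 - \<alpha>) * b) \<partial>lborel)"
  proof (rule nn_integral_mono)
    fix s
    show "ennreal (hker \<alpha> s * \<bar>w s\<bar>) * indicator {0<..1} s \<le> kn \<alpha> s * ennreal (\<alpha> / (1 - \<alpha>) * b)"
    proof (cases "0 < s \<and> s \<le> 1")
      case True
      have "hker \<alpha> s * \<bar>w s\<bar> \<le> hker \<alpha> s * (s * b)"
        using le[of s] True \<alpha> by (intro mult_left_mono) auto
      also have "\<dots> = ((1 - \<alpha>) * s powr (- \<alpha>)) * (\<alpha> / (1 - \<alpha>) * b)"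
        using True \<alpha> powr_add[of s "-1-\<alpha>" 1] by simp
      finally show ?thesis using True \<alpha> b by (simp add: kn_def ennreal_mult[symmetric] ennreal_leI)
    qed (auto split: split_indicator)
  qed
  also have "\<dots> = ennreal (\<alpha> / (1 - \<alpha>) * b)" using \<alpha> by (simp add: nn_integral_multc nn_integral_kn)
  finally show ?thesis .
qed

lemma increment_le:
  assumes [measurable]: "u \<in> borel_measurable borel" and "0 < \<alpha>"
  shows "(\<integral>\<^sup>+s\<in>{0<..}. ennreal (hker \<alpha> s * \<bar>u t - u (t - s)\<bar>) \<partial>lborel)
    \<le> near \<alpha> u t + ennreal \<bar>u t\<bar> + far \<alpha> (eabs u) t"
  unfolding near_def far_def using assms(2) by (intro nn_integral_kernel_le) auto

lemma increment_integrable: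
  assumes [measurable]: "u \<in> borel_measurable borel" and "0 < \<alpha>"
    and "near \<alpha> u t < top" "far \<alpha> (eabs u) t < top"
  shows "set_integrable lborel {0<..} (\<lambda>s. hker \<alpha> s * (u t - u (t - s)))"
  unfolding set_integrable_def
proof (rule integrableI_bounded)
  have "(\<integral>\<^sup>+s. ennreal (norm (indicat_real {0<..} s *\<^sub>R (hker \<alpha> s * (u t - u (t - s))))) \<partial>lborel)
     = (\<integral>\<^sup>+s\<in>{0<..}. ennreal (hker \<alpha> s * \<bar>u t - u (t - s)\<bar>) \<partial>lborel)"
    using assms(2) by (intro nn_integral_cong) (auto simp: abs_mult split: split_indicator)
  then show "(\<integral>\<^sup>+s. ennreal (norm (indicat_real {0<..} s *\<^sub>R (hker \<alpha> s * (u t - u (t - s))))) \<partial>lborel) < \<infinity>"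
    using increment_le[OF assms(1,2), of t] assms(3,4) by (auto intro: le_less_trans simp: ennreal_add_less_top)
qed measurable

lemma Dleft_integrand_integrable:
  assumes [measurable]: "u \<in> borel_measurable borel" and \<alpha>: "0 < \<alpha>"
    and "near \<alpha> u t < top" "far \<alpha> (eabs u) t < top"
  shows "set_integrable lebesgue {..<t} (Dleft_integrand \<alpha> u t)"
proof -
  have "integrable lborel (\<lambda>s. - (1 / \<alpha>) * (indicat_real {0<..} s *\<^sub>R (hker \<alpha> s * (u t - u (t - s)))))"
    using increment_integrable[OF assms] unfolding set_integrable_def by (intro integrable_mult_right)
  also have "(\<lambda>s. - (1 / \<alpha>) * (indicat_real {0<..} s *\<^sub>R (hker \<alpha> s * (u t - u (t - s)))))
    = (\<lambda>s. indicator {..<t} (t + (-1) * s) *\<^sub>R Dleft_integrand \<alpha> u t (t + (-1) * s))"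
    using \<alpha> unfolding Dleft_integrand_def
    by (auto simp: fun_eq_iff powr_minus[of _ "1 + \<alpha>", simplified] field_simps split: split_indicator)
  finally have "integrable lborel (\<lambda>\<tau>. indicator {..<t} \<tau> *\<^sub>R Dleft_integrand \<alpha> u t \<tau>)"
    by (subst (asm) lborel_integrable_real_affine_iff) auto
  then show ?thesis unfolding set_integrable_def
    by (subst integrable_completion) (auto simp: Dleft_integrand_def)
qed

text \<open>For each fixed s the identity of the two integrands, integrated over t, is invariance under the
translation by s; Fubini's theorem allows to integrate over t first.\<close>

lemma fractional_by_parts:
  assumes [measurable]: "u \<in> borel_measurable borel" "\<phi> \<in> borel_measurable borel" and \<alpha>: "0 < \<alpha>"
    and H1: "(\<integral>\<^sup>+t. \<integral>\<^sup>+s. ennreal (hker \<alpha> s * \<bar>\<phi> t - \<phi> (t + s)\<bar>) * indicator {0<..} s * ennreal \<bar>u t\<bar> \<partial>lborel \<partial>lborel) < top"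
    and H2: "(\<integral>\<^sup>+t. \<integral>\<^sup>+s. ennreal (hker \<alpha> s * \<bar>u t - u (t - s)\<bar>) * indicator {0<..} s * ennreal \<bar>\<phi> t\<bar> \<partial>lborel \<partial>lborel) < top"
    and int: "\<And>s. 0 \<le> s \<Longrightarrow> integrable lborel (\<lambda>t. u t * \<phi> (t + s))"
  shows "pair u (Dright \<alpha> \<phi>) = pair (Dleft_pointwise \<alpha> u) \<phi>"
    and "integrable lborel (\<lambda>t. Dleft_pointwise \<alpha> u t * \<phi> t)"
proof -
  define f where "f t s = hker \<alpha> s * (\<phi> t - \<phi> (t + s)) * indicator {0<..} s * u t" for t s
  define g where "g t s = hker \<alpha> s * (u t - u (t - s)) * indicator {0<..} s * \<phi> t" for t s
  have [measurable]: "(\<lambda>(t, s). f t s) \<in> borel_measurable (borel \<Otimes>\<^sub>M borel)"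
    "(\<lambda>(t, s). g t s) \<in> borel_measurable (borel \<Otimes>\<^sub>M borel)" unfolding f_def g_def by measurable
  have "(\<integral>\<^sup>+t. \<integral>\<^sup>+s. ennreal \<bar>f t s\<bar> \<partial>lborel \<partial>lborel) < top"
    using H1 \<alpha> by (simp add: f_def abs_mult ennreal_mult ennreal_indicator)
  note F = Fubini_real[OF _ this]
  have "(\<integral>\<^sup>+t. \<integral>\<^sup>+s. ennreal \<bar>g t s\<bar> \<partial>lborel \<partial>lborel) < top"
    using H2 \<alpha> by (simp add: g_def abs_mult ennreal_mult ennreal_indicator)
  note G = Fubini_real[OF _ this]
  have fR: "u t * Dright \<alpha> \<phi> t = rGamma (1 - \<alpha>) * (LINT s|lborel. f t s)" for t
  proof -
    have "(LINT s|lborel. f t s) = (LINT s|lborel. u t * (indicator {0<..} s *\<^sub>R (hker \<alpha> s * (\<phi> t - \<phi> (t + s)))))"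
      by (simp add: f_def mult_ac)
    then show ?thesis by (simp add: Dright_eq set_lebesgue_integral_def)
  qed
  have gL: "Dleft_pointwise \<alpha> u t * \<phi> t = rGamma (1 - \<alpha>) * (LINT s|lborel. g t s)" for t
  proof -
    have "(LINT s|lborel. g t s) = (LINT s|lborel. \<phi> t * (indicator {0<..} s *\<^sub>R (hker \<alpha> s * (u t - u (t - s)))))"
      by (simp add: g_def mult_ac)
    then show ?thesis by (simp add: Dleft_pointwise_eq set_lebesgue_integral_def)
  qed
  have swap: "(LINT t|lborel. f t s) = (LINT t|lborel. g t s)" for s
  proof (cases "0 < s")
    case True
    have i0: "integrable lborel (\<lambda>t. u t * \<phi> t)" using int[of 0] by simp
    have i1: "integrable lborel (\<lambda>t. u t * \<phi> (t + s))" using int[of s] True by simp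
    have e: "(LINT t|lborel. u (t - s) * \<phi> t) = (LINT t|lborel. u t * \<phi> (t + s))"
      using lborel_integral_shift(1)[of "\<lambda>t. u (t - s) * \<phi> t" s] by simp
    have "integrable lborel (\<lambda>t. u ((-s + 1 * t)) * \<phi> ((-s + 1 * t) + s))"
      by (rule lborel_integrable_real_affine[OF i1]) simp
    then have i2: "integrable lborel (\<lambda>t. u (t - s) * \<phi> t)" by simp
    have "(LINT t|lborel. f t s) = hker \<alpha> s * (LINT t|lborel. u t * \<phi> t - u t * \<phi> (t + s))"
      using True by (subst integral_mult_right_zero[symmetric]) (auto simp: f_def algebra_simps)
    also have "(LINT t|lborel. u t * \<phi> t - u t * \<phi> (t + s)) = (LINT t|lborel. u t * \<phi> t - u (t - s) * \<phi> t)"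
      using i0 i1 i2 e by simp
    also have "hker \<alpha> s * \<dots> = (LINT t|lborel. g t s)"
      using True by (subst integral_mult_right_zero[symmetric]) (auto simp: g_def algebra_simps)
    finally show ?thesis .
  qed (simp add: f_def g_def)
  show "pair u (Dright \<alpha> \<phi>) = pair (Dleft_pointwise \<alpha> u) \<phi>"
    unfolding fR gL using F(1) G(1) swap by simp
  show "integrable lborel (\<lambda>t. Dleft_pointwise \<alpha> u t * \<phi> t)" unfolding gL using G(2) by simp
qed

text \<open>A majorant of test functions: only two powers of decay at \<open>-\<infinity>\<close> are needed, and the support is
bounded on the right.\<close>

definition decay :: "real \<Rightarrow> real \<Rightarrow> real" where
  "decay A t = indicator {..A} t / (1 + t\<^sup>2)"

lemma decay_measurable [measurable]: "decay A \<in> borel_measurable borel"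
  unfolding decay_def by measurable

lemma decay_nonneg: "0 \<le> decay A t" by (simp add: decay_def)

lemma S_minus_decay:
  assumes "\<phi> \<in> S_minus"
  obtains A B where "0 \<le> B" "\<And>t. \<bar>\<phi> t\<bar> \<le> B * decay A t" "\<And>t s. 0 < s \<Longrightarrow> s \<le> 1 \<Longrightarrow> \<bar>\<phi> t - \<phi> (t + s)\<bar> \<le> s * (B * decay A t)"
proof -
  from assms obtain A where sm: "smooth \<phi>" and A: "\<And>t. A < t \<Longrightarrow> \<phi> t = 0"
    and dec: "\<And>l k. \<exists>B. \<forall>t. \<bar>t\<bar> ^ l * \<bar>(deriv ^^ k) \<phi> t\<bar> \<le> B" unfolding S_minus_def by blast
  have bd: "\<exists>B. \<forall>t. \<bar>(deriv ^^ k) \<phi> t\<bar> * (1 + t\<^sup>2) \<le> B" for k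
  proof -
    obtain B0 B2 where "\<And>t. \<bar>t\<bar> ^ 0 * \<bar>(deriv ^^ k) \<phi> t\<bar> \<le> B0" "\<And>t. \<bar>t\<bar> ^ 2 * \<bar>(deriv ^^ k) \<phi> t\<bar> \<le> B2"
      using dec by metis
    then have "\<bar>(deriv ^^ k) \<phi> t\<bar> * (1 + t\<^sup>2) \<le> B0 + B2" for t
      using add_mono[of "\<bar>(deriv ^^ k) \<phi> t\<bar>" B0] by (simp add: distrib_left mult.commute)
    then show ?thesis by blast
  qed
  obtain B0 where B0: "\<And>t. \<bar>\<phi> t\<bar> * (1 + t\<^sup>2) \<le> B0" using bd[of 0] by auto
  obtain B1 where B1: "\<And>t. \<bar>deriv \<phi> t\<bar> * (1 + t\<^sup>2) \<le> B1" using bd[of 1] by auto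
  have pos: "0 < 1 + t\<^sup>2" for t :: real by (simp add: add_pos_nonneg)
  have nn: "0 \<le> B0" "0 \<le> B1" using B0[of 0] B1[of 0] by auto
  define B where "B = max B0 (3 * B1)"
  show thesis
  proof (rule that[of B A])
    show "0 \<le> B" using nn by (simp add: B_def)
    fix t
    have "\<bar>\<phi> t\<bar> \<le> B / (1 + t\<^sup>2)"
      using B0[of t] pos[of t] by (simp add: pos_le_divide_eq B_def)
    then show "\<bar>\<phi> t\<bar> \<le> B * decay A t" using A[of t] by (auto simp: decay_def split: split_indicator)
    fix s :: real assume s: "0 < s" "s \<le> 1"
    show "\<bar>\<phi> t - \<phi> (t + s)\<bar> \<le> s * (B * decay A t)"
    proof (cases "t \<le> A")
      case True
      obtain z where z: "t < z" "z < t + s" "\<phi> (t + s) - \<phi> t = (t + s - t) * deriv \<phi> z"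
        using MVT2[of t "t + s" \<phi> "deriv \<phi>"] s smooth_DERIV0[OF sm] by auto
      \<comment> \<open>Transfers the decay of the derivative from the intermediate point z to t.\<close>
      have "1 + t\<^sup>2 \<le> 3 * (1 + z\<^sup>2)"
      proof -
        have "t\<^sup>2 \<le> 2 * z\<^sup>2 + 2 * (z - t)\<^sup>2"
          using zero_le_power2[of "z + (z - t)"] by (simp add: power2_eq_square algebra_simps)
        also have "\<dots> \<le> 3 * z\<^sup>2 + 2 * 1"
          using z s by (intro add_mono mult_left_mono mult_right_mono power_le_one) auto
        finally show ?thesis by simp
      qed
      then have "\<bar>deriv \<phi> z\<bar> * (1 + t\<^sup>2) \<le> 3 * (\<bar>deriv \<phi> z\<bar> * (1 + z\<^sup>2))"
        using mult_left_mono[of "1 + t\<^sup>2" "3 * (1 + z\<^sup>2)" "\<bar>deriv \<phi> z\<bar>"] by (simp add: algebra_simps)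
      also have "\<dots> \<le> B" using B1[of z] by (simp add: B_def)
      finally have "\<bar>deriv \<phi> z\<bar> \<le> B / (1 + t\<^sup>2)" using pos[of t] by (simp add: pos_le_divide_eq)
      then have "s * \<bar>deriv \<phi> z\<bar> \<le> s * (B / (1 + t\<^sup>2))" using s by (intro mult_left_mono) auto
      moreover have "\<bar>\<phi> t - \<phi> (t + s)\<bar> = s * \<bar>deriv \<phi> z\<bar>"
        using z(3) s by (subst abs_minus_commute) (simp add: abs_mult)
      ultimately show ?thesis using True by (simp add: decay_def)
    qed (use A[of t] A[of "t + s"] s in \<open>auto simp: decay_def\<close>)
  qed
qed

lemma decay_shift:
  assumes "0 \<le> s"
  shows "decay A (t + s) \<le> (2 + 2 * s\<^sup>2) * decay A t"
proof (cases "t + s \<le> A")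
  case True
  have pos: "0 < 1 + t\<^sup>2" "0 < 1 + (t + s)\<^sup>2" by (simp_all add: add_pos_nonneg)
  have "t\<^sup>2 \<le> 2 * (t + s)\<^sup>2 + 2 * s\<^sup>2" using zero_le_power2[of "t + s + s"] by (simp add: power2_eq_square algebra_simps)
  then have "1 + t\<^sup>2 \<le> 1 + 2 * (t + s)\<^sup>2 + 2 * s\<^sup>2" by simp
  also have "\<dots> \<le> (2 + 2 * s\<^sup>2) * (1 + (t + s)\<^sup>2)"
    using mult_nonneg_nonneg[of "s\<^sup>2" "(t + s)\<^sup>2"] by (simp add: algebra_simps)
  finally have "1 / (1 + (t + s)\<^sup>2) \<le> (2 + 2 * s\<^sup>2) / (1 + t\<^sup>2)"
    using pos by (simp add: divide_simps mult.commute)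
  then show ?thesis using True assms by (simp add: decay_def)
next
  case False
  then show ?thesis using decay_nonneg[of A t] by (simp add: decay_def)
qed

lemma S_minus_shift:
  assumes "\<phi> \<in> S_minus" "0 \<le> s"
  obtains A B where "0 \<le> B" "\<And>t. \<bar>\<phi> (t + s)\<bar> \<le> B * decay A t"
proof -
  obtain A B where B: "0 \<le> B" "\<And>t. \<bar>\<phi> t\<bar> \<le> B * decay A t" using S_minus_decay[OF assms(1)] by metis
  have "\<bar>\<phi> (t + s)\<bar> \<le> (B * (2 + 2 * s\<^sup>2)) * decay A t" for t
    using order_trans[OF B(2)[of "t + s"] mult_left_mono[OF decay_shift[OF assms(2), of A t] B(1)]] by (simp add: mult.assoc)
  then show thesis using that[of "B * (2 + 2 * s\<^sup>2)" A] B(1) by simp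
qed

lemma S_minus_measurable: "\<phi> \<in> S_minus \<Longrightarrow> \<phi> \<in> borel_measurable borel"
  by (auto simp: S_minus_def intro: smooth_measurable0)

text \<open>The far averages to the left and to the right are adjoint to each other.\<close>

lemma kf_swap:
  assumes [measurable]: "g \<in> borel_measurable borel" "h \<in> borel_measurable borel"
  shows "(\<integral>\<^sup>+t. \<integral>\<^sup>+s. kf \<alpha> s * h (t + s) * g t \<partial>lborel \<partial>lborel) = (\<integral>\<^sup>+t. far \<alpha> g t * h t \<partial>lborel)"
proof -
  have "(\<integral>\<^sup>+t. \<integral>\<^sup>+s. kf \<alpha> s * h (t + s) * g t \<partial>lborel \<partial>lborel)
    = (\<integral>\<^sup>+s. \<integral>\<^sup>+t. kf \<alpha> s * h (t + s) * g t \<partial>lborel \<partial>lborel)"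
    by (rule lborel_pair.Fubini') measurable
  also have "\<dots> = (\<integral>\<^sup>+s. \<integral>\<^sup>+t. kf \<alpha> s * h t * g (t - s) \<partial>lborel \<partial>lborel)"
  proof (rule nn_integral_cong)
    fix s
    show "(\<integral>\<^sup>+t. kf \<alpha> s * h (t + s) * g t \<partial>lborel) = (\<integral>\<^sup>+t. kf \<alpha> s * h t * g (t - s) \<partial>lborel)"
      using nn_integral_translate(2)[of "\<lambda>t. kf \<alpha> s * h t * g (t - s)" s] by (simp add: add.commute)
  qed
  also have "\<dots> = (\<integral>\<^sup>+t. \<integral>\<^sup>+s. kf \<alpha> s * h t * g (t - s) \<partial>lborel \<partial>lborel)"
    by (rule lborel_pair.Fubini') measurable
  also have "\<dots> = (\<integral>\<^sup>+t. far \<alpha> g t * h t \<partial>lborel)"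
    unfolding far_def by (intro nn_integral_cong, subst nn_integral_multc[symmetric]) (auto simp: mult_ac)
  finally show ?thesis .
qed

context left_weight
begin

text \<open>Up to a constant, \<open>1/(1 + t\<^sup>2)\<close> to the left of A is the far kernel of order 1 seen from a point \<open>t\<^sub>0\<close> to
the right of A, so the integral is bounded by a far part at \<open>t\<^sub>0\<close>, which is finite at every point.\<close>

lemma pairing_decay:
  assumes [measurable]: "g \<in> borel_measurable borel" and N: "N g < top"
  shows "(\<integral>\<^sup>+t. g t * ennreal (decay A t) \<partial>lborel) < top"
proof -
  \<comment> \<open>For t \<le> A the distance t0 - t is at least 2, so it lies in the support of the far kernel.\<close>
  define t0 where "t0 = \<bar>A\<bar> + 2"
  define D where "D = 2 * (t0\<^sup>2 + 1)"
  have D: "0 < D" by (simp add: D_def add_nonneg_pos)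
  have far: "far 1 g t0 < top"
    using far_bounded[OF assms, of t0] by (metis ennreal_less_top le_less_trans less_one linorder_not_less zero_less_one order_refl)
  have "(\<integral>\<^sup>+t. g t * ennreal (decay A t) \<partial>lborel) = (\<integral>\<^sup>+s. g (t0 - s) * ennreal (decay A (t0 - s)) \<partial>lborel)"
    by (rule nn_integral_translate(1)[symmetric]) measurable
  also have "\<dots> \<le> (\<integral>\<^sup>+s. ennreal D * (kf 1 s * g (t0 - s)) \<partial>lborel)"
  proof (rule nn_integral_mono)
    fix s
    show "g (t0 - s) * ennreal (decay A (t0 - s)) \<le> ennreal D * (kf 1 s * g (t0 - s))"
    proof (cases "t0 - s \<le> A")
      case True
      then have s: "2 \<le> s" by (auto simp: t0_def)
      define x where "x = t0 - s"
      have "s\<^sup>2 = (t0 - x)\<^sup>2" by (simp add: x_def)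
      also have "\<dots> \<le> 2 * t0\<^sup>2 + 2 * x\<^sup>2" using zero_le_power2[of "t0 + x"] by (simp add: power2_eq_square algebra_simps)
      also have "\<dots> \<le> D * (1 + x\<^sup>2)" by (simp add: D_def algebra_simps)
      finally have "s\<^sup>2 \<le> D * (1 + x\<^sup>2)" .
      then have "1 / (1 + x\<^sup>2) \<le> D * (1 / s\<^sup>2)"
        using s by (simp add: divide_simps add_pos_nonneg mult.commute)
      also have "1 / s\<^sup>2 = s powr (-1 - 1)"
        using s by (simp add: powr_minus_divide[of s 2, simplified])
      finally have "ennreal (decay A x) \<le> ennreal D * kf 1 s"
        using D s True by (simp add: decay_def kf_def x_def ennreal_mult[symmetric] ennreal_leI)
      from mult_left_mono[OF this, of "g x"] show ?thesis by (simp add: x_def mult_ac)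
    qed (simp add: decay_def)
  qed
  also have "\<dots> = ennreal D * far 1 g t0" unfolding far_def by (rule nn_integral_cmult) measurable
  also have "\<dots> < top" using far by (simp add: ennreal_mult_less_top)
  finally show ?thesis .
qed

lemma pairing_S_minus:
  assumes [measurable]: "g \<in> borel_measurable borel" and N: "N g < top" and \<phi>: "\<phi> \<in> S_minus"
  shows "(\<integral>\<^sup>+t. g t * ennreal \<bar>\<phi> t\<bar> \<partial>lborel) < top"
proof -
  obtain A B where B: "0 \<le> B" "\<And>t. \<bar>\<phi> t\<bar> \<le> B * decay A t" using S_minus_decay[OF \<phi>] by metis
  have "(\<integral>\<^sup>+t. g t * ennreal \<bar>\<phi> t\<bar> \<partial>lborel) \<le> (\<integral>\<^sup>+t. ennreal B * (g t * ennreal (decay A t)) \<partial>lborel)"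
  proof (rule nn_integral_mono)
    fix t
    have "ennreal \<bar>\<phi> t\<bar> \<le> ennreal B * ennreal (decay A t)"
      using B(2)[of t] B(1) by (simp add: ennreal_mult[symmetric] decay_nonneg ennreal_leI)
    from mult_left_mono[OF this, of "g t"] show "g t * ennreal \<bar>\<phi> t\<bar> \<le> ennreal B * (g t * ennreal (decay A t))"
      by (simp add: mult_ac)
  qed
  also have "\<dots> = ennreal B * (\<integral>\<^sup>+t. g t * ennreal (decay A t) \<partial>lborel)" by (rule nn_integral_cmult) measurable
  also have "\<dots> < top" using pairing_decay[OF assms(1) N] by (simp add: ennreal_mult_less_top)
  finally show ?thesis .
qed

lemma integrable_product:
  assumes [measurable]: "f \<in> borel_measurable borel" "\<phi> \<in> borel_measurable borel"
    and "(\<integral>\<^sup>+t. ennreal \<bar>f t\<bar> * ennreal \<bar>\<phi> t\<bar> \<partial>lborel) < top"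
  shows "integrable lborel (\<lambda>t. f t * \<phi> t)"
  using assms(3) by (intro integrableI_bounded) (auto simp: abs_mult ennreal_mult)

text \<open>The two finiteness conditions of \<open>fractional_by_parts\<close>: the increments of the test function are
controlled by its decay and the adjointness of the far averages, those of u by the assumption on
the near part and by the far part of u.\<close>

lemma coincidence:
  assumes [measurable]: "u \<in> borel_measurable borel" and N: "N (eabs u) < top"
    and \<alpha>: "0 < \<alpha>" "\<alpha> < 1" and \<phi>: "\<phi> \<in> S_minus"
    and near: "(\<integral>\<^sup>+t. near \<alpha> u t * ennreal \<bar>\<phi> t\<bar> \<partial>lborel) < top"
  shows "pair u (Dright \<alpha> \<phi>) = pair (Dleft_pointwise \<alpha> u) \<phi>"
    and "integrable lborel (\<lambda>t. Dleft_pointwise \<alpha> u t * \<phi> t)"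
proof -
  have [measurable]: "\<phi> \<in> borel_measurable borel" using S_minus_measurable[OF \<phi>] .
  obtain A B where B: "0 \<le> B" "\<And>t. \<bar>\<phi> t\<bar> \<le> B * decay A t" "\<And>t s. 0 < s \<Longrightarrow> s \<le> 1 \<Longrightarrow> \<bar>\<phi> t - \<phi> (t + s)\<bar> \<le> s * (B * decay A t)"
    using S_minus_decay[OF \<phi>] by metis
  let ?u = "\<lambda>t. ennreal \<bar>u t\<bar>"
  have Nfar: "N (far \<alpha> ?u) < top"
    using N_far[of ?u \<alpha>] \<alpha> N by (auto intro: le_less_trans simp: ennreal_mult_less_top)
  have fu: "(\<integral>\<^sup>+t. ?u t * ennreal \<bar>\<phi> t\<bar> \<partial>lborel) < top" "(\<integral>\<^sup>+t. far \<alpha> ?u t * ennreal \<bar>\<phi> t\<bar> \<partial>lborel) < top"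
    using pairing_S_minus[OF _ N \<phi>] pairing_S_minus[OF _ Nfar \<phi>] by auto
  have H2: "(\<integral>\<^sup>+t. \<integral>\<^sup>+s. ennreal (hker \<alpha> s * \<bar>u t - u (t - s)\<bar>) * indicator {0<..} s * ennreal \<bar>\<phi> t\<bar> \<partial>lborel \<partial>lborel) < top"
  proof -
    have "(\<integral>\<^sup>+t. \<integral>\<^sup>+s. ennreal (hker \<alpha> s * \<bar>u t - u (t - s)\<bar>) * indicator {0<..} s * ennreal \<bar>\<phi> t\<bar> \<partial>lborel \<partial>lborel)
      \<le> (\<integral>\<^sup>+t. near \<alpha> u t * ennreal \<bar>\<phi> t\<bar> + ?u t * ennreal \<bar>\<phi> t\<bar> + far \<alpha> ?u t * ennreal \<bar>\<phi> t\<bar> \<partial>lborel)"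
    proof (rule nn_integral_mono)
      fix t
      show "(\<integral>\<^sup>+s. ennreal (hker \<alpha> s * \<bar>u t - u (t - s)\<bar>) * indicator {0<..} s * ennreal \<bar>\<phi> t\<bar> \<partial>lborel)
        \<le> near \<alpha> u t * ennreal \<bar>\<phi> t\<bar> + ?u t * ennreal \<bar>\<phi> t\<bar> + far \<alpha> ?u t * ennreal \<bar>\<phi> t\<bar>"
        using mult_right_mono[OF increment_le[OF assms(1) \<alpha>(1), of t], of "ennreal \<bar>\<phi> t\<bar>"]
        by (subst nn_integral_multc) (auto simp: distrib_right)
    qed
    also have "\<dots> < top" using near fu by (simp add: nn_integral_add ennreal_add_less_top)
    finally show ?thesis .
  qed
  have H1: "(\<integral>\<^sup>+t. \<integral>\<^sup>+s. ennreal (hker \<alpha> s * \<bar>\<phi> t - \<phi> (t + s)\<bar>) * indicator {0<..} s * ?u t \<partial>lborel \<partial>lborel) < top"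
  proof -
    define \<kappa> where "\<kappa> = \<alpha> / (1 - \<alpha>)"
    have \<kappa>: "0 \<le> \<kappa>" using \<alpha> by (simp add: \<kappa>_def)
    have near_le: "(\<integral>\<^sup>+s\<in>{0<..1}. ennreal (hker \<alpha> s * \<bar>\<phi> t - \<phi> (t + s)\<bar>) \<partial>lborel) \<le> ennreal (\<kappa> * B) * ennreal (decay A t)" for t
      using nn_integral_hker_near_le[of \<alpha> "B * decay A t" "\<lambda>s. \<phi> t - \<phi> (t + s)"] B \<alpha> \<kappa> decay_nonneg[of A t]
      by (simp add: \<kappa>_def ennreal_mult[symmetric] mult.assoc)
    have "(\<integral>\<^sup>+t. \<integral>\<^sup>+s. ennreal (hker \<alpha> s * \<bar>\<phi> t - \<phi> (t + s)\<bar>) * indicator {0<..} s * ?u t \<partial>lborel \<partial>lborel)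
      \<le> (\<integral>\<^sup>+t. ennreal (\<kappa> * B) * (?u t * ennreal (decay A t)) + ?u t * ennreal \<bar>\<phi> t\<bar> + (\<integral>\<^sup>+s. kf \<alpha> s * ennreal \<bar>\<phi> (t + s)\<bar> * ?u t \<partial>lborel) \<partial>lborel)"
    proof (rule nn_integral_mono)
      fix t
      have "(\<integral>\<^sup>+s\<in>{0<..}. ennreal (hker \<alpha> s * \<bar>\<phi> t - \<phi> (t + s)\<bar>) \<partial>lborel)
        \<le> (\<integral>\<^sup>+s\<in>{0<..1}. ennreal (hker \<alpha> s * \<bar>\<phi> t - \<phi> (t + s)\<bar>) \<partial>lborel) + ennreal \<bar>\<phi> t\<bar> + (\<integral>\<^sup>+s. kf \<alpha> s * ennreal \<bar>\<phi> (t + s)\<bar> \<partial>lborel)"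
        using \<alpha> by (intro nn_integral_kernel_le) auto
      also have "\<dots> \<le> ennreal (\<kappa> * B) * ennreal (decay A t) + ennreal \<bar>\<phi> t\<bar> + (\<integral>\<^sup>+s. kf \<alpha> s * ennreal \<bar>\<phi> (t + s)\<bar> \<partial>lborel)"
        by (intro add_right_mono near_le)
      finally have "(\<integral>\<^sup>+s\<in>{0<..}. ennreal (hker \<alpha> s * \<bar>\<phi> t - \<phi> (t + s)\<bar>) \<partial>lborel) * ?u t
        \<le> (ennreal (\<kappa> * B) * ennreal (decay A t) + ennreal \<bar>\<phi> t\<bar> + (\<integral>\<^sup>+s. kf \<alpha> s * ennreal \<bar>\<phi> (t + s)\<bar> \<partial>lborel)) * ?u t"
        by (rule mult_right_mono) simp
      then show "(\<integral>\<^sup>+s. ennreal (hker \<alpha> s * \<bar>\<phi> t - \<phi> (t + s)\<bar>) * indicator {0<..} s * ?u t \<partial>lborel)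
        \<le> ennreal (\<kappa> * B) * (?u t * ennreal (decay A t)) + ?u t * ennreal \<bar>\<phi> t\<bar> + (\<integral>\<^sup>+s. kf \<alpha> s * ennreal \<bar>\<phi> (t + s)\<bar> * ?u t \<partial>lborel)"
        by (subst nn_integral_multc, measurable, subst nn_integral_multc, measurable)
           (simp only: distrib_right mult.assoc mult.commute[of "ennreal \<bar>\<phi> t\<bar>"] mult.commute[of "ennreal (decay A t)"])
    qed
    also have "\<dots> = ennreal (\<kappa> * B) * (\<integral>\<^sup>+t. ?u t * ennreal (decay A t) \<partial>lborel) + (\<integral>\<^sup>+t. ?u t * ennreal \<bar>\<phi> t\<bar> \<partial>lborel) + (\<integral>\<^sup>+t. far \<alpha> ?u t * ennreal \<bar>\<phi> t\<bar> \<partial>lborel)"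
      by (subst kf_swap[where h="\<lambda>t. ennreal \<bar>\<phi> t\<bar>", symmetric]) (auto simp: nn_integral_add nn_integral_cmult)
    also have "\<dots> < top" using fu pairing_decay[OF _ N, of A] by (simp add: ennreal_add_less_top ennreal_mult_less_top)
    finally show ?thesis .
  qed
  have int: "integrable lborel (\<lambda>t. u t * \<phi> (t + s))" if s0: "0 \<le> s" for s
  proof -
    obtain A' B' where B': "0 \<le> B'" "\<And>t. \<bar>\<phi> (t + s)\<bar> \<le> B' * decay A' t" using S_minus_shift[OF \<phi> s0] by metis
    have "(\<integral>\<^sup>+t. ?u t * ennreal \<bar>\<phi> (t + s)\<bar> \<partial>lborel) \<le> (\<integral>\<^sup>+t. ennreal B' * (?u t * ennreal (decay A' t)) \<partial>lborel)"
    proof (rule nn_integral_mono)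
      fix t
      have "ennreal \<bar>\<phi> (t + s)\<bar> \<le> ennreal B' * ennreal (decay A' t)"
        using B' by (simp add: ennreal_mult[symmetric] decay_nonneg ennreal_leI)
      from mult_left_mono[OF this, of "?u t"] show "?u t * ennreal \<bar>\<phi> (t + s)\<bar> \<le> ennreal B' * (?u t * ennreal (decay A' t))"
        by (simp add: mult_ac)
    qed
    also have "\<dots> = ennreal B' * (\<integral>\<^sup>+t. ?u t * ennreal (decay A' t) \<partial>lborel)" by (rule nn_integral_cmult) measurable
    also have "\<dots> < top" using pairing_decay[OF _ N] by (simp add: ennreal_mult_less_top)
    finally show ?thesis by (intro integrable_product) auto
  qed
  show "pair u (Dright \<alpha> \<phi>) = pair (Dleft_pointwise \<alpha> u) \<phi>"
    "integrable lborel (\<lambda>t. Dleft_pointwise \<alpha> u t * \<phi> t)"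
    using fractional_by_parts[OF _ _ \<alpha>(1) H1 H2 int] by auto
qed

end

section \<open>Fractional derivatives of Sobolev functions\<close>

lemma ev_left: "\<forall>\<^sub>F \<alpha> in at_left (1::real). 0 < \<alpha> \<and> \<alpha> < 1"
  by (intro eventually_at_leftI[of 0]) auto

lemma ev_right: "\<forall>\<^sub>F \<alpha> in at_right (0::real). 0 < \<alpha> \<and> \<alpha> < 1"
  by (intro eventually_at_rightI[of _ 1]) auto

lemma ennreal_abs_integral_le: "ennreal \<bar>LINT x|M. f x\<bar> \<le> (\<integral>\<^sup>+x. ennreal \<bar>f x\<bar> \<partial>M)" for f :: "'a \<Rightarrow> real"
  using integral_norm_bound_ennreal[of M f] not_integrable_integral_eq[of M f] by (cases "integrable M f") auto

text \<open>\<open>A\<^sub>\<alpha> v\<close> of the decomposition of \<open>D\<^sup>\<alpha> u\<close>, the absolute version that majorises it, and \<open>F\<^sub>\<alpha> u\<close>.\<close>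

definition near_mean :: "real \<Rightarrow> (real \<Rightarrow> real) \<Rightarrow> real \<Rightarrow> real" where
  "near_mean \<alpha> v t = (LINT s:{0<..1}|lborel. (1 - \<alpha>) * s powr (- \<alpha>) * mean s v t)"

definition near_avg :: "real \<Rightarrow> (real \<Rightarrow> real) \<Rightarrow> real \<Rightarrow> ennreal" where
  "near_avg \<alpha> v t = (\<integral>\<^sup>+s. kn \<alpha> s * avg s (eabs v) t \<partial>lborel)"

definition far_mean :: "real \<Rightarrow> (real \<Rightarrow> real) \<Rightarrow> real \<Rightarrow> real" where
  "far_mean \<alpha> u t = (LINT s:{1<..}|lborel. hker \<alpha> s * u (t - s))"

lemma measurable_near_avg [measurable]:
  assumes [measurable]: "v \<in> borel_measurable borel"
  shows "near_avg \<alpha> v \<in> borel_measurable borel"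
  unfolding near_avg_def by measurable

lemma far_mean_le: "0 < \<alpha> \<Longrightarrow> ennreal \<bar>far_mean \<alpha> u t\<bar> \<le> far \<alpha> (eabs u) t"
  unfolding far_mean_def set_lebesgue_integral_def far_def
  by (rule order_trans[OF ennreal_abs_integral_le], rule nn_integral_mono)
     (auto simp: kf_def abs_mult ennreal_mult split: split_indicator)

lemma kn_integrable:
  fixes \<alpha> :: real and m :: "real \<Rightarrow> real"
  assumes "\<alpha> < 1" and [measurable]: "m \<in> borel_measurable borel" and B: "\<And>s. 0 < s \<Longrightarrow> s \<le> 1 \<Longrightarrow> \<bar>m s\<bar> \<le> B"
  shows "set_integrable lborel {0<..1} (\<lambda>s. (1 - \<alpha>) * s powr (- \<alpha>) * m s)"
  unfolding set_integrable_def
proof (rule integrableI_bounded)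
  have "(\<integral>\<^sup>+s. ennreal (norm (indicat_real {0<..1} s *\<^sub>R ((1 - \<alpha>) * s powr (- \<alpha>) * m s))) \<partial>lborel)
    \<le> (\<integral>\<^sup>+s. kn \<alpha> s * ennreal B \<partial>lborel)"
  proof (rule nn_integral_mono)
    fix s
    show "ennreal (norm (indicat_real {0<..1} s *\<^sub>R ((1 - \<alpha>) * s powr (- \<alpha>) * m s))) \<le> kn \<alpha> s * ennreal B"
    proof (cases "s \<in> {0<..1}")
      case True
      then have "0 \<le> B" using B[of s] by auto
      then show ?thesis using True assms(1) B[of s]
        by (auto simp: kn_def abs_mult ennreal_mult[symmetric] intro!: ennreal_leI mult_left_mono)
    qed simp
  qed
  also have "\<dots> = ennreal B" using assms(1) by (simp add: nn_integral_multc nn_integral_kn)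
  finally show "(\<integral>\<^sup>+s. ennreal (norm (indicat_real {0<..1} s *\<^sub>R ((1 - \<alpha>) * s powr (- \<alpha>) * m s))) \<partial>lborel) < \<infinity>"
    by (simp add: le_less_trans)
qed measurable

lemma kn_LINT:
  fixes \<alpha> :: real
  assumes "\<alpha> < 1"
  shows "(LINT s:{0<..1}|lborel. (1 - \<alpha>) * s powr (- \<alpha>)) = 1"
proof -
  have "(LINT s:{0<..1}|lborel. (1 - \<alpha>) * s powr (- \<alpha>)) = enn2real (\<integral>\<^sup>+s. ennreal (indicator {0<..1} s *\<^sub>R ((1 - \<alpha>) * s powr (- \<alpha>))) \<partial>lborel)"
    unfolding set_lebesgue_integral_def using assms by (intro integral_eq_nn_integral) auto
  also have "(\<integral>\<^sup>+s. ennreal (indicator {0<..1} s *\<^sub>R ((1 - \<alpha>) * s powr (- \<alpha>))) \<partial>lborel) = (\<integral>\<^sup>+s. kn \<alpha> s \<partial>lborel)"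
    by (intro nn_integral_cong) (auto simp: kn_def split: split_indicator)
  finally show ?thesis using assms by (simp add: nn_integral_kn)
qed

lemma kf_LINT:
  fixes \<alpha> :: real
  assumes "0 < \<alpha>"
  shows "(LINT s:{1<..}|lborel. hker \<alpha> s) = 1" "set_integrable lborel {1<..} (\<lambda>s. hker \<alpha> s)"
proof -
  have e: "(\<integral>\<^sup>+s. ennreal (indicator {1<..} s *\<^sub>R (hker \<alpha> s)) \<partial>lborel) = 1"
    unfolding nn_integral_kf[OF assms, symmetric] by (intro nn_integral_cong) (auto simp: kf_def split: split_indicator)
  have "(LINT s:{1<..}|lborel. hker \<alpha> s) = enn2real (\<integral>\<^sup>+s. ennreal (indicator {1<..} s *\<^sub>R (hker \<alpha> s)) \<partial>lborel)"
    unfolding set_lebesgue_integral_def using assms by (intro integral_eq_nn_integral) auto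
  then show "(LINT s:{1<..}|lborel. hker \<alpha> s) = 1" using e by simp
  show "set_integrable lborel {1<..} (\<lambda>s. hker \<alpha> s)"
    unfolding set_integrable_def using e assms by (intro integrableI_nonneg) auto
qed

lemma near_mean_bounds:
  assumes v: "locint v" and \<alpha>: "\<alpha> < 1" and B: "\<And>s. 0 < s \<Longrightarrow> s \<le> 1 \<Longrightarrow> mean s (\<lambda>t. \<bar>v t\<bar>) t \<le> B"
  shows "ennreal \<bar>near_mean \<alpha> v t - v t\<bar> \<le> near_osc \<alpha> v t" "ennreal \<bar>near_mean \<alpha> v t\<bar> \<le> near_avg \<alpha> v t" "near_avg \<alpha> v t \<le> ennreal B"
proof -
  have [measurable]: "v \<in> borel_measurable borel" using v by (simp add: locint_def)
  have Bm: "\<bar>mean s v t\<bar> \<le> B" if "0 < s" "s \<le> 1" for s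
    using abs_mean_le[OF v that(1), of t] B[OF that] by simp
  have i1: "set_integrable lborel {0<..1} (\<lambda>s. (1 - \<alpha>) * s powr (- \<alpha>) * mean s v t)"
    by (rule kn_integrable[OF \<alpha> _ Bm]) measurable
  have i2: "set_integrable lborel {0<..1} (\<lambda>s. (1 - \<alpha>) * s powr (- \<alpha>) * v t)"
    by (rule kn_integrable[OF \<alpha>]) auto
  have "near_mean \<alpha> v t - v t = (LINT s:{0<..1}|lborel. (1 - \<alpha>) * s powr (- \<alpha>) * mean s v t) - (LINT s:{0<..1}|lborel. (1 - \<alpha>) * s powr (- \<alpha>) * v t)"
    using kn_LINT[OF \<alpha>] by (simp add: near_mean_def)
  also have "\<dots> = (LINT s:{0<..1}|lborel. (1 - \<alpha>) * s powr (- \<alpha>) * (mean s v t - v t))"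
    using i1 i2 by (subst set_integral_diff(2)[symmetric]) (simp_all add: right_diff_distrib)
  finally have "ennreal \<bar>near_mean \<alpha> v t - v t\<bar> \<le> (\<integral>\<^sup>+s. ennreal \<bar>indicator {0<..1} s *\<^sub>R ((1 - \<alpha>) * s powr (- \<alpha>) * (mean s v t - v t))\<bar> \<partial>lborel)"
    using ennreal_abs_integral_le by (simp add: set_lebesgue_integral_def)
  also have "\<dots> = near_osc \<alpha> v t" unfolding near_osc_def osc_def using \<alpha>
    by (intro nn_integral_cong) (auto simp: kn_def abs_mult ennreal_mult split: split_indicator)
  finally show "ennreal \<bar>near_mean \<alpha> v t - v t\<bar> \<le> near_osc \<alpha> v t" .
  have "ennreal \<bar>near_mean \<alpha> v t\<bar> \<le> (\<integral>\<^sup>+s. ennreal \<bar>indicator {0<..1} s *\<^sub>R ((1 - \<alpha>) * s powr (- \<alpha>) * mean s v t)\<bar> \<partial>lborel)"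
    using ennreal_abs_integral_le by (simp add: set_lebesgue_integral_def near_mean_def)
  also have "\<dots> \<le> near_avg \<alpha> v t" unfolding near_avg_def
  proof (rule nn_integral_mono)
    fix s
    show "ennreal \<bar>indicator {0<..1} s *\<^sub>R ((1 - \<alpha>) * s powr (- \<alpha>) * mean s v t)\<bar> \<le> kn \<alpha> s * avg s (eabs v) t"
    proof (cases "s \<in> {0<..1}")
      case True
      then show ?thesis using \<alpha> abs_mean_le[OF v, of s t]
        by (auto simp: kn_def abs_mult avg_abs[OF v] ennreal_mult intro!: mult_left_mono ennreal_leI)
    qed simp
  qed
  finally show "ennreal \<bar>near_mean \<alpha> v t\<bar> \<le> near_avg \<alpha> v t" .
  have "near_avg \<alpha> v t \<le> (\<integral>\<^sup>+s. kn \<alpha> s * ennreal B \<partial>lborel)" unfolding near_avg_def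
  proof (rule nn_integral_mono)
    fix s
    show "kn \<alpha> s * avg s (eabs v) t \<le> kn \<alpha> s * ennreal B"
    proof (cases "s \<in> {0<..1}")
      case True
      then show ?thesis using B[of s] by (auto simp: avg_abs[OF v] intro!: mult_left_mono ennreal_leI)
    qed (auto simp: kn_def)
  qed
  then show "near_avg \<alpha> v t \<le> ennreal B" using \<alpha> by (simp add: nn_integral_multc nn_integral_kn)
qed

text \<open>The coefficients of the two parts of the fractional derivative: coef0 belongs to the function, coef1
to its derivative. The form with the reciprocal Gamma function is continuous on the whole line,
so the limits at 0 and 1 are values.\<close>

definition coef0 :: "real \<Rightarrow> real" where "coef0 \<alpha> = rGamma (1 - \<alpha>)"
definition coef1 :: "real \<Rightarrow> real" where "coef1 \<alpha> = \<alpha> * rGamma (2 - \<alpha>)"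

lemma coef_nonneg: "0 < \<alpha> \<Longrightarrow> \<alpha> < 1 \<Longrightarrow> 0 \<le> coef0 \<alpha>" "0 < \<alpha> \<Longrightarrow> \<alpha> < 1 \<Longrightarrow> 0 \<le> coef1 \<alpha>"
  using Gamma_real_pos[of "1 - \<alpha>"] Gamma_real_pos[of "2 - \<alpha>"]
  by (auto simp: coef0_def coef1_def rGamma_inverse_Gamma intro!: mult_nonneg_nonneg less_imp_le)

lemma coef_continuous: "continuous_on UNIV coef0" "continuous_on UNIV coef1"
proof -
  have c: "continuous_on UNIV (\<lambda>\<alpha>::real. rGamma (c - \<alpha>))" for c
    by (rule continuous_on_compose2[of UNIV rGamma]) (auto intro!: continuous_intros continuous_on_rGamma)
  show "continuous_on UNIV coef0" "continuous_on UNIV coef1"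
    unfolding coef0_def coef1_def by (intro continuous_intros c)+
qed

lemma coef_tendsto:
  "(coef0 \<longlongrightarrow> 0) (at_left 1)" "(coef1 \<longlongrightarrow> 1) (at_left 1)" "(coef0 \<longlongrightarrow> 1) (at_right 0)" "(coef1 \<longlongrightarrow> 0) (at_right 0)"
proof -
  have c: "(coef0 \<longlongrightarrow> coef0 x) (at x within S)" "(coef1 \<longlongrightarrow> coef1 x) (at x within S)" for x S
    using coef_continuous by (auto simp: continuous_on_def intro: tendsto_within_subset)
  show "(coef0 \<longlongrightarrow> 0) (at_left 1)" "(coef1 \<longlongrightarrow> 1) (at_left 1)" "(coef0 \<longlongrightarrow> 1) (at_right 0)" "(coef1 \<longlongrightarrow> 0) (at_right 0)"
    using c(1)[of 1 "{..<1}"] c(2)[of 1 "{..<1}"] c(1)[of 0 "{0<..}"] c(2)[of 0 "{0<..}"]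
    by (simp_all add: coef0_def coef1_def)
qed

lemma coef_bounded: obtains G where "0 < G" "\<And>\<alpha>. 0 < \<alpha> \<Longrightarrow> \<alpha> < 1 \<Longrightarrow> coef0 \<alpha> \<le> G" "\<And>\<alpha>. 0 < \<alpha> \<Longrightarrow> \<alpha> < 1 \<Longrightarrow> coef1 \<alpha> \<le> G"
proof -
  have "bounded (coef0 ` {0..1})" "bounded (coef1 ` {0..1})"
    by (auto intro!: compact_imp_bounded compact_continuous_image continuous_on_subset[OF coef_continuous(1)] continuous_on_subset[OF coef_continuous(2)])
  then obtain G0 G1 where "\<forall>x\<in>{0..1}. \<bar>coef0 x\<bar> \<le> G0" "\<forall>x\<in>{0..1}. \<bar>coef1 x\<bar> \<le> G1"
    by (auto simp: bounded_iff)
  then have "coef0 \<alpha> \<le> max 1 (max G0 G1) \<and> coef1 \<alpha> \<le> max 1 (max G0 G1)" if "0 < \<alpha>" "\<alpha> < 1" for \<alpha>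
    using that by (auto simp: le_max_iff_disj abs_le_iff)
  then show thesis by (intro that[of "max 1 (max G0 G1)"]) auto
qed

lemma Dleft_pointwise_split:
  assumes [measurable]: "u \<in> borel_measurable borel" and \<alpha>: "0 < \<alpha>"
    and fin: "near \<alpha> u t < top" "far \<alpha> (eabs u) t < top"
  shows "Dleft_pointwise \<alpha> u t = rGamma (1 - \<alpha>) * ((LINT s:{0<..1}|lborel. hker \<alpha> s * (u t - u (t - s))) + (u t - far_mean \<alpha> u t))"
proof -
  let ?f = "\<lambda>s. hker \<alpha> s * (u t - u (t - s))"
  have i: "set_integrable lborel {0<..} ?f" by (rule increment_integrable[OF assms])
  have i1: "set_integrable lborel {0<..1} ?f" "set_integrable lborel {1<..} ?f"
    by (rule set_integrable_subset[OF i]; auto)+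
  have un: "{0<..1} \<union> {1<..} = {0::real<..}" by auto
  have "(LINT s:{0<..1} \<union> {1<..}|lborel. ?f s) = (LINT s:{0<..1}|lborel. ?f s) + (LINT s:{1<..}|lborel. ?f s)"
    by (rule set_integral_Un[OF _ i1]) auto
  then have "(LINT s:{0<..}|lborel. ?f s) = (LINT s:{0<..1}|lborel. ?f s) + (LINT s:{1<..}|lborel. ?f s)"
    unfolding un .
  moreover have "(LINT s:{1<..}|lborel. ?f s) = u t - far_mean \<alpha> u t"
  proof -
    have j1: "set_integrable lborel {1<..} (\<lambda>s. hker \<alpha> s * u t)"
      by (intro set_integrable_mult_left kf_LINT \<alpha>)
    then have j2: "set_integrable lborel {1<..} (\<lambda>s. hker \<alpha> s * u t - ?f s)"
      using i1(2) by (rule set_integral_diff)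
    have "(LINT s:{1<..}|lborel. hker \<alpha> s * u t - ?f s) = u t - (LINT s:{1<..}|lborel. ?f s)"
      using set_integral_diff(2)[OF j1 i1(2)] kf_LINT(1)[OF \<alpha>] by simp
    moreover have "(LINT s:{1<..}|lborel. hker \<alpha> s * u t - ?f s) = far_mean \<alpha> u t"
      unfolding far_mean_def by (simp add: right_diff_distrib)
    ultimately show ?thesis by simp
  qed
  ultimately show ?thesis unfolding Dleft_pointwise_eq[OF assms(1)] by simp
qed

context left_weight
begin

lemma N_scale_tendsto_0:
  fixes f :: "real \<Rightarrow> real \<Rightarrow> ennreal"
  assumes c: "(c \<longlongrightarrow> 0) F" "\<forall>\<^sub>F \<alpha> in F. 0 \<le> c \<alpha> \<and> f \<alpha> \<in> borel_measurable borel \<and> N (f \<alpha>) \<le> M" and M: "M < top"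
  shows "((\<lambda>\<alpha>. N (\<lambda>t. ennreal (c \<alpha>) * f \<alpha> t)) \<longlongrightarrow> 0) F"
proof -
  have "((\<lambda>\<alpha>. c \<alpha> powr p) \<longlongrightarrow> 0) F"
    using c p_pos by (intro tendsto_zero_powrI[OF c(1) tendsto_const]) (auto elim: eventually_mono)
  then have "((\<lambda>\<alpha>. ennreal (c \<alpha> powr p)) \<longlongrightarrow> ennreal 0) F" by (rule tendsto_ennrealI)
  then have "((\<lambda>\<alpha>. ennreal (c \<alpha> powr p) * M) \<longlongrightarrow> ennreal 0 * M) F"
    using M by (intro tendsto_mult_ennreal tendsto_const) auto
  moreover have "\<forall>\<^sub>F \<alpha> in F. N (\<lambda>t. ennreal (c \<alpha>) * f \<alpha> t) \<le> ennreal (c \<alpha> powr p) * M"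
    using c(2) by eventually_elim (auto simp: N_cmult intro!: mult_left_mono)
  ultimately show ?thesis
    by (intro tendsto_sandwich[of "\<lambda>_. 0" "\<lambda>\<alpha>. N (\<lambda>t. ennreal (c \<alpha>) * f \<alpha> t)"]) auto
qed

lemma N_bounded_scale_tendsto_0:
  fixes f :: "real \<Rightarrow> real \<Rightarrow> ennreal"
  assumes f: "((\<lambda>\<alpha>. N (f \<alpha>)) \<longlongrightarrow> 0) F" and c: "\<forall>\<^sub>F \<alpha> in F. 0 \<le> c \<alpha> \<and> c \<alpha> \<le> G \<and> f \<alpha> \<in> borel_measurable borel"
  shows "((\<lambda>\<alpha>. N (\<lambda>t. ennreal (c \<alpha>) * f \<alpha> t)) \<longlongrightarrow> 0) F"
proof -
  have "((\<lambda>\<alpha>. ennreal (G powr p) * N (f \<alpha>)) \<longlongrightarrow> ennreal (G powr p) * 0) F"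
    by (intro tendsto_mult_ennreal tendsto_const f) auto
  moreover have "\<forall>\<^sub>F \<alpha> in F. N (\<lambda>t. ennreal (c \<alpha>) * f \<alpha> t) \<le> ennreal (G powr p) * N (f \<alpha>)"
    using c by eventually_elim (use p_pos in \<open>auto simp: N_cmult intro!: mult_right_mono ennreal_leI powr_mono2\<close>)
  ultimately show ?thesis
    by (intro tendsto_sandwich[of "\<lambda>_. 0" "\<lambda>\<alpha>. N (\<lambda>t. ennreal (c \<alpha>) * f \<alpha> t)"]) auto
qed

lemma N_add_tendsto_0:
  fixes f g :: "real \<Rightarrow> real \<Rightarrow> ennreal"
  assumes f: "((\<lambda>\<alpha>. N (f \<alpha>)) \<longlongrightarrow> 0) F" and g: "((\<lambda>\<alpha>. N (g \<alpha>)) \<longlongrightarrow> 0) F"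
    and m: "\<And>\<alpha>. f \<alpha> \<in> borel_measurable borel" "\<And>\<alpha>. g \<alpha> \<in> borel_measurable borel"
  shows "((\<lambda>\<alpha>. N (\<lambda>t. f \<alpha> t + g \<alpha> t)) \<longlongrightarrow> 0) F"
proof -
  have "((\<lambda>\<alpha>. ennreal (2 powr p) * (N (f \<alpha>) + N (g \<alpha>))) \<longlongrightarrow> ennreal (2 powr p) * (0 + 0)) F"
    by (intro tendsto_mult_ennreal tendsto_const tendsto_add f g) auto
  then show ?thesis
    by (intro tendsto_sandwich[of "\<lambda>_. 0" "\<lambda>\<alpha>. N (\<lambda>t. f \<alpha> t + g \<alpha> t)"] always_eventually allI)
       (auto simp: m intro!: N_add)
qed

lemma N_le_tendsto_0:
  assumes "((\<lambda>\<alpha>. N (g \<alpha>)) \<longlongrightarrow> 0) F" "\<forall>\<^sub>F \<alpha> in F. AE t in lborel. f \<alpha> t \<le> g \<alpha> t"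
  shows "((\<lambda>\<alpha>. N (f \<alpha>)) \<longlongrightarrow> 0) F"
  using assms(1) eventually_mono[OF assms(2) N_mono]
  by (intro tendsto_sandwich[of "\<lambda>_. 0" "\<lambda>\<alpha>. N (f \<alpha>)"]) auto

text \<open>The decomposition of the fractional derivative on which everything about Sobolev functions rests.
The exceptional set of the increment formula depends on s; by Fubini's theorem, for almost every
t the formula holds for almost every s, which suffices inside an integral over s, and then all
orders are treated outside a single null set.\<close>

lemma sobolev_pointwise:
  assumes [measurable]: "u \<in> borel_measurable borel" "v \<in> borel_measurable borel"
    and Nu: "N (eabs u) < top" and Nv: "N (eabs v) < top"
    and inc: "\<And>h. 0 < h \<Longrightarrow> AE t in lborel. u t - u (t - h) = h * mean h v t"
  shows "AE t in lborel. \<exists>B. \<forall>\<alpha>. 0 < \<alpha> \<longrightarrow> \<alpha> < 1 \<longrightarrow>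
     near \<alpha> u t \<le> ennreal (\<alpha> / (1 - \<alpha>)) * near_avg \<alpha> v t \<and> near \<alpha> u t < top \<and>
     Dleft_pointwise \<alpha> u t = coef1 \<alpha> * near_mean \<alpha> v t + coef0 \<alpha> * (u t - far_mean \<alpha> u t) \<and>
     ennreal \<bar>near_mean \<alpha> v t - v t\<bar> \<le> near_osc \<alpha> v t \<and> ennreal \<bar>near_mean \<alpha> v t\<bar> \<le> near_avg \<alpha> v t \<and> \<bar>near_mean \<alpha> v t\<bar> \<le> B"
proof -
  have v: "locint v" by (rule N_finite_imp_locint[OF _ Nv]) measurable
  have "AE s in lborel. AE t in lborel. 0 < s \<longrightarrow> u t - u (t - s) = s * mean s v t"
  proof (rule AE_I2)
    fix s :: real
    show "AE t in lborel. 0 < s \<longrightarrow> u t - u (t - s) = s * mean s v t"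
      using inc[of s] by (cases "0 < s") auto
  qed
  \<comment> \<open>Exchange of the quantifiers over s and t.\<close>
  then have "AE t in lborel. AE s in lborel. 0 < s \<longrightarrow> u t - u (t - s) = s * mean s v t"
    by (subst (asm) lborel_pair.AE_commute) measurable
  then show ?thesis using avg_bounded_near[OF v]
  proof eventually_elim
    case (elim t)
    then obtain B where B: "0 \<le> B" "\<And>s. 0 < s \<Longrightarrow> s \<le> 1 \<Longrightarrow> mean s (\<lambda>t. \<bar>v t\<bar>) t \<le> B" by auto
    have main: "near \<alpha> u t \<le> ennreal (\<alpha> / (1 - \<alpha>)) * near_avg \<alpha> v t \<and> near \<alpha> u t < top \<and>
     Dleft_pointwise \<alpha> u t = coef1 \<alpha> * near_mean \<alpha> v t + coef0 \<alpha> * (u t - far_mean \<alpha> u t) \<and>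
     ennreal \<bar>near_mean \<alpha> v t - v t\<bar> \<le> near_osc \<alpha> v t \<and> ennreal \<bar>near_mean \<alpha> v t\<bar> \<le> near_avg \<alpha> v t \<and> \<bar>near_mean \<alpha> v t\<bar> \<le> B"
      if \<alpha>: "0 < \<alpha>" "\<alpha> < 1" for \<alpha>
    proof -
      note EB = near_mean_bounds[OF v \<alpha>(2) B(2)]
      have EvB: "\<bar>near_mean \<alpha> v t\<bar> \<le> B" using order_trans[OF EB(2,3)] B(1) by (simp add: ennreal_le_iff)
      have "near \<alpha> u t \<le> (\<integral>\<^sup>+s. ennreal (\<alpha> / (1 - \<alpha>)) * (kn \<alpha> s * avg s (eabs v) t) \<partial>lborel)"
        unfolding near_def
      proof (rule nn_integral_mono_AE, use elim(1) in eventually_elim)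
        fix s assume s: "0 < s \<longrightarrow> u t - u (t - s) = s * mean s v t"
        show "ennreal (hker \<alpha> s * \<bar>u t - u (t - s)\<bar>) * indicator {0<..1} s
          \<le> ennreal (\<alpha> / (1 - \<alpha>)) * (kn \<alpha> s * avg s (eabs v) t)"
        proof (cases "0 < s \<and> s \<le> 1")
          case True
          have "hker \<alpha> s * \<bar>u t - u (t - s)\<bar> \<le> hker \<alpha> s * (s * mean s (\<lambda>t. \<bar>v t\<bar>) t)"
            using True s \<alpha> abs_mean_le[OF v, of s t] by (intro mult_left_mono) (auto simp: abs_mult)
          also have "\<dots> = \<alpha> / (1 - \<alpha>) * (((1 - \<alpha>) * s powr (- \<alpha>)) * mean s (\<lambda>t. \<bar>v t\<bar>) t)"
            using True \<alpha> powr_add[of s "-1-\<alpha>" 1] by simp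
          finally have "ennreal (hker \<alpha> s * \<bar>u t - u (t - s)\<bar>) \<le> ennreal (\<alpha> / (1 - \<alpha>) * (((1 - \<alpha>) * s powr (- \<alpha>)) * mean s (\<lambda>t. \<bar>v t\<bar>) t))"
            by (rule ennreal_leI)
          also have "\<dots> = ennreal (\<alpha> / (1 - \<alpha>)) * (kn \<alpha> s * avg s (eabs v) t)"
          proof -
            have m: "ennreal (x * (y * z)) = ennreal x * (ennreal y * ennreal z)" if "0 \<le> x" "0 \<le> y" "0 \<le> z" for x y z
              using that by (simp add: ennreal_mult)
            have "0 \<le> mean s (\<lambda>t. \<bar>v t\<bar>) t" using True order_trans[OF abs_ge_zero abs_mean_le[OF v, of s t]] by auto
            then show ?thesis using True \<alpha> by (subst m) (auto simp: kn_def avg_abs[OF v])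
          qed
          finally show ?thesis using True by simp
        qed (auto split: split_indicator)
      qed
      also have "\<dots> = ennreal (\<alpha> / (1 - \<alpha>)) * near_avg \<alpha> v t" unfolding near_avg_def by (rule nn_integral_cmult) measurable
      finally have near: "near \<alpha> u t \<le> ennreal (\<alpha> / (1 - \<alpha>)) * near_avg \<alpha> v t" .
      have "near_avg \<alpha> v t < top" using EB(3) by (auto intro: le_less_trans)
      then have near_fin: "near \<alpha> u t < top" using near by (auto intro: le_less_trans simp: ennreal_mult_less_top)
      have far_fin: "far \<alpha> (eabs u) t < top"
      proof -
        obtain B' where "far \<alpha> (eabs u) t \<le> ennreal B'"
          using far_bounded[of "\<lambda>t. ennreal \<bar>u t\<bar>" t] Nu \<alpha> by (metis less_imp_le measurable_compose[OF _ measurable_ennreal] borel_measurable_abs assms(1))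
        then show ?thesis by (auto intro: le_less_trans)
      qed
      have "(LINT s:{0<..1}|lborel. hker \<alpha> s * (u t - u (t - s))) = (LINT s:{0<..1}|lborel. \<alpha> / (1 - \<alpha>) * ((1 - \<alpha>) * s powr (- \<alpha>) * mean s v t))"
        unfolding set_lebesgue_integral_def
      proof (rule integral_cong_AE)
        show "AE s in lborel. indicat_real {0<..1} s *\<^sub>R (hker \<alpha> s * (u t - u (t - s))) = indicat_real {0<..1} s *\<^sub>R (\<alpha> / (1 - \<alpha>) * ((1 - \<alpha>) * s powr (- \<alpha>) * mean s v t))"
          using elim(1)
        proof eventually_elim
          case (elim s)
          then show ?case using \<alpha> powr_add[of s "-1-\<alpha>" 1] by (auto split: split_indicator)
        qed
      qed measurable
      also have "\<dots> = \<alpha> / (1 - \<alpha>) * near_mean \<alpha> v t" unfolding near_mean_def by (rule set_integral_mult_right)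
      finally have "Dleft_pointwise \<alpha> u t = rGamma (1 - \<alpha>) * (\<alpha> / (1 - \<alpha>) * near_mean \<alpha> v t + (u t - far_mean \<alpha> u t))"
        using Dleft_pointwise_split[OF _ \<alpha>(1) near_fin far_fin] by simp
      moreover have "rGamma (1 - \<alpha>) * (\<alpha> / (1 - \<alpha>)) = coef1 \<alpha>"
        using rGamma_plus1[of "1 - \<alpha>", symmetric] \<alpha> by (simp add: coef1_def)
      ultimately have "Dleft_pointwise \<alpha> u t = coef1 \<alpha> * near_mean \<alpha> v t + coef0 \<alpha> * (u t - far_mean \<alpha> u t)"
        by (simp only: distrib_left coef0_def mult.assoc[symmetric])
      then show ?thesis using near near_fin EB EvB by auto
    qed
    then show ?case by blast
  qed
qed

lemma N_near_avg: "v \<in> borel_measurable borel \<Longrightarrow> \<alpha> < 1 \<Longrightarrow> N (near_avg \<alpha> v) \<le> ennreal K * N (eabs v)"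
  unfolding near_avg_def by (rule N_near) auto

end

text \<open>Borel representatives of a Sobolev function u and of its weak derivative v, the latter expressed
by increments.\<close>

locale weighted_sobolev = left_weight +
  fixes u v :: "real \<Rightarrow> real"
  assumes u_meas [measurable]: "u \<in> borel_measurable borel" and v_meas [measurable]: "v \<in> borel_measurable borel"
    and Nu: "N (eabs u) < top" and Nv: "N (eabs v) < top"
    and inc: "\<And>h. 0 < h \<Longrightarrow> AE t in lborel. u t - u (t - h) = h * mean h v t"
begin

abbreviation "fu \<alpha> \<equiv> far \<alpha> (eabs u)"
abbreviation "D \<alpha> \<equiv> Dleft_pointwise \<alpha> u"

lemma pointwise: "AE t in lborel. \<exists>B. \<forall>\<alpha>. 0 < \<alpha> \<longrightarrow> \<alpha> < 1 \<longrightarrow>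
     near \<alpha> u t \<le> ennreal (\<alpha> / (1 - \<alpha>)) * near_avg \<alpha> v t \<and> near \<alpha> u t < top \<and>
     Dleft_pointwise \<alpha> u t = coef1 \<alpha> * near_mean \<alpha> v t + coef0 \<alpha> * (u t - far_mean \<alpha> u t) \<and>
     ennreal \<bar>near_mean \<alpha> v t - v t\<bar> \<le> near_osc \<alpha> v t \<and> ennreal \<bar>near_mean \<alpha> v t\<bar> \<le> near_avg \<alpha> v t \<and> \<bar>near_mean \<alpha> v t\<bar> \<le> B"
  by (rule sobolev_pointwise[OF u_meas v_meas Nu Nv]) (rule inc)

lemma v_loc: "locint v" by (rule N_finite_imp_locint[OF _ Nv]) measurable

lemma fu_finite: "0 < \<alpha> \<Longrightarrow> \<alpha> < 1 \<Longrightarrow> fu \<alpha> t < top"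
proof -
  assume \<alpha>: "0 < \<alpha>" "\<alpha> < 1"
  obtain B' where "\<And>\<alpha>. 0 < \<alpha> \<Longrightarrow> \<alpha> \<le> 1 \<Longrightarrow> fu \<alpha> t \<le> ennreal B'"
    using far_bounded[OF _ Nu, of t] by (metis measurable_compose[OF _ measurable_ennreal] borel_measurable_abs u_meas)
  then have "fu \<alpha> t \<le> ennreal B'" using \<alpha> by simp
  then show ?thesis by (auto intro: le_less_trans)
qed

lemma D_integrable:
  "AE t in lborel. \<forall>\<alpha>. 0 < \<alpha> \<longrightarrow> \<alpha> < 1 \<longrightarrow> set_integrable lebesgue {..<t} (Dleft_integrand \<alpha> u t)"
  using pointwise
proof eventually_elim
  case (elim t)
  then show ?case by (auto intro!: Dleft_integrand_integrable fu_finite)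
qed

lemma D_coincides:
  assumes \<alpha>: "0 < \<alpha>" "\<alpha> < 1" and \<phi>: "\<phi> \<in> S_minus"
  shows "pair u (Dright \<alpha> \<phi>) = pair (D \<alpha>) \<phi>"
    and "integrable lborel (\<lambda>t. D \<alpha> t * \<phi> t)"
proof -
  have [measurable]: "\<phi> \<in> borel_measurable borel" using S_minus_measurable[OF \<phi>] .
  have fin: "(\<integral>\<^sup>+t. near_avg \<alpha> v t * ennreal \<bar>\<phi> t\<bar> \<partial>lborel) < top"
    using N_near_avg[of v \<alpha>] \<alpha> Nv by (intro pairing_S_minus \<phi>) (auto intro: le_less_trans simp: ennreal_mult_less_top)
  have "(\<integral>\<^sup>+t. near \<alpha> u t * ennreal \<bar>\<phi> t\<bar> \<partial>lborel) \<le> (\<integral>\<^sup>+t. ennreal (\<alpha> / (1 - \<alpha>)) * (near_avg \<alpha> v t * ennreal \<bar>\<phi> t\<bar>) \<partial>lborel)"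
  proof (rule nn_integral_mono_AE, use pointwise in eventually_elim)
    case (elim t)
    then have "near \<alpha> u t \<le> ennreal (\<alpha> / (1 - \<alpha>)) * near_avg \<alpha> v t" using \<alpha> by auto
    from mult_right_mono[OF this, of "ennreal \<bar>\<phi> t\<bar>"] show ?case by (simp add: mult.assoc)
  qed
  also have "\<dots> = ennreal (\<alpha> / (1 - \<alpha>)) * (\<integral>\<^sup>+t. near_avg \<alpha> v t * ennreal \<bar>\<phi> t\<bar> \<partial>lborel)" by (rule nn_integral_cmult) measurable
  also have "\<dots> < top" using fin by (simp add: ennreal_mult_less_top)
  finally have near: "(\<integral>\<^sup>+t. near \<alpha> u t * ennreal \<bar>\<phi> t\<bar> \<partial>lborel) < top" .
  show "pair u (Dright \<alpha> \<phi>) = pair (D \<alpha>) \<phi>" "integrable lborel (\<lambda>t. D \<alpha> t * \<phi> t)"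
    using coincidence[OF u_meas Nu \<alpha> \<phi> near] by auto
qed

lemma D_norm:
  assumes \<alpha>: "0 < \<alpha>" "\<alpha> < 1" and G: "0 < G" "coef0 \<alpha> \<le> G" "coef1 \<alpha> \<le> G"
  shows "N (eabs (D \<alpha>)) \<le> ennreal (G powr p * (2 powr p * (2 powr p * (K + 1) + 2 powr p * K))) * (N (eabs u) + N (eabs v))"
proof -
  let ?u = "\<lambda>t. ennreal \<bar>u t\<bar>" and ?v = "\<lambda>t. ennreal \<bar>v t\<bar>"
  have "N (eabs (D \<alpha>)) \<le> N (\<lambda>t. ennreal G * ((near_avg \<alpha> v t + ?u t) + fu \<alpha> t))"
  proof (rule N_mono, use pointwise in eventually_elim)
    case (elim t)
    then have e: "D \<alpha> t = coef1 \<alpha> * near_mean \<alpha> v t + coef0 \<alpha> * (u t - far_mean \<alpha> u t)" "ennreal \<bar>near_mean \<alpha> v t\<bar> \<le> near_avg \<alpha> v t" using \<alpha> by auto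
    have "\<bar>D \<alpha> t\<bar> \<le> \<bar>coef1 \<alpha> * near_mean \<alpha> v t\<bar> + \<bar>coef0 \<alpha> * (u t - far_mean \<alpha> u t)\<bar>" unfolding e by (rule abs_triangle_ineq)
    also have "\<dots> \<le> G * \<bar>near_mean \<alpha> v t\<bar> + G * \<bar>u t - far_mean \<alpha> u t\<bar>"
      unfolding abs_mult using coef_nonneg[OF \<alpha>] G by (intro add_mono mult_right_mono) auto
    also have "\<dots> \<le> G * (\<bar>near_mean \<alpha> v t\<bar> + \<bar>u t\<bar> + \<bar>far_mean \<alpha> u t\<bar>)"
      using G mult_left_mono[OF abs_triangle_ineq4[of "u t" "far_mean \<alpha> u t"], of G] by (simp add: distrib_left)
    finally have "ennreal \<bar>D \<alpha> t\<bar> \<le> ennreal (G * (\<bar>near_mean \<alpha> v t\<bar> + \<bar>u t\<bar> + \<bar>far_mean \<alpha> u t\<bar>))" by (rule ennreal_leI)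
    also have "\<dots> = ennreal G * ((ennreal \<bar>near_mean \<alpha> v t\<bar> + ?u t) + ennreal \<bar>far_mean \<alpha> u t\<bar>)"
      using G by (simp add: ennreal_mult)
    also have "\<dots> \<le> ennreal G * ((near_avg \<alpha> v t + ?u t) + fu \<alpha> t)"
      by (intro mult_left_mono add_mono e far_mean_le \<alpha>) auto
    finally show ?case .
  qed
  also have "\<dots> = ennreal (G powr p) * N (\<lambda>t. (near_avg \<alpha> v t + ?u t) + fu \<alpha> t)"
    using G by (subst N_cmult) auto
  also have "N (\<lambda>t. (near_avg \<alpha> v t + ?u t) + fu \<alpha> t) \<le> ennreal (2 powr p) * (N (\<lambda>t. near_avg \<alpha> v t + ?u t) + N (fu \<alpha>))"
    by (rule N_add) measurable
  also have "N (\<lambda>t. near_avg \<alpha> v t + ?u t) \<le> ennreal (2 powr p) * (N (near_avg \<alpha> v) + N ?u)"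
    by (rule N_add) measurable
  also have "N (near_avg \<alpha> v) \<le> ennreal K * N ?v" using \<alpha> by (intro N_near_avg) auto
  also have "N (fu \<alpha>) \<le> ennreal (2 powr p * K) * N ?u" using \<alpha> by (intro N_far) auto
  also have "ennreal (2 powr p) * (ennreal K * N ?v + N ?u) + ennreal (2 powr p * K) * N ?u
    \<le> ennreal (2 powr p * (K + 1) + 2 powr p * K) * (N ?u + N ?v)"
  proof -
    have "ennreal K * N ?v + N ?u \<le> ennreal (K + 1) * N ?v + ennreal (K + 1) * N ?u"
      using K_pos mult_right_mono[of 1 "ennreal (K + 1)" "N ?u"]
      by (intro add_mono mult_right_mono ennreal_leI) (auto simp: ennreal_le_1[symmetric] simp del: ennreal_plus)
    also have "\<dots> = ennreal (K + 1) * (N ?u + N ?v)" by (simp add: distrib_left add.commute del: ennreal_plus)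
    finally have "ennreal (2 powr p) * (ennreal K * N ?v + N ?u) \<le> ennreal (2 powr p) * (ennreal (K + 1) * (N ?u + N ?v))"
      by (rule mult_left_mono) simp
    also have "\<dots> = ennreal (2 powr p * (K + 1)) * (N ?u + N ?v)"
      using K_pos by (simp add: ennreal_mult mult.assoc del: ennreal_plus)
    finally have 1: "ennreal (2 powr p) * (ennreal K * N ?v + N ?u) \<le> ennreal (2 powr p * (K + 1)) * (N ?u + N ?v)" .
    have 2: "ennreal (2 powr p * K) * N ?u \<le> ennreal (2 powr p * K) * (N ?u + N ?v)"
      by (intro mult_left_mono) auto
    have "ennreal (2 powr p * (K + 1) + 2 powr p * K) = ennreal (2 powr p * (K + 1)) + ennreal (2 powr p * K)"
      using K_pos by (intro ennreal_plus) auto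
    then show ?thesis using add_mono[OF 1 2] by (simp add: distrib_right del: ennreal_plus)
  qed
  finally show ?thesis
    using K_pos G by (simp add: ennreal_mult mult.assoc mult_left_mono add_mono del: ennreal_plus)
qed

lemma N_fu_bound: "0 < \<alpha> \<Longrightarrow> \<alpha> < 1 \<Longrightarrow> N (fu \<alpha>) \<le> ennreal (2 powr p * K) * N (eabs u)"
  by (intro N_far) auto

text \<open>\<open>D\<^sup>\<alpha> u - v\<close> is the sum of \<open>coef1 (A\<^sub>\<alpha> v - v)\<close>, \<open>(coef1 - 1) v\<close> and \<open>coef0 (u - F\<^sub>\<alpha> u)\<close>; the first is
controlled by the mean oscillation of v, the others by their coefficients.\<close>

lemma D_tendsto_left_norm: "((\<lambda>\<alpha>. N (\<lambda>t. ennreal \<bar>D \<alpha> t - v t\<bar>)) \<longlongrightarrow> 0) (at_left 1)"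
proof -
  let ?u = "\<lambda>t. ennreal \<bar>u t\<bar>" and ?v = "\<lambda>t. ennreal \<bar>v t\<bar>"
  obtain G where G: "0 < G" "\<And>\<alpha>. 0 < \<alpha> \<Longrightarrow> \<alpha> < 1 \<Longrightarrow> coef0 \<alpha> \<le> G" "\<And>\<alpha>. 0 < \<alpha> \<Longrightarrow> \<alpha> < 1 \<Longrightarrow> coef1 \<alpha> \<le> G"
    using coef_bounded by metis
  have l1: "((\<lambda>\<alpha>. \<bar>coef1 \<alpha> - 1\<bar>) \<longlongrightarrow> 0) (at_left 1)"
    using tendsto_rabs[OF tendsto_diff[OF coef_tendsto(2) tendsto_const[of 1]]] by simp
  have t1: "((\<lambda>\<alpha>. N (\<lambda>t. ennreal (coef1 \<alpha>) * near_osc \<alpha> v t)) \<longlongrightarrow> 0) (at_left 1)"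
    by (rule N_bounded_scale_tendsto_0[OF N_near_osc_tendsto_0[OF v_meas Nv], where G=G], use ev_left in eventually_elim)
       (use coef_nonneg G in auto)
  have t2: "((\<lambda>\<alpha>. N (\<lambda>t. ennreal \<bar>coef1 \<alpha> - 1\<bar> * ?v t)) \<longlongrightarrow> 0) (at_left 1)"
    by (rule N_scale_tendsto_0[OF l1 _ Nv]) auto
  have t3: "((\<lambda>\<alpha>. N (\<lambda>t. ennreal (coef0 \<alpha>) * ?u t)) \<longlongrightarrow> 0) (at_left 1)"
    by (rule N_scale_tendsto_0[OF coef_tendsto(1) _ Nu], use ev_left in eventually_elim) (use coef_nonneg in auto)
  have t4: "((\<lambda>\<alpha>. N (\<lambda>t. ennreal (coef0 \<alpha>) * fu \<alpha> t)) \<longlongrightarrow> 0) (at_left 1)"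
    by (rule N_scale_tendsto_0[OF coef_tendsto(1), where M="ennreal (2 powr p * K) * N ?u"], use ev_left in eventually_elim)
       (use coef_nonneg N_fu_bound Nu in \<open>auto simp: ennreal_mult_less_top\<close>)
  show ?thesis
  proof (rule N_le_tendsto_0)
    show "((\<lambda>\<alpha>. N (\<lambda>t. ((ennreal (coef1 \<alpha>) * near_osc \<alpha> v t + ennreal \<bar>coef1 \<alpha> - 1\<bar> * ?v t) + ennreal (coef0 \<alpha>) * ?u t) + ennreal (coef0 \<alpha>) * fu \<alpha> t)) \<longlongrightarrow> 0) (at_left 1)"
      by (intro N_add_tendsto_0 t1 t2 t3 t4) auto
    show "\<forall>\<^sub>F \<alpha> in at_left 1. AE t in lborel. ennreal \<bar>D \<alpha> t - v t\<bar> \<le>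
       ((ennreal (coef1 \<alpha>) * near_osc \<alpha> v t + ennreal \<bar>coef1 \<alpha> - 1\<bar> * ?v t) + ennreal (coef0 \<alpha>) * ?u t) + ennreal (coef0 \<alpha>) * fu \<alpha> t"
      using ev_left
    proof eventually_elim
      case \<alpha>: (elim \<alpha>)
      show ?case using pointwise
      proof eventually_elim
        case (elim t)
        then have e: "D \<alpha> t = coef1 \<alpha> * near_mean \<alpha> v t + coef0 \<alpha> * (u t - far_mean \<alpha> u t)" "ennreal \<bar>near_mean \<alpha> v t - v t\<bar> \<le> near_osc \<alpha> v t" using \<alpha> by auto
        have nn: "0 \<le> coef0 \<alpha>" "0 \<le> coef1 \<alpha>" using coef_nonneg \<alpha> by auto
        have "D \<alpha> t - v t = coef1 \<alpha> * (near_mean \<alpha> v t - v t) + (coef1 \<alpha> - 1) * v t + coef0 \<alpha> * u t - coef0 \<alpha> * far_mean \<alpha> u t"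
          unfolding e by (simp add: algebra_simps)
        also have "\<bar>\<dots>\<bar> \<le> \<bar>coef1 \<alpha> * (near_mean \<alpha> v t - v t)\<bar> + \<bar>(coef1 \<alpha> - 1) * v t\<bar> + \<bar>coef0 \<alpha> * u t\<bar> + \<bar>coef0 \<alpha> * far_mean \<alpha> u t\<bar>" by linarith
        also have "\<dots> = coef1 \<alpha> * \<bar>near_mean \<alpha> v t - v t\<bar> + \<bar>coef1 \<alpha> - 1\<bar> * \<bar>v t\<bar> + coef0 \<alpha> * \<bar>u t\<bar> + coef0 \<alpha> * \<bar>far_mean \<alpha> u t\<bar>"
          using nn by (simp add: abs_mult)
        finally have "ennreal \<bar>D \<alpha> t - v t\<bar> \<le> ennreal (coef1 \<alpha>) * ennreal \<bar>near_mean \<alpha> v t - v t\<bar> + ennreal \<bar>coef1 \<alpha> - 1\<bar> * ?v t + ennreal (coef0 \<alpha>) * ?u t + ennreal (coef0 \<alpha>) * ennreal \<bar>far_mean \<alpha> u t\<bar>"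
          using nn by (simp add: ennreal_mult[symmetric] ennreal_plus[symmetric] ennreal_leI del: ennreal_plus)
        also have "\<dots> \<le> ((ennreal (coef1 \<alpha>) * near_osc \<alpha> v t + ennreal \<bar>coef1 \<alpha> - 1\<bar> * ?v t) + ennreal (coef0 \<alpha>) * ?u t) + ennreal (coef0 \<alpha>) * fu \<alpha> t"
          using \<alpha> by (intro add_mono mult_left_mono e far_mean_le order_refl) auto
        finally show ?case .
      qed
    qed
  qed
qed

text \<open>\<open>D\<^sup>\<alpha> u - u\<close> is the sum of \<open>coef1 A\<^sub>\<alpha> v\<close>, \<open>(coef0 - 1) u\<close> and \<open>- coef0 F\<^sub>\<alpha> u\<close>; only the last one needs more
than its coefficient.\<close>

lemma D_tendsto_right_norm:
  assumes far0: "((\<lambda>\<alpha>. N (fu \<alpha>)) \<longlongrightarrow> 0) (at_right 0)"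
  shows "((\<lambda>\<alpha>. N (\<lambda>t. ennreal \<bar>D \<alpha> t - u t\<bar>)) \<longlongrightarrow> 0) (at_right 0)"
proof -
  let ?u = "\<lambda>t. ennreal \<bar>u t\<bar>" and ?v = "\<lambda>t. ennreal \<bar>v t\<bar>"
  obtain G where G: "0 < G" "\<And>\<alpha>. 0 < \<alpha> \<Longrightarrow> \<alpha> < 1 \<Longrightarrow> coef0 \<alpha> \<le> G" "\<And>\<alpha>. 0 < \<alpha> \<Longrightarrow> \<alpha> < 1 \<Longrightarrow> coef1 \<alpha> \<le> G"
    using coef_bounded by metis
  have l1: "((\<lambda>\<alpha>. \<bar>coef0 \<alpha> - 1\<bar>) \<longlongrightarrow> 0) (at_right 0)"
    using tendsto_rabs[OF tendsto_diff[OF coef_tendsto(3) tendsto_const[of 1]]] by simp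
  have t1: "((\<lambda>\<alpha>. N (\<lambda>t. ennreal (coef1 \<alpha>) * near_avg \<alpha> v t)) \<longlongrightarrow> 0) (at_right 0)"
    by (rule N_scale_tendsto_0[OF coef_tendsto(4), where M="ennreal K * N ?v"], use ev_right in eventually_elim)
       (use coef_nonneg N_near_avg[OF v_meas] Nv in \<open>auto simp: ennreal_mult_less_top\<close>)
  have t2: "((\<lambda>\<alpha>. N (\<lambda>t. ennreal \<bar>coef0 \<alpha> - 1\<bar> * ?u t)) \<longlongrightarrow> 0) (at_right 0)"
    by (rule N_scale_tendsto_0[OF l1 _ Nu]) auto
  have t3: "((\<lambda>\<alpha>. N (\<lambda>t. ennreal (coef0 \<alpha>) * fu \<alpha> t)) \<longlongrightarrow> 0) (at_right 0)"
    by (rule N_bounded_scale_tendsto_0[OF far0, where G=G], use ev_right in eventually_elim)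
       (use coef_nonneg G in auto)
  show ?thesis
  proof (rule N_le_tendsto_0)
    show "((\<lambda>\<alpha>. N (\<lambda>t. (ennreal (coef1 \<alpha>) * near_avg \<alpha> v t + ennreal \<bar>coef0 \<alpha> - 1\<bar> * ?u t) + ennreal (coef0 \<alpha>) * fu \<alpha> t)) \<longlongrightarrow> 0) (at_right 0)"
      by (intro N_add_tendsto_0 t1 t2 t3) auto
    show "\<forall>\<^sub>F \<alpha> in at_right 0. AE t in lborel. ennreal \<bar>D \<alpha> t - u t\<bar> \<le>
       (ennreal (coef1 \<alpha>) * near_avg \<alpha> v t + ennreal \<bar>coef0 \<alpha> - 1\<bar> * ?u t) + ennreal (coef0 \<alpha>) * fu \<alpha> t"
      using ev_right
    proof eventually_elim
      case \<alpha>: (elim \<alpha>)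
      show ?case using pointwise
      proof eventually_elim
        case (elim t)
        then have e: "D \<alpha> t = coef1 \<alpha> * near_mean \<alpha> v t + coef0 \<alpha> * (u t - far_mean \<alpha> u t)" "ennreal \<bar>near_mean \<alpha> v t\<bar> \<le> near_avg \<alpha> v t" using \<alpha> by auto
        have nn: "0 \<le> coef0 \<alpha>" "0 \<le> coef1 \<alpha>" using coef_nonneg \<alpha> by auto
        have "D \<alpha> t - u t = coef1 \<alpha> * near_mean \<alpha> v t + (coef0 \<alpha> - 1) * u t - coef0 \<alpha> * far_mean \<alpha> u t"
          unfolding e by (simp add: algebra_simps)
        also have "\<bar>\<dots>\<bar> \<le> \<bar>coef1 \<alpha> * near_mean \<alpha> v t\<bar> + \<bar>(coef0 \<alpha> - 1) * u t\<bar> + \<bar>coef0 \<alpha> * far_mean \<alpha> u t\<bar>" by linarith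
        also have "\<dots> = coef1 \<alpha> * \<bar>near_mean \<alpha> v t\<bar> + \<bar>coef0 \<alpha> - 1\<bar> * \<bar>u t\<bar> + coef0 \<alpha> * \<bar>far_mean \<alpha> u t\<bar>"
          using nn by (simp add: abs_mult)
        finally have "ennreal \<bar>D \<alpha> t - u t\<bar> \<le> ennreal (coef1 \<alpha>) * ennreal \<bar>near_mean \<alpha> v t\<bar> + ennreal \<bar>coef0 \<alpha> - 1\<bar> * ?u t + ennreal (coef0 \<alpha>) * ennreal \<bar>far_mean \<alpha> u t\<bar>"
          using nn by (simp add: ennreal_mult[symmetric] ennreal_plus[symmetric] ennreal_leI del: ennreal_plus)
        also have "\<dots> \<le> (ennreal (coef1 \<alpha>) * near_avg \<alpha> v t + ennreal \<bar>coef0 \<alpha> - 1\<bar> * ?u t) + ennreal (coef0 \<alpha>) * fu \<alpha> t"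
          using \<alpha> by (intro add_mono mult_left_mono e far_mean_le order_refl) auto
        finally show ?case .
      qed
    qed
  qed
qed

lemma ennreal_abs_tendsto_0: "((\<lambda>\<alpha>. ennreal \<bar>x \<alpha>\<bar>) \<longlongrightarrow> 0) F \<Longrightarrow> (x \<longlongrightarrow> 0) F" for x :: "real \<Rightarrow> real"
  using tendsto_ennrealD[of "\<lambda>\<alpha>. \<bar>x \<alpha>\<bar>" 0 F] tendsto_rabs_zero_cancel by auto

lemma D_tendsto_left_ae: "AE t in lborel. ((\<lambda>\<alpha>. D \<alpha> t) \<longlongrightarrow> v t) (at_left 1)"
  using pointwise near_osc_tendsto_0[OF v_loc]
proof eventually_elim
  case (elim t)
  have near_mean: "((\<lambda>\<alpha>. near_mean \<alpha> v t - v t) \<longlongrightarrow> 0) (at_left 1)"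
  proof (rule ennreal_abs_tendsto_0)
    have "\<forall>\<^sub>F \<alpha> in at_left 1. ennreal \<bar>near_mean \<alpha> v t - v t\<bar> \<le> near_osc \<alpha> v t"
      using ev_left by eventually_elim (use elim in auto)
    then show "((\<lambda>\<alpha>. ennreal \<bar>near_mean \<alpha> v t - v t\<bar>) \<longlongrightarrow> 0) (at_left 1)"
      by (intro tendsto_sandwich[OF _ _ tendsto_const elim(2)]) auto
  qed
  obtain B where B: "0 \<le> B" "\<And>\<alpha>. 0 < \<alpha> \<Longrightarrow> \<alpha> \<le> 1 \<Longrightarrow> fu \<alpha> t \<le> ennreal B"
    using far_bounded[OF _ Nu, of t] by (metis measurable_compose[OF _ measurable_ennreal] borel_measurable_abs u_meas)
  have far_mean: "((\<lambda>\<alpha>. coef0 \<alpha> * (u t - far_mean \<alpha> u t)) \<longlongrightarrow> 0) (at_left 1)"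
  proof (rule tendsto_0_le[OF coef_tendsto(1), where K="\<bar>u t\<bar> + B"], use ev_left in eventually_elim)
    case (elim \<alpha>)
    have "ennreal \<bar>far_mean \<alpha> u t\<bar> \<le> ennreal B" using order_trans[OF far_mean_le B(2)] elim by auto
    then have "\<bar>far_mean \<alpha> u t\<bar> \<le> B" using B(1) by (simp add: ennreal_le_iff)
    then have "\<bar>u t - far_mean \<alpha> u t\<bar> \<le> \<bar>u t\<bar> + B" by linarith
    then show ?case by (simp add: abs_mult mult_left_mono)
  qed
  have "((\<lambda>\<alpha>. coef1 \<alpha> * ((near_mean \<alpha> v t - v t) + v t) + coef0 \<alpha> * (u t - far_mean \<alpha> u t)) \<longlongrightarrow> 1 * (0 + v t) + 0) (at_left 1)"
    by (intro tendsto_intros coef_tendsto near_mean far_mean)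
  then have "((\<lambda>\<alpha>. coef1 \<alpha> * ((near_mean \<alpha> v t - v t) + v t) + coef0 \<alpha> * (u t - far_mean \<alpha> u t)) \<longlongrightarrow> v t) (at_left 1)" by simp
  then show ?case
    by (rule Lim_transform_eventually) (use ev_left in eventually_elim, use elim in auto)
qed

lemma far_mean_tendsto_0: "((\<lambda>\<alpha>. far_mean \<alpha> u t) \<longlongrightarrow> 0) (at_right 0)"
proof (rule ennreal_abs_tendsto_0)
  have "\<forall>\<^sub>F \<alpha> in at_right 0. ennreal \<bar>far_mean \<alpha> u t\<bar> \<le> fu \<alpha> t"
    using ev_right by eventually_elim (auto intro: far_mean_le)
  then show "((\<lambda>\<alpha>. ennreal \<bar>far_mean \<alpha> u t\<bar>) \<longlongrightarrow> 0) (at_right 0)"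
    by (intro tendsto_sandwich[OF _ _ tendsto_const far_tendsto_0[OF _ Nu]]) auto
qed

lemma D_tendsto_right_ae: "AE t in lborel. ((\<lambda>\<alpha>. D \<alpha> t) \<longlongrightarrow> u t) (at_right 0)"
  using pointwise
proof eventually_elim
  case (elim t)
  then obtain B where B: "\<And>\<alpha>. 0 < \<alpha> \<Longrightarrow> \<alpha> < 1 \<Longrightarrow> \<bar>near_mean \<alpha> v t\<bar> \<le> B" by blast
  have near_mean: "((\<lambda>\<alpha>. coef1 \<alpha> * near_mean \<alpha> v t) \<longlongrightarrow> 0) (at_right 0)"
    by (rule tendsto_0_le[OF coef_tendsto(4), where K=B], use ev_right in eventually_elim)
       (use B in \<open>auto simp: abs_mult intro!: mult_left_mono\<close>)
  have "((\<lambda>\<alpha>. coef1 \<alpha> * near_mean \<alpha> v t + coef0 \<alpha> * (u t - far_mean \<alpha> u t)) \<longlongrightarrow> 0 + 1 * (u t - 0)) (at_right 0)"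
    by (intro tendsto_intros coef_tendsto near_mean far_mean_tendsto_0)
  then have "((\<lambda>\<alpha>. coef1 \<alpha> * near_mean \<alpha> v t + coef0 \<alpha> * (u t - far_mean \<alpha> u t)) \<longlongrightarrow> u t) (at_right 0)" by simp
  then show ?case
    by (rule Lim_transform_eventually) (use ev_right in eventually_elim, use elim in auto)
qed

end

section \<open>The increment formula for functions with a fractional derivative\<close>

text \<open>The increment \<open>I(x) - I(x - s)\<close> of the Riemann-Liouville kernel \<open>I(x) = x^(\<beta>-1)/\<Gamma>(\<beta>)\<close>, x > 0. For fixed s it
is integrable over the whole line, although I is not.\<close>

definition kdiff :: "real \<Rightarrow> real \<Rightarrow> real \<Rightarrow> real" where
  "kdiff \<beta> s x = rGamma \<beta> * (x powr (\<beta> - 1) * indicator {0<..} x - (x - s) powr (\<beta> - 1) * indicator {s<..} x)"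

lemma measurable_kdiff [measurable]: "kdiff \<beta> s \<in> borel_measurable borel"
  unfolding kdiff_def by measurable

lemma rGamma_pos: "0 < \<beta> \<Longrightarrow> 0 < rGamma \<beta>" for \<beta> :: real
  by (simp add: rGamma_inverse_Gamma Gamma_real_pos)

text \<open>The kernel is decreasing, so the integral of the difference over (s, 2] telescopes to at most the
integral of the kernel over (0, s].\<close>

lemma kdiff_near:
  assumes \<beta>: "0 < \<beta>" "\<beta> < 1" and s: "0 < s" "s \<le> 1"
  shows "(\<integral>\<^sup>+x\<in>{..2}. ennreal \<bar>kdiff \<beta> s x\<bar> \<partial>lborel) \<le> ennreal (rGamma \<beta> * (2 / \<beta>) * s powr \<beta>)"
proof -
  define k where "k x = ennreal (x powr (\<beta> - 1))" for x :: real
  have [measurable]: "k \<in> borel_measurable borel" unfolding k_def by measurable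
  define P where "P = (\<integral>\<^sup>+x\<in>{s<..2}. ennreal ((x - s) powr (\<beta> - 1) - x powr (\<beta> - 1)) \<partial>lborel)"
  define Q where "Q = (\<integral>\<^sup>+x\<in>{s<..2}. k x \<partial>lborel)"
  have k0: "(\<integral>\<^sup>+x\<in>{0..c}. k x \<partial>lborel) = ennreal (c powr \<beta> / \<beta>)" if "0 \<le> c" for c
    using nn_integral_powr_Icc[of "\<beta> - 1" c] that \<beta> by (simp add: k_def)
  have mono: "x powr (\<beta> - 1) \<le> (x - s) powr (\<beta> - 1)" if "s < x" for x
    using that s \<beta> by (intro powr_mono2') auto
  have "P + Q = (\<integral>\<^sup>+x. k (x - s) * indicator {s<..2} x \<partial>lborel)"
    unfolding P_def Q_def using mono
    by (subst nn_integral_add[symmetric])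
       (auto intro!: nn_integral_cong simp: k_def ennreal_plus[symmetric] simp del: ennreal_plus split: split_indicator)
  also have "\<dots> = (\<integral>\<^sup>+x. k x * indicator {s<..2} (s + x) \<partial>lborel)"
    using nn_integral_translate(2)[of "\<lambda>x. k (x - s) * indicator {s<..2} x" s] by simp
  also have "\<dots> \<le> (\<integral>\<^sup>+x. k x * indicator {0..s} x + k x * indicator {s<..2} x \<partial>lborel)"
    using s by (intro nn_integral_mono) (auto split: split_indicator)
  also have "\<dots> = ennreal (s powr \<beta> / \<beta>) + Q"
    unfolding Q_def using s by (subst nn_integral_add) (auto simp: k0)
  \<comment> \<open>Q is the integral of the kernel over (s, 2]; it cancels because it is finite.\<close>
  finally have "P + Q \<le> ennreal (s powr \<beta> / \<beta>) + Q" .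
  moreover have "Q < top"
  proof -
    have "Q \<le> (\<integral>\<^sup>+x\<in>{0..2}. k x \<partial>lborel)"
      unfolding Q_def using s by (intro nn_integral_mono) (auto split: split_indicator)
    also have "\<dots> < top" by (subst k0) auto
    finally show ?thesis .
  qed
  ultimately have P: "P \<le> ennreal (s powr \<beta> / \<beta>)"
    using ennreal_add_left_cancel_le[of Q P "ennreal (s powr \<beta> / \<beta>)"] by (auto simp: add.commute)
  have "(\<integral>\<^sup>+x\<in>{..2}. ennreal \<bar>kdiff \<beta> s x\<bar> \<partial>lborel) \<le>
    (\<integral>\<^sup>+x. ennreal (rGamma \<beta>) * (k x * indicator {0..s} x + ennreal ((x - s) powr (\<beta> - 1) - x powr (\<beta> - 1)) * indicator {s<..2} x) \<partial>lborel)"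
  proof (rule nn_integral_mono)
    fix x
    show "ennreal \<bar>kdiff \<beta> s x\<bar> * indicator {..2} x \<le>
      ennreal (rGamma \<beta>) * (k x * indicator {0..s} x + ennreal ((x - s) powr (\<beta> - 1) - x powr (\<beta> - 1)) * indicator {s<..2} x)"
    proof (cases "x \<le> 0 \<or> 2 < x")
      case True
      then show ?thesis using s by (auto simp: kdiff_def)
    next
      case False
      then show ?thesis using mono[of x] s rGamma_pos[OF \<beta>(1)]
        by (cases "s < x") (auto simp: kdiff_def k_def abs_mult ennreal_mult[symmetric] abs_minus_commute)
    qed
  qed
  also have "\<dots> = ennreal (rGamma \<beta>) * (ennreal (s powr \<beta> / \<beta>) + P)"
    unfolding P_def using s by (simp add: nn_integral_cmult nn_integral_add k0)
  also have "\<dots> \<le> ennreal (rGamma \<beta>) * (ennreal (s powr \<beta> / \<beta>) + ennreal (s powr \<beta> / \<beta>))"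
    by (intro mult_left_mono add_left_mono P) simp
  also have "\<dots> = ennreal (rGamma \<beta> * (2 / \<beta>) * s powr \<beta>)"
    using \<beta> rGamma_pos[OF \<beta>(1)] by (simp add: ennreal_mult[symmetric] ennreal_plus[symmetric] del: ennreal_plus)
  finally show ?thesis .
qed

text \<open>The mean value theorem; the decay \<open>x^(\<beta>-2)\<close> of the derivative is that of the far kernel of order
\<open>1 - \<beta>\<close>.\<close>

lemma kdiff_far:
  assumes \<beta>: "0 < \<beta>" "\<beta> < 1" and s: "0 < s" "s \<le> 1" and x: "2 < x"
  shows "ennreal \<bar>kdiff \<beta> s x\<bar> \<le> ennreal (4 * s * rGamma \<beta>) * kf (1 - \<beta>) x"
proof -
  have der: "((\<lambda>x. x powr (\<beta> - 1)) has_real_derivative (\<beta> - 1) * y powr (\<beta> - 2)) (at y)" if "0 < y" for y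
    using has_real_derivative_powr[OF that, of "\<beta> - 1"] by (simp add: diff_diff_eq)
  have "\<exists>z. x - s < z \<and> z < x \<and> x powr (\<beta> - 1) - (x - s) powr (\<beta> - 1) = (x - (x - s)) * ((\<beta> - 1) * z powr (\<beta> - 2))"
    using s x by (intro MVT2 der) auto
  then obtain z where z: "x - s < z" "z < x" "x powr (\<beta> - 1) - (x - s) powr (\<beta> - 1) = s * ((\<beta> - 1) * z powr (\<beta> - 2))"
    by auto
  have "z powr (\<beta> - 2) \<le> (x / 2) powr (\<beta> - 2)"
    using z s x \<beta> by (intro powr_mono2') auto
  also have "\<dots> = x powr (\<beta> - 2) * 2 powr (2 - \<beta>)"
    using x by (simp add: powr_divide powr_diff field_simps)
  also have "\<dots> \<le> x powr (\<beta> - 2) * 2 powr 2" using \<beta> by (intro mult_left_mono powr_mono) auto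
  finally have zx: "z powr (\<beta> - 2) \<le> 4 * x powr (\<beta> - 2)" by simp
  have "\<bar>kdiff \<beta> s x\<bar> = rGamma \<beta> * (s * ((1 - \<beta>) * z powr (\<beta> - 2)))"
    using z x s rGamma_pos[OF \<beta>(1)] \<beta> by (simp add: kdiff_def abs_mult)
  also have "\<dots> \<le> rGamma \<beta> * (s * ((1 - \<beta>) * (4 * x powr (\<beta> - 2))))"
    using zx s \<beta> rGamma_pos[OF \<beta>(1)] by (intro mult_left_mono) auto
  also have "\<dots> = (4 * s * rGamma \<beta>) * ((1 - \<beta>) * x powr (- 1 - (1 - \<beta>)))" by (simp add: mult_ac)
  finally show ?thesis
    using x s \<beta> rGamma_pos[OF \<beta>(1)] by (simp add: kf_def ennreal_mult[symmetric] ennreal_leI)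
qed

lemma kdiff_split:
  assumes "0 < \<beta>" "\<beta> < 1" "0 < s" "s \<le> 1" and [measurable]: "h \<in> borel_measurable borel"
    and near: "\<And>x. 0 < x \<Longrightarrow> x \<le> 2 \<Longrightarrow> h x \<le> M"
  shows "(\<integral>\<^sup>+x. ennreal \<bar>kdiff \<beta> s x\<bar> * h x \<partial>lborel)
    \<le> ennreal (rGamma \<beta> * (2 / \<beta>) * s powr \<beta>) * M + ennreal (4 * s * rGamma \<beta>) * (\<integral>\<^sup>+x. kf (1 - \<beta>) x * h x \<partial>lborel)"
proof -
  have "(\<integral>\<^sup>+x. ennreal \<bar>kdiff \<beta> s x\<bar> * h x \<partial>lborel)
    \<le> (\<integral>\<^sup>+x. ennreal \<bar>kdiff \<beta> s x\<bar> * indicator {..2} x * M + ennreal (4 * s * rGamma \<beta>) * (kf (1 - \<beta>) x * h x) \<partial>lborel)"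
  proof (rule nn_integral_mono)
    fix x
    show "ennreal \<bar>kdiff \<beta> s x\<bar> * h x \<le> ennreal \<bar>kdiff \<beta> s x\<bar> * indicator {..2} x * M + ennreal (4 * s * rGamma \<beta>) * (kf (1 - \<beta>) x * h x)"
    proof (cases "x \<le> 2")
      case True
      have "ennreal \<bar>kdiff \<beta> s x\<bar> * h x \<le> ennreal \<bar>kdiff \<beta> s x\<bar> * M"
        using near[of x] True assms(3) by (cases "0 < x") (auto intro!: mult_left_mono simp: kdiff_def)
      then show ?thesis using True by (simp add: add_increasing2)
    next
      case False
      then have "ennreal \<bar>kdiff \<beta> s x\<bar> * h x \<le> ennreal (4 * s * rGamma \<beta>) * kf (1 - \<beta>) x * h x"
        using assms(1-4) by (intro mult_right_mono kdiff_far) auto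
      then show ?thesis using False by (simp add: mult.assoc)
    qed
  qed
  also have "\<dots> = (\<integral>\<^sup>+x\<in>{..2}. ennreal \<bar>kdiff \<beta> s x\<bar> \<partial>lborel) * M + ennreal (4 * s * rGamma \<beta>) * (\<integral>\<^sup>+x. kf (1 - \<beta>) x * h x \<partial>lborel)"
    by (simp add: nn_integral_add nn_integral_multc nn_integral_cmult)
  also have "\<dots> \<le> ennreal (rGamma \<beta> * (2 / \<beta>) * s powr \<beta>) * M + ennreal (4 * s * rGamma \<beta>) * (\<integral>\<^sup>+x. kf (1 - \<beta>) x * h x \<partial>lborel)"
    using assms(1-4) by (intro add_right_mono mult_right_mono kdiff_near) auto
  finally show ?thesis .
qed

lemma beta_convolution:
  assumes \<beta>: "0 < \<beta>" "\<beta> < 1" and y: "0 < y"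
  shows "(\<integral>\<^sup>+x\<in>{0<..<y}. ennreal (x powr (\<beta> - 1) * (y - x) powr (- \<beta>)) \<partial>lborel) = ennreal (Gamma \<beta> * Gamma (1 - \<beta>))"
proof -
  have "(\<integral>\<^sup>+t. ennreal (indicator {0..1} t * (t powr (\<beta> - 1) * (1 - t) powr ((1 - \<beta>) - 1))) \<partial>lborel) = ennreal (Beta \<beta> (1 - \<beta>))"
    using \<beta> by (intro nn_integral_has_integral_lebesgue has_integral_Beta_real) auto
  also have "Beta \<beta> (1 - \<beta>) = Gamma \<beta> * Gamma (1 - \<beta>)" by (simp add: Beta_def)
  also have "(\<integral>\<^sup>+t. ennreal (indicator {0..1} t * (t powr (\<beta> - 1) * (1 - t) powr ((1 - \<beta>) - 1))) \<partial>lborel)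
    = (\<integral>\<^sup>+t. ennreal y * (ennreal ((0 + y * t) powr (\<beta> - 1) * (y - (0 + y * t)) powr (- \<beta>)) * indicator {0<..<y} (0 + y * t)) \<partial>lborel)"
  proof (rule nn_integral_cong)
    fix t :: real
    show "ennreal (indicator {0..1} t * (t powr (\<beta> - 1) * (1 - t) powr ((1 - \<beta>) - 1)))
      = ennreal y * (ennreal ((0 + y * t) powr (\<beta> - 1) * (y - (0 + y * t)) powr (- \<beta>)) * indicator {0<..<y} (0 + y * t))"
    proof (cases "0 < t \<and> t < 1")
      case True
      have yt: "y - y * t = y * (1 - t)" by (simp add: algebra_simps)
      have "y * ((y * t) powr (\<beta> - 1) * (y - y * t) powr (- \<beta>)) = (y * (y powr (\<beta> - 1) * y powr (- \<beta>))) * (t powr (\<beta> - 1) * (1 - t) powr (- \<beta>))"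
        unfolding yt by (simp add: powr_mult mult_ac)
      also have "y * (y powr (\<beta> - 1) * y powr (- \<beta>)) = 1"
      proof -
        have "y powr (\<beta> - 1) * y powr (- \<beta>) = y powr (-1)" by (simp add: powr_add[symmetric])
        then show ?thesis using y by (simp add: powr_minus)
      qed
      finally show ?thesis using True y by (auto simp: ennreal_mult[symmetric] mult_less_cancel_left)
    next
      case False
      then have "t \<notin> {0..1} \<or> t = 0 \<or> t = 1" by auto
      moreover have "\<not> (0 < y * t \<and> y * t < y)" using False y by (auto simp: zero_less_mult_iff)
      ultimately show ?thesis by (auto simp: indicator_def)
    qed
  qed
  also have "\<dots> = ennreal \<bar>y\<bar> * (\<integral>\<^sup>+t. ennreal ((0 + y * t) powr (\<beta> - 1) * (y - (0 + y * t)) powr (- \<beta>)) * indicator {0<..<y} (0 + y * t) \<partial>lborel)"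
    using y by (subst nn_integral_cmult) auto
  also have "\<dots> = (\<integral>\<^sup>+x\<in>{0<..<y}. ennreal (x powr (\<beta> - 1) * (y - x) powr (- \<beta>)) \<partial>lborel)"
    using y by (intro nn_integral_real_affine[symmetric]) auto
  finally show ?thesis by simp
qed

text \<open>The convolution of \<open>x^(\<beta>-1)\<close> and \<open>x^(-\<beta>)\<close> is constant (a Beta integral), so an increment of the first
kernel becomes the indicator of an interval.\<close>

lemma kdiff_convolution:
  assumes \<beta>: "0 < \<beta>" "\<beta> < 1" and s: "0 < s"
  shows "(LINT x|lborel. kdiff \<beta> s x * ((y - x) powr (- \<beta>) * indicator {..<y} x)) = Gamma (1 - \<beta>) * indicator {0<..s} y"
proof -
  define f where "f c x = (x - c) powr (\<beta> - 1) * (y - x) powr (- \<beta>) * indicator {c<..<y} x" for c x :: real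
  have [measurable]: "f c \<in> borel_measurable borel" for c unfolding f_def by measurable
  have f: "integrable lborel (f c) \<and> (LINT x|lborel. f c x) = Gamma \<beta> * Gamma (1 - \<beta>) * indicator {c<..} y" for c
  proof (cases "c < y")
    case True
    have "(\<integral>\<^sup>+x. ennreal (f c x) \<partial>lborel) = (\<integral>\<^sup>+x. ennreal (f c (c + x)) \<partial>lborel)"
      by (rule nn_integral_translate(2)[symmetric]) measurable
    also have "\<dots> = (\<integral>\<^sup>+x\<in>{0<..<y - c}. ennreal (x powr (\<beta> - 1) * ((y - c) - x) powr (- \<beta>)) \<partial>lborel)"
      by (intro nn_integral_cong) (auto simp: f_def algebra_simps split: split_indicator)
    also have "\<dots> = ennreal (Gamma \<beta> * Gamma (1 - \<beta>))" using beta_convolution[OF \<beta>, of "y - c"] True by simp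
    finally have e: "(\<integral>\<^sup>+x. ennreal (f c x) \<partial>lborel) = ennreal (Gamma \<beta> * Gamma (1 - \<beta>))" .
    have nn: "0 \<le> f c x" for x by (simp add: f_def)
    have "integrable lborel (f c)" using e nn by (intro integrableI_nonneg) auto
    moreover have "(LINT x|lborel. f c x) = Gamma \<beta> * Gamma (1 - \<beta>)"
      using e nn \<beta> Gamma_real_pos[of \<beta>] Gamma_real_pos[of "1 - \<beta>"] by (subst integral_eq_nn_integral) auto
    ultimately show ?thesis using True by simp
  next
    case False
    then have "f c = (\<lambda>x. 0)" by (auto simp: f_def)
    then show ?thesis using False by simp
  qed
  have "(LINT x|lborel. kdiff \<beta> s x * ((y - x) powr (- \<beta>) * indicator {..<y} x)) = (LINT x|lborel. rGamma \<beta> * (f 0 x - f s x))"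
    by (intro Bochner_Integration.integral_cong refl) (auto simp: kdiff_def f_def algebra_simps split: split_indicator)
  also have "\<dots> = rGamma \<beta> * (Gamma \<beta> * Gamma (1 - \<beta>) * indicator {0<..} y - Gamma \<beta> * Gamma (1 - \<beta>) * indicator {s<..} y)"
    using f[of 0] f[of s] by simp
  also have "\<dots> = (rGamma \<beta> * Gamma \<beta>) * (Gamma (1 - \<beta>) * (indicator {0<..} y - indicator {s<..} y))"
    by (simp add: algebra_simps)
  also have "rGamma \<beta> * Gamma \<beta> = 1" using Gamma_real_pos[OF \<beta>(1)] by (simp add: rGamma_inverse_Gamma)
  finally show ?thesis using s by (auto split: split_indicator)
qed

lemma test_deriv_measurable [measurable_dest]: "test \<phi> \<Longrightarrow> deriv \<phi> \<in> borel_measurable borel"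
  by (rule test_measurable)

lemma test_deriv_kernel_bound:
  assumes \<psi>: "test \<psi>" and \<beta>: "0 < \<beta>" "\<beta> < 1"
  obtains Z where "0 \<le> Z" "\<And>y. (\<integral>\<^sup>+r\<in>{0<..}. ennreal (r powr (- \<beta>) * \<bar>deriv \<psi> (y + r)\<bar>) \<partial>lborel) \<le> ennreal Z"
proof -
  have [measurable]: "deriv \<psi> \<in> borel_measurable borel" using test_measurable[OF \<psi>] by simp
  obtain A B where AB: "0 < A" "0 \<le> B" "\<And>t. \<bar>deriv \<psi> t\<bar> \<le> B * indicator {-A..A} t"
    using test_bounded[OF \<psi>, of 1] by (metis comp_apply funpow_0 funpow_Suc_right One_nat_def funpow_simps_right(2))
  have B: "\<bar>deriv \<psi> t\<bar> \<le> B" for t using AB(3)[of t] AB(2) by (auto split: split_indicator_asm)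
  have "(\<integral>\<^sup>+r\<in>{0<..}. ennreal (r powr (- \<beta>) * \<bar>deriv \<psi> (y + r)\<bar>) \<partial>lborel) \<le> ennreal (B / (1 - \<beta>) + B * (2 * A))" for y
  proof -
    have "(\<integral>\<^sup>+r\<in>{0<..}. ennreal (r powr (- \<beta>) * \<bar>deriv \<psi> (y + r)\<bar>) \<partial>lborel)
      \<le> (\<integral>\<^sup>+r. ennreal B * (ennreal (r powr (- \<beta>)) * indicator {0..1} r) + ennreal B * indicator {-A..A} (y + r) \<partial>lborel)"
    proof (rule nn_integral_mono)
      fix r
      show "ennreal (r powr (- \<beta>) * \<bar>deriv \<psi> (y + r)\<bar>) * indicator {0<..} r
        \<le> ennreal B * (ennreal (r powr (- \<beta>)) * indicator {0..1} r) + ennreal B * indicator {-A..A} (y + r)"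
      proof (cases "0 < r")
        case True
        show ?thesis
        proof (cases "r \<le> 1")
          case r1: True
          have "ennreal (r powr (- \<beta>) * \<bar>deriv \<psi> (y + r)\<bar>) \<le> ennreal B * ennreal (r powr (- \<beta>))"
            using B[of "y + r"] AB(2) by (subst ennreal_mult[symmetric]) (auto intro!: ennreal_leI simp: mult.commute[of B] mult_left_mono)
          then show ?thesis using True r1 by (simp add: add_increasing2)
        next
          case False
          have "r powr (- \<beta>) \<le> 1" using False \<beta> powr_mono[of "-\<beta>" 0 r] by simp
          then have "r powr (- \<beta>) * \<bar>deriv \<psi> (y + r)\<bar> \<le> 1 * (B * indicator {-A..A} (y + r))"
            by (intro mult_mono AB) auto
          then have "ennreal (r powr (- \<beta>) * \<bar>deriv \<psi> (y + r)\<bar>) \<le> ennreal (B * indicator {-A..A} (y + r))"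
            by (intro ennreal_leI) simp
          also have "\<dots> = ennreal B * indicator {-A..A} (y + r)" by (simp split: split_indicator)
          finally have "ennreal (r powr (- \<beta>) * \<bar>deriv \<psi> (y + r)\<bar>) \<le> ennreal B * indicator {-A..A} (y + r)" .
          then show ?thesis using False by simp
        qed
      qed simp
    qed
    also have "\<dots> = ennreal B * ennreal (1 / (1 - \<beta>)) + ennreal B * ennreal (2 * A)"
      using nn_integral_powr_Icc[of "-\<beta>" 1] \<beta> AB nn_integral_translate(2)[of "indicator {-A..A}" y]
      by (simp add: nn_integral_add nn_integral_cmult)
    also have "\<dots> = ennreal (B / (1 - \<beta>) + B * (2 * A))"
      using AB \<beta> by (simp add: ennreal_mult[symmetric] ennreal_plus[symmetric] del: ennreal_plus)
    finally show ?thesis .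
  qed
  moreover have "0 \<le> B / (1 - \<beta>) + B * (2 * A)" using AB \<beta> by auto
  ultimately show thesis using that by blast
qed

text \<open>Integration by parts, in the form of Fubini's theorem for \<open>\<psi>(y + s) - \<psi>(y) = \<integral>\<psi>'(y + r) dr\<close>.\<close>

lemma Dright_by_parts:
  assumes \<psi>: "test \<psi>" and \<beta>: "0 < \<beta>" "\<beta> < 1"
  shows "Dright \<beta> \<psi> y = - rGamma (1 - \<beta>) * (LINT r|lborel. r powr (- \<beta>) * indicator {0<..} r * deriv \<psi> (y + r))"
proof -
  have sm: "smooth \<psi>" using \<psi> by (simp add: test_def)
  have [measurable]: "\<psi> \<in> borel_measurable borel" "deriv \<psi> \<in> borel_measurable borel" using test_measurable[OF \<psi>] by auto
  define k where "k s = \<beta> * s powr (- 1 - \<beta>)" for s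
  have [measurable]: "k \<in> borel_measurable borel" unfolding k_def by measurable
  have k_nn: "0 \<le> k s" for s using \<beta> by (simp add: k_def)
  define f where "f s r = k s * indicator {0<..} s * indicator {0..s} r * deriv \<psi> (y + r)" for s r
  have ftc: "(LINT r|lborel. deriv \<psi> (y + r) * indicator {0..s} r) = \<psi> (y + s) - \<psi> (y + 0)" if "0 < s" for s
  proof (rule integral_FTC_Icc_real)
    fix r
    have a: "((\<lambda>r. y + r) has_real_derivative 1) (at r)" by (auto intro!: derivative_eq_intros)
    from DERIV_chain'[OF a smooth_DERIV0[OF sm]] show "((\<lambda>r. \<psi> (y + r)) has_real_derivative deriv \<psi> (y + r)) (at r)" by simp
    from DERIV_chain'[OF a smooth_DERIV0[OF smooth_deriv[OF sm]]] show "isCont (\<lambda>r. deriv \<psi> (y + r)) r" by (rule DERIV_isCont)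
  qed (use that in auto)
  have inner: "(LINT r|lborel. f s r) = - (indicator {0<..} s *\<^sub>R (\<beta> * s powr (- 1 - \<beta>) * (\<psi> y - \<psi> (y + s))))" for s
  proof (cases "0 < s")
    case True
    have "(LINT r|lborel. f s r) = (LINT r|lborel. k s * (deriv \<psi> (y + r) * indicator {0..s} r))"
      using True by (intro Bochner_Integration.integral_cong refl) (simp add: f_def)
    also have "\<dots> = k s * (\<psi> (y + s) - \<psi> (y + 0))" by (simp only: integral_mult_right_zero ftc[OF True])
    finally show ?thesis using True by (simp add: k_def algebra_simps)
  qed (simp add: f_def)
  have nn_k: "(\<integral>\<^sup>+s. ennreal (k s) * indicator {r..} s \<partial>lborel) = ennreal (r powr (- \<beta>))" if "0 < r" for r
    using nn_integral_powr_atLeast[OF \<beta>(1) that] by (simp add: k_def minus_diff_commute)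
  have inner2: "(LINT s|lborel. f s r) = r powr (- \<beta>) * indicator {0<..} r * deriv \<psi> (y + r)" if "r \<noteq> 0" for r
  proof (cases "0 < r")
    case True
    have "(LINT s|lborel. f s r) = (LINT s|lborel. deriv \<psi> (y + r) * (k s * indicator {r..} s))"
      using True by (intro Bochner_Integration.integral_cong refl) (auto simp: f_def split: split_indicator)
    also have "\<dots> = deriv \<psi> (y + r) * (LINT s|lborel. k s * indicator {r..} s)" by (rule integral_mult_right_zero)
    also have "(LINT s|lborel. k s * indicator {r..} s) = enn2real (\<integral>\<^sup>+s. ennreal (k s * indicator {r..} s) \<partial>lborel)"
      using k_nn by (intro integral_eq_nn_integral) auto
    also have "\<dots> = r powr (- \<beta>)" using nn_k[OF True] k_nn by (simp add: ennreal_mult ennreal_indicator)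
    finally show ?thesis using True by simp
  next
    case False
    then have "f s r = 0" for s using that by (auto simp: f_def split: split_indicator)
    then show ?thesis using False by simp
  qed
  have "(LINT s|lborel. LINT r|lborel. f s r) = (LINT r|lborel. LINT s|lborel. f s r)"
  proof (rule Fubini_real(1))
    obtain Z where Z: "(\<integral>\<^sup>+r\<in>{0<..}. ennreal (r powr (- \<beta>) * \<bar>deriv \<psi> (y + r)\<bar>) \<partial>lborel) \<le> ennreal Z"
      using test_deriv_kernel_bound[OF \<psi> \<beta>] by metis
    have "(\<integral>\<^sup>+s. \<integral>\<^sup>+r. ennreal \<bar>f s r\<bar> \<partial>lborel \<partial>lborel) = (\<integral>\<^sup>+r. \<integral>\<^sup>+s. ennreal \<bar>f s r\<bar> \<partial>lborel \<partial>lborel)"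
      unfolding f_def by (rule lborel_pair.Fubini') measurable
    also have "\<dots> = (\<integral>\<^sup>+r\<in>{0<..}. ennreal (r powr (- \<beta>) * \<bar>deriv \<psi> (y + r)\<bar>) \<partial>lborel)"
    proof (rule nn_integral_cong_AE, rule eventually_mono[OF AE_lborel_singleton[of 0]])
      fix r :: real assume "r \<noteq> 0"
      show "(\<integral>\<^sup>+s. ennreal \<bar>f s r\<bar> \<partial>lborel) = ennreal (r powr (- \<beta>) * \<bar>deriv \<psi> (y + r)\<bar>) * indicator {0<..} r"
      proof (cases "0 < r")
        case True
        have "(\<integral>\<^sup>+s. ennreal \<bar>f s r\<bar> \<partial>lborel) = (\<integral>\<^sup>+s. ennreal \<bar>deriv \<psi> (y + r)\<bar> * (ennreal (k s) * indicator {r..} s) \<partial>lborel)"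
          using True k_nn by (intro nn_integral_cong) (auto simp: f_def abs_mult ennreal_mult mult.commute split: split_indicator)
        also have "\<dots> = ennreal \<bar>deriv \<psi> (y + r)\<bar> * ennreal (r powr (- \<beta>))"
          by (subst nn_integral_cmult) (auto simp: nn_k[OF True])
        finally show ?thesis using True by (simp add: ennreal_mult mult.commute)
      next
        case False
        then have "f s r = 0" for s using \<open>r \<noteq> 0\<close> by (auto simp: f_def split: split_indicator)
        then show ?thesis using False by simp
      qed
    qed
    finally show "(\<integral>\<^sup>+s. \<integral>\<^sup>+r. ennreal \<bar>f s r\<bar> \<partial>lborel \<partial>lborel) < top" using Z by (auto intro: le_less_trans)
    show "(\<lambda>(s, r). f s r) \<in> borel_measurable (borel \<Otimes>\<^sub>M borel)" unfolding f_def by measurable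
  qed
  also have "\<dots> = (LINT r|lborel. r powr (- \<beta>) * indicator {0<..} r * deriv \<psi> (y + r))"
  proof (rule integral_cong_AE)
    show "AE r in lborel. (LINT s|lborel. f s r) = r powr (- \<beta>) * indicator {0<..} r * deriv \<psi> (y + r)"
      by (rule eventually_mono[OF AE_lborel_singleton[of 0]]) (rule inner2)
    show "(\<lambda>r. LINT s|lborel. f s r) \<in> borel_measurable lborel" unfolding f_def by measurable
  qed measurable
  finally have "- (LINT s:{0<..}|lborel. \<beta> * s powr (- 1 - \<beta>) * (\<psi> y - \<psi> (y + s))) = (LINT r|lborel. r powr (- \<beta>) * indicator {0<..} r * deriv \<psi> (y + r))"
    unfolding inner set_lebesgue_integral_def by simp
  then have "(LINT s:{0<..}|lborel. \<beta> * s powr (- 1 - \<beta>) * (\<psi> y - \<psi> (y + s))) = - (LINT r|lborel. r powr (- \<beta>) * indicator {0<..} r * deriv \<psi> (y + r))"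
    by simp
  then show ?thesis by (simp add: Dright_eq)
qed

lemma kdiff_integrable_nn:
  assumes "0 < \<beta>" "\<beta> < 1" "0 < s" "s \<le> 1"
  shows "(\<integral>\<^sup>+x. ennreal \<bar>kdiff \<beta> s x\<bar> \<partial>lborel) < top"
proof -
  have "(\<integral>\<^sup>+x. ennreal \<bar>kdiff \<beta> s x\<bar> * 1 \<partial>lborel) \<le> ennreal (rGamma \<beta> * (2 / \<beta>) * s powr \<beta>) * 1 + ennreal (4 * s * rGamma \<beta>) * (\<integral>\<^sup>+x. kf (1 - \<beta>) x * 1 \<partial>lborel)"
    using assms by (intro kdiff_split) auto
  also have "\<dots> < top" using assms by (simp add: nn_integral_kf ennreal_mult_less_top ennreal_add_less_top)
  finally show ?thesis by simp
qed

text \<open>Fractional integration undoes fractional differentiation: the convolution of the two kernels is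
the indicator of (0, s], against which \<open>\<psi>'\<close> integrates to an increment of \<open>\<psi>\<close>.\<close>

lemma kdiff_Dright:
  assumes \<psi>: "test \<psi>" and \<beta>: "0 < \<beta>" "\<beta> < 1" and s: "0 < s" "s \<le> 1"
  shows "(LINT x|lborel. kdiff \<beta> s x * Dright \<beta> \<psi> (t + x)) = \<psi> t - \<psi> (t + s)"
proof -
  have sm: "smooth \<psi>" using \<psi> by (simp add: test_def)
  have [measurable]: "\<psi> \<in> borel_measurable borel" "deriv \<psi> \<in> borel_measurable borel" using test_measurable[OF \<psi>] by auto
  define f where "f x y = kdiff \<beta> s x * ((y - x) powr (- \<beta>) * indicator {..<y} x) * deriv \<psi> (t + y)" for x y
  have 1: "kdiff \<beta> s x * Dright \<beta> \<psi> (t + x) = - rGamma (1 - \<beta>) * (LINT y|lborel. f x y)" for x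
  proof -
    have "(LINT r|lborel. r powr (- \<beta>) * indicator {0<..} r * deriv \<psi> (t + x + r)) = (LINT y|lborel. (y - x) powr (- \<beta>) * indicator {..<y} x * deriv \<psi> (t + y))"
      using lborel_integral_shift(1)[of "\<lambda>y. (y - x) powr (- \<beta>) * indicator {..<y} x * deriv \<psi> (t + y)" x]
      by (simp add: add_ac indicator_def)
    then have "Dright \<beta> \<psi> (t + x) = - rGamma (1 - \<beta>) * (LINT y|lborel. (y - x) powr (- \<beta>) * indicator {..<y} x * deriv \<psi> (t + y))"
      unfolding Dright_by_parts[OF \<psi> \<beta>] by simp
    moreover have "(LINT y|lborel. f x y) = kdiff \<beta> s x * (LINT y|lborel. (y - x) powr (- \<beta>) * indicator {..<y} x * deriv \<psi> (t + y))"
      unfolding f_def by (subst integral_mult_right_zero[symmetric]) (simp add: mult_ac)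
    ultimately show ?thesis by simp
  qed
  have "(LINT x|lborel. LINT y|lborel. f x y) = (LINT y|lborel. LINT x|lborel. f x y)"
  proof (rule Fubini_real(1))
    obtain Z where Z: "\<And>y. (\<integral>\<^sup>+r\<in>{0<..}. ennreal (r powr (- \<beta>) * \<bar>deriv \<psi> (y + r)\<bar>) \<partial>lborel) \<le> ennreal Z"
      using test_deriv_kernel_bound[OF \<psi> \<beta>] by metis
    have "(\<integral>\<^sup>+x. \<integral>\<^sup>+y. ennreal \<bar>f x y\<bar> \<partial>lborel \<partial>lborel) \<le> (\<integral>\<^sup>+x. ennreal \<bar>kdiff \<beta> s x\<bar> * ennreal Z \<partial>lborel)"
    proof (rule nn_integral_mono)
      fix x
      have "(\<integral>\<^sup>+y. ennreal \<bar>f x y\<bar> \<partial>lborel) = (\<integral>\<^sup>+y. ennreal \<bar>f x (x + y)\<bar> \<partial>lborel)"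
        unfolding f_def by (rule nn_integral_translate(2)[symmetric]) measurable
      also have "\<dots> = (\<integral>\<^sup>+r. ennreal \<bar>kdiff \<beta> s x\<bar> * (ennreal (r powr (- \<beta>) * \<bar>deriv \<psi> (t + x + r)\<bar>) * indicator {0<..} r) \<partial>lborel)"
        by (intro nn_integral_cong) (auto simp: f_def abs_mult ennreal_mult add_ac mult_ac split: split_indicator)
      also have "\<dots> = ennreal \<bar>kdiff \<beta> s x\<bar> * (\<integral>\<^sup>+r\<in>{0<..}. ennreal (r powr (- \<beta>) * \<bar>deriv \<psi> (t + x + r)\<bar>) \<partial>lborel)"
        by (rule nn_integral_cmult) measurable
      also have "\<dots> \<le> ennreal \<bar>kdiff \<beta> s x\<bar> * ennreal Z" by (intro mult_left_mono Z) simp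
      finally show "(\<integral>\<^sup>+y. ennreal \<bar>f x y\<bar> \<partial>lborel) \<le> ennreal \<bar>kdiff \<beta> s x\<bar> * ennreal Z" .
    qed
    also have "\<dots> < top" using kdiff_integrable_nn[OF \<beta> s] by (simp add: nn_integral_multc ennreal_mult_less_top)
    finally show "(\<integral>\<^sup>+x. \<integral>\<^sup>+y. ennreal \<bar>f x y\<bar> \<partial>lborel \<partial>lborel) < top" .
    show "(\<lambda>(x, y). f x y) \<in> borel_measurable (borel \<Otimes>\<^sub>M borel)" unfolding f_def by measurable
  qed
  also have "\<dots> = (LINT y|lborel. Gamma (1 - \<beta>) * (deriv \<psi> (t + y) * indicator {0<..s} y))"
  proof (rule Bochner_Integration.integral_cong[OF refl])
    fix y
    have "(LINT x|lborel. f x y) = (LINT x|lborel. kdiff \<beta> s x * ((y - x) powr (- \<beta>) * indicator {..<y} x)) * deriv \<psi> (t + y)"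
      unfolding f_def by (rule integral_mult_left_zero)
    then show "(LINT x|lborel. f x y) = Gamma (1 - \<beta>) * (deriv \<psi> (t + y) * indicator {0<..s} y)"
      unfolding kdiff_convolution[OF \<beta> s(1)] by simp
  qed
  also have "\<dots> = Gamma (1 - \<beta>) * (LINT y|lborel. deriv \<psi> (t + y) * indicator {0<..s} y)" by (rule integral_mult_right_zero)
  also have "(LINT y|lborel. deriv \<psi> (t + y) * indicator {0<..s} y) = (LINT y|lborel. deriv \<psi> (t + y) * indicator {0..s} y)"
    by (intro integral_cong_AE, measurable, rule eventually_mono[OF AE_lborel_singleton[of 0]]) (auto split: split_indicator)
  also have "\<dots> = \<psi> (t + s) - \<psi> (t + 0)"
  proof (rule integral_FTC_Icc_real)
    fix r
    have a: "((\<lambda>r. t + r) has_real_derivative 1) (at r)" by (auto intro!: derivative_eq_intros)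
    from DERIV_chain'[OF a smooth_DERIV0[OF sm]] show "((\<lambda>r. \<psi> (t + r)) has_real_derivative deriv \<psi> (t + r)) (at r)" by simp
    from DERIV_chain'[OF a smooth_DERIV0[OF smooth_deriv[OF sm]]] show "isCont (\<lambda>r. deriv \<psi> (t + r)) r" by (rule DERIV_isCont)
  qed (use s in auto)
  finally have "(LINT x|lborel. LINT y|lborel. f x y) = Gamma (1 - \<beta>) * (\<psi> (t + s) - \<psi> t)" by simp
  moreover have "rGamma (1 - \<beta>) * Gamma (1 - \<beta>) = 1"
  proof -
    have "Gamma (1 - \<beta>) \<noteq> 0" using Gamma_real_pos[of "1 - \<beta>"] \<beta> by linarith
    then show ?thesis by (simp add: rGamma_inverse_Gamma)
  qed
  ultimately show ?thesis unfolding 1 by (simp add: mult.assoc[symmetric])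
qed

text \<open>A common majorant for the right fractional derivatives of a test function, for all orders from
\<open>\<beta>\<close> up to 1: the decay of the test function itself, plus the tail of the hypersingular integral.\<close>

definition envelope :: "real \<Rightarrow> real \<Rightarrow> real \<Rightarrow> ennreal" where
  "envelope \<beta> A t = ennreal (decay A t) + (\<integral>\<^sup>+s. kf \<beta> s * ennreal (decay A (t + s)) \<partial>lborel)"

lemma measurable_envelope [measurable]: "envelope \<beta> A \<in> borel_measurable borel"
  unfolding envelope_def by measurable

lemma envelope_shift:
  assumes "0 \<le> x" "x \<le> 2"
  shows "envelope \<beta> A (t + x) \<le> 10 * envelope \<beta> A t"
proof -
  have d: "ennreal (decay A (r + x)) \<le> 10 * ennreal (decay A r)" for r
  proof -
    have "x\<^sup>2 \<le> 2\<^sup>2" using assms by (intro power_mono) auto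
    then have "(2 + 2 * x\<^sup>2) * decay A r \<le> 10 * decay A r"
      using decay_nonneg[of A r] by (intro mult_right_mono) auto
    then have "decay A (r + x) \<le> 10 * decay A r" using decay_shift[OF assms(1), of A r] by linarith
    then have "ennreal (decay A (r + x)) \<le> ennreal (10 * decay A r)" by (rule ennreal_leI)
    then show ?thesis by (simp add: ennreal_mult decay_nonneg)
  qed
  have "(\<integral>\<^sup>+s. kf \<beta> s * ennreal (decay A (t + x + s)) \<partial>lborel) \<le> (\<integral>\<^sup>+s. 10 * (kf \<beta> s * ennreal (decay A (t + s))) \<partial>lborel)"
  proof (rule nn_integral_mono)
    fix s
    show "kf \<beta> s * ennreal (decay A (t + x + s)) \<le> 10 * (kf \<beta> s * ennreal (decay A (t + s)))"
      using mult_left_mono[OF d[of "t + s"], of "kf \<beta> s"] by (simp add: add_ac mult_ac)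
  qed
  also have "\<dots> = 10 * (\<integral>\<^sup>+s. kf \<beta> s * ennreal (decay A (t + s)) \<partial>lborel)" by (rule nn_integral_cmult) measurable
  finally show ?thesis unfolding envelope_def distrib_left by (intro add_mono d)
qed

text \<open>The near part carries the factor \<open>\<alpha>/(1 - \<alpha>)\<close>, which the coefficient \<open>1/\<Gamma>(1 - \<alpha>)\<close> absorbs; so the bound
is uniform up to order 1.\<close>

lemma Dright_le_envelope:
  assumes \<phi>: "\<phi> \<in> S_minus" and \<alpha>0: "0 < \<alpha>0"
  obtains A c where "0 \<le> c" "\<And>\<alpha> t. \<alpha>0 \<le> \<alpha> \<Longrightarrow> \<alpha> < 1 \<Longrightarrow> ennreal \<bar>Dright \<alpha> \<phi> t\<bar> \<le> ennreal c * envelope \<alpha>0 A t"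
    "\<And>t. ennreal \<bar>\<phi> t\<bar> \<le> ennreal c * envelope \<alpha>0 A t"
proof -
  have [measurable]: "\<phi> \<in> borel_measurable borel" using S_minus_measurable[OF \<phi>] .
  obtain A B where B: "0 \<le> B" "\<And>t. \<bar>\<phi> t\<bar> \<le> B * decay A t" "\<And>t s. 0 < s \<Longrightarrow> s \<le> 1 \<Longrightarrow> \<bar>\<phi> t - \<phi> (t + s)\<bar> \<le> s * (B * decay A t)"
    using S_minus_decay[OF \<phi>] by metis
  obtain G where G: "0 < G" "\<And>\<alpha>. 0 < \<alpha> \<Longrightarrow> \<alpha> < 1 \<Longrightarrow> coef0 \<alpha> \<le> G" "\<And>\<alpha>. 0 < \<alpha> \<Longrightarrow> \<alpha> < 1 \<Longrightarrow> coef1 \<alpha> \<le> G"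
    using coef_bounded by metis
  define c where "c = B + G * (2 * B + B / \<alpha>0)"
  have c: "0 \<le> c" using B G \<alpha>0 by (simp add: c_def)
  have dB: "ennreal \<bar>\<phi> t\<bar> \<le> ennreal B * ennreal (decay A t)" for t
    using B by (simp add: ennreal_mult[symmetric] decay_nonneg ennreal_leI)
  have main: "ennreal \<bar>Dright \<alpha> \<phi> t\<bar> \<le> ennreal c * envelope \<alpha>0 A t" if \<alpha>: "\<alpha>0 \<le> \<alpha>" "\<alpha> < 1" for \<alpha> t
  proof -
    have \<alpha>': "0 < \<alpha>" using \<alpha> \<alpha>0 by simp
    define \<kappa> where "\<kappa> = \<alpha> / (1 - \<alpha>)"
    have \<kappa>: "0 \<le> \<kappa>" using \<alpha> \<alpha>' by (simp add: \<kappa>_def)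
    \<comment> \<open>The cancellation that keeps the bound uniform as \<open>\<alpha>\<close> tends to 1.\<close>
    have a01: "coef0 \<alpha> * \<kappa> = coef1 \<alpha>"
      using rGamma_plus1[of "1 - \<alpha>", symmetric] \<alpha> by (simp add: coef1_def coef0_def \<kappa>_def)
    have near: "(\<integral>\<^sup>+s\<in>{0<..1}. ennreal (hker \<alpha> s * \<bar>\<phi> t - \<phi> (t + s)\<bar>) \<partial>lborel) \<le> ennreal (\<kappa> * B) * ennreal (decay A t)"
      using nn_integral_hker_near_le[of \<alpha> "B * decay A t" "\<lambda>s. \<phi> t - \<phi> (t + s)"] B \<alpha> \<alpha>' \<kappa> decay_nonneg[of A t]
      by (simp add: \<kappa>_def ennreal_mult[symmetric] mult.assoc)
    have tail: "(\<integral>\<^sup>+s. kf \<alpha> s * ennreal \<bar>\<phi> (t + s)\<bar> \<partial>lborel) \<le> ennreal (B / \<alpha>0) * (\<integral>\<^sup>+s. kf \<alpha>0 s * ennreal (decay A (t + s)) \<partial>lborel)"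
    proof -
      have "(\<integral>\<^sup>+s. kf \<alpha> s * ennreal \<bar>\<phi> (t + s)\<bar> \<partial>lborel) \<le> (\<integral>\<^sup>+s. ennreal (B / \<alpha>0) * (kf \<alpha>0 s * ennreal (decay A (t + s))) \<partial>lborel)"
      proof (rule nn_integral_mono)
        fix s
        show "kf \<alpha> s * ennreal \<bar>\<phi> (t + s)\<bar> \<le> ennreal (B / \<alpha>0) * (kf \<alpha>0 s * ennreal (decay A (t + s)))"
        proof (cases "1 < s")
          case True
          have "hker \<alpha> s \<le> 1 * s powr (- 1 - \<alpha>0)"
            using \<alpha> \<alpha>' True by (intro mult_mono powr_mono) auto
          also have "\<dots> = 1 / \<alpha>0 * (\<alpha>0 * s powr (- 1 - \<alpha>0))" using \<alpha>0 by simp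
          finally have "hker \<alpha> s * \<bar>\<phi> (t + s)\<bar> \<le> 1 / \<alpha>0 * (\<alpha>0 * s powr (- 1 - \<alpha>0)) * (B * decay A (t + s))"
            using \<alpha>0 B by (intro mult_mono[of "hker \<alpha> s"]) auto
          also have "\<dots> = B / \<alpha>0 * ((\<alpha>0 * s powr (- 1 - \<alpha>0)) * decay A (t + s))" by simp
          finally have "ennreal (hker \<alpha> s * \<bar>\<phi> (t + s)\<bar>) \<le> ennreal (B / \<alpha>0 * ((\<alpha>0 * s powr (- 1 - \<alpha>0)) * decay A (t + s)))"
            by (rule ennreal_leI)
          moreover have "ennreal (B / \<alpha>0 * ((\<alpha>0 * s powr (- 1 - \<alpha>0)) * decay A (t + s))) = ennreal (B / \<alpha>0) * (ennreal (\<alpha>0 * s powr (- 1 - \<alpha>0)) * ennreal (decay A (t + s)))"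
            using \<alpha>0 B decay_nonneg[of A "t + s"] by (subst ennreal_mult, simp, simp, subst ennreal_mult) auto
          moreover have "ennreal (hker \<alpha> s * \<bar>\<phi> (t + s)\<bar>) = ennreal (hker \<alpha> s) * ennreal \<bar>\<phi> (t + s)\<bar>"
            using \<alpha>' by (subst ennreal_mult) auto
          ultimately show ?thesis using True by (simp add: kf_def)
        qed (simp add: kf_def)
      qed
      also have "\<dots> = ennreal (B / \<alpha>0) * (\<integral>\<^sup>+s. kf \<alpha>0 s * ennreal (decay A (t + s)) \<partial>lborel)" by (rule nn_integral_cmult) measurable
      finally show ?thesis .
    qed
    let ?w = "\<lambda>s. \<phi> t - \<phi> (t + s)"
    have "ennreal \<bar>LINT s:{0<..}|lborel. hker \<alpha> s * ?w s\<bar> \<le> (\<integral>\<^sup>+s. ennreal \<bar>indicat_real {0<..} s *\<^sub>R (hker \<alpha> s * ?w s)\<bar> \<partial>lborel)"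
      unfolding set_lebesgue_integral_def by (rule ennreal_abs_integral_le)
    also have "\<dots> = (\<integral>\<^sup>+s\<in>{0<..}. ennreal (hker \<alpha> s * \<bar>?w s\<bar>) \<partial>lborel)"
      using \<alpha>' by (intro nn_integral_cong) (auto simp: abs_mult split: split_indicator)
    also have "\<dots> \<le> (\<integral>\<^sup>+s\<in>{0<..1}. ennreal (hker \<alpha> s * \<bar>?w s\<bar>) \<partial>lborel) + ennreal \<bar>\<phi> t\<bar> + (\<integral>\<^sup>+s. kf \<alpha> s * ennreal \<bar>\<phi> (t + s)\<bar> \<partial>lborel)"
      using \<alpha>' by (intro nn_integral_kernel_le) auto
    also have "\<dots> \<le> ennreal (\<kappa> * B) * ennreal (decay A t) + ennreal B * ennreal (decay A t) + ennreal (B / \<alpha>0) * (\<integral>\<^sup>+s. kf \<alpha>0 s * ennreal (decay A (t + s)) \<partial>lborel)"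
      by (intro add_mono near dB tail)
    finally have I: "ennreal \<bar>LINT s:{0<..}|lborel. hker \<alpha> s * ?w s\<bar> \<le>
      ennreal (\<kappa> * B) * ennreal (decay A t) + ennreal B * ennreal (decay A t) + ennreal (B / \<alpha>0) * (\<integral>\<^sup>+s. kf \<alpha>0 s * ennreal (decay A (t + s)) \<partial>lborel)" .
    have coef0: "0 \<le> coef0 \<alpha>" "coef0 \<alpha> \<le> G" "coef1 \<alpha> \<le> G" using coef_nonneg G \<alpha> \<alpha>' by auto
    have "ennreal \<bar>Dright \<alpha> \<phi> t\<bar> = ennreal (coef0 \<alpha>) * ennreal \<bar>LINT s:{0<..}|lborel. hker \<alpha> s * ?w s\<bar>"
      using coef0 by (simp add: Dright_eq coef0_def[symmetric] abs_mult ennreal_mult)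
    also have "\<dots> \<le> ennreal (coef0 \<alpha>) * (ennreal (\<kappa> * B) * ennreal (decay A t) + ennreal B * ennreal (decay A t) + ennreal (B / \<alpha>0) * (\<integral>\<^sup>+s. kf \<alpha>0 s * ennreal (decay A (t + s)) \<partial>lborel))"
      by (rule mult_left_mono[OF I]) simp
    also have "\<dots> = ennreal (coef0 \<alpha> * (\<kappa> * B)) * ennreal (decay A t) + ennreal (coef0 \<alpha> * B) * ennreal (decay A t) + ennreal (coef0 \<alpha> * (B / \<alpha>0)) * (\<integral>\<^sup>+s. kf \<alpha>0 s * ennreal (decay A (t + s)) \<partial>lborel)"
      using coef0 \<kappa> B \<alpha>0 by (simp only: distrib_left mult.assoc[symmetric] ennreal_mult mult_nonneg_nonneg divide_nonneg_pos)
    also have "\<dots> \<le> ennreal (G * B) * envelope \<alpha>0 A t + ennreal (G * B) * envelope \<alpha>0 A t + ennreal (G * (B / \<alpha>0)) * envelope \<alpha>0 A t"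
    proof -
      have h1: "ennreal (coef0 \<alpha> * (\<kappa> * B)) \<le> ennreal (G * B)"
        using a01 coef0 B by (intro ennreal_leI) (simp add: mult.assoc[symmetric] mult_right_mono)
      have h2: "ennreal (coef0 \<alpha> * B) \<le> ennreal (G * B)" using coef0 B by (intro ennreal_leI) (simp add: mult_right_mono)
      have h3: "ennreal (coef0 \<alpha> * (B / \<alpha>0)) \<le> ennreal (G * (B / \<alpha>0))" using coef0 B \<alpha>0 by (intro ennreal_leI mult_right_mono) auto
      have t1: "ennreal (decay A t) \<le> envelope \<alpha>0 A t" and t2: "(\<integral>\<^sup>+s. kf \<alpha>0 s * ennreal (decay A (t + s)) \<partial>lborel) \<le> envelope \<alpha>0 A t"
        by (auto simp: envelope_def add_increasing add_increasing2)
      show ?thesis by (intro add_mono[OF add_mono] mult_mono[OF h1 t1] mult_mono[OF h2 t1] mult_mono[OF h3 t2]) auto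
    qed
    also have "\<dots> = ennreal (G * B + G * B + G * (B / \<alpha>0)) * envelope \<alpha>0 A t"
      using G B \<alpha>0 by (subst ennreal_plus, simp, simp, subst ennreal_plus) (simp_all only: distrib_right mult_nonneg_nonneg less_imp_le divide_nonneg_pos)
    also have "\<dots> \<le> ennreal c * envelope \<alpha>0 A t"
      using B G \<alpha>0 by (intro mult_right_mono ennreal_leI) (auto simp: c_def algebra_simps)
    finally show ?thesis .
  qed
  have phi: "ennreal \<bar>\<phi> t\<bar> \<le> ennreal c * envelope \<alpha>0 A t" for t
  proof -
    have "ennreal B * ennreal (decay A t) \<le> ennreal c * envelope \<alpha>0 A t"
      using B G \<alpha>0 by (intro mult_mono ennreal_leI) (auto simp: c_def envelope_def add_increasing2)
    then show ?thesis using dB[of t] by (rule order_trans[rotated])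
  qed
  show thesis by (rule that[OF c main phi])
qed

context left_weight
begin

lemma N_far_finite: "g \<in> borel_measurable borel \<Longrightarrow> N g < top \<Longrightarrow> 0 < \<alpha> \<Longrightarrow> \<alpha> \<le> 1 \<Longrightarrow> N (far \<alpha> g) < top"
  using N_far[of g \<alpha>] by (auto intro: le_less_trans simp: ennreal_mult_less_top)

lemma pairing_envelope:
  assumes [measurable]: "g \<in> borel_measurable borel" and N: "N g < top" and \<beta>: "0 < \<beta>" "\<beta> < 1"
  shows "(\<integral>\<^sup>+t. g t * envelope \<beta> A t \<partial>lborel) < top"
proof -
  have "(\<integral>\<^sup>+t. g t * envelope \<beta> A t \<partial>lborel) = (\<integral>\<^sup>+t. g t * ennreal (decay A t) + (\<integral>\<^sup>+s. kf \<beta> s * ennreal (decay A (t + s)) * g t \<partial>lborel) \<partial>lborel)"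
    unfolding envelope_def by (intro nn_integral_cong, subst nn_integral_multc) (auto simp: distrib_left mult.commute)
  also have "\<dots> = (\<integral>\<^sup>+t. g t * ennreal (decay A t) \<partial>lborel) + (\<integral>\<^sup>+t. far \<beta> g t * ennreal (decay A t) \<partial>lborel)"
    by (subst nn_integral_add) (auto simp: kf_swap[of g "\<lambda>t. ennreal (decay A t)"])
  also have "\<dots> < top"
    using pairing_decay[OF _ N] pairing_decay[OF _ N_far_finite[OF _ N]] \<beta> by (simp add: ennreal_add_less_top)
  finally show ?thesis .
qed

text \<open>Near 0 the envelope is comparable with its translates. Far out, the kernel is a far kernel, whose
adjoint turns g into a far part, again of finite modular.\<close>

lemma kdiff_pairing:
  assumes [measurable]: "g \<in> borel_measurable borel" and N: "N g < top" and \<beta>: "0 < \<beta>" "\<beta> < 1" and s: "0 < s" "s \<le> 1"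
  shows "(\<integral>\<^sup>+x. ennreal \<bar>kdiff \<beta> s x\<bar> * (\<integral>\<^sup>+t. g t * envelope \<beta> A (t + x) \<partial>lborel) \<partial>lborel) < top"
proof -
  have T: "(\<integral>\<^sup>+t. g t * envelope \<beta> A t \<partial>lborel) < top" by (rule pairing_envelope[OF _ N \<beta>]) measurable
  have near: "(\<integral>\<^sup>+t. g t * envelope \<beta> A (t + x) \<partial>lborel) \<le> 10 * (\<integral>\<^sup>+t. g t * envelope \<beta> A t \<partial>lborel)" if "0 < x" "x \<le> 2" for x
  proof -
    have "(\<integral>\<^sup>+t. g t * envelope \<beta> A (t + x) \<partial>lborel) \<le> (\<integral>\<^sup>+t. 10 * (g t * envelope \<beta> A t) \<partial>lborel)"
    proof (rule nn_integral_mono)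
      fix t show "g t * envelope \<beta> A (t + x) \<le> 10 * (g t * envelope \<beta> A t)"
        using mult_left_mono[OF envelope_shift[of x \<beta> A t], of "g t"] that by (simp add: mult_ac)
    qed
    then show ?thesis by (simp add: nn_integral_cmult)
  qed
  have "(\<integral>\<^sup>+x. kf (1 - \<beta>) x * (\<integral>\<^sup>+t. g t * envelope \<beta> A (t + x) \<partial>lborel) \<partial>lborel) = (\<integral>\<^sup>+x. \<integral>\<^sup>+t. kf (1 - \<beta>) x * envelope \<beta> A (t + x) * g t \<partial>lborel \<partial>lborel)"
    by (intro nn_integral_cong, subst nn_integral_cmult[symmetric]) (auto simp: mult_ac)
  also have "\<dots> = (\<integral>\<^sup>+t. \<integral>\<^sup>+x. kf (1 - \<beta>) x * envelope \<beta> A (t + x) * g t \<partial>lborel \<partial>lborel)"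
    by (rule lborel_pair.Fubini') measurable
  also have "\<dots> = (\<integral>\<^sup>+t. far (1 - \<beta>) g t * envelope \<beta> A t \<partial>lborel)" by (rule kf_swap) measurable
  also have "\<dots> < top" using \<beta> by (intro pairing_envelope N_far_finite N) auto
  finally have far: "(\<integral>\<^sup>+x. kf (1 - \<beta>) x * (\<integral>\<^sup>+t. g t * envelope \<beta> A (t + x) \<partial>lborel) \<partial>lborel) < top" .
  have "(\<integral>\<^sup>+x. ennreal \<bar>kdiff \<beta> s x\<bar> * (\<integral>\<^sup>+t. g t * envelope \<beta> A (t + x) \<partial>lborel) \<partial>lborel)
    \<le> ennreal (rGamma \<beta> * (2 / \<beta>) * s powr \<beta>) * (10 * (\<integral>\<^sup>+t. g t * envelope \<beta> A t \<partial>lborel))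
      + ennreal (4 * s * rGamma \<beta>) * (\<integral>\<^sup>+x. kf (1 - \<beta>) x * (\<integral>\<^sup>+t. g t * envelope \<beta> A (t + x) \<partial>lborel) \<partial>lborel)"
    by (rule kdiff_split[OF \<beta> s _ near]) measurable
  also have "\<dots> < top" using far T by (simp add: ennreal_add_less_top ennreal_mult_less_top)
  finally show ?thesis .
qed

lemma Dright_shift: "test \<psi> \<Longrightarrow> Dright \<beta> (\<lambda>t. \<psi> (t + x)) t = Dright \<beta> \<psi> (t + x)"
  using test_measurable[of \<psi>] by (simp add: Dright_eq add_ac)

text \<open>By Fubini's theorem and \<open>kdiff_split\<close>: near the origin of the kernel only the integral of g over a
bounded interval enters, far out the far part of g, which has finite modular.\<close>

lemma kdiff_local:
  assumes [measurable]: "g \<in> borel_measurable borel" and N: "N g < top" and \<beta>: "0 < \<beta>" "\<beta> < 1"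
  obtains c where "0 \<le> c" "\<And>s. 0 < s \<Longrightarrow> s \<le> 1 \<Longrightarrow>
    (\<integral>\<^sup>+t\<in>{a..b}. (\<integral>\<^sup>+x. ennreal \<bar>kdiff \<beta> s x\<bar> * g (t - x) \<partial>lborel) \<partial>lborel) \<le> ennreal (c * s powr \<beta>)"
proof -
  obtain M where M: "(\<integral>\<^sup>+t\<in>{a - 2..b}. g t \<partial>lborel) = ennreal M" "0 \<le> M"
    using N_finite_imp_local[OF _ N, of "a-2" b] by (cases "\<integral>\<^sup>+t\<in>{a - 2..b}. g t \<partial>lborel") auto
  have "(\<integral>\<^sup>+t\<in>{a..b}. far (1 - \<beta>) g t \<partial>lborel) < top"
    using \<beta> by (intro N_finite_imp_local N_far_finite N) auto
  then obtain F where F: "(\<integral>\<^sup>+t\<in>{a..b}. far (1 - \<beta>) g t \<partial>lborel) = ennreal F" "0 \<le> F"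
    by (cases "\<integral>\<^sup>+t\<in>{a..b}. far (1 - \<beta>) g t \<partial>lborel") auto
  define c where "c = rGamma \<beta> * (2 / \<beta>) * M + 4 * rGamma \<beta> * F"
  have rG: "0 < rGamma \<beta>" using rGamma_pos \<beta> by auto
  have c: "0 \<le> c" using rG M F \<beta> by (simp add: c_def)
  have "(\<integral>\<^sup>+t\<in>{a..b}. (\<integral>\<^sup>+x. ennreal \<bar>kdiff \<beta> s x\<bar> * g (t - x) \<partial>lborel) \<partial>lborel) \<le> ennreal (c * s powr \<beta>)" if s: "0 < s" "s \<le> 1" for s
  proof -
    define h where "h x = (\<integral>\<^sup>+t\<in>{a..b}. g (t - x) \<partial>lborel)" for x
    have [measurable]: "h \<in> borel_measurable borel" unfolding h_def by measurable
    have "(\<integral>\<^sup>+t\<in>{a..b}. (\<integral>\<^sup>+x. ennreal \<bar>kdiff \<beta> s x\<bar> * g (t - x) \<partial>lborel) \<partial>lborel)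
      = (\<integral>\<^sup>+t. \<integral>\<^sup>+x. ennreal \<bar>kdiff \<beta> s x\<bar> * (g (t - x) * indicator {a..b} t) \<partial>lborel \<partial>lborel)"
      by (intro nn_integral_cong, subst nn_integral_multc[symmetric]) (auto simp: mult_ac)
    also have "\<dots> = (\<integral>\<^sup>+x. \<integral>\<^sup>+t. ennreal \<bar>kdiff \<beta> s x\<bar> * (g (t - x) * indicator {a..b} t) \<partial>lborel \<partial>lborel)"
      by (rule lborel_pair.Fubini') measurable
    also have "\<dots> = (\<integral>\<^sup>+x. ennreal \<bar>kdiff \<beta> s x\<bar> * h x \<partial>lborel)"
      unfolding h_def by (intro nn_integral_cong nn_integral_cmult) measurable
    also have "\<dots> \<le> ennreal (rGamma \<beta> * (2 / \<beta>) * s powr \<beta>) * ennreal M + ennreal (4 * s * rGamma \<beta>) * (\<integral>\<^sup>+x. kf (1 - \<beta>) x * h x \<partial>lborel)"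
    proof (rule kdiff_split[OF \<beta> s])
      fix x :: real assume x: "0 < x" "x \<le> 2"
      have "h x = (\<integral>\<^sup>+t. g t * indicator {a..b} (t + x) \<partial>lborel)"
        unfolding h_def using nn_integral_translate(2)[of "\<lambda>t. g (t - x) * indicator {a..b} t" x] by (simp add: add.commute)
      also have "\<dots> \<le> (\<integral>\<^sup>+t\<in>{a - 2..b}. g t \<partial>lborel)" using x by (intro nn_integral_mono) (auto split: split_indicator)
      finally show "h x \<le> ennreal M" by (simp add: M)
    qed measurable
    also have "(\<integral>\<^sup>+x. kf (1 - \<beta>) x * h x \<partial>lborel) = (\<integral>\<^sup>+t\<in>{a..b}. far (1 - \<beta>) g t \<partial>lborel)"
    proof -
      have "(\<integral>\<^sup>+x. kf (1 - \<beta>) x * h x \<partial>lborel) = (\<integral>\<^sup>+x. \<integral>\<^sup>+t. kf (1 - \<beta>) x * (g (t - x) * indicator {a..b} t) \<partial>lborel \<partial>lborel)"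
        unfolding h_def by (intro nn_integral_cong nn_integral_cmult[symmetric]) measurable
      also have "\<dots> = (\<integral>\<^sup>+t. \<integral>\<^sup>+x. kf (1 - \<beta>) x * (g (t - x) * indicator {a..b} t) \<partial>lborel \<partial>lborel)"
        by (rule lborel_pair.Fubini') measurable
      also have "\<dots> = (\<integral>\<^sup>+t\<in>{a..b}. far (1 - \<beta>) g t \<partial>lborel)"
        unfolding far_def by (intro nn_integral_cong, subst nn_integral_multc[symmetric]) (auto simp: mult_ac)
      finally show ?thesis .
    qed
    also have "ennreal (rGamma \<beta> * (2 / \<beta>) * s powr \<beta>) * ennreal M + ennreal (4 * s * rGamma \<beta>) * (\<integral>\<^sup>+t\<in>{a..b}. far (1 - \<beta>) g t \<partial>lborel)
      = ennreal (rGamma \<beta> * (2 / \<beta>) * s powr \<beta> * M + 4 * s * rGamma \<beta> * F)"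
      using rG M F s \<beta> by (simp add: ennreal_mult[symmetric] ennreal_plus[symmetric] del: ennreal_plus)
    also have "\<dots> \<le> ennreal (c * s powr \<beta>)"
    proof (rule ennreal_leI)
      have "s \<le> s powr \<beta>" using s \<beta> powr_mono'[of \<beta> 1 s] by simp
      then have "4 * rGamma \<beta> * F * s \<le> 4 * rGamma \<beta> * F * s powr \<beta>" using rG F by (intro mult_left_mono) auto
      then show "rGamma \<beta> * (2 / \<beta>) * s powr \<beta> * M + 4 * s * rGamma \<beta> * F \<le> c * s powr \<beta>"
        by (simp add: c_def algebra_simps)
    qed
    finally show ?thesis .
  qed
  then show thesis using that c by blast
qed

text \<open>Pair both sides with a test function \<open>\<psi>\<close>. By \<open>kdiff_Dright\<close> the increment of \<open>\<psi>\<close> is an integral of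
translates of \<open>D\<^sup>\<beta> \<psi>\<close>; the hypothesis, applied to each translate of \<open>\<psi>\<close>, replaces u and \<open>D\<^sup>\<beta> \<psi>\<close> by v and
\<open>\<psi>\<close>. The envelope justifies both changes of the order of integration.\<close>

lemma frac_increment:
  assumes [measurable]: "u \<in> borel_measurable borel" "v \<in> borel_measurable borel"
    and Nu: "N (eabs u) < top" and Nv: "N (eabs v) < top"
    and \<beta>: "0 < \<beta>" "\<beta> < 1" and s: "0 < s" "s \<le> 1"
    and weak: "\<And>\<psi>. test \<psi> \<Longrightarrow> pair u (Dright \<beta> \<psi>) = pair v \<psi>"
  shows "AE t in lborel. u t - u (t - s) = (LINT x|lborel. kdiff \<beta> s x * v (t - x))"
proof (rule locint_ae_eq)
  have u: "locint u" by (rule N_finite_imp_locint[OF _ Nu]) measurable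
  show "locint (\<lambda>t. u t - u (t - s))" by (intro locint_diff u locint_shift)
  show "locint (\<lambda>t. LINT x|lborel. kdiff \<beta> s x * v (t - x))"
  proof (rule locintI)
    fix a b
    obtain c where c: "0 \<le> c" "\<And>s. 0 < s \<Longrightarrow> s \<le> 1 \<Longrightarrow>
      (\<integral>\<^sup>+t\<in>{a..b}. (\<integral>\<^sup>+x. ennreal \<bar>kdiff \<beta> s x\<bar> * ennreal \<bar>v (t - x)\<bar> \<partial>lborel) \<partial>lborel) \<le> ennreal (c * s powr \<beta>)"
      using kdiff_local[OF _ Nv \<beta>, of a b] by auto
    have "(\<integral>\<^sup>+t\<in>{a..b}. ennreal \<bar>LINT x|lborel. kdiff \<beta> s x * v (t - x)\<bar> \<partial>lborel) \<le> (\<integral>\<^sup>+t\<in>{a..b}. (\<integral>\<^sup>+x. ennreal \<bar>kdiff \<beta> s x\<bar> * ennreal \<bar>v (t - x)\<bar> \<partial>lborel) \<partial>lborel)"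
    proof (intro nn_integral_mono mult_right_mono)
      fix t
      show "ennreal \<bar>LINT x|lborel. kdiff \<beta> s x * v (t - x)\<bar> \<le> (\<integral>\<^sup>+x. ennreal \<bar>kdiff \<beta> s x\<bar> * ennreal \<bar>v (t - x)\<bar> \<partial>lborel)"
        using ennreal_abs_integral_le[of lborel "\<lambda>x. kdiff \<beta> s x * v (t - x)"] by (simp add: abs_mult ennreal_mult)
    qed simp
    then show "(\<integral>\<^sup>+t\<in>{a..b}. ennreal \<bar>LINT x|lborel. kdiff \<beta> s x * v (t - x)\<bar> \<partial>lborel) < top"
      using c(2)[OF s] by (meson ennreal_less_top le_less_trans order_trans)
  qed measurable
  fix \<psi> assume \<psi>: "test \<psi>"
  have [measurable]: "\<psi> \<in> borel_measurable borel" using test_measurable[OF \<psi>] by simp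
  define \<eta> where "\<eta> = Dright \<beta> \<psi>"
  have [measurable]: "\<eta> \<in> borel_measurable borel" unfolding \<eta>_def by measurable
  obtain A c where c: "0 \<le> c" "\<And>t. ennreal \<bar>\<eta> t\<bar> \<le> ennreal c * envelope \<beta> A t" "\<And>t. ennreal \<bar>\<psi> t\<bar> \<le> ennreal c * envelope \<beta> A t"
    using Dright_le_envelope[OF test_in_S_minus[OF \<psi>] \<beta>(1)] \<beta> unfolding \<eta>_def by (metis order_refl)
  have fin: "(\<integral>\<^sup>+x. \<integral>\<^sup>+t. ennreal \<bar>kdiff \<beta> s x * (w t * \<zeta> (t + x))\<bar> \<partial>lborel \<partial>lborel) < top"
    if [measurable]: "w \<in> borel_measurable borel" "\<zeta> \<in> borel_measurable borel" and Nw: "N (eabs w) < top" and \<zeta>: "\<And>t. ennreal \<bar>\<zeta> t\<bar> \<le> ennreal c * envelope \<beta> A t" for w \<zeta>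
  proof -
    have "(\<integral>\<^sup>+x. \<integral>\<^sup>+t. ennreal \<bar>kdiff \<beta> s x * (w t * \<zeta> (t + x))\<bar> \<partial>lborel \<partial>lborel)
      \<le> (\<integral>\<^sup>+x. ennreal c * (ennreal \<bar>kdiff \<beta> s x\<bar> * (\<integral>\<^sup>+t. ennreal \<bar>w t\<bar> * envelope \<beta> A (t + x) \<partial>lborel)) \<partial>lborel)"
    proof (rule nn_integral_mono)
      fix x
      have "(\<integral>\<^sup>+t. ennreal \<bar>kdiff \<beta> s x * (w t * \<zeta> (t + x))\<bar> \<partial>lborel) \<le> (\<integral>\<^sup>+t. (ennreal c * ennreal \<bar>kdiff \<beta> s x\<bar>) * (ennreal \<bar>w t\<bar> * envelope \<beta> A (t + x)) \<partial>lborel)"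
      proof (rule nn_integral_mono)
        fix t
        show "ennreal \<bar>kdiff \<beta> s x * (w t * \<zeta> (t + x))\<bar> \<le> (ennreal c * ennreal \<bar>kdiff \<beta> s x\<bar>) * (ennreal \<bar>w t\<bar> * envelope \<beta> A (t + x))"
          using mult_left_mono[OF \<zeta>[of "t + x"], of "ennreal \<bar>kdiff \<beta> s x\<bar> * ennreal \<bar>w t\<bar>"]
          by (simp add: abs_mult ennreal_mult mult_ac)
      qed
      also have "\<dots> = (ennreal c * ennreal \<bar>kdiff \<beta> s x\<bar>) * (\<integral>\<^sup>+t. ennreal \<bar>w t\<bar> * envelope \<beta> A (t + x) \<partial>lborel)"
        by (rule nn_integral_cmult) measurable
      finally show "(\<integral>\<^sup>+t. ennreal \<bar>kdiff \<beta> s x * (w t * \<zeta> (t + x))\<bar> \<partial>lborel) \<le> ennreal c * (ennreal \<bar>kdiff \<beta> s x\<bar> * (\<integral>\<^sup>+t. ennreal \<bar>w t\<bar> * envelope \<beta> A (t + x) \<partial>lborel))"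
        by (simp add: mult.assoc)
    qed
    also have "\<dots> = ennreal c * (\<integral>\<^sup>+x. ennreal \<bar>kdiff \<beta> s x\<bar> * (\<integral>\<^sup>+t. ennreal \<bar>w t\<bar> * envelope \<beta> A (t + x) \<partial>lborel) \<partial>lborel)"
      by (rule nn_integral_cmult) measurable
    also have "\<dots> < top" using kdiff_pairing[OF _ Nw \<beta> s, of A] by (simp add: ennreal_mult_less_top)
    finally show ?thesis .
  qed
  have pair: "(LINT t|lborel. u t * \<eta> (t + x)) = (LINT t|lborel. v t * \<psi> (t + x))" for x
    using weak[OF test_shift[OF \<psi>, of x]] by (simp add: Dright_shift[OF \<psi>] \<eta>_def)
  have iu: "integrable lborel (\<lambda>t. u t * \<psi> t)" "integrable lborel (\<lambda>t. u t * \<psi> (t + s))" "integrable lborel (\<lambda>t. u (t - s) * \<psi> t)"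
    using test_integrable(1)[OF u \<psi>] test_integrable(1)[OF u test_shift[OF \<psi>]] test_integrable(1)[OF locint_shift[OF u] \<psi>] by auto
  have "(LINT t|lborel. (u t - u (t - s)) * \<psi> t) = (LINT t|lborel. u t * (\<psi> t - \<psi> (t + s)))"
    using iu lborel_integral_shift(1)[of "\<lambda>t. u (t - s) * \<psi> t" s]
    by (simp add: left_diff_distrib right_diff_distrib)
  also have "\<dots> = (LINT t|lborel. LINT x|lborel. kdiff \<beta> s x * (u t * \<eta> (t + x)))"
  proof (rule Bochner_Integration.integral_cong[OF refl])
    fix t
    have "(LINT x|lborel. kdiff \<beta> s x * (u t * \<eta> (t + x))) = u t * (LINT x|lborel. kdiff \<beta> s x * \<eta> (t + x))"
      by (subst integral_mult_right_zero[symmetric]) (simp add: mult_ac)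
    then show "u t * (\<psi> t - \<psi> (t + s)) = (LINT x|lborel. kdiff \<beta> s x * (u t * \<eta> (t + x)))"
      using kdiff_Dright[OF \<psi> \<beta> s, of t] by (simp add: \<eta>_def)
  qed
  also have "\<dots> = (LINT x|lborel. LINT t|lborel. kdiff \<beta> s x * (u t * \<eta> (t + x)))"
    by (rule Fubini_real(1)[symmetric, OF _ fin[OF _ _ Nu c(2)]]) measurable
  also have "\<dots> = (LINT x|lborel. LINT t|lborel. kdiff \<beta> s x * (v t * \<psi> (t + x)))"
    by (simp add: pair)
  also have "\<dots> = (LINT x|lborel. LINT r|lborel. kdiff \<beta> s x * (v (r - x) * \<psi> r))"
  proof (rule Bochner_Integration.integral_cong[OF refl])
    fix x show "(LINT t|lborel. kdiff \<beta> s x * (v t * \<psi> (t + x))) = (LINT r|lborel. kdiff \<beta> s x * (v (r - x) * \<psi> r))"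
      using lborel_integral_shift(1)[of "\<lambda>r. kdiff \<beta> s x * (v (r - x) * \<psi> r)" x] by simp
  qed
  also have "\<dots> = (LINT r|lborel. LINT x|lborel. kdiff \<beta> s x * (v (r - x) * \<psi> r))"
  proof (rule Fubini_real(1))
    have "(\<integral>\<^sup>+r. ennreal \<bar>kdiff \<beta> s x * (v (r - x) * \<psi> r)\<bar> \<partial>lborel) = (\<integral>\<^sup>+t. ennreal \<bar>kdiff \<beta> s x * (v t * \<psi> (t + x))\<bar> \<partial>lborel)" for x
      using nn_integral_translate(2)[of "\<lambda>r. ennreal \<bar>kdiff \<beta> s x * (v (r - x) * \<psi> r)\<bar>" x] by (simp add: add.commute)
    then show "(\<integral>\<^sup>+x. \<integral>\<^sup>+r. ennreal \<bar>kdiff \<beta> s x * (v (r - x) * \<psi> r)\<bar> \<partial>lborel \<partial>lborel) < top"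
      using fin[OF _ _ Nv c(3)] by simp
  qed measurable
  also have "\<dots> = (LINT r|lborel. (LINT x|lborel. kdiff \<beta> s x * v (r - x)) * \<psi> r)"
    by (simp add: mult.assoc[symmetric])
  finally show "(LINT t|lborel. (u t - u (t - s)) * \<psi> t) = (LINT t|lborel. (LINT x|lborel. kdiff \<beta> s x * v (t - x)) * \<psi> t)" .
qed

text \<open>The increments of u over s have size \<open>O(s^\<beta>)\<close> in the mean, and \<open>s^(\<beta> - 1 - \<alpha>)\<close> is integrable at 0 for
\<open>\<alpha> < \<beta>\<close>.\<close>

lemma near_locally_finite:
  assumes [measurable]: "u \<in> borel_measurable borel" "v \<in> borel_measurable borel"
    and Nu: "N (eabs u) < top" and Nv: "N (eabs v) < top"
    and \<beta>: "0 < \<beta>" "\<beta> < 1" and \<alpha>: "0 < \<alpha>" "\<alpha> < \<beta>"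
    and weak: "\<And>\<psi>. test \<psi> \<Longrightarrow> pair u (Dright \<beta> \<psi>) = pair v \<psi>"
  shows "(\<integral>\<^sup>+t\<in>{a..b}. near \<alpha> u t \<partial>lborel) < top"
proof -
  obtain c where c: "0 \<le> c" "\<And>s. 0 < s \<Longrightarrow> s \<le> 1 \<Longrightarrow>
    (\<integral>\<^sup>+t\<in>{a..b}. (\<integral>\<^sup>+x. ennreal \<bar>kdiff \<beta> s x\<bar> * ennreal \<bar>v (t - x)\<bar> \<partial>lborel) \<partial>lborel) \<le> ennreal (c * s powr \<beta>)"
    using kdiff_local[OF _ Nv \<beta>, of a b] by auto
  have inc: "(\<integral>\<^sup>+t\<in>{a..b}. ennreal \<bar>u t - u (t - s)\<bar> \<partial>lborel) \<le> ennreal (c * s powr \<beta>)" if s: "0 < s" "s \<le> 1" for s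
  proof -
    have fi: "AE t in lborel. u t - u (t - s) = (LINT x|lborel. kdiff \<beta> s x * v (t - x))"
      by (rule frac_increment[OF assms(1,2) Nu Nv \<beta> s]) (rule weak)
    have "(\<integral>\<^sup>+t\<in>{a..b}. ennreal \<bar>u t - u (t - s)\<bar> \<partial>lborel) \<le> (\<integral>\<^sup>+t\<in>{a..b}. (\<integral>\<^sup>+x. ennreal \<bar>kdiff \<beta> s x\<bar> * ennreal \<bar>v (t - x)\<bar> \<partial>lborel) \<partial>lborel)"
    proof (rule nn_integral_mono_AE, use fi in eventually_elim)
      case (elim t)
      then show ?case
        using ennreal_abs_integral_le[of lborel "\<lambda>x. kdiff \<beta> s x * v (t - x)"] by (simp add: abs_mult ennreal_mult mult_right_mono)
    qed
    then show ?thesis using c(2)[OF s] by (rule order_trans)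
  qed
  have "(\<integral>\<^sup>+t\<in>{a..b}. near \<alpha> u t \<partial>lborel) = (\<integral>\<^sup>+t. \<integral>\<^sup>+s. ennreal (hker \<alpha> s) * indicator {0<..1} s * (ennreal \<bar>u t - u (t - s)\<bar> * indicator {a..b} t) \<partial>lborel \<partial>lborel)"
    unfolding near_def using \<alpha>
    by (intro nn_integral_cong, subst nn_integral_multc[symmetric]) (auto intro!: nn_integral_cong simp: ennreal_mult mult_ac)
  also have "\<dots> = (\<integral>\<^sup>+s. \<integral>\<^sup>+t. ennreal (hker \<alpha> s) * indicator {0<..1} s * (ennreal \<bar>u t - u (t - s)\<bar> * indicator {a..b} t) \<partial>lborel \<partial>lborel)"
    by (rule lborel_pair.Fubini') measurable
  also have "\<dots> = (\<integral>\<^sup>+s. ennreal (hker \<alpha> s) * indicator {0<..1} s * (\<integral>\<^sup>+t\<in>{a..b}. ennreal \<bar>u t - u (t - s)\<bar> \<partial>lborel) \<partial>lborel)"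
    by (intro nn_integral_cong nn_integral_cmult) measurable
  also have "\<dots> \<le> (\<integral>\<^sup>+s. ennreal (\<alpha> * c) * (ennreal (s powr (\<beta> - \<alpha> - 1)) * indicator {0..1} s) \<partial>lborel)"
  proof (rule nn_integral_mono)
    fix s
    show "ennreal (hker \<alpha> s) * indicator {0<..1} s * (\<integral>\<^sup>+t\<in>{a..b}. ennreal \<bar>u t - u (t - s)\<bar> \<partial>lborel)
      \<le> ennreal (\<alpha> * c) * (ennreal (s powr (\<beta> - \<alpha> - 1)) * indicator {0..1} s)"
    proof (cases "0 < s \<and> s \<le> 1")
      case True
      then have "ennreal (hker \<alpha> s) * (\<integral>\<^sup>+t\<in>{a..b}. ennreal \<bar>u t - u (t - s)\<bar> \<partial>lborel) \<le> ennreal (hker \<alpha> s) * ennreal (c * s powr \<beta>)"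
        by (intro mult_left_mono inc) auto
      also have "\<dots> = ennreal (\<alpha> * c * (s powr (- 1 - \<alpha>) * s powr \<beta>))"
        using \<alpha> c by (simp add: ennreal_mult[symmetric] mult_ac)
      also have "s powr (- 1 - \<alpha>) * s powr \<beta> = s powr (\<beta> - \<alpha> - 1)"
        unfolding powr_add[symmetric] by (rule arg_cong[where f="\<lambda>x. s powr x"]) simp
      finally show ?thesis using True \<alpha> c by (simp add: ennreal_mult)
    qed (auto split: split_indicator)
  qed
  also have "\<dots> = ennreal (\<alpha> * c) * ennreal (1 / (\<beta> - \<alpha>))"
    using nn_integral_powr_Icc[of "\<beta> - \<alpha> - 1" 1] \<alpha> by (simp add: nn_integral_cmult)
  also have "\<dots> < top" by (simp add: ennreal_mult_less_top)
  finally show ?thesis .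
qed

end

section \<open>Limits of distributional fractional derivatives\<close>

lemma AE_lborel_uminus:
  assumes "AE t in lborel. P (t::real)"
  shows "AE t in lborel. P (- t)"
proof -
  obtain Z where Z: "Z \<in> null_sets lborel" "{t \<in> space lborel. \<not> P t} \<subseteq> Z"
    using assms by (auto simp: eventually_ae_filter)
  have [measurable]: "Z \<in> sets borel" using Z(1) by auto
  have "AE t in lborel. t \<notin> Z" using Z(1) by (rule AE_not_in)
  then have "AE t in lborel. 0 + (- 1) * t \<notin> Z" by (intro AE_borel_affine[of "-1" "\<lambda>t. t \<notin> Z" 0]) auto
  then show ?thesis by eventually_elim (use Z(2) in auto)
qed

lemma filterlim_shift_real: "filterlim (\<lambda>n. real n + 2) at_top sequentially"
  by (rule filterlim_at_top_mono[OF filterlim_real_sequentially]) auto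

text \<open>After the reflection x to -x, right derivatives become left derivatives, and the limit is the case
p = 1 with constant weight of the limit for Sobolev functions.\<close>

lemma Dright_tendsto_deriv:
  assumes \<phi>: "test \<phi>"
  shows "AE t in lborel. ((\<lambda>\<alpha>. Dright \<alpha> \<phi> t) \<longlongrightarrow> - deriv \<phi> t) (at_left 1)"
proof -
  have sm: "smooth \<phi>" using \<phi> by (simp add: test_def)
  have [measurable]: "\<phi> \<in> borel_measurable borel" "deriv \<phi> \<in> borel_measurable borel" using test_measurable[OF \<phi>] by auto
  define u where "u x = \<phi> (- x)" for x
  define v where "v x = - deriv \<phi> (- x)" for x
  have [measurable]: "u \<in> borel_measurable borel" "v \<in> borel_measurable borel" unfolding u_def v_def by measurable
  interpret L: left_weight 1 "\<lambda>_. 1" "2 * 1"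
    by (rule left_weight_A1) (auto intro!: AE_I2 borel_integrable_atLeastAtMost')
  have fin: "L.N (eabs w) < top" if "\<And>t. \<bar>w t\<bar> \<le> B * indicator {-A..A} t" for w :: "real \<Rightarrow> real" and A B
  proof -
    have "L.N (eabs w) \<le> L.N (\<lambda>t. ennreal B * indicator {-A..A} t)"
    proof (intro L.N_mono AE_I2)
      fix t show "ennreal \<bar>w t\<bar> \<le> ennreal B * indicator {-A..A} t"
        using that[of t] by (auto split: split_indicator_asm split_indicator intro!: ennreal_leI)
    qed
    then show ?thesis using L.N_bounded_support by (rule le_less_trans)
  qed
  interpret S: weighted_sobolev 1 "\<lambda>_. 1" "2 * 1" u v
  proof
    obtain A B where "\<And>t. \<bar>(deriv ^^ 0) \<phi> t\<bar> \<le> B * indicator {-A..A} t" using test_bounded[OF \<phi>, of 0] by metis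
    then have "\<bar>u t\<bar> \<le> B * indicator {-A..A} (- t)" for t by (simp add: u_def)
    moreover have "indicator {-A..A} (- t) = (indicator {-A..A} t :: real)" for t by (auto split: split_indicator)
    ultimately have "\<bar>u t\<bar> \<le> B * indicator {-A..A} t" for t by simp
    then show "L.N (eabs u) < top" by (rule fin)
    obtain A B where "\<And>t. \<bar>(deriv ^^ 1) \<phi> t\<bar> \<le> B * indicator {-A..A} t" using test_bounded[OF \<phi>, of 1] by metis
    then have "\<bar>v t\<bar> \<le> B * indicator {-A..A} (- t)" for t by (simp add: v_def)
    moreover have "indicator {-A..A} (- t) = (indicator {-A..A} t :: real)" for t by (auto split: split_indicator)
    ultimately have "\<bar>v t\<bar> \<le> B * indicator {-A..A} t" for t by simp
    then show "L.N (eabs v) < top" by (rule fin)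
    fix h :: real assume h: "0 < h"
    have "u t - u (t - h) = h * mean h v t" for t
    proof -
      have "(LINT \<tau>|lborel. v \<tau> * indicator {t - h..t} \<tau>) = u t - u (t - h)"
      proof (rule integral_FTC_Icc_real)
        fix \<tau>
        have a: "((\<lambda>x. - x) has_real_derivative -1) (at \<tau>)" by (auto intro!: derivative_eq_intros)
        from DERIV_chain'[OF a smooth_DERIV0[OF sm]] show "(u has_real_derivative v \<tau>) (at \<tau>)" by (simp add: u_def[abs_def] v_def)
        from DERIV_chain'[OF a smooth_DERIV0[OF smooth_deriv[OF sm]]] have "isCont (\<lambda>x. deriv \<phi> (- x)) \<tau>" by (rule DERIV_isCont)
        then show "isCont v \<tau>" unfolding v_def[abs_def] by (rule isCont_minus)
      qed (use h in auto)
      then show ?thesis using h by (simp add: mean_def set_lebesgue_integral_def mult.commute)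
    qed
    then show "AE t in lborel. u t - u (t - h) = h * mean h v t" by simp
  qed measurable
  have e: "Dleft_pointwise \<alpha> u (- t) = Dright \<alpha> \<phi> t" for \<alpha> t
    by (simp add: Dleft_pointwise_eq Dright_eq u_def add.commute)
  show ?thesis using AE_lborel_uminus[OF S.D_tendsto_left_ae] by (simp add: e v_def)
qed

lemma envelope_le: "0 < \<beta> \<Longrightarrow> envelope \<beta> A t \<le> 2"
proof -
  assume \<beta>: "0 < \<beta>"
  have d: "ennreal (decay A t) \<le> 1" for t
    by (auto simp: decay_def ennreal_le_1 divide_le_eq_1 add_pos_nonneg split: split_indicator)
  have "(\<integral>\<^sup>+s. kf \<beta> s * ennreal (decay A (t + s)) \<partial>lborel) \<le> (\<integral>\<^sup>+s. kf \<beta> s * 1 \<partial>lborel)"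
    by (intro nn_integral_mono mult_left_mono d) simp
  also have "\<dots> = 1" using \<beta> by (simp add: nn_integral_kf)
  finally have "envelope \<beta> A t \<le> 1 + 1" unfolding envelope_def by (intro add_mono d)
  then show ?thesis by simp
qed

context left_weight
begin

text \<open>The inequality for adjacent intervals bounds the integral over [a, b], the weight of the next
interval of the same length being positive.\<close>

lemma local_tendsto_0:
  assumes m: "\<forall>\<^sub>F i in F. f i \<in> borel_measurable borel" and N: "((\<lambda>i. N (f i)) \<longlongrightarrow> 0) F" and ab: "a < b"
  shows "((\<lambda>i. \<integral>\<^sup>+t\<in>{a..b}. f i t \<partial>lborel) \<longlongrightarrow> 0) F"
proof (rule ennreal_tendsto_0I)
  fix e :: real assume e: "0 < e"
  define h where "h = b - a"
  have h: "0 < h" using ab by (simp add: h_def)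
  obtain w where w: "mass W {b..b + h} = ennreal w" "0 < w"
    using W_finite[of b "b+h"] W_positive[of b "b+h"] h
    by (cases "mass W {b..b + h}") (auto simp: ennreal_less_zero_iff)
  define d where "d = e powr p * w / (C * h) powr p"
  have d: "0 < d" using e w C h by (simp add: d_def)
  have "\<forall>\<^sub>F i in F. N (f i) < ennreal d" using order_tendstoD(2)[OF N] d by simp
  with m show "\<forall>\<^sub>F i in F. (\<integral>\<^sup>+t\<in>{a..b}. f i t \<partial>lborel) \<le> ennreal e"
  proof eventually_elim
    case (elim i)
    let ?I = "\<integral>\<^sup>+t\<in>{a..b}. f i t \<partial>lborel"
    have "epow p ?I * ennreal w \<le> ennreal ((C * h) powr p) * (\<integral>\<^sup>+x\<in>{b - h..b}. epow p (f i x) * ennreal (W x) \<partial>lborel)"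
      using adjacent[OF elim(1) h, of b] unfolding w by (simp add: h_def)
    also have "(\<integral>\<^sup>+x\<in>{b - h..b}. epow p (f i x) * ennreal (W x) \<partial>lborel) \<le> N (f i)"
      unfolding N_def by (intro nn_integral_mono) (auto split: split_indicator)
    also have "N (f i) \<le> ennreal d" using elim(2) by simp
    finally have "epow p ?I * ennreal w \<le> ennreal ((C * h) powr p) * ennreal d" by (simp add: mult_left_mono)
    also have "\<dots> = ennreal (e powr p) * ennreal w"
      using C h w d by (simp add: ennreal_mult[symmetric] d_def)
    finally have "ennreal (1 / w) * (epow p ?I * ennreal w) \<le> ennreal (1 / w) * (ennreal (e powr p) * ennreal w)"
      by (rule mult_left_mono) simp
    moreover have "ennreal (1 / w) * (x * ennreal w) = x" for x
    proof -
      have "ennreal (1 / w) * (x * ennreal w) = (ennreal (1 / w) * ennreal w) * x" by (simp only: mult_ac)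
      also have "ennreal (1 / w) * ennreal w = 1" using w(2) by (simp add: ennreal_mult[symmetric])
      finally show ?thesis by simp
    qed
    ultimately have "epow p ?I \<le> ennreal (e powr p)" by simp
    from le_of_epow_le[OF p_pos(1) this] show ?case using e p_pos by (simp add: powr_powr)
  qed
qed

text \<open>Along a sequence of orders tending to 1 the pairings with u converge by dominated convergence, the
envelope of order 1/2 being the majorant; those with \<open>f \<alpha>\<close> converge because convergence in norm
implies convergence in the mean on the support of \<open>\<phi>\<close>.\<close>

lemma limit_weak_deriv:
  assumes [measurable]: "u \<in> borel_measurable borel" "g \<in> borel_measurable borel"
    and Nu: "N (eabs u) < top" and Ng: "N (eabs g) < top"
    and f: "\<forall>\<^sub>F \<alpha> in at_left 1. f \<alpha> \<in> borel_measurable borel \<and> N (eabs (f \<alpha>)) < top \<and>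
       (\<forall>\<phi>. test \<phi> \<longrightarrow> pair u (Dright \<alpha> \<phi>) = pair (f \<alpha>) \<phi>)"
    and lim: "((\<lambda>\<alpha>. N (\<lambda>t. ennreal \<bar>f \<alpha> t - g t\<bar>)) \<longlongrightarrow> 0) (at_left 1)"
    and \<phi>: "test \<phi>"
  shows "pair u (deriv \<phi>) = - pair g \<phi>"
proof -
  have [measurable]: "\<phi> \<in> borel_measurable borel" "deriv \<phi> \<in> borel_measurable borel" using test_measurable[OF \<phi>] by auto
  define S where "S n = 1 - 1 / (real n + 2)" for n
  have S: "1 / 2 \<le> S n" "S n < 1" for n by (auto simp: S_def field_simps)
  have "S \<longlonglongrightarrow> 1 - 0" unfolding S_def
    by (intro tendsto_intros tendsto_divide_0[OF tendsto_const] filterlim_at_top_imp_at_infinity filterlim_shift_real)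
  then have "filterlim S (at_left 1) sequentially" using S(2) by (intro filterlim_seq_at_left) auto
  note evS = eventually_compose_filterlim[OF _ this] and limS = filterlim_compose[OF _ this]
  obtain A c where c: "0 \<le> c" "\<And>\<alpha> t. 1/2 \<le> \<alpha> \<Longrightarrow> \<alpha> < 1 \<Longrightarrow> ennreal \<bar>Dright \<alpha> \<phi> t\<bar> \<le> ennreal c * envelope (1/2) A t"
    by (rule Dright_le_envelope[OF test_in_S_minus[OF \<phi>], of "1/2"]) auto
  define w where "w t = \<bar>u t\<bar> * (c * enn2real (envelope (1/2) A t))" for t
  have envelope_fin: "envelope (1/2) A t = ennreal (enn2real (envelope (1/2) A t))" for t
    using envelope_le[of "1/2" A t] by (simp add: less_top[symmetric] top_unique) (metis ennreal_enn2real_if ennreal_top_neq_one infinity_ennreal_def top_neq_numeral top_unique)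
  have [measurable]: "w \<in> borel_measurable borel" unfolding w_def by measurable
  have w_int: "integrable lborel w"
  proof (rule integrableI_nonneg)
    have "(\<integral>\<^sup>+t. ennreal (w t) \<partial>lborel) = (\<integral>\<^sup>+t. ennreal c * (ennreal \<bar>u t\<bar> * envelope (1/2) A t) \<partial>lborel)"
      using c(1) envelope_fin by (intro nn_integral_cong) (simp add: w_def ennreal_mult mult_ac)
    also have "\<dots> = ennreal c * (\<integral>\<^sup>+t. ennreal \<bar>u t\<bar> * envelope (1/2) A t \<partial>lborel)" by (rule nn_integral_cmult) measurable
    also have "\<dots> < top" using pairing_envelope[OF _ Nu, of "1/2" A] by (simp add: ennreal_mult_less_top)
    finally show "(\<integral>\<^sup>+t. ennreal (w t) \<partial>lborel) < \<infinity>" by simp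
  qed (use c in \<open>auto simp: w_def\<close>)
  have L: "(\<lambda>n. LINT t|lborel. u t * Dright (S n) \<phi> t) \<longlonglongrightarrow> (LINT t|lborel. u t * (- deriv \<phi> t))"
  proof (rule integral_dominated_convergence[OF _ _ w_int])
    show "AE t in lborel. (\<lambda>n. u t * Dright (S n) \<phi> t) \<longlonglongrightarrow> u t * (- deriv \<phi> t)"
      using Dright_tendsto_deriv[OF \<phi>] by eventually_elim (intro tendsto_mult tendsto_const limS)
    show "AE t in lborel. norm (u t * Dright (S n) \<phi> t) \<le> w t" for n
    proof (rule AE_I2)
      fix t
      have "ennreal \<bar>Dright (S n) \<phi> t\<bar> \<le> ennreal (c * enn2real (envelope (1/2) A t))"
        using c(2)[of "S n" t] S[of n] c(1) envelope_fin[of t] by (simp add: ennreal_mult)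
      then have "\<bar>Dright (S n) \<phi> t\<bar> \<le> c * enn2real (envelope (1/2) A t)" using c(1) by (subst (asm) ennreal_le_iff) auto
      then show "norm (u t * Dright (S n) \<phi> t) \<le> w t" by (simp add: w_def abs_mult mult_left_mono)
    qed
  qed measurable
  obtain A' B where AB: "0 < A'" "0 \<le> B" "\<And>t. \<bar>\<phi> t\<bar> \<le> B * indicator {-A'..A'} t"
    using test_bounded[OF \<phi>, of 0] by (metis funpow_0)
  have g_int: "integrable lborel (\<lambda>t. g t * \<phi> t)"
    by (rule test_integrable(1)[OF N_finite_imp_locint[OF _ Ng] \<phi>]) measurable
  have R: "(\<lambda>n. pair (f (S n)) \<phi> - pair g \<phi>) \<longlonglongrightarrow> 0"
  proof -
    have "((\<lambda>\<alpha>. \<integral>\<^sup>+t\<in>{-A'..A'}. ennreal \<bar>f \<alpha> t - g t\<bar> \<partial>lborel) \<longlongrightarrow> 0) (at_left 1)"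
      using f AB(1) by (intro local_tendsto_0 lim) (auto elim!: eventually_mono)
    from tendsto_mult_ennreal[OF tendsto_const[of "ennreal B"] limS[OF this]]
    have l: "(\<lambda>n. ennreal B * (\<integral>\<^sup>+t\<in>{-A'..A'}. ennreal \<bar>f (S n) t - g t\<bar> \<partial>lborel)) \<longlonglongrightarrow> 0" by simp
    have "\<forall>\<^sub>F n in sequentially. ennreal \<bar>pair (f (S n)) \<phi> - pair g \<phi>\<bar> \<le> ennreal B * (\<integral>\<^sup>+t\<in>{-A'..A'}. ennreal \<bar>f (S n) t - g t\<bar> \<partial>lborel)"
      using evS[OF f]
    proof eventually_elim
      case (elim n)
      then have [measurable]: "f (S n) \<in> borel_measurable borel" by simp
      have "integrable lborel (\<lambda>t. f (S n) t * \<phi> t)"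
        using elim by (intro test_integrable(1)[OF N_finite_imp_locint \<phi>]) auto
      then have "pair (f (S n)) \<phi> - pair g \<phi> = (LINT t|lborel. (f (S n) t - g t) * \<phi> t)"
        using g_int by (simp add: left_diff_distrib)
      also have "ennreal \<bar>\<dots>\<bar> \<le> (\<integral>\<^sup>+t. ennreal \<bar>(f (S n) t - g t) * \<phi> t\<bar> \<partial>lborel)" by (rule ennreal_abs_integral_le)
      also have "\<dots> \<le> (\<integral>\<^sup>+t. ennreal B * (ennreal \<bar>f (S n) t - g t\<bar> * indicator {-A'..A'} t) \<partial>lborel)"
      proof (rule nn_integral_mono)
        fix t
        have "\<bar>(f (S n) t - g t) * \<phi> t\<bar> \<le> \<bar>f (S n) t - g t\<bar> * (B * indicator {-A'..A'} t)"
          unfolding abs_mult by (intro mult_left_mono AB) auto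
        then have "ennreal \<bar>(f (S n) t - g t) * \<phi> t\<bar> \<le> ennreal (\<bar>f (S n) t - g t\<bar> * (B * indicator {-A'..A'} t))" by (rule ennreal_leI)
        also have "\<dots> = ennreal B * (ennreal \<bar>f (S n) t - g t\<bar> * indicator {-A'..A'} t)"
          using AB(2) by (simp add: ennreal_mult mult_ac split: split_indicator)
        finally show "ennreal \<bar>(f (S n) t - g t) * \<phi> t\<bar> \<le> ennreal B * (ennreal \<bar>f (S n) t - g t\<bar> * indicator {-A'..A'} t)" .
      qed
      also have "\<dots> = ennreal B * (\<integral>\<^sup>+t\<in>{-A'..A'}. ennreal \<bar>f (S n) t - g t\<bar> \<partial>lborel)" by (rule nn_integral_cmult) measurable
      finally show ?case .
    qed
    then have "(\<lambda>n. ennreal \<bar>pair (f (S n)) \<phi> - pair g \<phi>\<bar>) \<longlonglongrightarrow> 0"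
      by (intro tendsto_sandwich[OF _ _ tendsto_const l]) auto
    then have "(\<lambda>n. \<bar>pair (f (S n)) \<phi> - pair g \<phi>\<bar>) \<longlonglongrightarrow> 0"
      using tendsto_ennrealD[of "\<lambda>n. \<bar>pair (f (S n)) \<phi> - pair g \<phi>\<bar>" 0] by simp
    then show ?thesis by (rule tendsto_rabs_zero_cancel)
  qed
  have "\<forall>\<^sub>F n in sequentially. pair (f (S n)) \<phi> - pair g \<phi> =
      (LINT t|lborel. u t * Dright (S n) \<phi> t) - pair g \<phi>"
    using evS[OF f]
  proof eventually_elim
    case (elim n)
    then have "(LINT t|lborel. u t * Dright (S n) \<phi> t) = pair (f (S n)) \<phi>" using \<phi> by blast
    then show ?case by (rule arg_cong[OF sym])
  qed
  from Lim_transform_eventually[OF R this]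
  have c1: "(\<lambda>n. (LINT t|lborel. u t * Dright (S n) \<phi> t) - pair g \<phi>) \<longlonglongrightarrow> 0" .
  have c2: "(\<lambda>n. (LINT t|lborel. u t * Dright (S n) \<phi> t) - pair g \<phi>) \<longlonglongrightarrow> (LINT t|lborel. u t * (- deriv \<phi> t)) - pair g \<phi>"
    by (rule tendsto_diff[OF L tendsto_const])
  have "(LINT t|lborel. u t * (- deriv \<phi> t)) - pair g \<phi> = 0"
    by (rule LIMSEQ_unique[OF c2 c1])
  then show ?thesis by simp
qed

lemma Dleft_locint:
  assumes [measurable]: "u \<in> borel_measurable borel" and Nu: "N (eabs u) < top"
    and \<alpha>: "0 < \<alpha>" "\<alpha> < 1" and near: "\<And>a b. (\<integral>\<^sup>+t\<in>{a..b}. near \<alpha> u t \<partial>lborel) < top"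
  shows "locint (Dleft_pointwise \<alpha> u)"
proof (rule locintI)
  fix a b
  let ?u = "\<lambda>t. ennreal \<bar>u t\<bar>"
  have "ennreal \<bar>Dleft_pointwise \<alpha> u t\<bar> \<le> ennreal (coef0 \<alpha>) * (near \<alpha> u t + ?u t + far \<alpha> ?u t)" for t
  proof -
    have "ennreal \<bar>Dleft_pointwise \<alpha> u t\<bar> = ennreal (coef0 \<alpha>) * ennreal \<bar>LINT s:{0<..}|lborel. hker \<alpha> s * (u t - u (t - s))\<bar>"
      using coef_nonneg[OF \<alpha>] by (simp add: Dleft_pointwise_eq coef0_def[symmetric] abs_mult ennreal_mult)
    also have "\<dots> \<le> ennreal (coef0 \<alpha>) * (\<integral>\<^sup>+s. ennreal \<bar>indicat_real {0<..} s *\<^sub>R (hker \<alpha> s * (u t - u (t - s)))\<bar> \<partial>lborel)"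
      unfolding set_lebesgue_integral_def by (intro mult_left_mono ennreal_abs_integral_le) simp
    also have "(\<integral>\<^sup>+s. ennreal \<bar>indicat_real {0<..} s *\<^sub>R (hker \<alpha> s * (u t - u (t - s)))\<bar> \<partial>lborel) = (\<integral>\<^sup>+s\<in>{0<..}. ennreal (hker \<alpha> s * \<bar>u t - u (t - s)\<bar>) \<partial>lborel)"
      using \<alpha> by (intro nn_integral_cong) (auto simp: abs_mult split: split_indicator)
    also have "\<dots> \<le> near \<alpha> u t + ?u t + far \<alpha> ?u t" using \<alpha> by (intro increment_le) auto
    finally show ?thesis by (simp add: mult_left_mono)
  qed
  then have "(\<integral>\<^sup>+t\<in>{a..b}. ennreal \<bar>Dleft_pointwise \<alpha> u t\<bar> \<partial>lborel) \<le> (\<integral>\<^sup>+t. ennreal (coef0 \<alpha>) * (near \<alpha> u t * indicator {a..b} t + ?u t * indicator {a..b} t + far \<alpha> ?u t * indicator {a..b} t) \<partial>lborel)"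
    by (intro nn_integral_mono) (auto split: split_indicator)
  also have "\<dots> = ennreal (coef0 \<alpha>) * ((\<integral>\<^sup>+t\<in>{a..b}. near \<alpha> u t \<partial>lborel) + (\<integral>\<^sup>+t\<in>{a..b}. ?u t \<partial>lborel) + (\<integral>\<^sup>+t\<in>{a..b}. far \<alpha> ?u t \<partial>lborel))"
    by (simp add: nn_integral_cmult nn_integral_add)
  also have "\<dots> < top"
    using near N_finite_imp_local[OF _ Nu, of a b] N_finite_imp_local[OF _ N_far_finite[OF _ Nu], of \<alpha> a b] \<alpha>
    by (simp add: ennreal_mult_less_top ennreal_add_less_top)
  finally show "(\<integral>\<^sup>+t\<in>{a..b}. ennreal \<bar>Dleft_pointwise \<alpha> u t\<bar> \<partial>lborel) < top" .
qed measurable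

lemma near_scale:
  assumes [measurable]: "u \<in> borel_measurable borel" and \<alpha>: "0 < \<alpha>" "\<alpha> \<le> \<alpha>1"
  shows "near \<alpha> u t \<le> ennreal (\<alpha> / \<alpha>1) * near \<alpha>1 u t"
proof -
  have "near \<alpha> u t \<le> (\<integral>\<^sup>+s. ennreal (\<alpha> / \<alpha>1) * (ennreal (hker \<alpha>1 s * \<bar>u t - u (t - s)\<bar>) * indicator {0<..1} s) \<partial>lborel)"
    unfolding near_def
  proof (rule nn_integral_mono)
    fix s
    show "ennreal (hker \<alpha> s * \<bar>u t - u (t - s)\<bar>) * indicator {0<..1} s \<le> ennreal (\<alpha> / \<alpha>1) * (ennreal (hker \<alpha>1 s * \<bar>u t - u (t - s)\<bar>) * indicator {0<..1} s)"
    proof (cases "0 < s \<and> s \<le> 1")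
      case True
      have "s powr (- 1 - \<alpha>) \<le> s powr (- 1 - \<alpha>1)" using True \<alpha> by (intro powr_mono') auto
      then have "hker \<alpha> s * \<bar>u t - u (t - s)\<bar> \<le> \<alpha> * s powr (- 1 - \<alpha>1) * \<bar>u t - u (t - s)\<bar>"
        using \<alpha> by (intro mult_right_mono mult_left_mono) auto
      also have "\<dots> = \<alpha> / \<alpha>1 * (hker \<alpha>1 s * \<bar>u t - u (t - s)\<bar>)" using \<alpha> by simp
      finally have "ennreal (hker \<alpha> s * \<bar>u t - u (t - s)\<bar>) \<le> ennreal (\<alpha> / \<alpha>1 * (hker \<alpha>1 s * \<bar>u t - u (t - s)\<bar>))"
        by (rule ennreal_leI)
      also have "\<dots> = ennreal (\<alpha> / \<alpha>1) * ennreal (hker \<alpha>1 s * \<bar>u t - u (t - s)\<bar>)"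
        using \<alpha> by (intro ennreal_mult) auto
      finally show ?thesis using True by simp
    qed (auto split: split_indicator)
  qed
  also have "\<dots> = ennreal (\<alpha> / \<alpha>1) * near \<alpha>1 u t" unfolding near_def by (rule nn_integral_cmult) measurable
  finally show ?thesis .
qed

lemma AE_of_local_finite:
  fixes h :: "real \<Rightarrow> ennreal"
  assumes [measurable]: "h \<in> borel_measurable borel" and "\<And>a b. (\<integral>\<^sup>+t\<in>{a..b}. h t \<partial>lborel) < top"
  shows "AE t in lborel. h t < (top::ennreal)"
proof -
  have "AE t in lborel. \<forall>n::nat. h t * indicator {-real n..real n} t \<noteq> top"
    unfolding AE_all_countable
  proof
    fix n :: nat
    show "AE t in lborel. h t * indicator {-real n..real n} t \<noteq> top"
      using assms(2)[of "-real n" "real n"] nn_integral_PInf_AE[of "\<lambda>t. h t * indicator {-real n..real n} t" lborel] by auto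
  qed
  then show ?thesis
  proof eventually_elim
    case (elim t)
    obtain n :: nat where "\<bar>t\<bar> \<le> real n" using real_arch_simple by blast
    then have "t \<in> {-real n..real n}" by (simp add: abs_le_iff)
    then have "h t * indicator {-real n..real n} t = h t" by simp
    then show ?case using elim by (metis less_top)
  qed
qed

lemma far_finite:
  assumes [measurable]: "g \<in> borel_measurable borel" and "N g < top" "0 < \<alpha>" "\<alpha> \<le> 1"
  shows "far \<alpha> g t < top"
  using far_bounded[OF assms(1,2), of t] assms(3,4) by (metis ennreal_less_top le_less_trans)

text \<open>For \<open>\<alpha> \<le> \<alpha>1\<close> the near part is at most \<open>\<alpha>/\<alpha>1\<close> times the near part of order \<open>\<alpha>1\<close>, which is almost
everywhere finite; so it disappears in the limit, as does the far part, and u remains.\<close>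

lemma small_order_limit:
  assumes [measurable]: "u \<in> borel_measurable borel" "v \<in> borel_measurable borel"
    and Nu: "N (eabs u) < top" and Nv: "N (eabs v) < top"
    and \<beta>: "0 < \<beta>" "\<beta> < 1" and \<alpha>1: "0 < \<alpha>1" "\<alpha>1 < \<beta>"
    and weak: "\<And>\<psi>. test \<psi> \<Longrightarrow> pair u (Dright \<beta> \<psi>) = pair v \<psi>"
  shows "AE t in lborel. ((\<lambda>\<alpha>. Dleft_pointwise \<alpha> u t) \<longlongrightarrow> u t) (at_right 0)"
    and "\<And>\<alpha>. 0 < \<alpha> \<Longrightarrow> \<alpha> \<le> \<alpha>1 \<Longrightarrow> locint (Dleft_pointwise \<alpha> u)"
    and "\<And>\<alpha> \<phi>. 0 < \<alpha> \<Longrightarrow> \<alpha> \<le> \<alpha>1 \<Longrightarrow> test \<phi> \<Longrightarrow> pair u (Dright \<alpha> \<phi>) = pair (Dleft_pointwise \<alpha> u) \<phi>"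
proof -
  let ?u = "\<lambda>t. ennreal \<bar>u t\<bar>"
  have near1: "(\<integral>\<^sup>+t\<in>{a..b}. near \<alpha>1 u t \<partial>lborel) < top" for a b
    by (rule near_locally_finite[OF assms(1,2) Nu Nv \<beta> \<alpha>1]) (rule weak)
  have near: "(\<integral>\<^sup>+t\<in>{a..b}. near \<alpha> u t \<partial>lborel) < top" if "0 < \<alpha>" "\<alpha> \<le> \<alpha>1" for \<alpha> a b
  proof -
    have "(\<integral>\<^sup>+t\<in>{a..b}. near \<alpha> u t \<partial>lborel) \<le> (\<integral>\<^sup>+t. ennreal (\<alpha> / \<alpha>1) * (near \<alpha>1 u t * indicator {a..b} t) \<partial>lborel)"
      using near_scale[OF assms(1) that] by (intro nn_integral_mono) (auto split: split_indicator)
    also have "\<dots> = ennreal (\<alpha> / \<alpha>1) * (\<integral>\<^sup>+t\<in>{a..b}. near \<alpha>1 u t \<partial>lborel)" by (rule nn_integral_cmult) measurable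
    also have "\<dots> < top" using near1 by (simp add: ennreal_mult_less_top)
    finally show ?thesis .
  qed
  show "locint (Dleft_pointwise \<alpha> u)" if "0 < \<alpha>" "\<alpha> \<le> \<alpha>1" for \<alpha>
    using that \<alpha>1 \<beta> by (intro Dleft_locint Nu near) auto
  show "pair u (Dright \<alpha> \<phi>) = pair (Dleft_pointwise \<alpha> u) \<phi>" if \<alpha>: "0 < \<alpha>" "\<alpha> \<le> \<alpha>1" and \<phi>: "test \<phi>" for \<alpha> \<phi>
  proof (rule coincidence(1)[OF assms(1) Nu \<alpha>(1) _ test_in_S_minus[OF \<phi>]])
    show "\<alpha> < 1" using \<alpha> \<alpha>1 \<beta> by simp
    have [measurable]: "\<phi> \<in> borel_measurable borel" using test_measurable[OF \<phi>] by simp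
    obtain A B where AB: "0 < A" "0 \<le> B" "\<And>t. \<bar>\<phi> t\<bar> \<le> B * indicator {-A..A} t"
      using test_bounded[OF \<phi>, of 0] by (metis funpow_0)
    have "(\<integral>\<^sup>+t. near \<alpha> u t * ennreal \<bar>\<phi> t\<bar> \<partial>lborel) \<le> (\<integral>\<^sup>+t. ennreal B * (near \<alpha> u t * indicator {-A..A} t) \<partial>lborel)"
    proof (rule nn_integral_mono)
      fix t
      have "ennreal \<bar>\<phi> t\<bar> \<le> ennreal (B * indicator {-A..A} t)" using AB(3) by (rule ennreal_leI)
      also have "\<dots> = ennreal B * indicator {-A..A} t" by (simp split: split_indicator)
      finally have "near \<alpha> u t * ennreal \<bar>\<phi> t\<bar> \<le> near \<alpha> u t * (ennreal B * indicator {-A..A} t)" by (rule mult_left_mono) simp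
      then show "near \<alpha> u t * ennreal \<bar>\<phi> t\<bar> \<le> ennreal B * (near \<alpha> u t * indicator {-A..A} t)" by (simp add: mult_ac)
    qed
    also have "\<dots> = ennreal B * (\<integral>\<^sup>+t\<in>{-A..A}. near \<alpha> u t \<partial>lborel)" by (rule nn_integral_cmult) measurable
    also have "\<dots> < top" using near[OF \<alpha>] by (simp add: ennreal_mult_less_top)
    finally show "(\<integral>\<^sup>+t. near \<alpha> u t * ennreal \<bar>\<phi> t\<bar> \<partial>lborel) < top" .
  qed
  have ev: "\<forall>\<^sub>F \<alpha> in at_right (0::real). 0 < \<alpha> \<and> \<alpha> < \<alpha>1"
    using \<alpha>1 by (intro eventually_at_rightI[of _ \<alpha>1]) auto
  show "AE t in lborel. ((\<lambda>\<alpha>. Dleft_pointwise \<alpha> u t) \<longlongrightarrow> u t) (at_right 0)"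
  proof (rule AE_mp[OF AE_of_local_finite[OF _ near1]], measurable, intro AE_I2 impI)
    fix t assume fin: "near \<alpha>1 u t < top"
    define J where "J \<alpha> = (LINT s:{0<..1}|lborel. hker \<alpha> s * (u t - u (t - s)))" for \<alpha>
    have near_fin: "near \<alpha> u t < top" if "0 < \<alpha>" "\<alpha> < \<alpha>1" for \<alpha>
      using near_scale[OF assms(1) that(1), of \<alpha>1 t] that fin by (auto intro: le_less_trans simp: ennreal_mult_less_top)
    have J: "(J \<longlongrightarrow> 0) (at_right 0)"
    proof -
      have "((\<lambda>\<alpha>. \<alpha> / \<alpha>1) \<longlongrightarrow> 0 / \<alpha>1) (at_right 0)" using \<alpha>1 by (intro tendsto_intros) auto
      then have "((\<lambda>\<alpha>. ennreal (\<alpha> / \<alpha>1)) \<longlongrightarrow> ennreal 0) (at_right 0)" by (intro tendsto_ennrealI) simp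
      then have "((\<lambda>\<alpha>. ennreal (\<alpha> / \<alpha>1) * near \<alpha>1 u t) \<longlongrightarrow> ennreal 0 * near \<alpha>1 u t) (at_right 0)"
        using fin by (intro tendsto_mult_ennreal tendsto_const) auto
      then have l: "((\<lambda>\<alpha>. ennreal (\<alpha> / \<alpha>1) * near \<alpha>1 u t) \<longlongrightarrow> 0) (at_right 0)" by simp
      have "\<forall>\<^sub>F \<alpha> in at_right 0. ennreal \<bar>J \<alpha>\<bar> \<le> ennreal (\<alpha> / \<alpha>1) * near \<alpha>1 u t"
        using ev
      proof eventually_elim
        case (elim \<alpha>)
        have "ennreal \<bar>J \<alpha>\<bar> \<le> (\<integral>\<^sup>+s. ennreal \<bar>indicat_real {0<..1} s *\<^sub>R (hker \<alpha> s * (u t - u (t - s)))\<bar> \<partial>lborel)"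
          unfolding J_def set_lebesgue_integral_def by (rule ennreal_abs_integral_le)
        also have "\<dots> = near \<alpha> u t" unfolding near_def using elim
          by (intro nn_integral_cong) (auto simp: abs_mult split: split_indicator)
        also have "\<dots> \<le> ennreal (\<alpha> / \<alpha>1) * near \<alpha>1 u t" using elim by (intro near_scale) auto
        finally show ?case .
      qed
      then have "((\<lambda>\<alpha>. ennreal \<bar>J \<alpha>\<bar>) \<longlongrightarrow> 0) (at_right 0)"
        by (intro tendsto_sandwich[OF _ _ tendsto_const l]) auto
      then show ?thesis using tendsto_ennrealD[of "\<lambda>\<alpha>. \<bar>J \<alpha>\<bar>" 0] by (auto intro: tendsto_rabs_zero_cancel)
    qed
    have far_mean: "((\<lambda>\<alpha>. far_mean \<alpha> u t) \<longlongrightarrow> 0) (at_right 0)"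
    proof -
      have "\<forall>\<^sub>F \<alpha> in at_right 0. ennreal \<bar>far_mean \<alpha> u t\<bar> \<le> far \<alpha> ?u t"
        using ev by eventually_elim (auto intro: far_mean_le)
      then have "((\<lambda>\<alpha>. ennreal \<bar>far_mean \<alpha> u t\<bar>) \<longlongrightarrow> 0) (at_right 0)"
        by (intro tendsto_sandwich[OF _ _ tendsto_const far_tendsto_0[OF _ Nu]]) auto
      then show ?thesis using tendsto_ennrealD[of "\<lambda>\<alpha>. \<bar>far_mean \<alpha> u t\<bar>" 0] by (auto intro: tendsto_rabs_zero_cancel)
    qed
    have "((\<lambda>\<alpha>. coef0 \<alpha> * (J \<alpha> + (u t - far_mean \<alpha> u t))) \<longlongrightarrow> 1 * (0 + (u t - 0))) (at_right 0)"
      by (intro tendsto_intros coef_tendsto J far_mean)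
    then have "((\<lambda>\<alpha>. coef0 \<alpha> * (J \<alpha> + (u t - far_mean \<alpha> u t))) \<longlongrightarrow> u t) (at_right 0)" by simp
    then show "((\<lambda>\<alpha>. Dleft_pointwise \<alpha> u t) \<longlongrightarrow> u t) (at_right 0)"
    proof (rule Lim_transform_eventually)
      show "\<forall>\<^sub>F \<alpha> in at_right 0. coef0 \<alpha> * (J \<alpha> + (u t - far_mean \<alpha> u t)) = Dleft_pointwise \<alpha> u t"
        using ev
      proof eventually_elim
        case (elim \<alpha>)
        have "far \<alpha> ?u t < top" using elim \<alpha>1 \<beta> by (intro far_finite Nu) auto
        then show ?case using Dleft_pointwise_split[OF assms(1), of \<alpha> t] near_fin[of \<alpha>] elim by (simp add: coef0_def J_def)
      qed
    qed
  qed
qed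

text \<open>Apply \<open>small_order_limit\<close> with the order \<open>\<beta>\<close> of one member of the family. Along a sequence of orders,
\<open>f\<close> converges to u almost everywhere and to g in the mean on bounded intervals, so u = g by Fatou's
lemma.\<close>

lemma small_order_identify:
  assumes [measurable]: "u \<in> borel_measurable borel" "g \<in> borel_measurable borel"
    and Nu: "N (eabs u) < top"
    and f: "\<forall>\<^sub>F \<alpha> in at_right 0. f \<alpha> \<in> borel_measurable borel \<and> N (eabs (f \<alpha>)) < top \<and>
       (\<forall>\<phi>. test \<phi> \<longrightarrow> pair u (Dright \<alpha> \<phi>) = pair (f \<alpha>) \<phi>)"
    and lim: "((\<lambda>\<alpha>. N (\<lambda>t. ennreal \<bar>f \<alpha> t - g t\<bar>)) \<longlongrightarrow> 0) (at_right 0)"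
  shows "AE t in lborel. g t = u t" "AE t in lborel. ((\<lambda>\<alpha>. Dleft_pointwise \<alpha> u t) \<longlongrightarrow> u t) (at_right 0)"
    "\<exists>\<alpha>1>0. \<forall>\<alpha>. 0 < \<alpha> \<longrightarrow> \<alpha> < \<alpha>1 \<longrightarrow> (AE t in lborel. f \<alpha> t = Dleft_pointwise \<alpha> u t)"
proof -
  obtain \<delta> where \<delta>: "0 < \<delta>" "\<And>\<alpha>. 0 < \<alpha> \<Longrightarrow> \<alpha> < \<delta> \<Longrightarrow> f \<alpha> \<in> borel_measurable borel \<and> N (eabs (f \<alpha>)) < top \<and>
       (\<forall>\<phi>. test \<phi> \<longrightarrow> pair u (Dright \<alpha> \<phi>) = pair (f \<alpha>) \<phi>)"
    using f by (auto simp: eventually_at_right_field)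
  \<comment> \<open>Halved so that the family is controlled at \<open>\<beta>\<close> itself.\<close>
  define \<beta> where "\<beta> = min \<delta> 1 / 2"
  have \<beta>: "0 < \<beta>" "\<beta> < 1" "\<beta> < \<delta>" using \<delta>(1) by (auto simp: \<beta>_def min_def)
  define \<alpha>1 where "\<alpha>1 = \<beta> / 2"
  have \<alpha>1: "0 < \<alpha>1" "\<alpha>1 < \<beta>" using \<beta> by (auto simp: \<alpha>1_def)
  note f\<beta> = \<delta>(2)[OF \<beta>(1,3)]
  note SO = small_order_limit[OF assms(1) conjunct1[OF f\<beta>] Nu conjunct1[OF conjunct2[OF f\<beta>]] \<beta>(1,2) \<alpha>1]
  have w: "test \<psi> \<Longrightarrow> pair u (Dright \<beta> \<psi>) = (LINT t|lborel. f \<beta> t * \<psi> t)" for \<psi> using f\<beta> by blast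
  show conv: "AE t in lborel. ((\<lambda>\<alpha>. Dleft_pointwise \<alpha> u t) \<longlongrightarrow> u t) (at_right 0)" by (rule SO(1)) (rule w)
  have eq: "AE t in lborel. f \<alpha> t = Dleft_pointwise \<alpha> u t" if \<alpha>: "0 < \<alpha>" "\<alpha> < \<alpha>1" for \<alpha>
  proof (rule locint_ae_eq)
    have fa: "f \<alpha> \<in> borel_measurable borel \<and> N (eabs (f \<alpha>)) < top \<and>
       (\<forall>\<phi>. test \<phi> \<longrightarrow> pair u (Dright \<alpha> \<phi>) = pair (f \<alpha>) \<phi>)"
      using \<alpha> \<alpha>1 \<beta> by (intro \<delta>(2)) auto
    show "locint (f \<alpha>)" using fa by (intro N_finite_imp_locint) auto
    show "locint (Dleft_pointwise \<alpha> u)" using \<alpha> by (intro SO(2) w) auto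
    fix \<phi> assume "test \<phi>"
    then show "pair (f \<alpha>) \<phi> = pair (Dleft_pointwise \<alpha> u) \<phi>"
      using fa SO(3)[OF w \<alpha>(1) less_imp_le[OF \<alpha>(2)]] by auto
  qed
  then show "\<exists>\<alpha>1>0. \<forall>\<alpha>. 0 < \<alpha> \<longrightarrow> \<alpha> < \<alpha>1 \<longrightarrow> (AE t in lborel. f \<alpha> t = Dleft_pointwise \<alpha> u t)" using \<alpha>1(1) by blast
  define S where "S n = \<alpha>1 / (real n + 2)" for n
  have S: "0 < S n" "S n < \<alpha>1" for n using \<alpha>1(1) by (auto simp: S_def field_simps add_pos_nonneg)
  have "S \<longlonglongrightarrow> 0" unfolding S_def
    by (intro tendsto_divide_0[OF tendsto_const] filterlim_at_top_imp_at_infinity filterlim_shift_real)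
  then have fS: "filterlim S (at_right 0) sequentially" using S(1) by (intro filterlim_seq_at_right) auto
  have zero: "(\<integral>\<^sup>+t\<in>{-real n..real n}. ennreal \<bar>u t - g t\<bar> \<partial>lborel) = 0" for n
  proof (cases "n = 0")
    case False
    let ?A = "{-real n..real n}"
    have "((\<lambda>\<alpha>. \<integral>\<^sup>+t\<in>?A. ennreal \<bar>f \<alpha> t - g t\<bar> \<partial>lborel) \<longlongrightarrow> 0) (at_right 0)"
      using f False by (intro local_tendsto_0 lim) (auto elim!: eventually_mono)
    from filterlim_compose[OF this fS] have l0: "(\<lambda>k. \<integral>\<^sup>+t\<in>?A. ennreal \<bar>f (S k) t - g t\<bar> \<partial>lborel) \<longlonglongrightarrow> 0" .
    have e: "(\<integral>\<^sup>+t\<in>?A. ennreal \<bar>f (S k) t - g t\<bar> \<partial>lborel) = (\<integral>\<^sup>+t\<in>?A. ennreal \<bar>Dleft_pointwise (S k) u t - g t\<bar> \<partial>lborel)" for k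
      by (intro nn_integral_cong_AE, use eq[OF S[of k]] in eventually_elim) auto
    have "(\<integral>\<^sup>+t\<in>?A. ennreal \<bar>u t - g t\<bar> \<partial>lborel) = (\<integral>\<^sup>+t. liminf (\<lambda>k. ennreal \<bar>Dleft_pointwise (S k) u t - g t\<bar> * indicator ?A t) \<partial>lborel)"
    proof (rule nn_integral_cong_AE, use conv in eventually_elim)
      case (elim t)
      have "(\<lambda>k. ennreal \<bar>Dleft_pointwise (S k) u t - g t\<bar>) \<longlonglongrightarrow> ennreal \<bar>u t - g t\<bar>"
        by (intro tendsto_ennrealI tendsto_intros filterlim_compose[OF elim fS])
      then have "(\<lambda>k. ennreal \<bar>Dleft_pointwise (S k) u t - g t\<bar> * indicator ?A t) \<longlonglongrightarrow> ennreal \<bar>u t - g t\<bar> * indicator ?A t"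
        by (cases "t \<in> ?A") auto
      then show ?case by (intro lim_imp_Liminf[symmetric]) auto
    qed
    also have "\<dots> \<le> liminf (\<lambda>k. \<integral>\<^sup>+t\<in>?A. ennreal \<bar>Dleft_pointwise (S k) u t - g t\<bar> \<partial>lborel)"
      by (rule nn_integral_liminf) measurable
    also have "\<dots> = 0" using l0 unfolding e by (intro lim_imp_Liminf) auto
    finally show ?thesis by simp
  next
    case True
    have "(\<integral>\<^sup>+t\<in>{0}. ennreal \<bar>u t - g t\<bar> \<partial>lborel) = (\<integral>\<^sup>+t. 0 \<partial>(lborel :: real measure))"
      by (intro nn_integral_cong_AE eventually_mono[OF AE_lborel_singleton[of 0]]) auto
    then show ?thesis using True by simp
  qed
  have "AE t in lborel. \<forall>n::nat. ennreal \<bar>u t - g t\<bar> * indicator {-real n..real n} t = 0"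
    unfolding AE_all_countable
  proof
    fix n show "AE t in lborel. ennreal \<bar>u t - g t\<bar> * indicator {-real n..real n} t = 0"
      using zero[of n] by (subst (asm) nn_integral_0_iff_AE) auto
  qed
  then show "AE t in lborel. g t = u t"
  proof eventually_elim
    case (elim t)
    obtain n :: nat where "\<bar>t\<bar> \<le> real n" using real_arch_simple by blast
    then show ?case using elim[rule_format, of n] by (auto simp: abs_le_iff indicator_def)
  qed
qed

end

section \<open>Borel representatives\<close>

lemma AE_lebesgue_iff: "(AE t in lebesgue. P t) \<longleftrightarrow> (AE t in lborel. P t)"
  by (rule AE_completion_iff)

lemma lebesgue_measurable_AE:
  fixes f g :: "real \<Rightarrow> real"
  assumes "g \<in> borel_measurable borel" "AE t in lborel. f t = g t"
  shows "f \<in> borel_measurable lebesgue"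
proof (rule borel_measurable_AE)
  show "g \<in> borel_measurable lebesgue" using assms(1) by (intro measurable_completion) simp
  show "AE t in lebesgue. g t = f t" using assms(2) by (auto simp: AE_lebesgue_iff elim: eventually_mono)
qed

lemma borel_version:
  fixes f :: "real \<Rightarrow> real"
  assumes "f \<in> borel_measurable lebesgue"
  obtains g where "g \<in> borel_measurable borel" "AE t in lborel. f t = g t"
  using completion_ex_borel_measurable_real[OF assms] by auto

lemma integrable_lebesgue_iff:
  fixes f g :: "real \<Rightarrow> real"
  assumes g: "g \<in> borel_measurable borel" and ae: "AE t in lborel. f t = g t"
  shows "integrable lebesgue f \<longleftrightarrow> integrable lborel g"
proof -
  have "integrable lebesgue f \<longleftrightarrow> integrable lebesgue g"
    by (rule integrable_cong_AE) (use g ae lebesgue_measurable_AE[OF g ae] in \<open>auto simp: AE_lebesgue_iff intro: measurable_completion\<close>)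
  also have "\<dots> \<longleftrightarrow> integrable lborel g" by (rule integrable_completion) (use g in simp)
  finally show ?thesis .
qed

lemma integral_lebesgue_eq:
  fixes f g :: "real \<Rightarrow> real"
  assumes g: "g \<in> borel_measurable borel" and ae: "AE t in lborel. f t = g t"
  shows "(LINT t|lebesgue. f t) = (LINT t|lborel. g t)"
proof -
  have "(LINT t|lebesgue. f t) = (LINT t|lebesgue. g t)"
    by (rule integral_cong_AE) (use g ae lebesgue_measurable_AE[OF g ae] in \<open>auto simp: AE_lebesgue_iff intro: measurable_completion\<close>)
  also have "\<dots> = (LINT t|lborel. g t)" by (rule integral_completion) (use g in simp)
  finally show ?thesis .
qed

lemma locally_integrable_iff:
  assumes g: "g \<in> borel_measurable borel" and ae: "AE t in lborel. f t = g t"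
  shows "locally_integrable f \<longleftrightarrow> locint g"
proof -
  have "f absolutely_integrable_on {a..b} \<longleftrightarrow> set_integrable lborel {a..b} g" for a b
    unfolding set_integrable_def
    by (rule integrable_lebesgue_iff) (use g ae in \<open>auto elim: eventually_mono\<close>)
  then show ?thesis using g by (auto simp: locally_integrable_def locint_def)
qed

lemma locally_integrable_measurable:
  assumes "locally_integrable f"
  shows "f \<in> borel_measurable lebesgue"
proof (rule borel_measurable_LIMSEQ_real)
  show "(\<lambda>t. indicat_real {- real n..real n} t *\<^sub>R f t) \<in> borel_measurable lebesgue" for n
    using assms unfolding locally_integrable_def set_integrable_def by blast
  fix t :: real
  obtain n :: nat where n: "\<bar>t\<bar> \<le> real n" using real_arch_simple by blast
  have "\<forall>\<^sub>F m in sequentially. f t = indicat_real {- real m..real m} t *\<^sub>R f t"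
    using eventually_ge_at_top[of n]
  proof eventually_elim
    case (elim m)
    then have "real n \<le> real m" by simp
    then have "t \<in> {- real m..real m}" using n by (auto simp: abs_le_iff)
    then show ?case by simp
  qed
  then show "(\<lambda>n. indicat_real {- real n..real n} t *\<^sub>R f t) \<longlonglongrightarrow> f t"
    by (rule Lim_transform_eventually[OF tendsto_const])
qed

lemma Dleft_integrand_ae:
  assumes ae: "AE \<tau> in lborel. u \<tau> = w \<tau>" and t: "u t = w t"
  shows "AE \<tau> in lborel. Dleft_integrand \<alpha> u t \<tau> = Dleft_integrand \<alpha> w t \<tau>"
  using ae by eventually_elim (simp add: Dleft_integrand_def t)

lemma Dleft_integrand_measurable:
  assumes [measurable]: "w \<in> borel_measurable borel"
  shows "Dleft_integrand \<alpha> w t \<in> borel_measurable borel"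
  unfolding Dleft_integrand_def[abs_def] by measurable

lemma Dleft_pointwise_ae:
  assumes w: "w \<in> borel_measurable borel" and ae: "AE \<tau> in lborel. u \<tau> = w \<tau>" and t: "u t = w t"
  shows "Dleft_pointwise \<alpha> u t = Dleft_pointwise \<alpha> w t"
    and "set_integrable lebesgue {..<t} (Dleft_integrand \<alpha> u t) \<longleftrightarrow> set_integrable lebesgue {..<t} (Dleft_integrand \<alpha> w t)"
proof -
  note m = Dleft_integrand_measurable[OF w, of \<alpha> t, measurable]
  have m': "(\<lambda>\<tau>. indicat_real {..<t} \<tau> *\<^sub>R Dleft_integrand \<alpha> w t \<tau>) \<in> borel_measurable borel" by measurable
  have e: "AE \<tau> in lborel. indicat_real {..<t} \<tau> *\<^sub>R Dleft_integrand \<alpha> u t \<tau> = indicat_real {..<t} \<tau> *\<^sub>R Dleft_integrand \<alpha> w t \<tau>"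
    using Dleft_integrand_ae[OF ae t, of \<alpha>] by eventually_elim simp
  have "(LINT \<tau>:{..<t}|lebesgue. Dleft_integrand \<alpha> u t \<tau>) = (LINT \<tau>:{..<t}|lebesgue. Dleft_integrand \<alpha> w t \<tau>)"
    unfolding set_lebesgue_integral_def
    using integral_lebesgue_eq[OF m' e] integral_lebesgue_eq[OF m' AE_I2[OF refl]] by simp
  then show "Dleft_pointwise \<alpha> u t = Dleft_pointwise \<alpha> w t" by (simp add: Dleft_pointwise_def)
  show "set_integrable lebesgue {..<t} (Dleft_integrand \<alpha> u t) \<longleftrightarrow> set_integrable lebesgue {..<t} (Dleft_integrand \<alpha> w t)"
    unfolding set_integrable_def
    using integrable_lebesgue_iff[OF m' e] integrable_lebesgue_iff[OF m' AE_I2[OF refl]] by simp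
qed

lemma coincides_with_iff:
  assumes [measurable]: "w \<in> borel_measurable borel" "g \<in> borel_measurable borel"
    and u: "AE t in lborel. u t = w t" and f: "AE t in lborel. f t = g t"
  shows "coincides_with (Dleft \<alpha> (distr_of u)) f \<longleftrightarrow>
    (\<forall>\<phi>\<in>S_minus. integrable lborel (\<lambda>t. g t * \<phi> t) \<and> pair w (Dright \<alpha> \<phi>) = pair g \<phi>)"
  unfolding coincides_with_def Dleft_def distr_of_def
proof (rule ball_cong[OF refl])
  fix \<phi> assume "\<phi> \<in> S_minus"
  then have [measurable]: "\<phi> \<in> borel_measurable borel" by (rule S_minus_measurable)
  have e: "AE t in lborel. u t * Dright \<alpha> \<phi> t = w t * Dright \<alpha> \<phi> t" "AE t in lborel. f t * \<phi> t = g t * \<phi> t"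
    using u f by (auto elim: eventually_mono)
  have m: "(\<lambda>t. w t * Dright \<alpha> \<phi> t) \<in> borel_measurable borel" "(\<lambda>t. g t * \<phi> t) \<in> borel_measurable borel" by measurable
  show "(integrable lebesgue (\<lambda>t. f t * \<phi> t) \<and> (LINT t|lebesgue. u t * Dright \<alpha> \<phi> t) = (LINT t|lebesgue. f t * \<phi> t)) \<longleftrightarrow>
    (integrable lborel (\<lambda>t. g t * \<phi> t) \<and> pair w (Dright \<alpha> \<phi>) = pair g \<phi>)"
    using integral_lebesgue_eq[OF m(1) e(1)] integral_lebesgue_eq[OF m(2) e(2)] integrable_lebesgue_iff[OF m(2) e(2)] by simp
qed

lemma has_weak_deriv_iff:
  assumes [measurable]: "w \<in> borel_measurable borel" "g \<in> borel_measurable borel"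
    and u: "AE t in lborel. u t = w t" and v: "AE t in lborel. v t = g t"
  shows "has_weak_deriv u v \<longleftrightarrow> locint w \<and> locint g \<and>
    (\<forall>\<phi>. test \<phi> \<longrightarrow> pair w (deriv \<phi>) = - pair g \<phi>)"
proof -
  have "(LINT t|lebesgue. u t * deriv \<phi> t) = pair w (deriv \<phi>)"
    "(LINT t|lebesgue. v t * \<phi> t) = pair g \<phi>" if "test \<phi>" for \<phi>
  proof -
    note [measurable] = test_measurable[OF that]
    show "(LINT t|lebesgue. u t * deriv \<phi> t) = pair w (deriv \<phi>)"
      using u by (intro integral_lebesgue_eq) (measurable, auto elim: eventually_mono)
    show "(LINT t|lebesgue. v t * \<phi> t) = pair g \<phi>"
      using v by (intro integral_lebesgue_eq) (measurable, auto elim: eventually_mono)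
  qed
  then show ?thesis
    unfolding has_weak_deriv_def test_def[symmetric] locally_integrable_iff[OF assms(1) u] locally_integrable_iff[OF assms(2) v] by auto
qed

locale lebesgue_weight = left_weight +
  fixes \<omega> :: "real \<Rightarrow> real"
  assumes \<omega>_measurable [measurable]: "\<omega> \<in> borel_measurable lebesgue"
    and \<omega>_ae: "AE t in lborel. \<omega> t = W t"
begin

lemma nn_integral_weighted:
  assumes [measurable]: "f \<in> borel_measurable lebesgue"
  shows "(\<integral>\<^sup>+t. f t \<partial>weighted \<omega>) = (\<integral>\<^sup>+t. f t * ennreal (W t) \<partial>lborel)"
proof -
  have "(\<integral>\<^sup>+t. f t \<partial>weighted \<omega>) = (\<integral>\<^sup>+t. ennreal (\<omega> t) * f t \<partial>lebesgue)"
    unfolding weighted_def by (rule nn_integral_density) measurable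
  also have "\<dots> = (\<integral>\<^sup>+t. ennreal (\<omega> t) * f t \<partial>lborel)" by simp
  also have "\<dots> = (\<integral>\<^sup>+t. f t * ennreal (W t) \<partial>lborel)"
    using \<omega>_ae by (intro nn_integral_cong_AE) (auto simp: mult.commute elim: eventually_mono)
  finally show ?thesis .
qed

lemma nn_integral_powr_weighted:
  assumes [measurable]: "f \<in> borel_measurable lebesgue"
  shows "(\<integral>\<^sup>+t. ennreal (\<bar>f t\<bar> powr p) \<partial>weighted \<omega>) = N (eabs f)"
  unfolding N_def by (subst nn_integral_weighted) (auto simp: epow_ennreal)

lemma Lp_iff: "f \<in> Lp p \<omega> \<longleftrightarrow> f \<in> borel_measurable lebesgue \<and> N (eabs f) < top"
proof (cases "f \<in> borel_measurable lebesgue")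
  case True
  note [measurable] = True
  have "(\<lambda>t. \<bar>f t\<bar> powr p) \<in> borel_measurable (weighted \<omega>)" unfolding weighted_def by measurable
  then have "integrable (weighted \<omega>) (\<lambda>t. \<bar>f t\<bar> powr p) \<longleftrightarrow> (\<integral>\<^sup>+t. ennreal (\<bar>f t\<bar> powr p) \<partial>weighted \<omega>) < top"
    by (simp add: integrable_iff_bounded)
  then show ?thesis using True by (simp add: Lp_def nn_integral_powr_weighted)
qed (simp add: Lp_def)

lemma Lp_norm_eq:
  assumes [measurable]: "f \<in> borel_measurable lebesgue"
  shows "Lp_norm p \<omega> f = enn2real (N (eabs f)) powr (1 / p)"
proof -
  have m: "(\<lambda>t. \<bar>f t\<bar> powr p) \<in> borel_measurable (weighted \<omega>)" unfolding weighted_def by measurable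
  have "(LINT t|weighted \<omega>. \<bar>f t\<bar> powr p) = enn2real (\<integral>\<^sup>+t. ennreal (\<bar>f t\<bar> powr p) \<partial>weighted \<omega>)"
    by (rule integral_eq_nn_integral[OF m]) (rule AE_I2, rule powr_ge_zero)
  then show ?thesis unfolding Lp_norm_def by (simp only: nn_integral_powr_weighted[OF assms])
qed

lemma Lp_version:
  assumes "f \<in> Lp p \<omega>"
  obtains g where "g \<in> borel_measurable borel" "AE t in lborel. f t = g t" "N (eabs g) < top"
proof -
  obtain g where g: "g \<in> borel_measurable borel" "AE t in lborel. f t = g t"
    using assms by (auto simp: Lp_iff intro: borel_version)
  have "N (eabs f) = N (eabs g)" using g(2) by (intro N_cong) (auto elim: eventually_mono)
  then show thesis using that g assms by (auto simp: Lp_iff)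
qed

lemma Lp_I:
  assumes "g \<in> borel_measurable borel" "AE t in lborel. f t = g t" "N (eabs g) < top"
  shows "f \<in> Lp p \<omega>"
proof -
  have "N (eabs f) = N (eabs g)" using assms(2) by (intro N_cong) (auto elim: eventually_mono)
  then show ?thesis using assms(3) lebesgue_measurable_AE[OF assms(1,2)] by (simp add: Lp_iff)
qed

lemma Lp_diff_finite:
  assumes "f \<in> Lp p \<omega>" "g \<in> Lp p \<omega>"
  shows "N (\<lambda>t. ennreal \<bar>f t - g t\<bar>) < top"
proof -
  obtain f' where f': "f' \<in> borel_measurable borel" "AE t in lborel. f t = f' t" "N (eabs f') < top"
    using Lp_version[OF assms(1)] .
  obtain g' where g': "g' \<in> borel_measurable borel" "AE t in lborel. g t = g' t" "N (eabs g') < top"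
    using Lp_version[OF assms(2)] .
  note [measurable] = f'(1) g'(1)
  have "N (\<lambda>t. ennreal \<bar>f t - g t\<bar>) \<le> N (\<lambda>t. ennreal \<bar>f' t\<bar> + ennreal \<bar>g' t\<bar>)"
  proof (rule N_mono, use f'(2) g'(2) in eventually_elim)
    case (elim t)
    then show ?case by (simp flip: ennreal_plus add: ennreal_leI abs_triangle_ineq4)
  qed
  also have "\<dots> \<le> ennreal (2 powr p) * (N (eabs f') + N (eabs g'))" by (rule N_add) measurable
  also have "\<dots> < top" using f'(3) g'(3) by (simp add: ennreal_mult_less_top)
  finally show ?thesis .
qed

lemma Lp_tendsto_iff:
  "Lp_tendsto p \<omega> f g F \<longleftrightarrow> g \<in> Lp p \<omega> \<and> (\<forall>\<^sub>F i in F. f i \<in> Lp p \<omega>) \<and> ((\<lambda>i. N (\<lambda>t. ennreal \<bar>f i t - g t\<bar>)) \<longlongrightarrow> 0) F"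
proof -
  have "((\<lambda>i. Lp_norm p \<omega> (\<lambda>t. f i t - g t)) \<longlongrightarrow> 0) F \<longleftrightarrow> ((\<lambda>i. N (\<lambda>t. ennreal \<bar>f i t - g t\<bar>)) \<longlongrightarrow> 0) F"
    if g: "g \<in> Lp p \<omega>" and f: "\<forall>\<^sub>F i in F. f i \<in> Lp p \<omega>"
  proof -
    let ?n = "\<lambda>i. enn2real (N (\<lambda>t. ennreal \<bar>f i t - g t\<bar>))"
    have e1: "\<forall>\<^sub>F i in F. Lp_norm p \<omega> (\<lambda>t. f i t - g t) = ?n i powr (1 / p)"
      using f by eventually_elim (rule Lp_norm_eq, use g in \<open>auto simp: Lp_def\<close>)
    have e2: "\<forall>\<^sub>F i in F. ?n i = (?n i powr (1 / p)) powr p"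
      using p_pos by (intro always_eventually allI) (simp add: powr_powr)
    have e3: "\<forall>\<^sub>F i in F. N (\<lambda>t. ennreal \<bar>f i t - g t\<bar>) = ennreal (?n i)"
      using f by eventually_elim (use Lp_diff_finite[OF _ g] in simp)
    have "((\<lambda>i. Lp_norm p \<omega> (\<lambda>t. f i t - g t)) \<longlongrightarrow> 0) F \<longleftrightarrow> ((\<lambda>i. ?n i powr (1 / p)) \<longlongrightarrow> 0) F"
      by (rule tendsto_cong[OF e1])
    also have "\<dots> \<longleftrightarrow> (?n \<longlongrightarrow> 0) F"
    proof
      assume "((\<lambda>i. ?n i powr (1 / p)) \<longlongrightarrow> 0) F"
      then have "((\<lambda>i. (?n i powr (1 / p)) powr p) \<longlongrightarrow> 0) F"
        by (rule tendsto_zero_powrI[OF _ tendsto_const _ p_pos(1)]) (simp add: always_eventually)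
      then show "(?n \<longlongrightarrow> 0) F" unfolding tendsto_cong[OF e2] .
    next
      assume "(?n \<longlongrightarrow> 0) F"
      then show "((\<lambda>i. ?n i powr (1 / p)) \<longlongrightarrow> 0) F"
        using p_pos by (intro tendsto_zero_powrI[OF _ tendsto_const]) auto
    qed
    also have "\<dots> \<longleftrightarrow> ((\<lambda>i. ennreal (?n i)) \<longlongrightarrow> ennreal 0) F"
      using tendsto_ennrealI[of ?n 0 F] tendsto_ennrealD[of ?n 0 F] by auto
    also have "\<dots> \<longleftrightarrow> ((\<lambda>i. N (\<lambda>t. ennreal \<bar>f i t - g t\<bar>)) \<longlongrightarrow> 0) F"
      unfolding tendsto_cong[OF e3] by simp
    finally show ?thesis .
  qed
  then show ?thesis unfolding Lp_tendsto_def by blast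
qed

end

section \<open>Sobolev functions and limits in the weighted space\<close>

lemma A_minus_weight:
  assumes p: "1 \<le> p" and A: "\<omega> \<in> A_minus p"
  obtains W C where "lebesgue_weight p W C \<omega>"
proof -
  have \<omega>: "\<And>t. 0 < \<omega> t" "locally_integrable \<omega>" using A by (auto simp: A_minus_def)
  have [measurable]: "\<omega> \<in> borel_measurable lebesgue" by (rule locally_integrable_measurable[OF \<omega>(2)])
  obtain W0 where W0 [measurable]: "W0 \<in> borel_measurable borel" and ae0: "AE t in lborel. \<omega> t = W0 t"
    using borel_version[of \<omega>] by auto
  \<comment> \<open>The value 1 on the null set where the Borel version fails to be positive.\<close>
  define W where "W t = (if 0 < W0 t then W0 t else 1)" for t
  have W [measurable]: "W \<in> borel_measurable borel" unfolding W_def by measurable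
  have Wpos: "\<And>t. 0 < W t" by (simp add: W_def)
  have ae: "AE t in lborel. \<omega> t = W t" using ae0
  proof eventually_elim
    case (elim t)
    then show ?case using \<omega>(1)[of t] by (simp add: W_def)
  qed
  have loc: "\<And>a b. set_integrable lborel {a..b} W"
    using \<omega>(2) locally_integrable_iff[OF W ae] by (simp add: locint_def)
  have "\<exists>C. left_weight p W C"
  proof (cases "p = 1")
    case True
    then obtain C where C: "0 < C" "AE t in lebesgue. M_plus \<omega> t \<le> ennreal (C * \<omega> t)"
      using A by (auto simp: A_minus_def)
    have "AE t in lborel. \<forall>h>0. mass W {t..t + h} \<le> ennreal (C * h * W t)"
      using C(2)[unfolded AE_lebesgue_iff] ae
    proof eventually_elim
      case (elim t)
      show ?case
      proof (intro allI impI)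
        fix h :: real assume h: "0 < h"
        have i: "(\<integral>\<^sup>+\<tau>\<in>{t..t + h}. ennreal \<bar>\<omega> \<tau>\<bar> \<partial>lebesgue) = mass W {t..t + h}"
          unfolding nn_integral_lebesgue by (rule nn_integral_cong_AE, use ae in eventually_elim) (use Wpos in \<open>simp add: less_imp_le\<close>)
        have "ennreal (1 / h) * mass W {t..t + h} \<le> M_plus \<omega> t"
          unfolding M_plus_def i[symmetric] using h by (intro SUP_upper) simp
        also have "\<dots> \<le> ennreal (C * W t)" using elim by simp
        finally have "ennreal h * (ennreal (1 / h) * mass W {t..t + h}) \<le> ennreal h * ennreal (C * W t)"
          by (rule mult_left_mono) simp
        also have "ennreal h * ennreal (C * W t) = ennreal (C * h * W t)"
          using h C(1) Wpos[of t] by (subst ennreal_mult[symmetric]) (auto simp: mult_ac)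
        also have "ennreal h * (ennreal (1 / h) * mass W {t..t + h}) = mass W {t..t + h}"
          using h by (subst mult.assoc[symmetric], subst ennreal_mult[symmetric]) auto
        finally show "mass W {t..t + h} \<le> ennreal (C * h * W t)" .
      qed
    qed
    then have "left_weight 1 W (2 * C)" by (intro left_weight_A1 W Wpos loc C)
    then show ?thesis using True by blast
  next
    case False
    define q where "q = p / (p - 1)"
    obtain C where C: "0 < C" "locally_integrable (\<lambda>t. \<omega> t powr (1 - q))"
      "\<And>a h. 0 < h \<Longrightarrow> (1 / h * (LINT \<tau>:{a..a + h}|lebesgue. \<omega> \<tau>)) powr (1 / p) *
                (1 / h * (LINT \<tau>:{a - h..a}|lebesgue. \<omega> \<tau> powr (1 - q))) powr (1 / q) \<le> C"
      using A False by (auto simp: A_minus_def Let_def q_def)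
    have m: "(\<lambda>t. W t powr (1 - q)) \<in> borel_measurable borel" by measurable
    have ae': "AE t in lborel. \<omega> t powr (1 - q) = W t powr (1 - q)" using ae by eventually_elim simp
    have s: "(LINT \<tau>:{a..b}|lebesgue. f \<tau>) = (LINT \<tau>:{a..b}|lborel. g \<tau>)"
      if "g \<in> borel_measurable borel" "AE t in lborel. f t = g t" for f g :: "real \<Rightarrow> real" and a b :: real
      unfolding set_lebesgue_integral_def
      by (rule integral_lebesgue_eq) (use that in \<open>auto elim: eventually_mono\<close>)
    have "left_weight p W C"
    proof (rule left_weight_Ap[OF W Wpos loc _ q_def _ C(1)])
      show "1 < p" using p False by simp
      show "set_integrable lborel {a..b} (\<lambda>t. W t powr (1 - q))" for a b
        using C(2) locally_integrable_iff[OF m ae'] by (simp add: locint_def)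
      show "(1 / h * (LINT \<tau>:{a..a + h}|lborel. W \<tau>)) powr (1 / p) *
                (1 / h * (LINT \<tau>:{a - h..a}|lborel. W \<tau> powr (1 - q))) powr (1 / q) \<le> C" if "0 < h" for a h
        using C(3)[OF that, of a] unfolding s[OF W ae] s[OF m ae'] .
    qed
    then show ?thesis by blast
  qed
  then obtain C where "left_weight p W C" by blast
  then have "lebesgue_weight p W C \<omega>"
    by (intro lebesgue_weight.intro lebesgue_weight_axioms.intro ae) auto
  then show thesis by (rule that)
qed

context lebesgue_weight
begin

lemma Dleft_pointwise_ae_eq:
  assumes "w \<in> borel_measurable borel" "AE t in lborel. u t = w t"
  shows "AE t in lborel. \<forall>\<alpha>. Dleft_pointwise \<alpha> u t = Dleft_pointwise \<alpha> w t"
  using assms(2) by eventually_elim (intro allI Dleft_pointwise_ae(1)[OF assms])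

text \<open>Two weak derivatives of the same function have the same pairings, hence are equal almost
everywhere; so any weak derivative inherits the integrability of the one in the definition of the
Sobolev space.\<close>

lemma sobolev_version:
  assumes u: "u \<in> W1p p \<omega>" and u': "has_weak_deriv u u'"
  obtains w v where "weighted_sobolev p W C w v" "AE t in lborel. u t = w t" "AE t in lborel. u' t = v t"
proof -
  obtain v0 where v0: "v0 \<in> Lp p \<omega>" "has_weak_deriv u v0" and uL: "u \<in> Lp p \<omega>" using u by (auto simp: W1p_def)
  obtain w where w: "w \<in> borel_measurable borel" "AE t in lborel. u t = w t" "N (eabs w) < top"
    using Lp_version[OF uL] .
  obtain v where v: "v \<in> borel_measurable borel" "AE t in lborel. v0 t = v t" "N (eabs v) < top"
    using Lp_version[OF v0(1)] .
  have "u' \<in> borel_measurable lebesgue" using u' by (auto simp: has_weak_deriv_def intro: locally_integrable_measurable)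
  then obtain g where g: "g \<in> borel_measurable borel" "AE t in lborel. u' t = g t" by (rule borel_version)
  note wv = v0(2)[unfolded has_weak_deriv_iff[OF w(1) v(1) w(2) v(2)]]
  note wg = u'[unfolded has_weak_deriv_iff[OF w(1) g(1) w(2) g(2)]]
  have "AE t in lborel. g t = v t"
    by (rule locint_ae_eq) (use wv wg in auto)
  with g(2) have ae: "AE t in lborel. u' t = v t" by eventually_elim simp
  have "weighted_sobolev p W C w v"
  proof
    show "AE t in lborel. w t - w (t - h) = h * mean h v t" if "0 < h" for h
      by (rule weak_deriv_increment[OF _ _ _ that]) (use wv in auto)
  qed (use w v in auto)
  then show thesis using w(2) ae by (rule that)
qed

text \<open>The supremum over integer lengths lies below \<open>M\<^sup>- u\<close>; being countable it is Borel, so its weighted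
integral is its modular.\<close>

lemma maximal_far_tendsto_0:
  assumes p1: "p = 1" and [measurable]: "w \<in> borel_measurable borel" and w: "AE t in lborel. u t = w t"
    and fin: "N (eabs w) < top" and max: "(\<integral>\<^sup>+t. M_minus u t \<partial>weighted \<omega>) < \<infinity>"
  shows "((\<lambda>\<alpha>. N (far \<alpha> (eabs w))) \<longlongrightarrow> 0) (at_right 0)"
proof (rule N_far_tendsto_0_maximal[OF _ fin])
  let ?S = "\<lambda>t. SUP n. avg (real (Suc n)) (eabs w) t"
  have m: "?S \<in> borel_measurable borel" by measurable
  have e1: "N f = (\<integral>\<^sup>+t. f t * ennreal (W t) \<partial>lborel)" for f
  proof -
    have "epow p x = x" for x unfolding p1 by (cases x) auto
    then show ?thesis by (simp add: N_def)
  qed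
  have "?S t \<le> M_minus u t" for t
  proof (rule SUP_least)
    fix n
    have i: "(\<integral>\<^sup>+\<tau>\<in>{t - h..t}. ennreal \<bar>u \<tau>\<bar> \<partial>lebesgue) = (\<integral>\<^sup>+\<tau>\<in>{t - h..t}. ennreal \<bar>w \<tau>\<bar> \<partial>lborel)" for h
      unfolding nn_integral_lebesgue by (rule nn_integral_cong_AE, use w in eventually_elim) simp
    show "avg (real (Suc n)) (eabs w) t \<le> M_minus u t"
      unfolding M_minus_def avg_def i[symmetric] by (rule SUP_upper) simp
  qed
  then have "(\<integral>\<^sup>+t. ?S t \<partial>weighted \<omega>) \<le> (\<integral>\<^sup>+t. M_minus u t \<partial>weighted \<omega>)" by (intro nn_integral_mono)
  also note max
  also have "(\<integral>\<^sup>+t. ?S t \<partial>weighted \<omega>) = (\<integral>\<^sup>+t. ?S t * ennreal (W t) \<partial>lborel)"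
    using m by (intro nn_integral_weighted measurable_completion) simp
  finally show "N ?S < top" unfolding e1 by simp
qed measurable

text \<open>Passes from modulars to norms; the factor 2 comes from bounding a sum by twice the maximum, after
which the p-th root is monotone.\<close>

lemma Lp_norm_le:
  assumes f: "f \<in> borel_measurable lebesgue" and g: "g \<in> Lp p \<omega>" and h: "h \<in> Lp p \<omega>" and Q: "0 < Q"
    and le: "N (eabs f) \<le> ennreal Q * (N (eabs g) + N (eabs h))"
  shows "Lp_norm p \<omega> f \<le> (2 * Q) powr (1 / p) * (Lp_norm p \<omega> g + Lp_norm p \<omega> h)"
proof -
  define x y where "x = enn2real (N (eabs g))" and "y = enn2real (N (eabs h))"
  have xy: "0 \<le> x" "0 \<le> y" "N (eabs g) = ennreal x" "N (eabs h) = ennreal y"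
    using g h by (auto simp: x_def y_def Lp_iff)
  have "N (eabs f) \<le> ennreal (Q * (x + y))"
    using le xy Q by (simp add: ennreal_mult ennreal_plus)
  then have "enn2real (N (eabs f)) \<le> Q * (x + y)" using xy Q by (simp add: enn2real_leI)
  also have "\<dots> \<le> 2 * Q * max x y"
    using Q by (simp add: mult_left_mono max_def)
  finally have "Lp_norm p \<omega> f \<le> (2 * Q * max x y) powr (1 / p)"
    unfolding Lp_norm_eq[OF f] using p_pos by (intro powr_mono2) auto
  also have "\<dots> = (2 * Q) powr (1 / p) * max x y powr (1 / p)" by (rule powr_mult)
  also have "\<dots> \<le> (2 * Q) powr (1 / p) * (x powr (1 / p) + y powr (1 / p))"
    by (intro mult_left_mono) (auto simp: max_def)
  also have "x powr (1 / p) + y powr (1 / p) = Lp_norm p \<omega> g + Lp_norm p \<omega> h"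
    using g h by (simp add: Lp_norm_eq Lp_iff x_def y_def)
  finally show ?thesis .
qed

lemma sobolev_derivative:
  assumes u: "u \<in> W1p p \<omega>" and u': "has_weak_deriv u u'"
    and G: "0 < G" "\<And>\<alpha>. 0 < \<alpha> \<Longrightarrow> \<alpha> < 1 \<Longrightarrow> coef0 \<alpha> \<le> G" "\<And>\<alpha>. 0 < \<alpha> \<Longrightarrow> \<alpha> < 1 \<Longrightarrow> coef1 \<alpha> \<le> G"
    and Q: "Q = G powr p * (2 powr p * (2 powr p * (K + 1) + 2 powr p * K))"
  shows "\<forall>\<alpha>\<in>{0<..<1}. Dleft_pointwise \<alpha> u \<in> Lp p \<omega> \<and>
          (AE t in lebesgue. set_integrable lebesgue {..<t} (Dleft_integrand \<alpha> u t)) \<and>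
          coincides_with (Dleft \<alpha> (distr_of u)) (Dleft_pointwise \<alpha> u) \<and>
          Lp_norm p \<omega> (Dleft_pointwise \<alpha> u) \<le> (2 * Q) powr (1 / p) * (Lp_norm p \<omega> u + Lp_norm p \<omega> u')"
    and "Lp_tendsto p \<omega> (\<lambda>\<alpha>. Dleft_pointwise \<alpha> u) u' (at_left 1)"
    and "AE t in lebesgue. ((\<lambda>\<alpha>. Dleft_pointwise \<alpha> u t) \<longlongrightarrow> u' t) (at_left 1)"
    and "AE t in lebesgue. ((\<lambda>\<alpha>. Dleft_pointwise \<alpha> u t) \<longlongrightarrow> u t) (at_right 0)"
    and "1 < p \<or> p = 1 \<and> (\<integral>\<^sup>+t. M_minus u t \<partial>weighted \<omega>) < \<infinity> \<Longrightarrow>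
       Lp_tendsto p \<omega> (\<lambda>\<alpha>. Dleft_pointwise \<alpha> u) u (at_right 0)"
proof -
  obtain w v where ws: "weighted_sobolev p W C w v" and uw: "AE t in lborel. u t = w t" and uv: "AE t in lborel. u' t = v t"
    using sobolev_version[OF u u'] .
  interpret ws: weighted_sobolev p W C w v by (rule ws)
  note [measurable] = ws.u_meas ws.v_meas
  have Du: "AE t in lborel. \<forall>\<alpha>. Dleft_pointwise \<alpha> u t = Dleft_pointwise \<alpha> w t"
    by (rule Dleft_pointwise_ae_eq[OF ws.u_meas uw])
  have D1: "AE t in lborel. Dleft_pointwise \<alpha> u t = Dleft_pointwise \<alpha> w t" for \<alpha> using Du by eventually_elim simp
  have uL: "u \<in> Lp p \<omega>" by (rule Lp_I[OF ws.u_meas uw ws.Nu])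
  have vL: "u' \<in> Lp p \<omega>" by (rule Lp_I[OF ws.v_meas uv ws.Nv])
  have Nuw: "N (eabs u) = N (eabs w)" "N (eabs u') = N (eabs v)"
    using uw uv by (auto intro!: N_cong elim: eventually_mono)
  have NDu: "N (\<lambda>t. ennreal \<bar>Dleft_pointwise \<alpha> u t\<bar>) = N (\<lambda>t. ennreal \<bar>Dleft_pointwise \<alpha> w t\<bar>)" for \<alpha>
    by (rule N_cong, use D1[of \<alpha>] in eventually_elim) simp
  have Qpos: "0 < Q" using G(1) K_pos by (auto simp: Q intro!: mult_pos_pos add_pos_pos)
  have DN: "N (\<lambda>t. ennreal \<bar>Dleft_pointwise \<alpha> w t\<bar>) \<le> ennreal Q * (N (eabs w) + N (eabs v))"
    if "0 < \<alpha>" "\<alpha> < 1" for \<alpha>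
    unfolding Q by (rule ws.D_norm) (use that G in auto)
  have DL: "Dleft_pointwise \<alpha> u \<in> Lp p \<omega>" if "0 < \<alpha>" "\<alpha> < 1" for \<alpha>
  proof (rule Lp_I[OF _ D1])
    have "ennreal Q * (N (eabs w) + N (eabs v)) < top"
      using ws.Nu ws.Nv by (simp add: ennreal_mult_less_top)
    with DN[OF that] show "N (\<lambda>t. ennreal \<bar>Dleft_pointwise \<alpha> w t\<bar>) < top" by (rule le_less_trans)
  qed measurable
  show "\<forall>\<alpha>\<in>{0<..<1}. Dleft_pointwise \<alpha> u \<in> Lp p \<omega> \<and>
          (AE t in lebesgue. set_integrable lebesgue {..<t} (Dleft_integrand \<alpha> u t)) \<and>
          coincides_with (Dleft \<alpha> (distr_of u)) (Dleft_pointwise \<alpha> u) \<and>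
          Lp_norm p \<omega> (Dleft_pointwise \<alpha> u) \<le> (2 * Q) powr (1 / p) * (Lp_norm p \<omega> u + Lp_norm p \<omega> u')"
  proof (intro ballI conjI)
    fix \<alpha> :: real assume "\<alpha> \<in> {0<..<1}"
    then have \<alpha>: "0 < \<alpha>" "\<alpha> < 1" by auto
    show "Dleft_pointwise \<alpha> u \<in> Lp p \<omega>" by (rule DL[OF \<alpha>])
    show "AE t in lebesgue. set_integrable lebesgue {..<t} (Dleft_integrand \<alpha> u t)"
      unfolding AE_lebesgue_iff using ws.D_integrable uw
      by eventually_elim (use \<alpha> Dleft_pointwise_ae(2)[OF ws.u_meas uw] in blast)
    show "coincides_with (Dleft \<alpha> (distr_of u)) (Dleft_pointwise \<alpha> u)"
      using ws.D_coincides[OF \<alpha>] by (subst coincides_with_iff[OF ws.u_meas _ uw D1]) auto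
    show "Lp_norm p \<omega> (Dleft_pointwise \<alpha> u) \<le> (2 * Q) powr (1 / p) * (Lp_norm p \<omega> u + Lp_norm p \<omega> u')"
      by (rule Lp_norm_le[OF _ uL vL Qpos]) (use DL[OF \<alpha>] DN[OF \<alpha>] in \<open>auto simp: Lp_iff Nuw NDu\<close>)
  qed
  show "Lp_tendsto p \<omega> (\<lambda>\<alpha>. Dleft_pointwise \<alpha> u) u' (at_left 1)"
    unfolding Lp_tendsto_iff
  proof (intro conjI vL)
    show "\<forall>\<^sub>F \<alpha> in at_left 1. Dleft_pointwise \<alpha> u \<in> Lp p \<omega>" using ev_left by eventually_elim (simp add: DL)
    have "N (\<lambda>t. ennreal \<bar>Dleft_pointwise \<alpha> u t - u' t\<bar>) = N (\<lambda>t. ennreal \<bar>Dleft_pointwise \<alpha> w t - v t\<bar>)" for \<alpha>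
      by (rule N_cong, use D1[of \<alpha>] uv in eventually_elim) simp
    then show "((\<lambda>\<alpha>. N (\<lambda>t. ennreal \<bar>Dleft_pointwise \<alpha> u t - u' t\<bar>)) \<longlongrightarrow> 0) (at_left 1)"
      using ws.D_tendsto_left_norm by simp
  qed
  show "AE t in lebesgue. ((\<lambda>\<alpha>. Dleft_pointwise \<alpha> u t) \<longlongrightarrow> u' t) (at_left 1)"
    unfolding AE_lebesgue_iff using Du uv ws.D_tendsto_left_ae by eventually_elim simp
  show "AE t in lebesgue. ((\<lambda>\<alpha>. Dleft_pointwise \<alpha> u t) \<longlongrightarrow> u t) (at_right 0)"
    unfolding AE_lebesgue_iff using Du uw ws.D_tendsto_right_ae by eventually_elim simp
  assume H: "1 < p \<or> p = 1 \<and> (\<integral>\<^sup>+t. M_minus u t \<partial>weighted \<omega>) < \<infinity>"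
  show "Lp_tendsto p \<omega> (\<lambda>\<alpha>. Dleft_pointwise \<alpha> u) u (at_right 0)"
    unfolding Lp_tendsto_iff
  proof (intro conjI uL)
    show "\<forall>\<^sub>F \<alpha> in at_right 0. Dleft_pointwise \<alpha> u \<in> Lp p \<omega>" using ev_right by eventually_elim (simp add: DL)
    have e: "N (\<lambda>t. ennreal \<bar>Dleft_pointwise \<alpha> u t - u t\<bar>) = N (\<lambda>t. ennreal \<bar>Dleft_pointwise \<alpha> w t - w t\<bar>)" for \<alpha>
      by (rule N_cong, use D1[of \<alpha>] uw in eventually_elim) simp
    have "((\<lambda>\<alpha>. N (far \<alpha> (eabs w))) \<longlongrightarrow> 0) (at_right 0)"
      using H
    proof
      assume "1 < p"
      then show ?thesis by (intro N_far_tendsto_0 ws.Nu) measurable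
    next
      assume "p = 1 \<and> (\<integral>\<^sup>+t. M_minus u t \<partial>weighted \<omega>) < \<infinity>"
      then show ?thesis by (intro maximal_far_tendsto_0[OF _ ws.u_meas uw ws.Nu]) auto
    qed
    then show "((\<lambda>\<alpha>. N (\<lambda>t. ennreal \<bar>Dleft_pointwise \<alpha> u t - u t\<bar>)) \<longlongrightarrow> 0) (at_right 0)"
      unfolding e by (rule ws.D_tendsto_right_norm)
  qed
qed

lemma Lp_family_version:
  obtains h where "\<And>\<alpha>. f \<alpha> \<in> Lp p \<omega> \<Longrightarrow> h \<alpha> \<in> borel_measurable borel"
    "\<And>\<alpha>. f \<alpha> \<in> Lp p \<omega> \<Longrightarrow> AE t in lborel. f \<alpha> t = h \<alpha> t"
    "\<And>\<alpha>. f \<alpha> \<in> Lp p \<omega> \<Longrightarrow> N (eabs (h \<alpha>)) < top"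
proof -
  have "\<forall>\<alpha>. \<exists>h. f \<alpha> \<in> Lp p \<omega> \<longrightarrow> h \<in> borel_measurable borel \<and> (AE t in lborel. f \<alpha> t = h t) \<and> N (eabs h) < top"
    using Lp_version by metis
  from choice[OF this] show thesis using that by blast
qed

text \<open>Transfers the common hypotheses of the two converse statements to Borel functions, order by order.\<close>

lemma borel_representatives:
  assumes u: "u \<in> Lp p \<omega>" and f: "\<forall>\<^sub>F \<alpha> in F. f \<alpha> \<in> Lp p \<omega> \<and> coincides_with (Dleft \<alpha> (distr_of u)) (f \<alpha>)"
    and g: "Lp_tendsto p \<omega> f g F"
  obtains w h g' where "w \<in> borel_measurable borel" "AE t in lborel. u t = w t" "N (eabs w) < top"
    "g' \<in> borel_measurable borel" "AE t in lborel. g t = g' t" "N (eabs g') < top"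
    "\<And>\<alpha>. f \<alpha> \<in> Lp p \<omega> \<Longrightarrow> AE t in lborel. f \<alpha> t = h \<alpha> t"
    "\<forall>\<^sub>F \<alpha> in F. h \<alpha> \<in> borel_measurable borel \<and> N (eabs (h \<alpha>)) < top \<and>
       (\<forall>\<phi>. test \<phi> \<longrightarrow> pair w (Dright \<alpha> \<phi>) = pair (h \<alpha>) \<phi>)"
    "((\<lambda>\<alpha>. N (\<lambda>t. ennreal \<bar>h \<alpha> t - g' t\<bar>)) \<longlongrightarrow> 0) F"
proof -
  have gL: "g \<in> Lp p \<omega>" and lim: "((\<lambda>\<alpha>. N (\<lambda>t. ennreal \<bar>f \<alpha> t - g t\<bar>)) \<longlongrightarrow> 0) F" using g by (auto simp: Lp_tendsto_iff)
  obtain w where w: "w \<in> borel_measurable borel" "AE t in lborel. u t = w t" "N (eabs w) < top"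
    using Lp_version[OF u] .
  obtain g' where g': "g' \<in> borel_measurable borel" "AE t in lborel. g t = g' t" "N (eabs g') < top"
    using Lp_version[OF gL] .
  obtain h where h: "\<And>\<alpha>. f \<alpha> \<in> Lp p \<omega> \<Longrightarrow> h \<alpha> \<in> borel_measurable borel"
    "\<And>\<alpha>. f \<alpha> \<in> Lp p \<omega> \<Longrightarrow> AE t in lborel. f \<alpha> t = h \<alpha> t"
    "\<And>\<alpha>. f \<alpha> \<in> Lp p \<omega> \<Longrightarrow> N (eabs (h \<alpha>)) < top"
    using Lp_family_version[of f] by metis
  have 1: "\<forall>\<^sub>F \<alpha> in F. h \<alpha> \<in> borel_measurable borel \<and> N (eabs (h \<alpha>)) < top \<and>
       (\<forall>\<phi>. test \<phi> \<longrightarrow> pair w (Dright \<alpha> \<phi>) = pair (h \<alpha>) \<phi>)"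
    using f
  proof eventually_elim
    case (elim \<alpha>)
    then have L: "f \<alpha> \<in> Lp p \<omega>" and c: "coincides_with (Dleft \<alpha> (distr_of u)) (f \<alpha>)" by auto
    then show ?case
      using h(1,3)[OF L] c[unfolded coincides_with_iff[OF w(1) h(1)[OF L] w(2) h(2)[OF L]]] test_in_S_minus by blast
  qed
  have "\<forall>\<^sub>F \<alpha> in F. N (\<lambda>t. ennreal \<bar>f \<alpha> t - g t\<bar>) = N (\<lambda>t. ennreal \<bar>h \<alpha> t - g' t\<bar>)"
    using f
  proof eventually_elim
    case (elim \<alpha>)
    then have L: "f \<alpha> \<in> Lp p \<omega>" by auto
    show ?case by (rule N_cong, use h(2)[OF L] g'(2) in eventually_elim) simp
  qed
  from Lim_transform_eventually[OF lim this] have 2: "((\<lambda>\<alpha>. N (\<lambda>t. ennreal \<bar>h \<alpha> t - g' t\<bar>)) \<longlongrightarrow> 0) F" .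
  show thesis by (rule that[OF w g' h(2) 1 2])
qed

lemma N_limit_cong:
  assumes "((\<lambda>\<alpha>. N (\<lambda>t. ennreal \<bar>f \<alpha> t - g t\<bar>)) \<longlongrightarrow> 0) F"
    and "\<forall>\<^sub>F \<alpha> in F. AE t in lborel. f \<alpha> t = f' \<alpha> t" and "AE t in lborel. g t = g' t"
  shows "((\<lambda>\<alpha>. N (\<lambda>t. ennreal \<bar>f' \<alpha> t - g' t\<bar>)) \<longlongrightarrow> 0) F"
proof -
  have "\<forall>\<^sub>F \<alpha> in F. N (\<lambda>t. ennreal \<bar>f \<alpha> t - g t\<bar>) = N (\<lambda>t. ennreal \<bar>f' \<alpha> t - g' t\<bar>)"
    using assms(2)
  proof eventually_elim
    case (elim \<alpha>)
    show ?case by (rule N_cong, use elim assms(3) in eventually_elim) simp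
  qed
  from Lim_transform_eventually[OF assms(1) this] show ?thesis .
qed

text \<open>The limit g is the weak derivative by \<open>limit_weak_deriv\<close>, so the results on Sobolev functions apply
to u. As \<open>f \<alpha>\<close> and the pointwise derivative represent the same distribution, they agree almost
everywhere, which transfers the convergence.\<close>

lemma convergence_implies_sobolev:
  assumes u: "u \<in> Lp p \<omega>" and f: "\<forall>\<^sub>F \<alpha> in at_left 1. f \<alpha> \<in> Lp p \<omega> \<and> coincides_with (Dleft \<alpha> (distr_of u)) (f \<alpha>)"
    and g: "Lp_tendsto p \<omega> f g (at_left 1)"
  shows "u \<in> W1p p \<omega>"
    and "has_weak_deriv u u' \<Longrightarrow> Lp_tendsto p \<omega> f u' (at_left 1)"
    and "has_weak_deriv u u' \<Longrightarrow> AE t in lebesgue. ((\<lambda>\<alpha>. Dleft_pointwise \<alpha> u t) \<longlongrightarrow> u' t) (at_left 1)"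
proof -
  obtain w h g' where w: "w \<in> borel_measurable borel" "AE t in lborel. u t = w t" "N (eabs w) < top"
    and g': "g' \<in> borel_measurable borel" "AE t in lborel. g t = g' t" "N (eabs g') < top"
    and h: "\<And>\<alpha>. f \<alpha> \<in> Lp p \<omega> \<Longrightarrow> AE t in lborel. f \<alpha> t = h \<alpha> t"
    and ev: "\<forall>\<^sub>F \<alpha> in at_left 1. h \<alpha> \<in> borel_measurable borel \<and> N (eabs (h \<alpha>)) < top \<and>
       (\<forall>\<phi>. test \<phi> \<longrightarrow> pair w (Dright \<alpha> \<phi>) = pair (h \<alpha>) \<phi>)"
    and lim: "((\<lambda>\<alpha>. N (\<lambda>t. ennreal \<bar>h \<alpha> t - g' t\<bar>)) \<longlongrightarrow> 0) (at_left 1)"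
    by (rule borel_representatives[OF u f g]) (rule that)
  have "has_weak_deriv u g"
    unfolding has_weak_deriv_iff[OF w(1) g'(1) w(2) g'(2)]
    by (intro conjI allI impI N_finite_imp_locint w g' limit_weak_deriv[OF w(1) g'(1) w(3) g'(3) ev lim])
  moreover have "g \<in> Lp p \<omega>" using g by (simp add: Lp_tendsto_def)
  ultimately show uW: "u \<in> W1p p \<omega>" using u by (auto simp: W1p_def)
  obtain G where G: "0 < G" "\<And>\<alpha>. 0 < \<alpha> \<Longrightarrow> \<alpha> < 1 \<Longrightarrow> coef0 \<alpha> \<le> G" "\<And>\<alpha>. 0 < \<alpha> \<Longrightarrow> \<alpha> < 1 \<Longrightarrow> coef1 \<alpha> \<le> G"
    using coef_bounded by metis
  assume u': "has_weak_deriv u u'"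
  note S = sobolev_derivative[OF uW u' G refl]
  show "AE t in lebesgue. ((\<lambda>\<alpha>. Dleft_pointwise \<alpha> u t) \<longlongrightarrow> u' t) (at_left 1)" by (rule S(3))
  have eq: "\<forall>\<^sub>F \<alpha> in at_left 1. AE t in lborel. Dleft_pointwise \<alpha> u t = f \<alpha> t"
    using f ev ev_left
  proof eventually_elim
    case (elim \<alpha>)
    then have L: "f \<alpha> \<in> Lp p \<omega>" and \<alpha>: "0 < \<alpha>" "\<alpha> < 1" by auto
    have D1: "AE t in lborel. Dleft_pointwise \<alpha> u t = Dleft_pointwise \<alpha> w t"
      using Dleft_pointwise_ae_eq[OF w(1,2)] by eventually_elim simp
    have Dm: "Dleft_pointwise \<alpha> w \<in> borel_measurable borel" using w(1) by measurable
    have DL: "Dleft_pointwise \<alpha> u \<in> Lp p \<omega>" "coincides_with (Dleft \<alpha> (distr_of u)) (Dleft_pointwise \<alpha> u)" using S(1) \<alpha> by auto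
    have "N (\<lambda>t. ennreal \<bar>Dleft_pointwise \<alpha> w t\<bar>) = N (\<lambda>t. ennreal \<bar>Dleft_pointwise \<alpha> u t\<bar>)"
      using D1 by (intro N_cong) (auto elim: eventually_mono)
    then have loc: "locint (Dleft_pointwise \<alpha> w)" using DL(1) by (intro N_finite_imp_locint Dm) (simp add: Lp_iff)
    have "AE t in lborel. Dleft_pointwise \<alpha> w t = h \<alpha> t"
    proof (rule locint_ae_eq[OF loc])
      show "locint (h \<alpha>)" using elim by (intro N_finite_imp_locint) auto
      show "pair (Dleft_pointwise \<alpha> w) \<phi> = pair (h \<alpha>) \<phi>" if "test \<phi>" for \<phi>
        using DL(2)[unfolded coincides_with_iff[OF w(1) Dm w(2) D1]] test_in_S_minus[OF that] elim that by metis
    qed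
    with D1 h[OF L] show ?case by eventually_elim simp
  qed
  show "Lp_tendsto p \<omega> f u' (at_left 1)"
    unfolding Lp_tendsto_iff
  proof (intro conjI)
    show "u' \<in> Lp p \<omega>" using S(2) by (simp add: Lp_tendsto_def)
    show "\<forall>\<^sub>F \<alpha> in at_left 1. f \<alpha> \<in> Lp p \<omega>" using f by (auto elim: eventually_mono)
    show "((\<lambda>\<alpha>. N (\<lambda>t. ennreal \<bar>f \<alpha> t - u' t\<bar>)) \<longlongrightarrow> 0) (at_left 1)"
      using S(2) by (intro N_limit_cong[OF _ eq]) (auto simp: Lp_tendsto_iff)
  qed
qed

text \<open>The representative that converges is the pointwise fractional derivative, which
represents f for all small orders and converges outside one null set; for the other orders f itself is kept.\<close>

lemma convergence_at_order_0:
  assumes u: "u \<in> Lp p \<omega>" and f: "\<forall>\<^sub>F \<alpha> in at_right 0. f \<alpha> \<in> Lp p \<omega> \<and> coincides_with (Dleft \<alpha> (distr_of u)) (f \<alpha>)"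
    and g: "Lp_tendsto p \<omega> f g (at_right 0)"
  shows "ae_class_tendsto f u (at_right 0)" and "Lp_tendsto p \<omega> f u (at_right 0)"
proof -
  obtain w h g' where w: "w \<in> borel_measurable borel" "AE t in lborel. u t = w t" "N (eabs w) < top"
    and g': "g' \<in> borel_measurable borel" "AE t in lborel. g t = g' t" "N (eabs g') < top"
    and h: "\<And>\<alpha>. f \<alpha> \<in> Lp p \<omega> \<Longrightarrow> AE t in lborel. f \<alpha> t = h \<alpha> t"
    and ev: "\<forall>\<^sub>F \<alpha> in at_right 0. h \<alpha> \<in> borel_measurable borel \<and> N (eabs (h \<alpha>)) < top \<and>
       (\<forall>\<phi>. test \<phi> \<longrightarrow> pair w (Dright \<alpha> \<phi>) = pair (h \<alpha>) \<phi>)"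
    and lim: "((\<lambda>\<alpha>. N (\<lambda>t. ennreal \<bar>h \<alpha> t - g' t\<bar>)) \<longlongrightarrow> 0) (at_right 0)"
    by (rule borel_representatives[OF u f g]) (rule that)
  note S = small_order_identify[OF w(1) g'(1) w(3) ev lim]
  have gu: "AE t in lborel. g t = u t" using S(1) g'(2) w(2) by eventually_elim simp
  show "Lp_tendsto p \<omega> f u (at_right 0)"
    unfolding Lp_tendsto_iff
  proof (intro conjI u)
    show "\<forall>\<^sub>F \<alpha> in at_right 0. f \<alpha> \<in> Lp p \<omega>" using f by (auto elim: eventually_mono)
    show "((\<lambda>\<alpha>. N (\<lambda>t. ennreal \<bar>f \<alpha> t - u t\<bar>)) \<longlongrightarrow> 0) (at_right 0)"
      by (rule N_limit_cong[OF _ _ gu]) (use g in \<open>auto simp: Lp_tendsto_iff\<close>)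
  qed
  obtain \<alpha>1 where \<alpha>1: "0 < \<alpha>1" "\<And>\<alpha>. 0 < \<alpha> \<Longrightarrow> \<alpha> < \<alpha>1 \<Longrightarrow> AE t in lborel. h \<alpha> t = Dleft_pointwise \<alpha> w t" using S(3) by blast
  obtain \<delta> where \<delta>: "0 < \<delta>" "\<And>\<alpha>. 0 < \<alpha> \<Longrightarrow> \<alpha> < \<delta> \<Longrightarrow> f \<alpha> \<in> Lp p \<omega>"
    using f by (auto simp: eventually_at_right_field)
  define f' where "f' \<alpha> = (if 0 < \<alpha> \<and> \<alpha> < min \<alpha>1 \<delta> then Dleft_pointwise \<alpha> w else f \<alpha>)" for \<alpha>
  show "ae_class_tendsto f u (at_right 0)"
    unfolding ae_class_tendsto_def AE_lebesgue_iff
  proof (intro exI[of _ f'] conjI allI)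
    fix \<alpha>
    show "AE t in lborel. f' \<alpha> t = f \<alpha> t"
    proof (cases "0 < \<alpha> \<and> \<alpha> < min \<alpha>1 \<delta>")
      case True
      then have "AE t in lborel. h \<alpha> t = Dleft_pointwise \<alpha> w t" "AE t in lborel. f \<alpha> t = h \<alpha> t"
        using \<alpha>1(2)[of \<alpha>] h[OF \<delta>(2)[of \<alpha>]] by auto
      then show ?thesis by eventually_elim (use True in \<open>simp add: f'_def\<close>)
    next
      case False
      then have "f' \<alpha> = f \<alpha>" unfolding f'_def by (rule if_not_P)
      then show ?thesis by simp
    qed
  next
    have e: "\<forall>\<^sub>F \<alpha> in at_right 0. 0 < \<alpha> \<and> \<alpha> < min \<alpha>1 \<delta>"
      using \<alpha>1(1) \<delta>(1) by (intro eventually_at_rightI[of _ "min \<alpha>1 \<delta>"]) auto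
    show "AE t in lborel. ((\<lambda>\<alpha>. f' \<alpha> t) \<longlongrightarrow> u t) (at_right 0)"
      using S(2) w(2)
    proof eventually_elim
      case (elim t)
      have "\<forall>\<^sub>F \<alpha> in at_right 0. Dleft_pointwise \<alpha> w t = f' \<alpha> t" using e by eventually_elim (simp add: f'_def)
      from Lim_transform_eventually[OF elim(1) this] show ?case using elim(2) by simp
    qed
  qed
qed

end

theorem theorem1p1:
  fixes p :: real and \<omega> :: "real \<Rightarrow> real"
  assumes "1 \<le> p" and "\<omega> \<in> A_minus p"
  shows
   "(\<exists>C>0. \<forall>u u'. u \<in> W1p p \<omega> \<and> has_weak_deriv u u' \<longrightarrow>
       (\<forall>\<alpha>\<in>{0<..<1}.
          Dleft_pointwise \<alpha> u \<in> Lp p \<omega> \<and>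
          (AE t in lebesgue. set_integrable lebesgue {..<t} (Dleft_integrand \<alpha> u t)) \<and>
          coincides_with (Dleft \<alpha> (distr_of u)) (Dleft_pointwise \<alpha> u) \<and>
          Lp_norm p \<omega> (Dleft_pointwise \<alpha> u) \<le> C * (Lp_norm p \<omega> u + Lp_norm p \<omega> u')) \<and>
       Lp_tendsto p \<omega> (\<lambda>\<alpha>. Dleft_pointwise \<alpha> u) u' (at_left 1) \<and>
       (AE t in lebesgue. ((\<lambda>\<alpha>. Dleft_pointwise \<alpha> u t) \<longlongrightarrow> u' t) (at_left 1)) \<and>
       (AE t in lebesgue. ((\<lambda>\<alpha>. Dleft_pointwise \<alpha> u t) \<longlongrightarrow> u t) (at_right 0)) \<and>
       (1 < p \<or>
        p = 1 \<and> (\<integral>\<^sup>+t. M_minus u t \<partial>weighted \<omega>) < \<infinity> \<and> (\<integral>\<^sup>+t. M_minus u' t \<partial>weighted \<omega>) < \<infinity>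
          \<longrightarrow> Lp_tendsto p \<omega> (\<lambda>\<alpha>. Dleft_pointwise \<alpha> u) u (at_right 0))) \<and>
    (\<forall>u\<in>Lp p \<omega>. \<forall>f.
       (\<forall>\<^sub>F \<alpha> in at_left 1. f \<alpha> \<in> Lp p \<omega> \<and> coincides_with (Dleft \<alpha> (distr_of u)) (f \<alpha>)) \<and>
       (\<exists>g. Lp_tendsto p \<omega> f g (at_left 1)) \<longrightarrow>
       u \<in> W1p p \<omega> \<and>
       (\<forall>u'. has_weak_deriv u u' \<longrightarrow>
          Lp_tendsto p \<omega> f u' (at_left 1) \<and>
          (AE t in lebesgue. ((\<lambda>\<alpha>. Dleft_pointwise \<alpha> u t) \<longlongrightarrow> u' t) (at_left 1)))) \<and>
    (\<forall>u\<in>Lp p \<omega>. \<forall>f.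
       (\<forall>\<^sub>F \<alpha> in at_right 0. f \<alpha> \<in> Lp p \<omega> \<and> coincides_with (Dleft \<alpha> (distr_of u)) (f \<alpha>)) \<and>
       (\<exists>g. Lp_tendsto p \<omega> f g (at_right 0)) \<longrightarrow>
       ae_class_tendsto f u (at_right 0) \<and>
       Lp_tendsto p \<omega> f u (at_right 0))"
  (is "(\<exists>C>0. \<forall>u u'. _ u u' \<longrightarrow> ?A C u u') \<and> (\<forall>u\<in>_. \<forall>f. ?B u f) \<and> (\<forall>u\<in>_. \<forall>f. ?C u f)")
proof -
  obtain W C0 where "lebesgue_weight p W C0 \<omega>" using A_minus_weight[OF assms] .
  then interpret lebesgue_weight p W C0 \<omega> .
  obtain G where G: "0 < G" "\<And>\<alpha>. 0 < \<alpha> \<Longrightarrow> \<alpha> < 1 \<Longrightarrow> coef0 \<alpha> \<le> G" "\<And>\<alpha>. 0 < \<alpha> \<Longrightarrow> \<alpha> < 1 \<Longrightarrow> coef1 \<alpha> \<le> G"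
    using coef_bounded by metis
  define Q where "Q = G powr p * (2 powr p * (2 powr p * (K + 1) + 2 powr p * K))"
  have "0 < Q" using G(1) K_pos by (auto simp: Q_def intro!: mult_pos_pos add_pos_pos)
  then have Q: "0 < (2 * Q) powr (1 / p)" by simp
  show ?thesis
  proof (intro conjI)
    show "\<exists>C>0. \<forall>u u'. u \<in> W1p p \<omega> \<and> has_weak_deriv u u' \<longrightarrow> ?A C u u'"
    proof (intro exI[of _ "(2 * Q) powr (1 / p)"] conjI[OF Q] allI impI)
      fix u u' assume H: "u \<in> W1p p \<omega> \<and> has_weak_deriv u u'"
      note a = sobolev_derivative[OF conjunct1[OF H] conjunct2[OF H] G Q_def]
      show "?A ((2 * Q) powr (1 / p)) u u'"
        by (intro conjI impI a) auto
    qed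
    show "\<forall>u\<in>Lp p \<omega>. \<forall>f. ?B u f" using convergence_implies_sobolev by blast
    show "\<forall>u\<in>Lp p \<omega>. \<forall>f. ?C u f" using convergence_at_order_0 by blast
  qed
qed

end
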